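(* Over a field $\mathbb K$ of characteristic $0$, the operad $\mathsf{Lie}$ of Lie algebras is stably Koszul, i.e. $H^\bullet(\mathsf{Lie}_\infty^\circlearrowright,\delta)=\mathsf{Lie}^\circlearrowright$: the natural morphism of dg props $$(\mathsf{Lie}_\infty^\circlearrowright,\delta)\longrightarrow(\mathsf{Lie}^\circlearrowright,0)$$ from the wheeled extension of the minimal resolution of $\mathsf{Lie}$ to the wheeled extension of $\mathsf{Lie}$ is a quasi-isomorphism.
   Context: **Graphs.** An $\mathbb S$-bimodule $E$ is a collection of graded vector spaces $E(m,n)$ with commuting left $\mathbb S_m$- and right $\mathbb S_n$-actions. $\mathfrak G^\circlearrowright(m,n)$ is the set of finite, not necessarily connected, directed graphs with $m$ labelled output legs and $n$ labelled input legs; $\mathfrak G^\uparrow(m,n)$ consists of those without wheels, a wheel being a directed path which begins and ends at the same vertex; internal edges lying on a wheel are called cyclic. $G\langle E\rangle=\big(\bigotimes_v E(Out(v),In(v))\big)_{\mathrm{Aut}\,G}$ is the space of graphs $G$ with each internal vertex $v$ decorated by an element of $E$ with outputs $Out(v)$ and inputs $In(v)$. $\mathsf P\langle E\rangle=\bigoplus_{G\in\mathfrak G^\uparrow}G\langle E\rangle$ is the free prop on $E$ and $\mathsf P^\circlearrowright\langle E\rangle=\bigoplus_{G\in\mathfrak G^\circlearrowright}G\langle E\rangle$ its wheeled version; both are props under disjoint union and grafting. A differential on $\mathsf P\langle E\rangle$ is determined by its values on corollas and extends to $\mathsf P^\circlearrowright\langle E\rangle$ by acting vertex by vertex. **Wheeled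 extensions.** For an operad (or dioperad) $D$ presented as the free one on $E$ modulo relations $I$, the wheeled extension is $D^\circlearrowright=\mathsf P^\circlearrowright\langle E\rangle/\langle I\rangle^\circlearrowright$, where $\langle I\rangle^\circlearrowright$ is spanned by decorated graphs for which there is a (possibly empty) set of cyclic edges whose breaking into two legs produces a graph lying in the ideal $\langle I\rangle\subset\mathsf P\langle E\rangle$. If $D$ is dg, so is $D^\circlearrowright$. A Koszul (di)operad $D$ with minimal resolution $(D_\infty,\delta)\to(D,0)$ is stably Koszul if the induced morphism $(D_\infty^\circlearrowright,\delta)\to(D^\circlearrowright,0)$ is a quasi-isomorphism. **The operads.** In the grading used here $\mathsf{Lie}$ is generated by one degree $1$ operation $\mu$ with one output and two symmetric inputs, modulo the Jacobi relation: the sum over cyclic permutations of the inputs of $\mu\circ(\mu\otimes1)$ is zero. Its minimal resolution $\mathsf{Lie}_\infty$ is the free dg operad generated by degree $1$ corollas with one output and $n$ symmetric inputs, $n\ge2$, and the differential of the $(1,n)$-corolla is the sum over $[n]=J_1\sqcup J_2$, $|J_1|\ge2$, $|J_2|\ge1$, of the two-vertex trees in which the corolla with inputs $J_1$ is grafted into an input of the corolla whose other inputs are $J_2$. The morphism $\mathsf{Lie}_\infty\to\mathsf{Lie}$ sends the $(1,2)$-corolla to $\mu$ and all other generators to zero. *)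

theory Defs
  imports
    Complex_Main
    "HOL-Library.Poly_Mapping"
    "HOL-Library.Multiset"
    "HOL-Combinatorics.Permutations"
begin

section \<open>Free vector spaces and presented cochain complexes\<close>

definition fscale :: "'k::field \<Rightarrow> ('g \<Rightarrow>\<^sub>0 'k) \<Rightarrow> ('g \<Rightarrow>\<^sub>0 'k)" where
  "fscale c x = Poly_Mapping.map (\<lambda>a. c * a) x"

lemma lookup_fscale [simp]: "Poly_Mapping.lookup (fscale c x) g = c * Poly_Mapping.lookup x g"
  by (simp add: fscale_def Poly_Mapping.map.rep_eq when_def)

interpretation fvs: vector_space "fscale :: 'k::field \<Rightarrow> ('g \<Rightarrow>\<^sub>0 'k) \<Rightarrow> ('g \<Rightarrow>\<^sub>0 'k)"
  by unfold_locales
    (auto intro!: poly_mapping_eqI simp: lookup_add algebra_simps)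

abbreviation fgen :: "'g \<Rightarrow> ('g \<Rightarrow>\<^sub>0 'k::field)" where
  "fgen g \<equiv> Poly_Mapping.single g 1"

definition lin_ext :: "('g \<Rightarrow> ('h \<Rightarrow>\<^sub>0 'k)) \<Rightarrow> ('g \<Rightarrow>\<^sub>0 'k::field) \<Rightarrow> ('h \<Rightarrow>\<^sub>0 'k)" where
  "lin_ext f x = (\<Sum>g\<in>Poly_Mapping.keys x. fscale (Poly_Mapping.lookup x g) (f g))"

definition bilin_ext ::
    "('g \<Rightarrow> 'g \<Rightarrow> 'g) \<Rightarrow> ('g \<Rightarrow>\<^sub>0 'k::field) \<Rightarrow> ('g \<Rightarrow>\<^sub>0 'k) \<Rightarrow> ('g \<Rightarrow>\<^sub>0 'k)" where
  "bilin_ext f x y = lin_ext (\<lambda>g. lin_ext (\<lambda>h. fgen (f g h)) y) x"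

text \<open>
  A record \<open>A\<close> stands for the graded quotient with components
  \<open>chains A d / (rels A \<inter> chains A d)\<close>, and \<open>diff A\<close> induces its differential of degree \<open>+1\<close>.
\<close>

record 'v presented_complex =
  chains :: "int \<Rightarrow> 'v set"
  rels :: "'v set"
  diff :: "'v \<Rightarrow> 'v"

definition is_cochain_complex :: "('g \<Rightarrow>\<^sub>0 'k::field) presented_complex \<Rightarrow> bool" where
  "is_cochain_complex A \<longleftrightarrow>
     (\<forall>d. fvs.subspace (chains A d)) \<and> fvs.subspace (rels A) \<and>
     Vector_Spaces.linear fscale fscale (diff A) \<and>
     (\<forall>d. diff A ` chains A d \<subseteq> chains A (d + 1)) \<and>
     (\<forall>d. diff A ` (rels A \<inter> chains A d) \<subseteq> rels A) \<and>
     (\<forall>d. \<forall>x\<in>chains A d. diff A (diff A x) \<in> rels A)"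

definition is_cochain_map ::
    "('g \<Rightarrow>\<^sub>0 'k::field) presented_complex \<Rightarrow> ('h \<Rightarrow>\<^sub>0 'k) presented_complex
      \<Rightarrow> (('g \<Rightarrow>\<^sub>0 'k) \<Rightarrow> ('h \<Rightarrow>\<^sub>0 'k)) \<Rightarrow> bool" where
  "is_cochain_map A B f \<longleftrightarrow>
     Vector_Spaces.linear fscale fscale f \<and>
     (\<forall>d. f ` chains A d \<subseteq> chains B d) \<and>
     (\<forall>d. f ` (rels A \<inter> chains A d) \<subseteq> rels B) \<and>
     (\<forall>d. \<forall>x\<in>chains A d. f (diff A x) - diff B (f x) \<in> rels B)"

definition cocycles :: "('g \<Rightarrow>\<^sub>0 'k::field) presented_complex \<Rightarrow> int \<Rightarrow> ('g \<Rightarrow>\<^sub>0 'k) set" where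
  "cocycles A d = {x \<in> chains A d. diff A x \<in> rels A}"

definition cohomologous ::
    "('g \<Rightarrow>\<^sub>0 'k::field) presented_complex \<Rightarrow> int \<Rightarrow> (('g \<Rightarrow>\<^sub>0 'k) \<times> ('g \<Rightarrow>\<^sub>0 'k)) set" where
  "cohomologous A d = {(x, y). x \<in> cocycles A d \<and> y \<in> cocycles A d \<and>
     (\<exists>z\<in>chains A (d - 1). x - y - diff A z \<in> rels A)}"

definition cohomology ::
    "('g \<Rightarrow>\<^sub>0 'k::field) presented_complex \<Rightarrow> int \<Rightarrow> ('g \<Rightarrow>\<^sub>0 'k) set set" where
  "cohomology A d = cocycles A d // cohomologous A d"

definition quasi_isomorphism ::
    "('g \<Rightarrow>\<^sub>0 'k::field) presented_complex \<Rightarrow> ('h \<Rightarrow>\<^sub>0 'k) presented_complex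
      \<Rightarrow> (('g \<Rightarrow>\<^sub>0 'k) \<Rightarrow> ('h \<Rightarrow>\<^sub>0 'k)) \<Rightarrow> bool" where
  "quasi_isomorphism A B f \<longleftrightarrow>
     is_cochain_complex A \<and> is_cochain_complex B \<and> is_cochain_map A B f \<and>
     (\<forall>d. bij_betw (\<lambda>X. cohomologous B d `` (f ` X)) (cohomology A d) (cohomology B d))"

section \<open>Directed graphs with labelled legs\<close>

text \<open>
  Vertices are \<open>0, \<dots>, nverts - 1\<close>, edges are the positions of the list \<open>edges\<close>. An edge starts at
  an input leg or at a vertex and ends at an output leg or at a vertex; an edge from an input leg
  to an output leg is allowed (it is the unit of the prop), a circle without vertices is not.
\<close>

datatype 'v source = InLeg nat | OutOf 'v
datatype 'v target = OutLeg nat | Into 'v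

datatype dgraph = DGraph (nverts: nat) (edges: "(nat source \<times> nat target) list")

definition In_edges :: "dgraph \<Rightarrow> nat \<Rightarrow> nat set" where
  "In_edges G v = {e. e < length (edges G) \<and> snd (edges G ! e) = Into v}"

definition Out_edges :: "dgraph \<Rightarrow> nat \<Rightarrow> nat set" where
  "Out_edges G v = {e. e < length (edges G) \<and> fst (edges G ! e) = OutOf v}"

definition is_dgraph :: "nat \<Rightarrow> nat \<Rightarrow> dgraph \<Rightarrow> bool" where
  "is_dgraph m n G \<longleftrightarrow>
     fst ` set (edges G) \<subseteq> InLeg ` {..<n} \<union> OutOf ` {..<nverts G} \<and>
     snd ` set (edges G) \<subseteq> OutLeg ` {..<m} \<union> Into ` {..<nverts G} \<and>
     (\<forall>i<n. \<exists>!e. e < length (edges G) \<and> fst (edges G ! e) = InLeg i) \<and>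
     (\<forall>j<m. \<exists>!e. e < length (edges G) \<and> snd (edges G ! e) = OutLeg j)"

definition adjacency :: "dgraph \<Rightarrow> (nat \<times> nat) set" where
  "adjacency G = {(u, v). (OutOf u, Into v) \<in> set (edges G)}"

definition wheel_free :: "dgraph \<Rightarrow> bool" where
  "wheel_free G \<longleftrightarrow> acyclic (adjacency G)"

definition cyclic_edge :: "dgraph \<Rightarrow> nat \<Rightarrow> bool" where
  "cyclic_edge G e \<longleftrightarrow> e < length (edges G) \<and>
     (\<exists>u v. edges G ! e = (OutOf u, Into v) \<and> (v, u) \<in> (adjacency G)\<^sup>*)"

section \<open>Decorated graphs, the free prop and its wheeled version\<close>

text \<open>
  A set \<open>T\<close> of biarities stands for the \<open>\<S>\<close>-bimodule \<open>E\<close> with \<open>E(p, q)\<close> the trivial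
  one-dimensional representation placed in degree \<open>1\<close> if \<open>(p, q) \<in> T\<close>, and \<open>E(p, q) = 0\<close>
  otherwise. As \<open>E(Out v, In v)\<close> is then a copy of the ground field in degree \<open>1\<close>, the unordered
  tensor product over the vertices of \<open>G\<close> is spanned by the orderings of the vertices, with an odd
  reordering acting by \<open>-1\<close>. A \<open>dgraph\<close> denotes the graph decorated by the generators, multiplied
  in the order \<open>0, \<dots>, nverts - 1\<close>, so that its degree is \<open>nverts\<close>. Dividing out
  \<open>coinv_rels\<close> gives the sum of the spaces \<open>G\<langle>E\<rangle>\<close> over isomorphism classes of graphs.
\<close>

definition wheeled_graphs :: "(nat \<times> nat) set \<Rightarrow> nat \<Rightarrow> nat \<Rightarrow> dgraph set" where
  "wheeled_graphs T m n = {G. is_dgraph m n G \<and>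
     (\<forall>v<nverts G. (card (Out_edges G v), card (In_edges G v)) \<in> T)}"

definition wheel_free_graphs :: "(nat \<times> nat) set \<Rightarrow> nat \<Rightarrow> nat \<Rightarrow> dgraph set" where
  "wheel_free_graphs T m n = {G \<in> wheeled_graphs T m n. wheel_free G}"

definition graph_span :: "dgraph set \<Rightarrow> (dgraph \<Rightarrow>\<^sub>0 'k::field) set" where
  "graph_span S = {x. Poly_Mapping.keys x \<subseteq> S}"

text \<open>Equality of multisets of edges amounts to the existence of a bijection between the edges.\<close>

definition graph_iso :: "(nat \<Rightarrow> nat) \<Rightarrow> dgraph \<Rightarrow> dgraph \<Rightarrow> bool" where
  "graph_iso \<sigma> G H \<longleftrightarrow> nverts H = nverts G \<and> \<sigma> permutes {..<nverts G} \<and>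
     mset (edges H) = mset (map (map_prod (map_source \<sigma>) (map_target \<sigma>)) (edges G))"

definition coinv_rels :: "dgraph set \<Rightarrow> (dgraph \<Rightarrow>\<^sub>0 'k::field) set" where
  "coinv_rels S = fvs.span {fgen H - fscale (of_int (sign \<sigma>)) (fgen G) | \<sigma> G H.
     G \<in> S \<and> H \<in> S \<and> graph_iso \<sigma> G H}"

text \<open>Disjoint union of an \<open>(m, n)\<close>-graph with a further graph, whose legs come last.\<close>

definition hcomp_graph :: "nat \<Rightarrow> nat \<Rightarrow> dgraph \<Rightarrow> dgraph \<Rightarrow> dgraph" where
  "hcomp_graph m n G H = DGraph (nverts G + nverts H)
     (edges G @ map (\<lambda>(s, t).
        (case s of InLeg i \<Rightarrow> InLeg (n + i) | OutOf v \<Rightarrow> OutOf (nverts G + v),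
         case t of OutLeg j \<Rightarrow> OutLeg (m + j) | Into v \<Rightarrow> Into (nverts G + v))) (edges H))"

text \<open>
  Grafting of the output legs of \<open>H\<close> into the input legs of \<open>G\<close>: the edge of \<open>H\<close> ending at output
  \<open>j\<close> is merged with the edge of \<open>G\<close> starting at input \<open>j\<close>.
\<close>

definition vcomp_graph :: "dgraph \<Rightarrow> dgraph \<Rightarrow> dgraph" where
  "vcomp_graph G H = DGraph (nverts G + nverts H)
     (map (\<lambda>(s, t).
        (map_source (\<lambda>v. nverts G + v) s,
         case t of OutLeg j \<Rightarrow> the (map_of (edges G) (InLeg j))
                 | Into v \<Rightarrow> Into (nverts G + v))) (edges H)
      @ filter (\<lambda>(s, t). \<exists>v. s = OutOf v) (edges G))"

abbreviation hcomp ::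
    "nat \<Rightarrow> nat \<Rightarrow> (dgraph \<Rightarrow>\<^sub>0 'k::field) \<Rightarrow> (dgraph \<Rightarrow>\<^sub>0 'k) \<Rightarrow> (dgraph \<Rightarrow>\<^sub>0 'k)" where
  "hcomp m n \<equiv> bilin_ext (hcomp_graph m n)"

abbreviation vcomp ::
    "(dgraph \<Rightarrow>\<^sub>0 'k::field) \<Rightarrow> (dgraph \<Rightarrow>\<^sub>0 'k) \<Rightarrow> (dgraph \<Rightarrow>\<^sub>0 'k)" where
  "vcomp \<equiv> bilin_ext vcomp_graph"

text \<open>
  The full preimage, in the span of wheel-free decorated graphs, of the ideal of the free prop
  generated by \<open>I\<close>. Permutations of legs are graftings with graphs without vertices.
\<close>

inductive prop_ideal ::
    "(nat \<times> nat) set \<Rightarrow> (nat \<Rightarrow> nat \<Rightarrow> (dgraph \<Rightarrow>\<^sub>0 'k::field) set)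
      \<Rightarrow> nat \<Rightarrow> nat \<Rightarrow> (dgraph \<Rightarrow>\<^sub>0 'k) \<Rightarrow> bool"
  for T :: "(nat \<times> nat) set" and I :: "nat \<Rightarrow> nat \<Rightarrow> (dgraph \<Rightarrow>\<^sub>0 'k::field) set"
where
  generator: "x \<in> I m n \<Longrightarrow> prop_ideal T I m n x"
| coinvariance: "x \<in> coinv_rels (wheel_free_graphs T m n) \<Longrightarrow> prop_ideal T I m n x"
| add: "prop_ideal T I m n x \<Longrightarrow> prop_ideal T I m n y \<Longrightarrow> prop_ideal T I m n (x + y)"
| scale: "prop_ideal T I m n x \<Longrightarrow> prop_ideal T I m n (fscale c x)"
| hcomp_left: "prop_ideal T I m n x \<Longrightarrow> y \<in> graph_span (wheel_free_graphs T p q) \<Longrightarrow>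
    prop_ideal T I (m + p) (n + q) (hcomp m n x y)"
| hcomp_right: "x \<in> graph_span (wheel_free_graphs T m n) \<Longrightarrow> prop_ideal T I p q y \<Longrightarrow>
    prop_ideal T I (m + p) (n + q) (hcomp m n x y)"
| vcomp_left: "prop_ideal T I l m x \<Longrightarrow> y \<in> graph_span (wheel_free_graphs T m n) \<Longrightarrow>
    prop_ideal T I l n (vcomp x y)"
| vcomp_right: "x \<in> graph_span (wheel_free_graphs T l m) \<Longrightarrow> prop_ideal T I m n y \<Longrightarrow>
    prop_ideal T I l n (vcomp x y)"

section \<open>Wheeled extensions\<close>

text \<open>Breaking an edge of an \<open>(m, n)\<close>-graph into output leg \<open>m\<close> and input leg \<open>n\<close>.\<close>

definition break_edge :: "nat \<Rightarrow> nat \<Rightarrow> nat \<Rightarrow> dgraph \<Rightarrow> dgraph" where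
  "break_edge m n e G = DGraph (nverts G)
     ((edges G)[e := (fst (edges G ! e), OutLeg m)] @ [(InLeg n, snd (edges G ! e))])"

fun break_edges :: "nat \<Rightarrow> nat \<Rightarrow> nat list \<Rightarrow> dgraph \<Rightarrow> dgraph" where
  "break_edges m n [] G = G"
| "break_edges m n (e # es) G = break_edges (Suc m) (Suc n) es (break_edge m n e G)"

text \<open>
  \<open>z\<close> is a linear combination of decorated graphs, each equipped with an enumerated set of \<open>r\<close>
  cyclic edges; relations such as the Jacobi one involve several graphs, so that it is the
  combination of the broken graphs that has to lie in the ideal.
\<close>

definition wheeled_ideal ::
    "(nat \<times> nat) set \<Rightarrow> (nat \<Rightarrow> nat \<Rightarrow> (dgraph \<Rightarrow>\<^sub>0 'k::field) set)
      \<Rightarrow> nat \<Rightarrow> nat \<Rightarrow> (dgraph \<Rightarrow>\<^sub>0 'k) set" where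
  "wheeled_ideal T I m n = fvs.span {lin_ext (\<lambda>(G, es). fgen G) z | z r.
     Poly_Mapping.keys z \<subseteq> {(G, es). G \<in> wheeled_graphs T m n \<and>
       length es = r \<and> distinct es \<and> (\<forall>e\<in>set es. cyclic_edge G e)} \<and>
     prop_ideal T I (m + r) (n + r) (lin_ext (\<lambda>(G, es). fgen (break_edges m n es G)) z)}"

definition wheeled_extension ::
    "(nat \<times> nat) set \<Rightarrow> (nat \<Rightarrow> nat \<Rightarrow> (dgraph \<Rightarrow>\<^sub>0 'k::field) set)
      \<Rightarrow> ((dgraph \<Rightarrow>\<^sub>0 'k) \<Rightarrow> (dgraph \<Rightarrow>\<^sub>0 'k)) \<Rightarrow> nat \<Rightarrow> nat
      \<Rightarrow> (dgraph \<Rightarrow>\<^sub>0 'k) presented_complex" where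
  "wheeled_extension T I \<delta> m n =
     \<lparr>chains = (\<lambda>d. graph_span {G \<in> wheeled_graphs T m n. int (nverts G) = d}),
      rels = fvs.span (coinv_rels (wheeled_graphs T m n) \<union> wheeled_ideal T I m n),
      diff = \<delta>\<rparr>"

section \<open>The operads of Lie and strongly homotopy Lie algebras\<close>

definition lie_arities :: "(nat \<times> nat) set" where
  "lie_arities = {(1, 2)}"

definition lie_inf_arities :: "(nat \<times> nat) set" where
  "lie_inf_arities = {(1, q) | q. 2 \<le> q}"

text \<open>Inputs \<open>a\<close>, \<open>b\<close> enter a bracket whose output, together with \<open>c\<close>, enters the root bracket.\<close>

definition bracket_tree :: "nat \<Rightarrow> nat \<Rightarrow> nat \<Rightarrow> dgraph" where
  "bracket_tree a b c = DGraph 2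
     [(OutOf 0, OutLeg 0), (OutOf 1, Into 0), (InLeg a, Into 1), (InLeg b, Into 1),
      (InLeg c, Into 0)]"

definition jacobi :: "dgraph \<Rightarrow>\<^sub>0 'k::field" where
  "jacobi = fgen (bracket_tree 0 1 2) + fgen (bracket_tree 1 2 0) + fgen (bracket_tree 2 0 1)"

definition jacobi_relations :: "nat \<Rightarrow> nat \<Rightarrow> (dgraph \<Rightarrow>\<^sub>0 'k::field) set" where
  "jacobi_relations m n = (if m = 1 \<and> n = 3 then {jacobi} else {})"

definition split_vertex :: "dgraph \<Rightarrow> nat \<Rightarrow> nat set \<Rightarrow> dgraph" where
  "split_vertex G v J = DGraph (Suc (nverts G))
     (map (\<lambda>e. if e \<in> J then (fst (edges G ! e), Into (nverts G)) else edges G ! e)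
        [0..<length (edges G)]
      @ [(OutOf (nverts G), Into v)])"

text \<open>
  Acting on vertex \<open>v\<close> costs \<open>(-1)\<^sup>v\<close> and puts the root of the two-vertex tree at position \<open>v\<close> and
  the corolla grafted into it at position \<open>v + 1\<close>. Moving the latter to the last position, as
  \<open>split_vertex\<close> does, costs \<open>(-1)\<close> to the power \<open>nverts - 1 - v\<close>.
\<close>

definition lie_inf_diff_graph :: "dgraph \<Rightarrow> (dgraph \<Rightarrow>\<^sub>0 'k::field)" where
  "lie_inf_diff_graph G = fscale ((-1) ^ (nverts G + 1))
     (\<Sum>v<nverts G. \<Sum>J | J \<subseteq> In_edges G v \<and> 2 \<le> card J \<and> 1 \<le> card (In_edges G v - J).
        fgen (split_vertex G v J))"

definition lie_inf_diff :: "(dgraph \<Rightarrow>\<^sub>0 'k::field) \<Rightarrow> (dgraph \<Rightarrow>\<^sub>0 'k)" where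
  "lie_inf_diff = lin_ext lie_inf_diff_graph"

definition Lie_inf_wheeled :: "nat \<Rightarrow> nat \<Rightarrow> (dgraph \<Rightarrow>\<^sub>0 'k::field) presented_complex" where
  "Lie_inf_wheeled = wheeled_extension lie_inf_arities (\<lambda>_ _. {}) lie_inf_diff"

definition Lie_wheeled :: "nat \<Rightarrow> nat \<Rightarrow> (dgraph \<Rightarrow>\<^sub>0 'k::field) presented_complex" where
  "Lie_wheeled = wheeled_extension lie_arities jacobi_relations (\<lambda>_. 0)"

text \<open>
  A decorated graph is sent to itself if all of its vertices are binary brackets, and to zero if
  some vertex carries a generator of higher arity.
\<close>

definition lie_projection :: "(dgraph \<Rightarrow>\<^sub>0 'k::field) \<Rightarrow> (dgraph \<Rightarrow>\<^sub>0 'k)" where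
  "lie_projection = lin_ext (\<lambda>G.
     if \<forall>v<nverts G. (card (Out_edges G v), card (In_edges G v)) \<in> lie_arities
     then fgen G else 0)"

text \<open>Compatibility with disjoint union, with grafting, and with units and permutations of legs.\<close>

definition is_prop_map ::
    "(nat \<times> nat) set \<Rightarrow> ((dgraph \<Rightarrow>\<^sub>0 'k::field) \<Rightarrow> (dgraph \<Rightarrow>\<^sub>0 'k)) \<Rightarrow> bool" where
  "is_prop_map T f \<longleftrightarrow>
     (\<forall>m n p q. \<forall>x\<in>graph_span (wheeled_graphs T m n). \<forall>y\<in>graph_span (wheeled_graphs T p q).
        f (hcomp m n x y) = hcomp m n (f x) (f y)) \<and>
     (\<forall>l m n. \<forall>x\<in>graph_span (wheeled_graphs T l m). \<forall>y\<in>graph_span (wheeled_graphs T m n).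
        f (vcomp x y) = vcomp (f x) (f y)) \<and>
     (\<forall>n. \<forall>G\<in>wheeled_graphs T n n. nverts G = 0 \<longrightarrow> f (fgen G) = fgen G)"

end

theory Submission
  imports Defs "HOL-Combinatorics.Orbits"
begin

text \<open>
  \<^bold>\<open>Parent functions.\<close> Every generator of the two operads has a single output, so that a graph is
  the same as a function sending each source of an edge (an input leg or a vertex) to the target of
  the only edge that leaves it. Modulo isomorphism of graphs the differential becomes the sum over
  all ways to split off a set \<open>A\<close> of at least two, but not all, inputs of a vertex. Counting edges
  shows that a graph has at most \<open>n - m\<close> vertices, with equality iff all vertices are binary. Hence
  the complex of \<open>(m, n)\<close>-graphs lives in degrees up to \<open>n - m\<close>, its top degree consists of exactly
  the graphs that survive the projection, and the projection is the identity there. The theorem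
  therefore amounts to two facts: the cohomology below the top degree vanishes, and in the top degree
  the boundaries are exactly the relations of the wheeled extension of the Lie operad.

  \<^bold>\<open>Vanishing below the top degree\<close> (\<open>acyclic_below_top\<close>). Each connected component of a graph is a
  rooted tree or has exactly one wheel. Joining each root to a leaf of its tree turns the trees into
  graphs with one wheel, and the wheels together form the spine: each vertex on it has exactly
  one input on the spine and at least one side input. Filter by the number of edges on the spine. On the
  associated graded only the splittings off the spine remain, and these act on the forest of side
  inputs. A contracting homotopy merges a vertex \<open>w\<close> into a spine vertex whose only side input is
  \<open>w\<close>. With the splittings that detach all side inputs of a spine vertex at once,
  it satisfies the homotopy identity up to the factor \<open>\<beta>\<close>, the number of spine vertices whose side
  inputs are not just one input leg (\<open>homotopy_identity\<close>). In characteristic zero one may divide by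
  \<open>\<beta>\<close>, which vanishes only if all vertices lie on the spine and are binary, hence in the top degree.

  \<^bold>\<open>Relations are boundaries\<close> (\<open>wheeled_ideal_jacobi\<close>). The Jacobi relation is the boundary of the
  ternary corolla. Disjoint union and grafting with binary graphs, and joining an output leg to an
  input leg, commute with the differential up to sign, because binary vertices cannot be split. As
  the broken graphs in the definition of the wheeled ideal are glued back together by such joinings,
  everything in the ideal is a boundary.

  \<^bold>\<open>Boundaries are relations\<close> (\<open>split_sum_in_wheeled_ideal\<close>). A graph one degree below the top has a
  single ternary vertex. Breaking all of its cyclic edges yields a graph without wheels, which can
  be cut below and above the ternary vertex into a composite of binary graphs with the ternary
  corolla (\<open>topological_factorization\<close>); so its boundary lies in the ideal generated by the Jacobi
  relation. The cyclic edges remain cyclic in all splittings of the graph, so that the boundary of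
  the original graph lies in the wheeled ideal.
\<close>

section \<open>Linear extension and congruence modulo a subspace\<close>

interpretation lin_ext: Vector_Spaces.linear fscale fscale
  "lin_ext f :: ('g \<Rightarrow>\<^sub>0 'k::field) \<Rightarrow> ('h \<Rightarrow>\<^sub>0 'k)" for f
proof -
  have eq: "lin_ext f x = (\<Sum>g\<in>S. fscale (Poly_Mapping.lookup x g) (f g))"
    if "finite S" "Poly_Mapping.keys x \<subseteq> S" for x :: "'g \<Rightarrow>\<^sub>0 'k" and S
    unfolding lin_ext_def using that
    by (intro sum.mono_neutral_left) (auto simp: in_keys_iff)
  show "Vector_Spaces.linear fscale fscale (lin_ext f)"
  proof (unfold Vector_Spaces.linear_iff, intro conjI allI)
    fix x y :: "'g \<Rightarrow>\<^sub>0 'k"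
    let ?S = "Poly_Mapping.keys x \<union> Poly_Mapping.keys y"
    have "Poly_Mapping.keys (x + y) \<subseteq> ?S" by (rule Poly_Mapping.keys_add)
    then show "lin_ext f (x + y) = lin_ext f x + lin_ext f y"
      by (simp add: eq[of ?S] lookup_add fvs.scale_left_distrib sum.distrib)
  next
    fix c and x :: "'g \<Rightarrow>\<^sub>0 'k"
    have "Poly_Mapping.keys (fscale c x) \<subseteq> Poly_Mapping.keys x"
      by (auto simp: in_keys_iff)
    then show "lin_ext f (fscale c x) = fscale c (lin_ext f x)"
      by (simp add: eq[of "Poly_Mapping.keys x"] fvs.scale_sum_right)
  qed (unfold_locales)
qed

lemma lin_ext_fgen [simp]: "lin_ext f (fgen g) = f g"
  by (simp add: lin_ext_def)

lemma poly_mapping_eq_sum_fgen: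
  "x = (\<Sum>g\<in>Poly_Mapping.keys x. fscale (Poly_Mapping.lookup x g) (fgen g))"
proof -
  have "lin_ext fgen x = x"
  proof (rule poly_mapping_eqI)
    fix k
    show "Poly_Mapping.lookup (lin_ext fgen x) k = Poly_Mapping.lookup x k"
      by (simp add: lin_ext_def lookup_sum lookup_single when_def in_keys_iff if_distrib cong: if_cong)
  qed
  then show ?thesis by (simp add: lin_ext_def)
qed

lemma graph_span_eq_span:
  "(graph_span S :: (dgraph \<Rightarrow>\<^sub>0 'k::field) set) = fvs.span (fgen ` S)"
proof (rule antisym; rule subsetI)
  fix x :: "dgraph \<Rightarrow>\<^sub>0 'k" assume "x \<in> graph_span S"
  then have "(\<Sum>g\<in>Poly_Mapping.keys x. fscale (Poly_Mapping.lookup x g) (fgen g))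
      \<in> fvs.span (fgen ` S)"
    by (intro fvs.span_sum fvs.span_scale fvs.span_base) (auto simp: graph_span_def)
  then show "x \<in> fvs.span (fgen ` S)" using poly_mapping_eq_sum_fgen[of x] by simp
next
  fix x :: "dgraph \<Rightarrow>\<^sub>0 'k" assume x: "x \<in> fvs.span (fgen ` S)"
  have "fvs.subspace (graph_span S :: (dgraph \<Rightarrow>\<^sub>0 'k) set)"
    unfolding fvs.subspace_def graph_span_def
    by (auto simp: in_keys_iff subset_iff lookup_add) (metis add.left_neutral)
  then have "fvs.span (fgen ` S) \<subseteq> (graph_span S :: (dgraph \<Rightarrow>\<^sub>0 'k) set)"
    by (intro fvs.span_minimal) (auto simp: graph_span_def)
  then show "x \<in> graph_span S" using x by blast
qed

lemma subspace_graph_span: "fvs.subspace (graph_span S)"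
  by (simp add: graph_span_eq_span)

lemma fgen_in_graph_span [simp]: "(fgen G :: dgraph \<Rightarrow>\<^sub>0 'k::field) \<in> graph_span S \<longleftrightarrow> G \<in> S"
  by (simp add: graph_span_def)

lemma graph_span_induct [consumes 1, case_names subspace base]:
  assumes "x \<in> graph_span S" "fvs.subspace {x. P x}" "\<And>G. G \<in> S \<Longrightarrow> P (fgen G)"
  shows "P x"
  using fvs.span_induct[of x "fgen ` S" P] assms by (auto simp: graph_span_eq_span)

lemma graph_span_mono: "S \<subseteq> T \<Longrightarrow> graph_span S \<subseteq> graph_span T"
  by (auto simp: graph_span_def)

lemma subspace_preimage:
  assumes "fvs.subspace C" "Vector_Spaces.linear fscale fscale f"
  shows "fvs.subspace {x. f x \<in> C}"
proof -
  interpret f: Vector_Spaces.linear fscale fscale f by fact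
  show ?thesis using assms(1)
    by (auto simp: fvs.subspace_def f.zero f.add f.scale)
qed

lemma lin_ext_in_subspace:
  assumes "fvs.subspace C" "x \<in> graph_span S" "\<And>G. G \<in> S \<Longrightarrow> f G \<in> C"
  shows "lin_ext f x \<in> C"
  using assms(2)
proof (induction rule: graph_span_induct)
  case subspace
  show ?case by (rule subspace_preimage[OF assms(1) lin_ext.linear_axioms])
qed (simp add: assms(3))

lemma lin_ext_cong:
  assumes "x \<in> graph_span S" "\<And>G. G \<in> S \<Longrightarrow> f G = g G"
  shows "lin_ext f x = lin_ext g x"
  using assms unfolding lin_ext_def graph_span_def by (auto intro!: sum.cong)

definition cong_mod :: "('g \<Rightarrow>\<^sub>0 'k::field) set \<Rightarrow> ('g \<Rightarrow>\<^sub>0 'k) \<Rightarrow> ('g \<Rightarrow>\<^sub>0 'k) \<Rightarrow> bool" where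
  "cong_mod C x y \<longleftrightarrow> x - y \<in> C"

context
  fixes C :: "('g \<Rightarrow>\<^sub>0 'k::field) set"
  assumes C: "fvs.subspace C"
begin

lemma cong_mod_refl [simp]: "cong_mod C x x"
  using C by (simp add: cong_mod_def fvs.subspace_0)

lemma cong_mod_sym: "cong_mod C x y \<Longrightarrow> cong_mod C y x"
  using fvs.subspace_neg[OF C, of "x - y"] by (simp add: cong_mod_def)

lemma cong_mod_trans [trans]: "cong_mod C x y \<Longrightarrow> cong_mod C y z \<Longrightarrow> cong_mod C x z"
  using fvs.subspace_add[OF C, of "x - y" "y - z"] by (simp add: cong_mod_def)

lemma cong_mod_add: "cong_mod C x y \<Longrightarrow> cong_mod C x' y' \<Longrightarrow> cong_mod C (x + x') (y + y')"
  using fvs.subspace_add[OF C, of "x - y" "x' - y'"] by (simp add: cong_mod_def algebra_simps)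

lemma cong_mod_diff: "cong_mod C x y \<Longrightarrow> cong_mod C x' y' \<Longrightarrow> cong_mod C (x - x') (y - y')"
  using fvs.subspace_diff[OF C, of "x - y" "x' - y'"] by (simp add: cong_mod_def algebra_simps)

lemma cong_mod_scale: "cong_mod C x y \<Longrightarrow> cong_mod C (fscale c x) (fscale c y)"
  using fvs.subspace_scale[OF C, of "x - y" c]
  by (simp add: cong_mod_def fvs.scale_right_diff_distrib)

lemma cong_mod_sum:
  "(\<And>i. i \<in> I \<Longrightarrow> cong_mod C (f i) (g i)) \<Longrightarrow> cong_mod C (sum f I) (sum g I)"
  using fvs.subspace_sum[OF C, of I "\<lambda>i. f i - g i"] by (simp add: cong_mod_def sum_subtractf)

lemma cong_mod_in: "cong_mod C x y \<Longrightarrow> y \<in> C \<Longrightarrow> x \<in> C"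
  using fvs.subspace_add[OF C, of "x - y" y] by (simp add: cong_mod_def)

end

abbreviation fsign :: "(nat \<Rightarrow> nat) \<Rightarrow> 'k::field" where
  "fsign \<sigma> \<equiv> of_int (sign \<sigma>)"

lemma fsign_cases: "(fsign \<sigma> :: 'k::field) = 1 \<or> (fsign \<sigma> :: 'k) = -1"
  by (cases \<sigma> rule: sign_cases) auto

lemma fsign_square [simp]: "fsign \<sigma> * (fsign \<sigma> :: 'k::field) = 1"
  using fsign_cases[of \<sigma>, where 'k='k] by auto

lemma fsign_square_left [simp]: "fsign \<sigma> * (fsign \<sigma> * (x :: 'k::field)) = x"
  by (simp flip: mult.assoc)

lemma fsign_nz [simp]: "(fsign \<sigma> :: 'k::field) \<noteq> 0"
  using fsign_cases[of \<sigma>, where 'k='k] by auto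

lemma fsign_compose:
  assumes "\<sigma> permutes {..<V::nat}" "\<tau> permutes {..<V}"
  shows "(fsign (\<sigma> \<circ> \<tau>) :: 'k::field) = fsign \<sigma> * fsign \<tau>"
  using sign_compose[of \<sigma> \<tau>] assms permutes_imp_permutation[of "{..<V}"] by simp

section \<open>Graphs with one output at each vertex as parent functions\<close>

text \<open>
  The sources of the edges of a graph with \<open>n\<close> input legs and \<open>V\<close>
  vertices, each of which starts exactly one edge.
\<close>

definition sources :: "nat \<Rightarrow> nat \<Rightarrow> nat source set" where
  "sources n V = InLeg ` {..<n} \<union> OutOf ` {..<V}"

definition inputs :: "nat \<Rightarrow> nat \<Rightarrow> (nat source \<Rightarrow> nat target) \<Rightarrow> nat \<Rightarrow> nat source set" where
  "inputs n V f v = {s \<in> sources n V. f s = Into v}"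

text \<open>
  The value off the sources is fixed so that graphs up to the order of their edges correspond to
  parent functions one to one.
\<close>

definition is_parent :: "nat \<Rightarrow> nat \<Rightarrow> nat \<Rightarrow> (nat source \<Rightarrow> nat target) \<Rightarrow> bool" where
  "is_parent m n V f \<longleftrightarrow>
     (\<forall>s\<in>sources n V. f s \<in> OutLeg ` {..<m} \<union> Into ` {..<V}) \<and>
     (\<forall>s. s \<notin> sources n V \<longrightarrow> f s = OutLeg 0) \<and>
     (\<forall>j<m. \<exists>!s. s \<in> sources n V \<and> f s = OutLeg j) \<and>
     (\<forall>v<V. 2 \<le> card (inputs n V f v))"

definition encodes :: "nat \<Rightarrow> dgraph \<Rightarrow> (nat source \<Rightarrow> nat target) \<Rightarrow> bool" where
  "encodes n G f \<longleftrightarrow>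
     mset (edges G) = image_mset (\<lambda>s. (s, f s)) (mset_set (sources n (nverts G)))"

definition parent :: "nat \<Rightarrow> dgraph \<Rightarrow> nat source \<Rightarrow> nat target" where
  "parent n G s =
     (if s \<in> sources n (nverts G) then the (map_of (edges G) s) else OutLeg 0)"

text \<open>
  The representative with a fixed order of edges, namely input legs first and vertices afterwards;
  edges leaving vertices are thus found at the positions \<open>n + v\<close>.
\<close>

definition graph_of :: "nat \<Rightarrow> nat \<Rightarrow> (nat source \<Rightarrow> nat target) \<Rightarrow> dgraph" where
  "graph_of n V f = DGraph V (map (\<lambda>s. (s, f s)) (map InLeg [0..<n] @ map OutOf [0..<V]))"

text \<open>
  The action of a renumbering of the vertices, by conjugation.
\<close>

definition relabel ::
    "(nat \<Rightarrow> nat) \<Rightarrow> (nat source \<Rightarrow> nat target) \<Rightarrow> nat source \<Rightarrow> nat target" where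
  "relabel \<sigma> f s = map_target \<sigma> (f (map_source (inv \<sigma>) s))"

abbreviation W :: "nat \<Rightarrow> nat \<Rightarrow> dgraph set" where
  "W \<equiv> wheeled_graphs lie_inf_arities"

lemma is_parent_OutLegE:
  assumes "is_parent m n V f" "j < m"
  obtains s where "s \<in> sources n V" "f s = OutLeg j"
    "\<And>s'. s' \<in> sources n V \<Longrightarrow> f s' = OutLeg j \<Longrightarrow> s' = s"
  using assms unfolding is_parent_def Ex1_def by blast

lemma finite_sources [simp]: "finite (sources n V)"
  by (simp add: sources_def)

lemma card_sources: "card (sources n V) = n + V"
  unfolding sources_def
  by (subst card_Un_disjoint) (auto simp: card_image inj_on_def)

lemma sources_simps [simp]:
  "InLeg i \<in> sources n V \<longleftrightarrow> i < n" "OutOf v \<in> sources n V \<longleftrightarrow> v < V"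
  by (auto simp: sources_def)

lemma finite_inputs [simp]: "finite (inputs n V f v)"
  by (simp add: inputs_def)

lemma encodes_graph_of [simp]: "encodes n (graph_of n V f) f"
proof -
  have "mset (map InLeg [0..<n] @ map OutOf [0..<V]) = mset_set (sources n V)"
    by (subst mset_set_set[symmetric])
       (auto simp: distinct_map inj_on_def sources_def atLeast0LessThan
             simp flip: mset_append intro!: arg_cong[where f=mset_set])
  then show ?thesis
    by (simp only: encodes_def graph_of_def dgraph.sel mset_map)
qed

lemma nverts_graph_of [simp]: "nverts (graph_of n V f) = V"
  by (simp add: graph_of_def)

context
  fixes n G f assumes enc: "encodes n G f"
begin

lemma encodes_set: "set (edges G) = (\<lambda>s. (s, f s)) ` sources n (nverts G)"
proof -
  have "set_mset (mset (edges G)) = (\<lambda>s. (s, f s)) ` sources n (nverts G)"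
    using enc unfolding encodes_def by simp
  then show ?thesis by simp
qed

lemma encodes_fst: "mset (map fst (edges G)) = mset_set (sources n (nverts G))"
proof -
  have "image_mset fst (mset (edges G)) = mset_set (sources n (nverts G))"
    using enc unfolding encodes_def by (simp add: image_mset.compositionality comp_def)
  then show ?thesis by simp
qed

lemma encodes_distinct: "distinct (map fst (edges G))"
  unfolding distinct_count_atmost_1 encodes_fst
  by (metis encodes_fst count_mset_set' finite_sources finite_set_mset_mset_set set_mset_mset)

lemma encodes_set_fst: "set (map fst (edges G)) = sources n (nverts G)"
  using encodes_fst by (metis finite_sources finite_set_mset_mset_set set_mset_mset)

lemma encodes_edge: "e < length (edges G) \<Longrightarrow> edges G ! e = (fst (edges G ! e), f (fst (edges G ! e)))"
  using encodes_set nth_mem[of e "edges G"] by auto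

lemma encodes_snd: "e < length (edges G) \<Longrightarrow> snd (edges G ! e) = f (fst (edges G ! e))"
  using encodes_edge by (metis snd_conv)

lemma encodes_bij:
  "bij_betw (\<lambda>e. fst (edges G ! e)) {..<length (edges G)} (sources n (nverts G))"
  using bij_betw_nth[OF encodes_distinct refl refl] encodes_set_fst
  by (auto simp: bij_betw_def inj_on_def image_iff in_set_conv_nth Bex_def
        simp del: set_map)

lemma encodes_In_edges:
  "bij_betw (\<lambda>e. fst (edges G ! e)) (In_edges G v) (inputs n (nverts G) f v)"
proof -
  have "In_edges G v = {e \<in> {..<length (edges G)}. f (fst (edges G ! e)) = Into v}"
    unfolding In_edges_def by (auto simp: encodes_snd)
  moreover have "inputs n (nverts G) f v = (\<lambda>e. fst (edges G ! e)) ` \<dots>"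
    using encodes_bij by (auto simp: bij_betw_def inputs_def)
  ultimately show ?thesis
    using encodes_bij by (auto simp: bij_betw_def intro: inj_on_subset)
qed

lemma encodes_card_In: "card (In_edges G v) = card (inputs n (nverts G) f v)"
  using encodes_In_edges by (rule bij_betw_same_card)

lemma encodes_card_Out: "v < nverts G \<Longrightarrow> card (Out_edges G v) = 1"
proof -
  assume v: "v < nverts G"
  obtain e where e: "e < length (edges G)" "fst (edges G ! e) = OutOf v"
    using encodes_bij v unfolding bij_betw_def by (auto dest!: equalityD2 simp: subset_iff image_iff)
      (metis sources_simps(2) lessThan_iff)
  have "Out_edges G v = {e}"
    unfolding Out_edges_def using encodes_bij e by (auto simp: bij_betw_def inj_on_def)
  then show ?thesis by simp
qed

lemma encodes_parent: "s \<in> sources n (nverts G) \<Longrightarrow> parent n G s = f s"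
proof -
  assume s: "s \<in> sources n (nverts G)"
  then have "(s, f s) \<in> set (edges G)" by (simp add: encodes_set)
  then show ?thesis using s encodes_distinct by (simp add: parent_def)
qed

text \<open>
  Each source starts one edge, so the conditions on the outputs hold automatically, and those on the
  inputs are the ones that parent functions satisfy.
\<close>

lemma encodes_in_W:
  assumes f: "is_parent m n (nverts G) f"
  shows "G \<in> W m n"
proof -
  have ex1: "\<exists>!e. e < length (edges G) \<and> fst (edges G ! e) = s" if "s \<in> sources n (nverts G)" for s
    using encodes_bij that unfolding bij_betw_def inj_on_def
    by (metis (no_types, lifting) imageE lessThan_iff)
  have "\<exists>!e. e < length (edges G) \<and> snd (edges G ! e) = OutLeg j" if "j < m" for j
  proof -
    obtain s where s: "s \<in> sources n (nverts G)" "f s = OutLeg j"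
      and un: "\<And>s'. s' \<in> sources n (nverts G) \<Longrightarrow> f s' = OutLeg j \<Longrightarrow> s' = s"
      using is_parent_OutLegE[OF f \<open>j < m\<close>] by blast
    obtain e where e: "e < length (edges G)" "fst (edges G ! e) = s"
      and une: "\<And>e'. e' < length (edges G) \<Longrightarrow> fst (edges G ! e') = s \<Longrightarrow> e' = e"
      using ex1[OF s(1)] by metis
    show ?thesis
    proof (rule ex1I[of _ e])
      show "e < length (edges G) \<and> snd (edges G ! e) = OutLeg j"
        using e s encodes_snd by auto
      fix e' assume e': "e' < length (edges G) \<and> snd (edges G ! e') = OutLeg j"
      then have "fst (edges G ! e') \<in> sources n (nverts G)"
        using encodes_bij by (auto simp: bij_betw_def)
      then have "fst (edges G ! e') = s" using un e' encodes_snd by auto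
      then show "e' = e" using une e' by auto
    qed
  qed
  moreover have "fst ` set (edges G) \<subseteq> InLeg ` {..<n} \<union> OutOf ` {..<nverts G}"
    by (auto simp: encodes_set sources_def)
  moreover have "snd ` set (edges G) \<subseteq> OutLeg ` {..<m} \<union> Into ` {..<nverts G}"
    using f by (auto simp: encodes_set is_parent_def)
  ultimately have "is_dgraph m n G"
    unfolding is_dgraph_def using ex1 by auto
  moreover have "(card (Out_edges G v), card (In_edges G v)) \<in> lie_inf_arities"
    if "v < nverts G" for v
    using that f by (auto simp: lie_inf_arities_def encodes_card_In encodes_card_Out is_parent_def)
  ultimately show ?thesis by (simp add: wheeled_graphs_def)
qed

end

lemma graph_of_in_W [simp]: "is_parent m n V f \<Longrightarrow> graph_of n V f \<in> W m n"
  by (rule encodes_in_W[OF encodes_graph_of]) simp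

lemma parent_eq:
  assumes "encodes n G f" "is_parent m n (nverts G) f"
  shows "parent n G = f"
proof
  fix s show "parent n G s = f s"
    using encodes_parent[OF assms(1)] assms(2)
    by (cases "s \<in> sources n (nverts G)") (auto simp: parent_def is_parent_def)
qed

lemma parent_graph_of [simp]: "is_parent m n V f \<Longrightarrow> parent n (graph_of n V f) = f"
  by (rule parent_eq[OF encodes_graph_of]) simp

text \<open>
  Counting arities: each vertex starts exactly one edge, because all generators have one output, and
  so does each input leg.
\<close>

lemma W_encodes:
  assumes G: "G \<in> W m n"
  shows "encodes n G (parent n G)" "is_parent m n (nverts G) (parent n G)"
proof -
  let ?S = "sources n (nverts G)" and ?es = "edges G"
  have dg: "is_dgraph m n G"
    and ar: "\<And>v. v < nverts G \<Longrightarrow> (card (Out_edges G v), card (In_edges G v)) \<in> lie_inf_arities"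
    using G by (auto simp: wheeled_graphs_def)
  have ex1: "\<exists>!e. e < length ?es \<and> fst (?es ! e) = s" if "s \<in> ?S" for s
  proof (cases s)
    case (InLeg i)
    then show ?thesis using dg that by (auto simp: is_dgraph_def)
  next
    case (OutOf v)
    then have "card (Out_edges G v) = 1" using ar that by (auto simp: lie_inf_arities_def)
    then obtain e where "Out_edges G v = {e}" by (auto simp: card_1_singleton_iff)
    then show ?thesis using OutOf unfolding Out_edges_def by (intro ex1I[of _ e]) auto
  qed
  have sub: "fst (?es ! e) \<in> ?S" if "e < length ?es" for e
    using dg nth_mem[OF that] unfolding is_dgraph_def sources_def by (meson image_eqI subsetD)
  have dist: "distinct (map fst ?es)"
    unfolding distinct_conv_nth using ex1 sub by simp metis
  have "set (map fst ?es) = ?S"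
    using ex1 sub by (fastforce simp: in_set_conv_nth set_eq_iff image_iff Bex_def simp del: set_map)
  then have ms: "mset (map fst ?es) = mset_set ?S"
    using dist by (metis mset_set_set)
  have "map (\<lambda>s. (s, parent n G s)) (map fst ?es) = ?es"
    unfolding map_map
  proof (rule map_idI)
    fix e assume e: "e \<in> set ?es"
    then have "fst e \<in> ?S" using sub by (auto simp: in_set_conv_nth)
    moreover have "map_of ?es (fst e) = Some (snd e)" using dist e by simp
    ultimately show "((\<lambda>s. (s, parent n G s)) \<circ> fst) e = e" by (simp add: parent_def)
  qed
  then show enc: "encodes n G (parent n G)"
    unfolding encodes_def by (metis ms mset_map)
  show "is_parent m n (nverts G) (parent n G)"
    unfolding is_parent_def
  proof (intro conjI allI ballI impI)
    fix s assume "s \<in> ?S"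
    then have "(s, parent n G s) \<in> set ?es" using encodes_set[OF enc] by auto
    then show "parent n G s \<in> OutLeg ` {..<m} \<union> Into ` {..<nverts G}"
      using dg unfolding is_dgraph_def by (metis image_eqI snd_conv subsetD)
  next
    fix j assume "j < m"
    then obtain e where e: "e < length ?es" "snd (?es ! e) = OutLeg j"
      and un: "\<And>e'. e' < length ?es \<Longrightarrow> snd (?es ! e') = OutLeg j \<Longrightarrow> e' = e"
      using dg unfolding is_dgraph_def by metis
    show "\<exists>!s. s \<in> ?S \<and> parent n G s = OutLeg j"
    proof (rule ex1I[of _ "fst (?es ! e)"])
      show "fst (?es ! e) \<in> ?S \<and> parent n G (fst (?es ! e)) = OutLeg j"
        using e sub encodes_snd[OF enc] by auto
      fix s assume s: "s \<in> ?S \<and> parent n G s = OutLeg j"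
      then obtain e' where "e' < length ?es" "fst (?es ! e') = s" using ex1 by blast
      then show "s = fst (?es ! e)" using un[of e'] s encodes_snd[OF enc] by auto
    qed
  next
    fix v assume "v < nverts G"
    then show "2 \<le> card (inputs n (nverts G) (parent n G) v)"
      using ar[of v] encodes_card_In[OF enc, of v] by (simp add: lie_inf_arities_def)
  qed (simp add: parent_def)
qed

lemma binary_in_W_iff:
  "G \<in> wheeled_graphs lie_arities m n \<longleftrightarrow>
    G \<in> W m n \<and> (\<forall>v<nverts G. card (inputs n (nverts G) (parent n G) v) = 2)"
proof -
  have "lie_arities \<subseteq> lie_inf_arities" by (auto simp: lie_arities_def lie_inf_arities_def)
  then have "wheeled_graphs lie_arities m n \<subseteq> W m n" by (auto simp: wheeled_graphs_def)
  moreover have "G \<in> wheeled_graphs lie_arities m n \<longleftrightarrow>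
      (\<forall>v<nverts G. card (inputs n (nverts G) (parent n G) v) = 2)" if "G \<in> W m n"
    using that encodes_card_In[OF W_encodes(1)[OF that]] encodes_card_Out[OF W_encodes(1)[OF that]]
    by (auto simp: wheeled_graphs_def lie_arities_def)
  ultimately show ?thesis by blast
qed

section \<open>Isomorphisms\<close>

lemma map_source_comp [simp]: "map_source f (map_source g s) = map_source (\<lambda>x. f (g x)) s"
  by (cases s) auto

lemma map_source_ident [simp]: "map_source (\<lambda>x. x) s = s"
  by (cases s) auto

lemma map_target_comp [simp]: "map_target f (map_target g s) = map_target (\<lambda>x. f (g x)) s"
  by (cases s) auto

lemma map_target_ident [simp]: "map_target (\<lambda>x. x) s = s"
  by (cases s) auto

lemma map_source_sources:
  assumes "\<sigma> permutes {..<V}"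
  shows "map_source \<sigma> s \<in> sources n V \<longleftrightarrow> s \<in> sources n V"
  using permutes_in_image[OF assms] by (cases s) auto

lemma bij_map_source:
  assumes "\<sigma> permutes A"
  shows "bij (map_source \<sigma>)"
  by (rule o_bij[of "map_source (inv \<sigma>)"])
     (auto simp: fun_eq_iff permutes_inverses[OF assms])

lemma relabel_apply:
  assumes "\<sigma> permutes A"
  shows "relabel \<sigma> f (map_source \<sigma> s) = map_target \<sigma> (f s)"
  by (simp add: relabel_def permutes_inverses[OF assms])

lemma relabel_eqI:
  assumes "\<sigma> permutes A" "\<And>s. g (map_source \<sigma> s) = map_target \<sigma> (f s)"
  shows "g = relabel \<sigma> f"
proof
  fix s
  have "map_source \<sigma> (map_source (inv \<sigma>) s) = s" by (simp add: permutes_inverses[OF assms(1)])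
  then show "g s = relabel \<sigma> f s" using assms(2)[of "map_source (inv \<sigma>) s"]
    by (simp add: relabel_def)
qed

lemma relabel_relabel:
  assumes "\<sigma> permutes A" "\<tau> permutes A"
  shows "relabel \<sigma> (relabel \<tau> f) = relabel (\<sigma> \<circ> \<tau>) f"
proof (rule relabel_eqI[OF permutes_compose[OF assms(2,1)]])
  fix s
  have "map_source (\<sigma> \<circ> \<tau>) s = map_source \<sigma> (map_source \<tau> s)" by (cases s) auto
  then show "relabel \<sigma> (relabel \<tau> f) (map_source (\<sigma> \<circ> \<tau>) s) = map_target (\<sigma> \<circ> \<tau>) (f s)"
    by (simp add: relabel_apply[OF assms(1)] relabel_apply[OF assms(2)] comp_def del: map_source_comp)
qed

lemma relabel_id [simp]: "relabel id f = f"
  by (simp add: relabel_def fun_eq_iff id_def inv_id[unfolded id_def])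

lemma inputs_relabel:
  assumes "\<sigma> permutes {..<V}"
  shows "inputs n V (relabel \<sigma> f) (\<sigma> v) = map_source \<sigma> ` inputs n V f v"
proof (intro set_eqI iffI)
  fix s assume "s \<in> inputs n V (relabel \<sigma> f) (\<sigma> v)"
  moreover obtain t where t: "s = map_source \<sigma> t"
    using bij_map_source[OF assms] by (metis bij_pointE)
  ultimately have "t \<in> inputs n V f v"
    using permutes_inj[OF assms]
    by (cases "f t") (auto simp: inputs_def relabel_apply[OF assms] map_source_sources[OF assms] inj_eq)
  then show "s \<in> map_source \<sigma> ` inputs n V f v" using t by blast
next
  fix s assume "s \<in> map_source \<sigma> ` inputs n V f v"
  then show "s \<in> inputs n V (relabel \<sigma> f) (\<sigma> v)"
    by (auto simp: inputs_def relabel_apply[OF assms] map_source_sources[OF assms])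
qed

lemma is_parent_relabel:
  assumes \<sigma>: "\<sigma> permutes {..<V}" and f: "is_parent m n V f"
  shows "is_parent m n V (relabel \<sigma> f)"
proof -
  have sur: "\<exists>t. s = map_source \<sigma> t" for s
    using bij_map_source[OF \<sigma>] by (metis bij_pointE)
  have inj: "map_source \<sigma> s = map_source \<sigma> t \<longleftrightarrow> s = t" for s t
    using bij_map_source[OF \<sigma>] by (metis bij_pointE)
  note [simp] = relabel_apply[OF \<sigma>] map_source_sources[OF \<sigma>]
  show ?thesis unfolding is_parent_def
  proof (intro conjI allI impI ballI)
    fix s assume s: "s \<in> sources n V"
    obtain t where t: "s = map_source \<sigma> t" using sur by blast
    with s f have "f t \<in> OutLeg ` {..<m} \<union> Into ` {..<V}" by (auto simp: is_parent_def)
    then show "relabel \<sigma> f s \<in> OutLeg ` {..<m} \<union> Into ` {..<V}"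
      using permutes_in_image[OF \<sigma>] t by auto
  next
    fix s assume s: "s \<notin> sources n V"
    obtain t where t: "s = map_source \<sigma> t" using sur by blast
    with s f show "relabel \<sigma> f s = OutLeg 0" by (auto simp: is_parent_def)
  next
    fix j assume "j < m"
    then obtain s where s: "s \<in> sources n V" "f s = OutLeg j"
      and un: "\<And>s'. s' \<in> sources n V \<Longrightarrow> f s' = OutLeg j \<Longrightarrow> s' = s"
      using is_parent_OutLegE[OF f] by blast
    show "\<exists>!s. s \<in> sources n V \<and> relabel \<sigma> f s = OutLeg j"
    proof (rule ex1I[of _ "map_source \<sigma> s"])
      show "map_source \<sigma> s \<in> sources n V \<and> relabel \<sigma> f (map_source \<sigma> s) = OutLeg j"
        using s by simp
      fix s' assume s': "s' \<in> sources n V \<and> relabel \<sigma> f s' = OutLeg j"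
      obtain t where t: "s' = map_source \<sigma> t" using sur by blast
      with s' have "t \<in> sources n V \<and> f t = OutLeg j" by (cases "f t") auto
      then show "s' = map_source \<sigma> s" using un t by blast
    qed
  next
    fix v assume "v < V"
    then have "inv \<sigma> v < V" using permutes_in_image[OF permutes_inv[OF \<sigma>], of v] by auto
    then have "2 \<le> card (inputs n V f (inv \<sigma> v))" using f by (auto simp: is_parent_def)
    moreover have "inputs n V (relabel \<sigma> f) v = map_source \<sigma> ` inputs n V f (inv \<sigma> v)"
      using inputs_relabel[OF \<sigma>, of n f "inv \<sigma> v"] by (simp add: permutes_inverses[OF \<sigma>])
    ultimately show "2 \<le> card (inputs n V (relabel \<sigma> f) v)"
      by (simp add: card_image inj_on_def inj)
  qed
qed

lemma graph_iso_relabel: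
  assumes G: "encodes n G f" and H: "encodes n H (relabel \<sigma> f)" and V: "nverts H = nverts G"
    and \<sigma>: "\<sigma> permutes {..<nverts G}"
  shows "graph_iso \<sigma> G H"
proof -
  let ?S = "sources n (nverts G)"
  have im: "map_source \<sigma> ` ?S = ?S"
  proof (intro set_eqI iffI)
    fix s assume "s \<in> ?S"
    moreover obtain t where "s = map_source \<sigma> t"
      using bij_map_source[OF \<sigma>] by (metis bij_pointE)
    ultimately show "s \<in> map_source \<sigma> ` ?S" using map_source_sources[OF \<sigma>] by auto
  qed (auto simp: map_source_sources[OF \<sigma>])
  have "mset_set ?S = image_mset (map_source \<sigma>) (mset_set ?S)"
    using image_mset_mset_set[of "map_source \<sigma>" ?S] bij_map_source[OF \<sigma>] im
    by (metis bij_is_inj inj_on_subset subset_UNIV)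
  then have "mset (edges H) = image_mset (\<lambda>s. (s, relabel \<sigma> f s)) (image_mset (map_source \<sigma>) (mset_set ?S))"
    using H V unfolding encodes_def by metis
  also have "\<dots> = image_mset (map_prod (map_source \<sigma>) (map_target \<sigma>)) (mset (edges G))"
    using G unfolding encodes_def
    by (simp add: image_mset.compositionality comp_def relabel_apply[OF \<sigma>])
  finally show ?thesis using V \<sigma> by (simp add: graph_iso_def)
qed

lemma graph_iso_parent:
  assumes iso: "graph_iso \<sigma> G H" and G: "G \<in> W m n" and H: "H \<in> W m n"
  shows "parent n H = relabel \<sigma> (parent n G)"
proof -
  have \<sigma>: "\<sigma> permutes {..<nverts G}" and V: "nverts H = nverts G"
    and ms: "mset (edges H) = mset (map (map_prod (map_source \<sigma>) (map_target \<sigma>)) (edges G))"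
    using iso by (auto simp: graph_iso_def)
  have set: "set (edges H) = map_prod (map_source \<sigma>) (map_target \<sigma>) ` set (edges G)"
    using ms by (metis mset_eq_setD set_map)
  note eG = encodes_set[OF W_encodes(1)[OF G]] and eH = encodes_set[OF W_encodes(1)[OF H]]
  show ?thesis
  proof (rule relabel_eqI[OF \<sigma>])
    fix s
    show "parent n H (map_source \<sigma> s) = map_target \<sigma> (parent n G s)"
    proof (cases "s \<in> sources n (nverts G)")
      case True
      then have "(map_source \<sigma> s, map_target \<sigma> (parent n G s)) \<in> set (edges H)"
        unfolding set eG by force
      then show ?thesis unfolding eH by auto
    next
      case False
      then show ?thesis using V map_source_sources[OF \<sigma>] by (simp add: parent_def)
    qed
  qed
qed

section \<open>Coinvariants\<close>

abbreviation C :: "nat \<Rightarrow> nat \<Rightarrow> (dgraph \<Rightarrow>\<^sub>0 'k::field) set" where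
  "C m n \<equiv> coinv_rels (W m n)"

abbreviation pgen :: "nat \<Rightarrow> nat \<Rightarrow> (nat source \<Rightarrow> nat target) \<Rightarrow> (dgraph \<Rightarrow>\<^sub>0 'k::field)" where
  "pgen n V f \<equiv> fgen (graph_of n V f)"

lemma subspace_coinv_rels [simp]: "fvs.subspace (coinv_rels S)"
  by (simp add: coinv_rels_def)

lemma cong_coinv_trans [trans]:
  "cong_mod (coinv_rels S) x y \<Longrightarrow> cong_mod (coinv_rels S) y z \<Longrightarrow> cong_mod (coinv_rels S) x z"
  by (rule cong_mod_trans) simp

lemma cong_iso:
  assumes "G \<in> S" "H \<in> S" "graph_iso \<sigma> G H"
  shows "cong_mod (coinv_rels S) (fgen H) (fscale (fsign \<sigma>) (fgen G))"
  unfolding cong_mod_def coinv_rels_def using assms by (intro fvs.span_base) blast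

text \<open>
  A map defined on graphs descends to coinvariants as soon as it is equivariant with the sign of the
  renumbering.
\<close>

lemma lin_ext_coinv:
  assumes D: "fvs.subspace D" and x: "x \<in> coinv_rels S"
    and F: "\<And>\<sigma> G H. G \<in> S \<Longrightarrow> H \<in> S \<Longrightarrow> graph_iso \<sigma> G H \<Longrightarrow>
      cong_mod D (F H) (fscale (fsign \<sigma>) (F G))"
  shows "lin_ext F x \<in> D"
proof -
  have "coinv_rels S \<subseteq> {x. lin_ext F x \<in> D}"
    unfolding coinv_rels_def
  proof (rule fvs.span_minimal)
    show "fvs.subspace {x. lin_ext F x \<in> D}"
      by (rule subspace_preimage[OF D lin_ext.linear_axioms])
  qed (use F in \<open>auto simp: lin_ext.diff lin_ext.scale cong_mod_def\<close>)
  then show ?thesis using x by blast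
qed

lemma lin_ext_cong_mod:
  assumes D: "fvs.subspace D" and x: "x \<in> graph_span S"
    and "\<And>G. G \<in> S \<Longrightarrow> cong_mod D (F G) (F' G)"
  shows "cong_mod D (lin_ext F x) (lin_ext F' x)"
  using x
proof (induction rule: graph_span_induct)
  case subspace
  show ?case unfolding fvs.subspace_def
    using D by (auto simp: lin_ext.zero lin_ext.add lin_ext.scale intro: cong_mod_add cong_mod_scale)
qed (simp add: assms(3))

lemma cong_encodes:
  assumes "encodes n G f" "encodes n H (relabel \<sigma> f)" "is_parent m n (nverts G) f"
    "nverts H = nverts G" "\<sigma> permutes {..<nverts G}"
  shows "cong_mod (C m n) (fgen H) (fscale (fsign \<sigma>) (fgen G))"
proof (rule cong_iso)
  show "G \<in> W m n" by (rule encodes_in_W) fact+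
  show "H \<in> W m n" by (rule encodes_in_W[OF assms(2)]) (simp add: assms is_parent_relabel)
  show "graph_iso \<sigma> G H" by (rule graph_iso_relabel) fact+
qed

text \<open>
  A renumbering of the vertices costs its sign, since all generators have degree one.
\<close>

lemma cong_relabel:
  assumes "is_parent m n V f" "\<sigma> permutes {..<V}"
  shows "cong_mod (C m n) (pgen n V (relabel \<sigma> f)) (fscale (fsign \<sigma>) (pgen n V f))"
  by (rule cong_encodes[OF encodes_graph_of encodes_graph_of]) (simp_all add: assms)

lemma cong_pgen:
  assumes "encodes n G f" "is_parent m n (nverts G) f"
  shows "cong_mod (C m n) (fgen G) (pgen n (nverts G) f)"
proof -
  have "cong_mod (C m n) (fgen G) (fscale (fsign id) (pgen n (nverts G) f))"
    by (rule cong_encodes[OF encodes_graph_of]) (simp_all add: assms permutes_id)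
  then show ?thesis by simp
qed

lemma cong_pgen_parent:
  "G \<in> W m n \<Longrightarrow> cong_mod (C m n) (fgen G) (pgen n (nverts G) (parent n G))"
  by (rule cong_pgen) (auto intro: W_encodes)

section \<open>Splitting a vertex\<close>

text \<open>
  The inputs \<open>A\<close> of \<open>v\<close> are moved to a new last vertex, whose output
  becomes an input of \<open>v\<close>. At least one input has to stay at \<open>v\<close>, so
  \<open>v\<close> keeps two inputs, counting the new one.
\<close>

definition splittings ::
    "nat \<Rightarrow> nat \<Rightarrow> (nat source \<Rightarrow> nat target) \<Rightarrow> (nat \<times> nat source set) set" where
  "splittings n V f =
     {(v, A). v < V \<and> A \<subseteq> inputs n V f v \<and> 2 \<le> card A \<and> A \<noteq> inputs n V f v}"

definition split_at ::
    "nat \<Rightarrow> (nat source \<Rightarrow> nat target) \<Rightarrow> nat \<Rightarrow> nat source set \<Rightarrow> nat source \<Rightarrow> nat target" where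
  "split_at V f v A s = (if s \<in> A then Into V else if s = OutOf V then Into v else f s)"

definition split_sum ::
    "nat \<Rightarrow> nat \<Rightarrow> (nat source \<Rightarrow> nat target) \<Rightarrow> (dgraph \<Rightarrow>\<^sub>0 'k::field)" where
  "split_sum n V f = (\<Sum>(v, A)\<in>splittings n V f. pgen n (Suc V) (split_at V f v A))"

lemma sources_Suc: "sources n (Suc V) = insert (OutOf V) (sources n V)"
  by (auto simp: sources_def lessThan_Suc)

lemma inputs_subset: "inputs n V f v \<subseteq> sources n V"
  by (auto simp: inputs_def)

lemma finite_splittings [simp]: "finite (splittings n V f)"
proof -
  have "splittings n V f \<subseteq> {..<V} \<times> Pow (sources n V)"
    using inputs_subset by (fastforce simp: splittings_def)
  then show ?thesis by (rule finite_subset) simp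
qed

lemma splittings_OutOf: "(v, A) \<in> splittings n V f \<Longrightarrow> OutOf V \<notin> A"
  using inputs_subset[of n V f v] by (auto simp: splittings_def)

lemma splittings_finite: "(v, A) \<in> splittings n V f \<Longrightarrow> finite A"
  by (auto simp: splittings_def intro: finite_subset)

context
  fixes m n V f v A
  assumes f: "is_parent m n V f" and A: "(v, A) \<in> splittings n V f"
begin

lemma splitting_facts:
  "v < V" "OutOf V \<notin> A" "A \<subseteq> sources n V" "\<And>s. s \<in> A \<Longrightarrow> f s = Into v"
  using A splittings_OutOf[OF A] by (auto simp: splittings_def inputs_def)

lemma inputs_split_new: "inputs n (Suc V) (split_at V f v A) V = A"
proof -
  have "f s \<noteq> Into V" if "s \<in> sources n V" for s
    using f that by (auto simp: is_parent_def)
  then show ?thesis using splitting_facts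
    by (auto simp: inputs_def split_at_def sources_Suc split: if_splits)
qed

lemma inputs_split_same:
  "inputs n (Suc V) (split_at V f v A) v = insert (OutOf V) (inputs n V f v - A)"
  using splitting_facts(1-3) by (auto simp: inputs_def split_at_def sources_Suc split: if_splits)

lemma inputs_split_other:
  "u < V \<Longrightarrow> u \<noteq> v \<Longrightarrow> inputs n (Suc V) (split_at V f v A) u = inputs n V f u"
  using splitting_facts by (auto simp: inputs_def split_at_def sources_Suc split: if_splits)

lemma is_parent_split: "is_parent m n (Suc V) (split_at V f v A)"
proof -
  have v: "v < V" and sub: "A \<subseteq> inputs n V f v" using A by (auto simp: splittings_def)
  show ?thesis unfolding is_parent_def
  proof (intro conjI allI impI ballI)
    fix s assume "s \<in> sources n (Suc V)"
    then show "split_at V f v A s \<in> OutLeg ` {..<m} \<union> Into ` {..<Suc V}"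
      using f v by (fastforce simp: split_at_def is_parent_def sources_Suc)
  next
    fix s assume "s \<notin> sources n (Suc V)"
    then show "split_at V f v A s = OutLeg 0"
      using f sub by (auto simp: split_at_def is_parent_def sources_Suc inputs_def)
  next
    fix j assume "j < m"
    then obtain s where s: "s \<in> sources n V" "f s = OutLeg j"
      and un: "\<And>s'. s' \<in> sources n V \<Longrightarrow> f s' = OutLeg j \<Longrightarrow> s' = s"
      using is_parent_OutLegE[OF f] by blast
    have "s \<notin> A" "s \<noteq> OutOf V" using s sub by (auto simp: inputs_def)
    then have "s \<in> sources n (Suc V) \<and> split_at V f v A s = OutLeg j"
      using s by (simp add: split_at_def sources_Suc)
    moreover have "s' = s" if "s' \<in> sources n (Suc V) \<and> split_at V f v A s' = OutLeg j" for s'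
      by (rule un) (use that in \<open>auto simp: split_at_def sources_Suc split: if_splits\<close>)
    ultimately show "\<exists>!s. s \<in> sources n (Suc V) \<and> split_at V f v A s = OutLeg j" by blast
  next
    fix u assume u: "u < Suc V"
    consider "u = V" | "u = v" | "u < V" "u \<noteq> v" using u by linarith
    then show "2 \<le> card (inputs n (Suc V) (split_at V f v A) u)"
    proof cases
      case 1
      then show ?thesis using A by (simp add: inputs_split_new splittings_def)
    next
      case 2
      have "inputs n V f v - A \<noteq> {}" using A by (auto simp: splittings_def)
      then have "0 < card (inputs n V f v - A)" by (simp add: card_gt_0_iff)
      moreover have "OutOf V \<notin> inputs n V f v - A" using inputs_subset[of n V f v] by auto
      ultimately show ?thesis using 2 by (simp add: inputs_split_same)
    next
      case 3
      then show ?thesis using f by (simp add: inputs_split_other is_parent_def)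
    qed
  qed
qed

end

lemma relabel_split:
  assumes \<sigma>: "\<sigma> permutes {..<V}"
  shows "split_at V (relabel \<sigma> f) (\<sigma> v) (map_source \<sigma> ` A) = relabel \<sigma> (split_at V f v A)"
proof (rule relabel_eqI[OF \<sigma>])
  fix s
  have V: "\<sigma> V = V" using \<sigma> by (simp add: permutes_not_in)
  have "map_source \<sigma> s \<in> map_source \<sigma> ` A \<longleftrightarrow> s \<in> A"
    by (rule inj_image_mem_iff[OF bij_is_inj[OF bij_map_source[OF \<sigma>]]])
  moreover have "map_source \<sigma> s = OutOf V \<longleftrightarrow> s = OutOf V"
    using permutes_inj[OF \<sigma>] V by (cases s) (auto dest: injD[where y=V])
  ultimately show "split_at V (relabel \<sigma> f) (\<sigma> v) (map_source \<sigma> ` A) (map_source \<sigma> s) =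
      map_target \<sigma> (split_at V f v A s)"
    using V by (simp add: split_at_def relabel_apply[OF \<sigma>])
qed

lemma splittings_relabel:
  assumes \<sigma>: "\<sigma> permutes {..<V}"
  shows "bij_betw (\<lambda>(v, A). (\<sigma> v, map_source \<sigma> ` A)) (splittings n V f) (splittings n V (relabel \<sigma> f))"
proof -
  have into: "(\<lambda>(v, A). (\<sigma> v, map_source \<sigma> ` A)) ` splittings n V f \<subseteq> splittings n V (relabel \<sigma> f)"
    if \<sigma>: "\<sigma> permutes {..<V}" for \<sigma> f
  proof -
    have inj: "inj (map_source \<sigma>)" using bij_map_source[OF \<sigma>] by (rule bij_is_inj)
    have "(\<sigma> v, map_source \<sigma> ` A) \<in> splittings n V (relabel \<sigma> f)"
      if "(v, A) \<in> splittings n V f" for v A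
      using that permutes_in_image[OF \<sigma>, of v] card_image[OF inj_on_subset[OF inj subset_UNIV], of A]
      by (auto simp: splittings_def inputs_relabel[OF \<sigma>] inj_image_eq_iff[OF inj])
    then show ?thesis by auto
  qed
  note \<sigma>' = permutes_inv[OF \<sigma>]
  have undo: "relabel (inv \<sigma>) (relabel \<sigma> f) = f"
    by (simp add: relabel_relabel[OF \<sigma>' \<sigma>] permutes_inv_o[OF \<sigma>])
  show ?thesis
    by (rule bij_betw_byWitness[where f'="\<lambda>(v, A). (inv \<sigma> v, map_source (inv \<sigma>) ` A)"])
       (use into[OF \<sigma>, of f] into[OF \<sigma>', of "relabel \<sigma> f"] undo in
         \<open>auto simp: permutes_inverses[OF \<sigma>] image_image\<close>)
qed

lemma split_sum_relabel:
  assumes f: "is_parent m n V f" and \<sigma>: "\<sigma> permutes {..<V}"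
  shows "cong_mod (C m n) (split_sum n V (relabel \<sigma> f)) (fscale (fsign \<sigma>) (split_sum n V f))"
proof -
  have \<sigma>': "\<sigma> permutes {..<Suc V}" by (rule permutes_subset[OF \<sigma>]) auto
  have "split_sum n V (relabel \<sigma> f) =
      (\<Sum>(v, A)\<in>splittings n V f. pgen n (Suc V) (relabel \<sigma> (split_at V f v A)))"
    unfolding split_sum_def
    by (subst sum.reindex_bij_betw[OF splittings_relabel[OF \<sigma>], symmetric])
       (simp add: case_prod_unfold relabel_split[OF \<sigma>])
  also have "cong_mod (C m n) \<dots> (fscale (fsign \<sigma>) (split_sum n V f))"
    unfolding split_sum_def fvs.scale_sum_right
  proof (rule cong_mod_sum[OF subspace_coinv_rels], clarify)
    fix v A assume "(v, A) \<in> splittings n V f"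
    then show "cong_mod (C m n) (pgen n (Suc V) (relabel \<sigma> (split_at V f v A)))
        (fscale (fsign \<sigma>) (pgen n (Suc V) (split_at V f v A)))"
      by (rule cong_relabel[OF is_parent_split[OF f] \<sigma>'])
  qed
  finally show ?thesis .
qed

section \<open>The differential in terms of parent functions\<close>

lemma encodes_split:
  assumes G: "encodes n G f" and J: "J \<subseteq> In_edges G v"
  shows "encodes n (split_vertex G v J)
    (split_at (nverts G) f v ((\<lambda>e. fst (edges G ! e)) ` J))"
proof -
  let ?V = "nverts G" and ?src = "\<lambda>e. fst (edges G ! e)" and ?L = "length (edges G)"
  let ?g = "split_at ?V f v (?src ` J)"
  have inj: "inj_on ?src {..<?L}" using encodes_bij[OF G] by (simp add: bij_betw_def)
  have JL: "J \<subseteq> {..<?L}" using J by (auto simp: In_edges_def)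
  have mem: "?src e \<in> ?src ` J \<longleftrightarrow> e \<in> J" if "e < ?L" for e
    using inj_on_image_mem_iff[OF inj _ JL] that by auto
  have src: "?src e \<in> sources n ?V" if "e < ?L" for e
    using encodes_bij[OF G] that by (auto simp: bij_betw_def)
  have "(if e \<in> J then (?src e, Into ?V) else edges G ! e) = (?src e, ?g (?src e))"
    if "e < ?L" for e
    using mem[OF that] src[OF that] encodes_edge[OF G that] by (auto simp: split_at_def)
  then have "map (\<lambda>e. if e \<in> J then (?src e, Into ?V) else edges G ! e) [0..<?L]
      = map (\<lambda>s. (s, ?g s)) (map ?src [0..<?L])" by simp
  also have "map ?src [0..<?L] = map fst (edges G)"
    by (rule nth_equalityI) auto
  finally have "mset (edges (split_vertex G v J)) =
      image_mset (\<lambda>s. (s, ?g s)) (mset (map fst (edges G))) + {#(OutOf ?V, Into v)#}"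
    by (simp add: split_vertex_def image_mset.compositionality)
  moreover have "OutOf ?V \<notin> ?src ` J"
  proof
    assume "OutOf ?V \<in> ?src ` J"
    then obtain e where "e \<in> J" "?src e = OutOf ?V" by force
    then show False using JL src[of e] by auto
  qed
  ultimately have "mset (edges (split_vertex G v J)) =
      image_mset (\<lambda>s. (s, ?g s)) (mset_set (sources n (Suc ?V)))"
    by (simp only: encodes_fst[OF G]) (simp add: sources_Suc split_at_def)
  then show ?thesis by (simp add: encodes_def split_vertex_def)
qed

lemma nverts_split_vertex [simp]: "nverts (split_vertex G v J) = Suc (nverts G)"
  by (simp add: split_vertex_def)

lemma finite_In_edges [simp]: "finite (In_edges G v)"
  by (simp add: In_edges_def)

lemma split_vertex_splittings:
  assumes G: "encodes n G f" and v: "v < nverts G"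
    and J: "J \<subseteq> In_edges G v" "2 \<le> card J" "1 \<le> card (In_edges G v - J)"
  shows "(v, (\<lambda>e. fst (edges G ! e)) ` J) \<in> splittings n (nverts G) f"
proof -
  note b = encodes_In_edges[OF G, of v]
  have inj: "inj_on (\<lambda>e. fst (edges G ! e)) (In_edges G v)" using b by (simp add: bij_betw_def)
  have "J \<noteq> In_edges G v" using J(3) by auto
  then have "(\<lambda>e. fst (edges G ! e)) ` J \<noteq> (\<lambda>e. fst (edges G ! e)) ` In_edges G v"
    using inj_on_image_eq_iff[OF inj J(1)] by simp
  then show ?thesis using v J b card_image[OF inj_on_subset[OF inj J(1)]]
    by (auto simp: splittings_def bij_betw_def)
qed

text \<open>
  Subsets of the list positions of incoming edges correspond to subsets of sources, and different
  orders of the edges denote isomorphic graphs. From here on the differential is studied through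
  parent functions only.
\<close>

lemma diff_graph_cong:
  assumes G: "encodes n G f" and f: "is_parent m n (nverts G) f"
  shows "cong_mod (C m n) (lie_inf_diff_graph G)
    (fscale ((-1) ^ (nverts G + 1)) (split_sum n (nverts G) f))"
proof -
  let ?V = "nverts G" and ?src = "\<lambda>e. fst (edges G ! e)"
  let ?Js = "\<lambda>v. {J. J \<subseteq> In_edges G v \<and> 2 \<le> card J \<and> 1 \<le> card (In_edges G v - J)}"
  let ?As = "\<lambda>v. {A. A \<subseteq> inputs n ?V f v \<and> 2 \<le> card A \<and> A \<noteq> inputs n ?V f v}"
  have inner: "(\<Sum>J\<in>?Js v. pgen n (Suc ?V) (split_at ?V f v (?src ` J))) =
      (\<Sum>A\<in>?As v. pgen n (Suc ?V) (split_at ?V f v A))" if v: "v < ?V" for v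
  proof (rule sum.reindex_bij_betw)
    have b: "bij_betw (image ?src) (Pow (In_edges G v)) (Pow (inputs n ?V f v))"
      by (rule bij_betw_Pow[OF encodes_In_edges[OF G]])
    show "bij_betw (image ?src) (?Js v) (?As v)"
    proof (rule bij_betw_subset[OF b])
      show "image ?src ` ?Js v = ?As v"
      proof (intro set_eqI iffI)
        fix A assume "A \<in> image ?src ` ?Js v"
        then show "A \<in> ?As v" using split_vertex_splittings[OF G v] by (auto simp: splittings_def)
      next
        fix A assume A: "A \<in> ?As v"
        then have "A \<in> image ?src ` Pow (In_edges G v)"
          using bij_betw_imp_surj_on[OF b] by simp
        then obtain J where J: "J \<subseteq> In_edges G v" "A = ?src ` J" by auto
        have "card A = card J"
          using card_image[OF inj_on_subset[OF bij_betw_imp_inj_on[OF encodes_In_edges[OF G]] J(1)]] J(2)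
          by simp
        moreover have "In_edges G v - J \<noteq> {}"
          using A J bij_betw_imp_surj_on[OF encodes_In_edges[OF G, of v]] by auto
        ultimately show "A \<in> image ?src ` ?Js v"
          using A J by (auto simp: Suc_le_eq card_gt_0_iff)
      qed
    qed auto
  qed
  have "splittings n ?V f = Sigma {..<?V} ?As"
    by (auto simp: splittings_def)
  then have "split_sum n ?V f = (\<Sum>v<?V. \<Sum>A\<in>?As v. pgen n (Suc ?V) (split_at ?V f v A))"
    unfolding split_sum_def by (simp add: sum.Sigma)
  also have "\<dots> = (\<Sum>v<?V. \<Sum>J\<in>?Js v. pgen n (Suc ?V) (split_at ?V f v (?src ` J)))"
    by (rule sum.cong[OF refl], rule inner[symmetric]) simp
  finally have eq: "split_sum n ?V f =
      (\<Sum>v<?V. \<Sum>J\<in>?Js v. pgen n (Suc ?V) (split_at ?V f v (?src ` J)))" .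
  show ?thesis unfolding lie_inf_diff_graph_def eq
  proof (intro cong_mod_scale cong_mod_sum subspace_coinv_rels)
    fix v J assume *: "v \<in> {..<?V}" "J \<in> ?Js v"
    then have "(v, ?src ` J) \<in> splittings n ?V f"
      using split_vertex_splittings[OF G] by simp
    then show "cong_mod (C m n) (fgen (split_vertex G v J))
        (pgen n (Suc ?V) (split_at ?V f v (?src ` J)))"
      using cong_pgen[OF encodes_split[OF G], of J v m] is_parent_split[OF f] * by simp
  qed
qed

lemma diff_fgen: "lie_inf_diff (fgen G) = lie_inf_diff_graph G"
  by (simp add: lie_inf_diff_def)

lemma diff_pgen_cong:
  "is_parent m n V f \<Longrightarrow>
    cong_mod (C m n) (lie_inf_diff (pgen n V f)) (fscale ((-1) ^ (V + 1)) (split_sum n V f))"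
  using diff_graph_cong[OF encodes_graph_of, of m n V f] by (simp add: diff_fgen)

interpretation lie_inf_diff: Vector_Spaces.linear fscale fscale
    "lie_inf_diff :: (dgraph \<Rightarrow>\<^sub>0 'k::field) \<Rightarrow> (dgraph \<Rightarrow>\<^sub>0 'k)"
  unfolding lie_inf_diff_def[abs_def] by (rule lin_ext.linear_axioms)

lemma diff_in_C: "x \<in> C m n \<Longrightarrow> lie_inf_diff x \<in> C m n"
  unfolding lie_inf_diff_def
proof (erule lin_ext_coinv[OF subspace_coinv_rels])
  fix \<sigma> G H assume G: "G \<in> W m n" and H: "H \<in> W m n" and iso: "graph_iso \<sigma> G H"
  have V: "nverts H = nverts G" and \<sigma>: "\<sigma> permutes {..<nverts G}"
    using iso by (auto simp: graph_iso_def)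
  note eG = W_encodes[OF G] and eH = W_encodes[OF H]
  note cg = diff_graph_cong[OF eG]
  have "cong_mod (C m n) (lie_inf_diff_graph H)
      (fscale ((-1) ^ (nverts G + 1)) (split_sum n (nverts G) (relabel \<sigma> (parent n G))))"
    using diff_graph_cong[OF eH] graph_iso_parent[OF iso G H] V by simp
  also have "cong_mod (C m n) \<dots> (fscale ((-1) ^ (nverts G + 1))
      (fscale (fsign \<sigma>) (split_sum n (nverts G) (parent n G))))"
    by (intro cong_mod_scale subspace_coinv_rels split_sum_relabel eG \<sigma>)
  also have "\<dots> = fscale (fsign \<sigma>) (fscale ((-1) ^ (nverts G + 1)) (split_sum n (nverts G) (parent n G)))"
    by (simp add: fvs.scale_left_commute)
  also have "cong_mod (C m n) \<dots> (fscale (fsign \<sigma>) (lie_inf_diff_graph G))"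
    by (intro cong_mod_scale subspace_coinv_rels cong_mod_sym[OF _ cg])
  finally show "cong_mod (C m n) (lie_inf_diff_graph H) (fscale (fsign \<sigma>) (lie_inf_diff_graph G))"
    by simp
qed

lemma split_vertex_in_W:
  assumes G: "G \<in> W m n" and v: "v < nverts G"
    and J: "J \<subseteq> In_edges G v" "2 \<le> card J" "1 \<le> card (In_edges G v - J)"
  shows "split_vertex G v J \<in> W m n"
  using encodes_in_W[OF encodes_split[OF W_encodes(1)[OF G] J(1)]]
    is_parent_split[OF W_encodes(2)[OF G] split_vertex_splittings[OF W_encodes(1)[OF G] v J]]
  by simp

lemma diff_graph_span:
  assumes "x \<in> graph_span {G \<in> W m n. int (nverts G) = d}"
  shows "lie_inf_diff x \<in> graph_span {G \<in> W m n. int (nverts G) = d + 1}"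
  unfolding lie_inf_diff_def
proof (rule lin_ext_in_subspace[OF subspace_graph_span assms])
  fix G assume "G \<in> {G \<in> W m n. int (nverts G) = d}"
  then show "lie_inf_diff_graph G \<in> graph_span {G \<in> W m n. int (nverts G) = d + 1}"
    unfolding lie_inf_diff_graph_def
    by (intro fvs.subspace_scale fvs.subspace_sum subspace_graph_span)
       (auto simp: split_vertex_in_W)
qed


section \<open>The differential squares to zero\<close>

definition splittings2 ::
    "nat \<Rightarrow> nat \<Rightarrow> (nat source \<Rightarrow> nat target)
      \<Rightarrow> ((nat \<times> nat source set) \<times> (nat \<times> nat source set)) set" where
  "splittings2 n V f =
     (SIGMA (v, A):splittings n V f. splittings n (Suc V) (split_at V f v A))"

definition split_at2 ::
    "nat \<Rightarrow> (nat source \<Rightarrow> nat target)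
      \<Rightarrow> (nat \<times> nat source set) \<times> (nat \<times> nat source set) \<Rightarrow> nat source \<Rightarrow> nat target" where
  "split_at2 V f = (\<lambda>((v, A), (u, B)). split_at (Suc V) (split_at V f v A) u B)"

text \<open>
  The other order in which the same two vertices can be split off. A second splitting that acts on
  the first new vertex is exchanged with one that acts on the old vertex once more, and splittings
  at unrelated places trade places.
\<close>

definition swap_splittings ::
    "nat \<Rightarrow> (nat \<times> nat source set) \<times> (nat \<times> nat source set)
      \<Rightarrow> (nat \<times> nat source set) \<times> (nat \<times> nat source set)" where
  "swap_splittings V = (\<lambda>((v, A), (u, B)).
     if u = V then ((v, B), (v, insert (OutOf V) (A - B)))
     else if OutOf V \<in> B then ((v, (B - {OutOf V}) \<union> A), (V, A))
     else ((u, B), (v, A)))"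

lemma splittings2_cases [consumes 2, case_names new_vertex new_edge disjoint]:
  assumes f: "is_parent m n V f" and P: "P \<in> splittings2 n V f"
  obtains v A B where "P = ((v, A), (V, B))" "(v, A) \<in> splittings n V f"
      "B \<subset> A" "2 \<le> card B"
  | v A K where "P = ((v, A), (v, insert (OutOf V) K))" "(v, A) \<in> splittings n V f"
      "K \<subset> inputs n V f v - A" "K \<noteq> {}"
  | v A u B where "P = ((v, A), (u, B))" "(v, A) \<in> splittings n V f" "u < V"
      "(u, B) \<in> splittings n V f" "A \<inter> B = {}" "OutOf V \<notin> B"
proof -
  obtain v A u B where P': "P = ((v, A), (u, B))" and A: "(v, A) \<in> splittings n V f"
    and B: "(u, B) \<in> splittings n (Suc V) (split_at V f v A)"
    using P by (auto simp: splittings2_def)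
  note fA = splitting_facts[OF f A]
  note ins = inputs_split_new[OF f A] inputs_split_same[OF f A] inputs_split_other[OF f A]
  consider "u = V" | "u = v" "OutOf V \<in> B" | "u = v" "OutOf V \<notin> B" | "u < V" "u \<noteq> v"
    using B by (auto simp: splittings_def less_Suc_eq)
  then show thesis
  proof cases
    case 1
    then show thesis using that(1)[OF _ A, of B] P' B ins(1) by (auto simp: splittings_def)
  next
    case 2
    define K where "K = B - {OutOf V}"
    have BK: "B = insert (OutOf V) K" "OutOf V \<notin> K" using 2 by (auto simp: K_def)
    have "K \<subset> inputs n V f v - A" using B BK 2 ins(2) inputs_subset[of n V f v]
      by (auto simp: splittings_def)
    moreover have "K \<noteq> {}" using B BK by (auto simp: splittings_def)
    ultimately show thesis using that(2)[OF _ A, of K] P' BK 2 by simp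
  next
    case 3
    have "A \<noteq> {}" using A by (auto simp: splittings_def)
    then have "(u, B) \<in> splittings n V f" "A \<inter> B = {}"
      using B 3 ins(2) fA(1) A by (auto simp: splittings_def)
    then show thesis using that(3)[OF _ A, of u B] P' 3 fA(1) by auto
  next
    case 4
    have BI: "B \<subseteq> inputs n V f u" using B ins(3)[OF 4] by (simp add: splittings_def)
    have "(u, B) \<in> splittings n V f"
      using B 4 ins(3)[OF 4] by (simp add: splittings_def)
    moreover have "A \<inter> B = {}" using BI fA(4) 4 by (auto simp: inputs_def)
    moreover have "OutOf V \<notin> B" using BI by (auto simp: inputs_def)
    ultimately show thesis using that(3)[OF _ A, of u B] P' 4 by auto
  qed
qed

lemma swap_splittings:
  assumes f: "is_parent m n V f" and P: "P \<in> splittings2 n V f"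
  shows "swap_splittings V P \<in> splittings2 n V f"
    and "swap_splittings V (swap_splittings V P) = P"
    and "split_at2 V f (swap_splittings V P) = relabel (transpose V (Suc V)) (split_at2 V f P)"
proof -
  let ?\<tau> = "transpose V (Suc V)"
  have \<tau>: "?\<tau> permutes {..<Suc (Suc V)}" by (rule permutes_swap_id) auto
  have outV: "f s \<noteq> Into V" "f s \<noteq> Into (Suc V)" "f (OutOf V) = OutLeg 0" "f (OutOf (Suc V)) = OutLeg 0" for s
    using f by (cases "s \<in> sources n V"; auto simp: is_parent_def)+
  have fix_t: "map_target ?\<tau> (f s) = f s" for s
    using outV(1,2)[of s] by (cases "f s") (auto simp: transpose_def)
  have src: "map_source ?\<tau> s = (if s = OutOf V then OutOf (Suc V) else if s = OutOf (Suc V) then OutOf V else s)" for s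
    by (cases s) (auto simp: transpose_def)
  have "swap_splittings V P \<in> splittings2 n V f \<and>
      swap_splittings V (swap_splittings V P) = P \<and>
      split_at2 V f (swap_splittings V P) = relabel ?\<tau> (split_at2 V f P)"
    using f P
  proof (cases rule: splittings2_cases)
    case (new_vertex v A B)
    note fA = splitting_facts[OF f new_vertex(2)]
    have B: "(v, B) \<in> splittings n V f" using new_vertex by (auto simp: splittings_def)
    have fin: "finite (A - B)" "A - B \<noteq> {}" using new_vertex splittings_finite by auto
    then have "0 < card (A - B)" by (simp add: card_gt_0_iff)
    moreover obtain x where "x \<in> inputs n V f v" "x \<notin> A"
      using new_vertex(2) by (auto simp: splittings_def)
    then have "x \<in> insert (OutOf V) (inputs n V f v - B)" "x \<notin> insert (OutOf V) (A - B)"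
      using new_vertex(3) inputs_subset[of n V f v] by auto
    then have "insert (OutOf V) (A - B) \<noteq> insert (OutOf V) (inputs n V f v - B)" by metis
    ultimately have "(v, insert (OutOf V) (A - B)) \<in> splittings n (Suc V) (split_at V f v B)"
      using new_vertex fA fin
      by (auto simp: splittings_def inputs_split_same[OF f B])
    then have "swap_splittings V P \<in> splittings2 n V f"
      using new_vertex B by (auto simp: swap_splittings_def splittings2_def)
    moreover have "swap_splittings V (swap_splittings V P) = P"
      using new_vertex fA by (auto simp: swap_splittings_def)
    moreover have "split_at2 V f (swap_splittings V P) = relabel ?\<tau> (split_at2 V f P)"
    proof (rule relabel_eqI[OF \<tau>])
      fix s
      have "OutOf V \<notin> B" "OutOf (Suc V) \<notin> A" using fA new_vertex by auto
      then show "split_at2 V f (swap_splittings V P) (map_source ?\<tau> s) = map_target ?\<tau> (split_at2 V f P s)"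
        using new_vertex fA fix_t[of s]
        by (auto simp: split_at2_def swap_splittings_def split_at_def src)
    qed
    ultimately show ?thesis by blast
  next
    case (new_edge v A K)
    note fA = splitting_facts[OF f new_edge(2)]
    have K: "OutOf V \<notin> K" "OutOf (Suc V) \<notin> K" "finite K"
      using new_edge(3) inputs_subset[of n V f v] by (auto intro: finite_subset)
    have finA: "finite A" by (rule splittings_finite[OF new_edge(2)])
    have "2 \<le> card A" using new_edge(2) by (simp add: splittings_def)
    then have "2 \<le> card (K \<union> A)" using card_mono[of "K \<union> A" A] K finA by auto
    then have KA: "(v, K \<union> A) \<in> splittings n V f" using new_edge by (auto simp: splittings_def)
    have "A \<noteq> K \<union> A" using new_edge(3,4) by blast
    then have "(V, A) \<in> splittings n (Suc V) (split_at V f v (K \<union> A))"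
      using new_edge(2) by (auto simp: splittings_def inputs_split_new[OF f KA])
    then have "swap_splittings V P \<in> splittings2 n V f"
      using new_edge(1) KA fA K by (auto simp: swap_splittings_def splittings2_def)
    moreover have "swap_splittings V (swap_splittings V P) = P"
      using new_edge fA K by (auto simp: swap_splittings_def)
    moreover have "split_at2 V f (swap_splittings V P) = relabel ?\<tau> (split_at2 V f P)"
    proof (rule relabel_eqI[OF \<tau>])
      fix s
      have "OutOf (Suc V) \<notin> A" using fA by auto
      then show "split_at2 V f (swap_splittings V P) (map_source ?\<tau> s) = map_target ?\<tau> (split_at2 V f P s)"
        using new_edge(1,3) fA K fix_t[of s]
        by (auto simp: split_at2_def swap_splittings_def split_at_def src)
    qed
    ultimately show ?thesis by blast
  next
    case (disjoint v A u B)
    note fA = splitting_facts[OF f disjoint(2)] and fB = splitting_facts[OF f disjoint(4)]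
    have "A \<noteq> {}" using disjoint(2) by (auto simp: splittings_def)
    moreover have "inputs n (Suc V) (split_at V f u B) v =
        (if v = u then insert (OutOf V) (inputs n V f v - B) else inputs n V f v)"
      using inputs_split_same[OF f disjoint(4)] inputs_split_other[OF f disjoint(4), of v] fA(1)
      by auto
    ultimately have "(v, A) \<in> splittings n (Suc V) (split_at V f u B)"
      using disjoint fA by (auto simp: splittings_def)
    then have "swap_splittings V P \<in> splittings2 n V f"
      using disjoint by (auto simp: swap_splittings_def splittings2_def)
    moreover have "swap_splittings V (swap_splittings V P) = P"
      using disjoint fA by (auto simp: swap_splittings_def)
    moreover have "split_at2 V f (swap_splittings V P) = relabel ?\<tau> (split_at2 V f P)"
    proof (rule relabel_eqI[OF \<tau>])
      fix s
      have "OutOf (Suc V) \<notin> A" "OutOf (Suc V) \<notin> B" using fA fB by auto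
      then show "split_at2 V f (swap_splittings V P) (map_source ?\<tau> s) = map_target ?\<tau> (split_at2 V f P s)"
        using disjoint fA fB fix_t[of s]
        by (auto simp: split_at2_def swap_splittings_def split_at_def src)
    qed
    ultimately show ?thesis by blast
  qed
  then show "swap_splittings V P \<in> splittings2 n V f"
    and "swap_splittings V (swap_splittings V P) = P"
    and "split_at2 V f (swap_splittings V P) = relabel ?\<tau> (split_at2 V f P)"
    by blast+
qed

lemma is_parent_split_at2:
  assumes "is_parent m n V f" "P \<in> splittings2 n V f"
  shows "is_parent m n (Suc (Suc V)) (split_at2 V f P)"
  using assms is_parent_split[OF is_parent_split]
  by (fastforce simp: splittings2_def split_at2_def)

text \<open>
  Exchanging the order of the two splittings transposes the two new vertices, which changes the
  sign: the double sum equals its own negative, and two is invertible.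
\<close>

lemma split_sum_split_sum:
  assumes f: "is_parent m n V f"
  shows "(\<Sum>(v, A)\<in>splittings n V f. split_sum n (Suc V) (split_at V f v A)) \<in>
    (C m n :: (dgraph \<Rightarrow>\<^sub>0 'k::field_char_0) set)"
proof -
  let ?Z = "splittings2 n V f" and ?g = "\<lambda>P. pgen n (Suc (Suc V)) (split_at2 V f P) :: dgraph \<Rightarrow>\<^sub>0 'k"
  let ?S = "\<Sum>P\<in>?Z. ?g P"
  have eq: "(\<Sum>(v, A)\<in>splittings n V f. split_sum n (Suc V) (split_at V f v A)) = ?S"
    by (simp add: split_sum_def splittings2_def split_at2_def case_prod_unfold sum.Sigma)
  have \<tau>: "transpose V (Suc V) permutes {..<Suc (Suc V)}" by (rule permutes_swap_id) auto
  have "?S = (\<Sum>P\<in>?Z. ?g (swap_splittings V P))"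
    by (rule sum.reindex_bij_witness[of _ "swap_splittings V" "swap_splittings V"])
       (simp_all add: swap_splittings(1,2)[OF f])
  also have "\<dots> = (\<Sum>P\<in>?Z. pgen n (Suc (Suc V)) (relabel (transpose V (Suc V)) (split_at2 V f P)))"
    by (rule sum.cong) (simp_all add: swap_splittings(3)[OF f])
  also have "cong_mod (C m n) \<dots> (\<Sum>P\<in>?Z. fscale (fsign (transpose V (Suc V))) (?g P))"
    by (intro cong_mod_sum subspace_coinv_rels cong_relabel is_parent_split_at2[OF f] \<tau>)
  also have "\<dots> = - ?S" by (simp add: sign_swap_id sum_negf)
  finally have "?S + ?S \<in> C m n" by (simp add: cong_mod_def)
  then have "fscale (1/2) (?S + ?S) \<in> C m n"
    by (rule fvs.subspace_scale[OF subspace_coinv_rels])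
  moreover have "fscale (1/2) (?S + ?S) = ?S"
    by (simp add: fvs.scale_right_distrib flip: fvs.scale_left_distrib)
  ultimately show ?thesis by (simp add: eq)
qed

lemma diff_cong: "cong_mod (C m n) x y \<Longrightarrow> cong_mod (C m n) (lie_inf_diff x) (lie_inf_diff y)"
  using diff_in_C[of "x - y" m n] by (simp add: cong_mod_def lie_inf_diff.diff)

lemma diff_diff:
  assumes "x \<in> graph_span (W m n)"
  shows "lie_inf_diff (lie_inf_diff x) \<in> (C m n :: (dgraph \<Rightarrow>\<^sub>0 'k::field_char_0) set)"
  using assms
proof (induction rule: graph_span_induct)
  case subspace
  then show ?case
    by (auto simp: fvs.subspace_def lie_inf_diff.zero lie_inf_diff.add lie_inf_diff.scale
        intro: fvs.subspace_0[OF subspace_coinv_rels] fvs.subspace_add[OF subspace_coinv_rels]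
          fvs.subspace_scale[OF subspace_coinv_rels])
next
  case (base G)
  let ?V = "nverts G" and ?f = "parent n G" and ?c = "(-1) ^ (nverts G + 1) :: 'k"
  note f = W_encodes(2)[OF base]
  have "cong_mod (C m n) (lie_inf_diff (fgen G :: dgraph \<Rightarrow>\<^sub>0 'k)) (fscale ?c (split_sum n ?V ?f))"
    using diff_graph_cong[OF W_encodes[OF base]] by (simp add: diff_fgen)
  then have "cong_mod (C m n) (lie_inf_diff (lie_inf_diff (fgen G :: dgraph \<Rightarrow>\<^sub>0 'k)))
      (lie_inf_diff (fscale ?c (split_sum n ?V ?f)))" by (rule diff_cong)
  also have "\<dots> = fscale ?c (\<Sum>(v, A)\<in>splittings n ?V ?f.
      lie_inf_diff (pgen n (Suc ?V) (split_at ?V ?f v A)))"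
    by (simp add: lie_inf_diff.scale lie_inf_diff.sum split_sum_def case_prod_unfold lie_inf_diff.neg)
  also have "cong_mod (C m n) \<dots> (fscale ?c (\<Sum>(v, A)\<in>splittings n ?V ?f.
      fscale ((-1) ^ (Suc ?V + 1)) (split_sum n (Suc ?V) (split_at ?V ?f v A))))"
    using diff_pgen_cong[OF is_parent_split[OF f]]
    by (auto intro!: cong_mod_scale cong_mod_sum simp del: power_Suc)
  also have "\<dots> = fscale (?c * (-1) ^ (Suc ?V + 1))
      (\<Sum>(v, A)\<in>splittings n ?V ?f. split_sum n (Suc ?V) (split_at ?V ?f v A))"
    by (simp only: fvs.scale_scale[symmetric] fvs.scale_sum_right case_prod_unfold)
  also have "cong_mod (C m n) \<dots> 0"
    unfolding cong_mod_def diff_zero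
    by (rule fvs.subspace_scale[OF subspace_coinv_rels split_sum_split_sum[OF f]])
  finally show ?case by (simp add: cong_mod_def)
qed

section \<open>The spine of a graph\<close>

text \<open>
  One step towards the root, where the output leg \<open>j\<close> is glued to the input leg
  \<open>\<rho> j\<close>.
\<close>

definition close_step ::
    "(nat \<Rightarrow> nat) \<Rightarrow> (nat source \<Rightarrow> nat target) \<Rightarrow> nat source \<Rightarrow> nat source" where
  "close_step \<rho> f s = (case f s of Into v \<Rightarrow> OutOf v | OutLeg j \<Rightarrow> InLeg (\<rho> j))"

definition periodic :: "(nat \<Rightarrow> nat) \<Rightarrow> (nat source \<Rightarrow> nat target) \<Rightarrow> nat source \<Rightarrow> bool" where
  "periodic \<rho> f s \<longleftrightarrow> s \<in> orbit (close_step \<rho> f) s"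

text \<open>
  The gluing \<open>\<rho>\<close> joins the root of each tree to a leaf of the same tree, so that
  the path from that leaf to the root becomes a wheel.
\<close>

definition closes_trees ::
    "nat \<Rightarrow> nat \<Rightarrow> nat \<Rightarrow> (nat source \<Rightarrow> nat target) \<Rightarrow> (nat \<Rightarrow> nat) \<Rightarrow> bool" where
  "closes_trees m n V f \<rho> \<longleftrightarrow> (\<forall>j<m. \<rho> j < n) \<and>
     (\<forall>s\<in>sources n V. \<forall>j<m. f s = OutLeg j \<longrightarrow> periodic \<rho> f s)"

text \<open>
  An arbitrary choice, which depends only on the set of admissible gluings. As this set does not
  change under splittings and renumberings, the choice is compatible with both.
\<close>

definition closing :: "nat \<Rightarrow> nat \<Rightarrow> nat \<Rightarrow> (nat source \<Rightarrow> nat target) \<Rightarrow> nat \<Rightarrow> nat" where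
  "closing m n V f = (SOME \<rho>. closes_trees m n V f \<rho>)"

text \<open>
  The edges on the wheels, after the trees have been closed up; an edge is named by its source.
\<close>

definition spine :: "nat \<Rightarrow> nat \<Rightarrow> nat \<Rightarrow> (nat source \<Rightarrow> nat target) \<Rightarrow> nat source set" where
  "spine m n V f = {s \<in> sources n V. periodic (closing m n V f) f s}"

lemma finite_spine [simp]: "finite (spine m n V f)"
  by (simp add: spine_def)

lemma close_step_simps:
  "f s = Into v \<Longrightarrow> close_step \<rho> f s = OutOf v"
  "f s = OutLeg j \<Longrightarrow> close_step \<rho> f s = InLeg (\<rho> j)"
  by (simp_all add: close_step_def)

lemma periodic_step: "periodic \<rho> f s \<Longrightarrow> periodic \<rho> f (close_step \<rho> f s)"
  unfolding periodic_def by (metis orbit.base orbit.step orbit_step)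

text \<open>
  A map is injective on its periodic points. For the spine this says that wheels do not merge.
\<close>

lemma periodic_inj:
  assumes "periodic \<rho> f s" "periodic \<rho> f t" "close_step \<rho> f s = close_step \<rho> f t"
  shows "s = t"
proof -
  let ?F = "close_step \<rho> f"
  obtain a b where a: "0 < a" "(?F ^^ a) s = s" and b: "0 < b" "(?F ^^ b) t = t"
    using assms(1,2) by (auto simp: periodic_def orbit_altdef)
  have "(?F ^^ (k * a)) s = s" "(?F ^^ (k * b)) t = t" for k
    using a(2) b(2) by (induction k) (auto simp: funpow_add)
  then have *: "(?F ^^ (a * b)) s = s" "(?F ^^ (a * b)) t = t" by (metis mult.commute)+
  obtain c where c: "a * b = Suc c" using a b by (metis gr0_implies_Suc nat_0_less_mult_iff)
  have "(?F ^^ (a * b)) s = (?F ^^ (a * b)) t"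
    unfolding c funpow_Suc_right using assms(3) by simp
  then show ?thesis using * by simp
qed

lemma close_step_sources:
  assumes "is_parent m n V f" "\<forall>j<m. \<rho> j < n" "s \<in> sources n V"
  shows "close_step \<rho> f s \<in> sources n V"
proof -
  have "f s \<in> OutLeg ` {..<m} \<union> Into ` {..<V}" using assms(1,3) by (simp add: is_parent_def)
  then show ?thesis using assms(2) by (auto simp: close_step_def)
qed

text \<open>
  Walking upwards from the root of a tree must end, and it can only end at an input leg, because
  every vertex has inputs.
\<close>

lemma ex_closes_trees:
  assumes f: "is_parent m n V f"
  shows "\<exists>\<rho>. closes_trees m n V f \<rho>"
proof -
  have leaf: "\<exists>i<n. InLeg i = t \<or>
      (\<exists>Y. InLeg i \<in> Y \<and> Y \<subseteq> sources n V \<and> (\<forall>y\<in>Y. y \<noteq> t \<longrightarrow> (\<exists>v. f y = Into v \<and> OutOf v \<in> Y)) \<and>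
        (\<forall>\<rho>. \<forall>y\<in>Y. y \<noteq> t \<longrightarrow> t \<in> orbit (close_step \<rho> f) y))"
    if t: "t \<in> sources n V" "f t = OutLeg j" for t j
  proof -
    \<comment> \<open>sources from which \<open>t\<close> is reached; the step is made to leave the sources at output legs\<close>
    define S where "S s = (case f s of Into v \<Rightarrow> OutOf v | OutLeg j \<Rightarrow> InLeg n)" for s :: "nat source"
    define Y where "Y = {s \<in> sources n V. s = t \<or> t \<in> orbit S s}"
    have fin: "finite Y" by (simp add: Y_def)
    have "\<exists>i<n. InLeg i \<in> Y"
    proof (rule ccontr)
      assume no: "\<not> ?thesis"
      have ex: "\<exists>x. x \<in> Y \<and> S x = y" if y: "y \<in> Y" for y
      proof -
        obtain v where v: "y = OutOf v" "v < V"
          using y no by (cases y) (auto simp: Y_def)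
        then have "inputs n V f v \<noteq> {}" using f by (auto simp: is_parent_def)
        then obtain x where x: "x \<in> sources n V" "f x = Into v" by (auto simp: inputs_def)
        then have "S x = y" using v by (simp add: S_def)
        moreover have "t \<in> orbit S x"
          using y \<open>S x = y\<close> unfolding Y_def by (auto intro: orbit.base orbit_trans)
        ultimately show ?thesis using x by (auto simp: Y_def)
      qed
      define b where "b y = (SOME x. x \<in> Y \<and> S x = y)" for y
      have b: "b y \<in> Y" "S (b y) = y" if "y \<in> Y" for y
        using someI_ex[OF ex[OF that]] by (simp_all add: b_def)
      have "inj_on b Y" by (rule inj_onI) (metis b(2))
      then have "b ` Y = Y" using b(1) by (intro endo_inj_surj fin) auto
      moreover have "t \<in> Y" using t by (simp add: Y_def)
      ultimately obtain y where "y \<in> Y" "t = b y" by auto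
      then have "S t \<in> sources n V" using b(2)[of y] by (auto simp: Y_def)
      then show False using t by (simp add: S_def)
    qed
    then obtain i where i: "i < n" "InLeg i \<in> Y" by blast
    have step: "\<exists>v. f y = Into v \<and> OutOf v \<in> Y" if y: "y \<in> Y" "y \<noteq> t" for y
    proof (cases "f y")
      case (OutLeg j')
      have "z = InLeg n" if "z \<in> orbit S y" for z
        using that
      proof induction
        case base
        then show ?case using OutLeg by (simp add: S_def)
      next
        case (step z)
        have "f (InLeg n) = OutLeg 0" using f by (simp add: is_parent_def)
        then show ?case using step by (simp add: S_def)
      qed
      then have "t = InLeg n" using y by (auto simp: Y_def)
      then show ?thesis using t by simp
    next
      case (Into v)
      then have S: "S y = OutOf v" by (simp add: S_def)
      have "t \<in> orbit S y" using y by (simp add: Y_def)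
      then have "OutOf v = t \<or> t \<in> orbit S (OutOf v)" using orbit_step[of t S y] S by auto
      moreover have "OutOf v \<in> sources n V" using f y Into by (auto simp: is_parent_def Y_def)
      ultimately show ?thesis using Into by (auto simp: Y_def)
    qed
    have "t \<in> orbit (close_step \<rho> f) y" if y: "y \<in> Y" "y \<noteq> t" for \<rho> y
    proof -
      have "(x \<in> sources n V \<longrightarrow> x \<in> orbit (close_step \<rho> f) y)" if "x \<in> orbit S y" for x
        using that
      proof induction
        case base
        then show ?case
          using step[OF y] orbit.base[of "close_step \<rho> f" y] by (auto simp: S_def close_step_simps)
      next
        case (step x)
        show ?case
        proof
          assume Sx: "S x \<in> sources n V"
          then obtain v where v: "f x = Into v" by (cases "f x") (auto simp: S_def)
          then have "x \<in> sources n V" using f by (auto simp: is_parent_def)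
          then have "close_step \<rho> f x \<in> orbit (close_step \<rho> f) y" using step by (auto intro: orbit.step)
          then show "S x \<in> orbit (close_step \<rho> f) y" using v by (simp add: S_def close_step_def)
        qed
      qed
      moreover have "t \<in> orbit S y" using y by (simp add: Y_def)
      ultimately show ?thesis using t by blast
    qed
    then show ?thesis using i step by (intro exI[of _ i] conjI disjI2 exI[of _ Y]) (auto simp: Y_def)
  qed
  have "\<exists>i<n. \<forall>\<rho>. \<rho> j = i \<longrightarrow> (\<forall>t\<in>sources n V. f t = OutLeg j \<longrightarrow> periodic \<rho> f t)" if j: "j < m" for j
  proof -
    obtain t where t: "t \<in> sources n V" "f t = OutLeg j"
      and un: "\<And>s'. s' \<in> sources n V \<Longrightarrow> f s' = OutLeg j \<Longrightarrow> s' = t"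
      using is_parent_OutLegE[OF f j] by blast
    obtain i where i: "i < n" and *: "InLeg i = t \<or> (\<forall>\<rho>. t \<in> orbit (close_step \<rho> f) (InLeg i))"
      using leaf[OF t] by blast
    have "periodic \<rho> f t" if "\<rho> j = i" for \<rho>
    proof -
      have "close_step \<rho> f t = InLeg i" using t that by (simp add: close_step_def)
      then show ?thesis unfolding periodic_def using * orbit.base[of "close_step \<rho> f" t]
        by (metis orbit_trans)
    qed
    then show ?thesis using i un by blast
  qed
  then obtain \<rho> where "\<And>j. j < m \<Longrightarrow> \<rho> j < n \<and> (\<forall>\<rho>'. \<rho>' j = \<rho> j \<longrightarrow>
      (\<forall>t\<in>sources n V. f t = OutLeg j \<longrightarrow> periodic \<rho>' f t))"
    by metis
  then show ?thesis unfolding closes_trees_def by blast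
qed

lemma closes_trees_closing: "is_parent m n V f \<Longrightarrow> closes_trees m n V f (closing m n V f)"
  unfolding closing_def by (rule someI_ex[OF ex_closes_trees])

context
  fixes m n V f
  assumes f: "is_parent m n V f"
begin

lemma spine_OutLeg: "s \<in> sources n V \<Longrightarrow> f s = OutLeg j \<Longrightarrow> s \<in> spine m n V f"
  using closes_trees_closing[OF f] f by (fastforce simp: spine_def closes_trees_def is_parent_def)

text \<open>
  A periodic point has exactly one periodic preimage.
\<close>

lemma spine_input:
  assumes v: "OutOf v \<in> spine m n V f"
  obtains s where "inputs n V f v \<inter> spine m n V f = {s}"
proof -
  let ?\<rho> = "closing m n V f"
  let ?F = "close_step ?\<rho> f"
  have \<rho>: "\<forall>j<m. ?\<rho> j < n" using closes_trees_closing[OF f] by (simp add: closes_trees_def)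
  have vs: "OutOf v \<in> sources n V" using v by (simp add: spine_def)
  have inS: "s \<in> sources n V" if "s \<in> orbit ?F (OutOf v)" for s
    using that by induction (auto intro: close_step_sources[OF f \<rho>] vs)
  have per: "OutOf v \<in> orbit ?F (OutOf v)" using v by (simp add: spine_def periodic_def)
  have "\<exists>s. s \<in> sources n V \<and> periodic ?\<rho> f s \<and> ?F s = OutOf v"
    using per
  proof cases
    case base
    then show ?thesis using per vs by (intro exI[of _ "OutOf v"]) (auto simp: periodic_def)
  next
    case (step y)
    have "y \<in> orbit ?F y"
      using per step orbit_trans[OF step(2)] orbit.base[of ?F y] by metis
    then show ?thesis using step inS[OF step(2)] by (intro exI[of _ y]) (auto simp: periodic_def)
  qed
  then obtain s where s: "s \<in> spine m n V f" "?F s = OutOf v" by (auto simp: spine_def)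
  have fs: "f s = Into v" using s(2) by (auto simp: close_step_def split: target.splits)
  have only: "s' = s" if "s' \<in> spine m n V f" "f s' = Into v" for s'
    by (rule periodic_inj[of ?\<rho> f]) (use s that in \<open>auto simp: spine_def close_step_simps\<close>)
  have "s \<in> inputs n V f v \<inter> spine m n V f"
    using s fs by (simp add: inputs_def spine_def)
  moreover have "x = s" if "x \<in> inputs n V f v \<inter> spine m n V f" for x
    by (rule only) (use that in \<open>simp_all add: inputs_def\<close>)
  ultimately have "inputs n V f v \<inter> spine m n V f = {s}" by blast
  then show thesis by (rule that)
qed

text \<open>
  Every vertex leads into a wheel when one walks towards the root; consider the last step before the
  spine is reached.
\<close>

lemma spine_entry:
  assumes v: "v < V" "OutOf v \<notin> spine m n V f"
  obtains u w where "u < V" "OutOf u \<in> spine m n V f" "OutOf w \<in> inputs n V f u - spine m n V f"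
proof -
  let ?\<rho> = "closing m n V f" and ?P = "spine m n V f"
  let ?F = "close_step ?\<rho> f"
  let ?s = "\<lambda>k. (?F ^^ k) (OutOf v)"
  have \<rho>: "\<forall>j<m. ?\<rho> j < n" using closes_trees_closing[OF f] by (simp add: closes_trees_def)
  have src: "?s k \<in> sources n V" for k
    using v by (induction k) (auto intro: close_step_sources[OF f \<rho>])
  have "\<not> inj_on ?s (UNIV :: nat set)"
    using finite_imageD[of ?s UNIV] finite_subset[of "range ?s" "sources n V"] src by auto
  then obtain a b where ab: "a < b" "?s a = ?s b"
    unfolding inj_on_def by (metis linorder_less_linear UNIV_I)
  then have "(?F ^^ (b - a)) (?s a) = ?s a"
    by (metis funpow_add comp_apply le_add_diff_inverse2 less_imp_le)
  then have "?s a \<in> ?P" using src ab(1)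
    unfolding spine_def periodic_def orbit_altdef by (metis (mono_tags, lifting) mem_Collect_eq zero_less_diff)
  define k where "k = (LEAST k. ?s k \<in> ?P)"
  have k: "?s k \<in> ?P" unfolding k_def by (rule LeastI[of "\<lambda>k. ?s k \<in> ?P"]) fact
  have less: "?s l \<notin> ?P" if "l < k" for l using not_less_Least[of l "\<lambda>k. ?s k \<in> ?P"] that k_def by simp
  obtain l where l: "k = Suc l" using k v by (cases k) auto
  have lP: "?s l \<notin> ?P" using less l by simp
  obtain u where u: "f (?s l) = Into u"
    using lP spine_OutLeg[OF src] by (cases "f (?s l)") auto
  then have uP: "OutOf u \<in> ?P" using k l by (simp add: close_step_simps)
  have "\<exists>w. ?s l = OutOf w"
  proof (cases l)
    case (Suc l')
    then have "?s l' \<notin> ?P" using less l by simp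
    then obtain w where "f (?s l') = Into w" using spine_OutLeg[OF src] by (cases "f (?s l')") auto
    then show ?thesis using Suc by (simp add: close_step_simps)
  qed simp
  then obtain w where w: "?s l = OutOf w" by blast
  show thesis
  proof (rule that[of u w])
    show "u < V" "OutOf u \<in> ?P" using uP by (auto simp: spine_def)
    show "OutOf w \<in> inputs n V f u - ?P"
      using u lP src[of l] unfolding w by (simp add: inputs_def)
  qed
qed

end

section \<open>The spine under splittings and relabellings\<close>

context
  fixes m n V f v A
  assumes f: "is_parent m n V f" and A: "(v, A) \<in> splittings n V f"
begin

private abbreviation "f' \<equiv> split_at V f v A"

text \<open>
  A splitting inserts the new vertex on the way from the elements of \<open>A\<close> to
  \<open>v\<close>, and on no other way.
\<close>

lemma periodic_split:
  assumes \<rho>: "\<forall>j<m. \<rho> j < n"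
  shows "s \<in> sources n V \<Longrightarrow> periodic \<rho> f' s \<longleftrightarrow> periodic \<rho> f s"
    and "periodic \<rho> f' (OutOf V) \<longleftrightarrow> (\<exists>a\<in>A. periodic \<rho> f a)"
proof -
  let ?F = "close_step \<rho> f" and ?F' = "close_step \<rho> f'"
  note facts = splitting_facts[OF f A]
  have src: "?F s \<in> sources n V" if "s \<in> sources n V" for s
    by (rule close_step_sources[OF f \<rho> that])
  have new: "?F' (OutOf V) = OutOf v" using facts by (simp add: close_step_def split_at_def)
  have inA: "?F' s = OutOf V" "?F s = OutOf v" if "s \<in> A" for s
    using that facts by (auto simp: close_step_def split_at_def)
  have notA: "?F' s = ?F s" if "s \<in> sources n V" "s \<notin> A" for s
    using that by (auto simp: close_step_def split_at_def)
  have to: "t \<in> sources n V \<and> t \<in> orbit ?F' s" if "t \<in> orbit ?F s" "s \<in> sources n V" for s t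
    using that
  proof induction
    case base
    have "?F s \<in> orbit ?F' s"
    proof (cases "s \<in> A")
      case True
      then have "?F s = ?F' (?F' s)" using inA new by simp
      then show ?thesis by (auto intro: orbit.intros)
    next
      case False
      then show ?thesis using notA[OF base] orbit.base[of ?F' s] by simp
    qed
    then show ?case using src base by simp
  next
    case (step y)
    have "?F y \<in> orbit ?F' s"
    proof (cases "y \<in> A")
      case True
      then have "?F y = ?F' (?F' y)" using inA new by simp
      then show ?thesis using step by (auto intro: orbit.intros)
    next
      case False
      then show ?thesis using notA[of y] step by (metis orbit.step)
    qed
    then show ?case using src step by simp
  qed
  have from_: "(t = OutOf V \<and> (\<exists>a\<in>A. a = s \<or> a \<in> orbit ?F s)) \<or> (t \<in> sources n V \<and> t \<in> orbit ?F s)"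
    if "t \<in> orbit ?F' s" "s \<in> sources n V" for s t
    using that
  proof induction
    case base
    then show ?case using inA[of s] notA[of s] src[of s] orbit.base[of ?F s] by (cases "s \<in> A") auto
  next
    case (step y)
    from step(2)[OF step(3)] show ?case
    proof
      assume "y = OutOf V \<and> (\<exists>a\<in>A. a = s \<or> a \<in> orbit ?F s)"
      then obtain a where a: "y = OutOf V" "a \<in> A" "a = s \<or> a \<in> orbit ?F s" by blast
      have "?F a \<in> orbit ?F s" using a(3) by (auto intro: orbit.intros)
      then show ?thesis using a new inA[of a] facts(1) by simp
    next
      assume y: "y \<in> sources n V \<and> y \<in> orbit ?F s"
      show ?thesis
      proof (cases "y \<in> A")
        case True
        then show ?thesis using y inA by auto
      next
        case False
        then show ?thesis using y notA src by (metis orbit.step)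
      qed
    qed
  qed
  show iff: "periodic \<rho> f' s \<longleftrightarrow> periodic \<rho> f s" if "s \<in> sources n V" for s
    using to[OF _ that, of s] from_[OF _ that, of s] that unfolding periodic_def by auto
  show "periodic \<rho> f' (OutOf V) \<longleftrightarrow> (\<exists>a\<in>A. periodic \<rho> f a)"
  proof
    assume "periodic \<rho> f' (OutOf V)"
    then have "OutOf V \<in> orbit ?F' (OutOf v)"
      using orbit_step[of "OutOf V" ?F' "OutOf V"] new facts(1) by (auto simp: periodic_def)
    then obtain a where a: "a \<in> A" "a = OutOf v \<or> a \<in> orbit ?F (OutOf v)"
      using from_[of "OutOf V" "OutOf v"] facts(1) by auto
    then have "a \<in> orbit ?F a" using inA(2)[OF a(1)] by (metis orbit.base orbit_trans)
    then show "\<exists>a\<in>A. periodic \<rho> f a" using a by (auto simp: periodic_def)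
  next
    assume "\<exists>a\<in>A. periodic \<rho> f a"
    then obtain a where a: "a \<in> A" "periodic \<rho> f a" by blast
    then have "periodic \<rho> f' a" using iff[of a] facts(3) by auto
    then have "periodic \<rho> f' (?F' a)" by (rule periodic_step)
    then show "periodic \<rho> f' (OutOf V)" using inA a by simp
  qed
qed

lemma closing_split: "closing m n (Suc V) f' = closing m n V f"
proof -
  have "closes_trees m n (Suc V) f' \<rho> \<longleftrightarrow> closes_trees m n V f \<rho>" for \<rho>
  proof (cases "\<forall>j<m. \<rho> j < n")
    case True
    have "(f' s = OutLeg j \<longrightarrow> periodic \<rho> f' s) \<longleftrightarrow> (f s = OutLeg j \<longrightarrow> periodic \<rho> f s)"
      if "s \<in> sources n V" for s j
      using periodic_split(1)[OF True that] splitting_facts[OF f A] that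
      by (auto simp: split_at_def)
    moreover have "f' (OutOf V) \<noteq> OutLeg j" for j by (simp add: split_at_def)
    ultimately show ?thesis by (simp add: closes_trees_def sources_Suc)
  qed (auto simp: closes_trees_def)
  then show ?thesis by (simp add: closing_def)
qed

lemma spine_split:
  "spine m n (Suc V) f' =
     (if A \<inter> spine m n V f = {} then spine m n V f else insert (OutOf V) (spine m n V f))"
proof -
  have \<rho>: "\<forall>j<m. closing m n V f j < n"
    using closes_trees_closing[OF f] by (simp add: closes_trees_def)
  show ?thesis
    using periodic_split(1)[OF \<rho>] periodic_split(2)[OF \<rho>] splitting_facts(3)[OF f A]
    by (auto simp: spine_def closing_split sources_Suc)
qed

text \<open>
  The spine grows exactly if its input at \<open>v\<close> is among those split off. The filtration
  by the size of the spine is therefore preserved, and its associated graded sees only the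
  splittings of side inputs.
\<close>

lemma card_spine_split:
  "card (spine m n (Suc V) f') = card (spine m n V f) + (if A \<inter> spine m n V f = {} then 0 else 1)"
proof -
  have "OutOf V \<notin> spine m n V f" by (simp add: spine_def)
  then show ?thesis by (simp add: spine_split)
qed

end

lemma periodic_relabel:
  assumes \<sigma>: "\<sigma> permutes {..<V}"
  shows "periodic \<rho> (relabel \<sigma> f) (map_source \<sigma> s) \<longleftrightarrow> periodic \<rho> f s"
proof -
  let ?F = "close_step \<rho> f" and ?F' = "close_step \<rho> (relabel \<sigma> f)"
  have step: "?F' (map_source \<sigma> s) = map_source \<sigma> (?F s)" for s
    by (cases "f s") (simp_all add: close_step_def relabel_apply[OF \<sigma>])
  have "(?F' ^^ k) (map_source \<sigma> s) = map_source \<sigma> ((?F ^^ k) s)" for k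
    by (induction k) (simp_all add: step)
  moreover have "inj (map_source \<sigma>)" using bij_map_source[OF \<sigma>] by (rule bij_is_inj)
  ultimately show ?thesis by (auto simp: periodic_def orbit_altdef inj_eq)
qed

lemma closing_relabel:
  assumes \<sigma>: "\<sigma> permutes {..<V}"
  shows "closing m n V (relabel \<sigma> f) = closing m n V f"
proof -
  have "(\<forall>s\<in>sources n V. \<forall>j<m. relabel \<sigma> f s = OutLeg j \<longrightarrow> periodic \<rho> (relabel \<sigma> f) s) \<longleftrightarrow>
      (\<forall>s\<in>sources n V. \<forall>j<m. f s = OutLeg j \<longrightarrow> periodic \<rho> f s)" (is "?L \<longleftrightarrow> ?R") for \<rho>
  proof
    assume L: ?L
    show ?R
    proof (intro ballI allI impI)
      fix s j assume "s \<in> sources n V" "j < m" "f s = OutLeg j"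
      then show "periodic \<rho> f s"
        using L[rule_format, of "map_source \<sigma> s" j]
        by (simp add: map_source_sources[OF \<sigma>] relabel_apply[OF \<sigma>] periodic_relabel[OF \<sigma>])
    qed
  next
    assume R: ?R
    show ?L
    proof (intro ballI allI impI)
      fix s j assume *: "s \<in> sources n V" "j < m" "relabel \<sigma> f s = OutLeg j"
      obtain t where t: "s = map_source \<sigma> t" using bij_map_source[OF \<sigma>] by (metis bij_pointE)
      then have "f t = OutLeg j" using *(3) by (cases "f t") (auto simp: relabel_apply[OF \<sigma>])
      then show "periodic \<rho> (relabel \<sigma> f) s"
        using R * t by (simp add: map_source_sources[OF \<sigma>] periodic_relabel[OF \<sigma>])
    qed
  qed
  then show ?thesis by (simp add: closing_def closes_trees_def)
qed

lemma spine_relabel: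
  assumes \<sigma>: "\<sigma> permutes {..<V}"
  shows "spine m n V (relabel \<sigma> f) = map_source \<sigma> ` spine m n V f"
proof (intro set_eqI iffI)
  fix s assume s: "s \<in> spine m n V (relabel \<sigma> f)"
  obtain t where "s = map_source \<sigma> t" using bij_map_source[OF \<sigma>] by (metis bij_pointE)
  then show "s \<in> map_source \<sigma> ` spine m n V f" using s
    by (auto simp: spine_def closing_relabel[OF \<sigma>] periodic_relabel[OF \<sigma>] map_source_sources[OF \<sigma>])
qed (auto simp: spine_def closing_relabel[OF \<sigma>] periodic_relabel[OF \<sigma>] map_source_sources[OF \<sigma>])

lemma card_spine_relabel:
  assumes \<sigma>: "\<sigma> permutes {..<V}"
  shows "card (spine m n V (relabel \<sigma> f)) = card (spine m n V f)"
  unfolding spine_relabel[OF \<sigma>]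
  by (rule card_image) (rule inj_on_subset[OF bij_is_inj[OF bij_map_source[OF \<sigma>]] subset_UNIV])

section \<open>Contractible vertices and full splittings\<close>

definition side_inputs ::
    "nat \<Rightarrow> nat \<Rightarrow> nat \<Rightarrow> (nat source \<Rightarrow> nat target) \<Rightarrow> nat \<Rightarrow> nat source set" where
  "side_inputs m n V f v = inputs n V f v - spine m n V f"

text \<open>
  Spine vertices at which the side inputs can be detached together, or have been so already. Their
  number is the factor in the homotopy identity.
\<close>

definition unfinished :: "nat \<Rightarrow> nat \<Rightarrow> nat \<Rightarrow> (nat source \<Rightarrow> nat target) \<Rightarrow> nat set" where
  "unfinished m n V f =
     {v. v < V \<and> OutOf v \<in> spine m n V f \<and> (\<forall>i. side_inputs m n V f v \<noteq> {InLeg i})}"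

text \<open>
  All side inputs of a spine vertex are detached together.
\<close>

definition full_splittings ::
    "nat \<Rightarrow> nat \<Rightarrow> nat \<Rightarrow> (nat source \<Rightarrow> nat target) \<Rightarrow> (nat \<times> nat source set) set" where
  "full_splittings m n V f =
     {(v, A) \<in> splittings n V f. OutOf v \<in> spine m n V f \<and> A = side_inputs m n V f v}"

text \<open>
  The vertices which a full splitting can have produced: outside the spine, and the only side input
  of a spine vertex.
\<close>

definition contractible :: "nat \<Rightarrow> nat \<Rightarrow> nat \<Rightarrow> (nat source \<Rightarrow> nat target) \<Rightarrow> nat set" where
  "contractible m n V f =
     {w. w < V \<and> (\<exists>v<V. OutOf v \<in> spine m n V f \<and> side_inputs m n V f v = {OutOf w})}"

definition side_splittings ::
    "nat \<Rightarrow> nat \<Rightarrow> nat \<Rightarrow> (nat source \<Rightarrow> nat target) \<Rightarrow> (nat \<times> nat source set) set" where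
  "side_splittings m n V f = {(v, A) \<in> splittings n V f. A \<inter> spine m n V f = {}}"

text \<open>
  The inverse of a splitting: the inputs of the last vertex are handed over to the vertex below it.
\<close>

definition merge_last ::
    "nat \<Rightarrow> (nat source \<Rightarrow> nat target) \<Rightarrow> nat source \<Rightarrow> nat target" where
  "merge_last V g s =
     (if s = OutOf V then OutLeg 0 else if g s = Into V then g (OutOf V) else g s)"

text \<open>
  The vertex \<open>w\<close> is moved to the last position and then merged; the transposition
  contributes the sign in the sum below.
\<close>

definition contract ::
    "nat \<Rightarrow> (nat source \<Rightarrow> nat target) \<Rightarrow> nat \<Rightarrow> nat source \<Rightarrow> nat target" where
  "contract V g w = merge_last V (relabel (transpose w V) g)"

definition contract_sum ::
    "nat \<Rightarrow> nat \<Rightarrow> nat \<Rightarrow> (nat source \<Rightarrow> nat target) \<Rightarrow> (dgraph \<Rightarrow>\<^sub>0 'k::field)" where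
  "contract_sum m n V g = (\<Sum>w\<in>contractible m n (Suc V) g.
     fscale (fsign (transpose w V)) (pgen n V (contract V g w)))"

lemma finite_unfinished [simp]: "finite (unfinished m n V f)"
  by (simp add: unfinished_def)

lemma finite_contractible [simp]: "finite (contractible m n V f)"
  by (simp add: contractible_def)

lemma finite_full_splittings [simp]: "finite (full_splittings m n V f)"
  by (rule finite_subset[OF _ finite_splittings[of n V f]]) (auto simp: full_splittings_def)

lemma finite_side_splittings [simp]: "finite (side_splittings m n V f)"
  by (rule finite_subset[OF _ finite_splittings[of n V f]]) (auto simp: side_splittings_def)

lemma full_side_splittings: "full_splittings m n V f \<subseteq> side_splittings m n V f"
  by (auto simp: full_splittings_def side_splittings_def side_inputs_def)

lemma finite_side_inputs [simp]: "finite (side_inputs m n V f v)"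
  by (simp add: side_inputs_def)

context
  fixes m n V f
  assumes f: "is_parent m n V f"
begin

lemma side_inputs_nonempty:
  assumes "OutOf v \<in> spine m n V f"
  shows "side_inputs m n V f v \<noteq> {}" "side_inputs m n V f v \<noteq> inputs n V f v"
proof -
  obtain s where s: "inputs n V f v \<inter> spine m n V f = {s}" using spine_input[OF f assms] .
  show "side_inputs m n V f v \<noteq> inputs n V f v" using s by (auto simp: side_inputs_def)
  have "v < V" using assms by (simp add: spine_def)
  then have "2 \<le> card (inputs n V f v)" using f by (simp add: is_parent_def)
  show "side_inputs m n V f v \<noteq> {}"
  proof
    assume "side_inputs m n V f v = {}"
    then have "inputs n V f v = {s}" using s by (auto simp: side_inputs_def)
    then show False using \<open>2 \<le> card (inputs n V f v)\<close> by simp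
  qed
qed

text \<open>
  A spine vertex has side inputs because it has two inputs and only one on the spine. If there are
  at least two, they can be detached together; if there is one, it is an input leg or a vertex, and
  the vertex can be contracted.
\<close>

lemma card_unfinished:
  "card (unfinished m n V f) = card (full_splittings m n V f) + card (contractible m n V f)"
proof -
  let ?T = "{v. v < V \<and> OutOf v \<in> spine m n V f \<and> (\<exists>w. side_inputs m n V f v = {OutOf w})}"
  let ?FS = "fst ` full_splittings m n V f"
  have "unfinished m n V f = ?FS \<union> ?T"
  proof (intro set_eqI iffI)
    fix v assume v: "v \<in> unfinished m n V f"
    let ?D = "side_inputs m n V f v"
    have P: "OutOf v \<in> spine m n V f" "v < V" using v by (auto simp: unfinished_def)
    show "v \<in> ?FS \<union> ?T"
    proof (cases "2 \<le> card ?D")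
      case True
      then have "(v, ?D) \<in> full_splittings m n V f"
        using P side_inputs_nonempty(2)[OF P(1)]
        by (auto simp: full_splittings_def splittings_def side_inputs_def)
      then show ?thesis by force
    next
      case False
      moreover have "0 < card ?D" using side_inputs_nonempty(1)[OF P(1)] by (simp add: card_gt_0_iff)
      ultimately have "card ?D = 1" by linarith
      then obtain s where s: "?D = {s}" by (auto simp: card_1_singleton_iff)
      then show ?thesis using P v by (cases s) (auto simp: unfinished_def)
    qed
  next
    fix v assume "v \<in> ?FS \<union> ?T"
    then show "v \<in> unfinished m n V f"
      by (auto simp: full_splittings_def unfinished_def splittings_def)
  qed
  moreover have "?FS \<inter> ?T = {}"
    by (auto simp: full_splittings_def splittings_def)
  moreover have "card ?FS = card (full_splittings m n V f)"
    by (rule card_image) (auto simp: inj_on_def full_splittings_def)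
  moreover have "card (contractible m n V f) = card ?T"
  proof (rule bij_betw_same_card)
    let ?g = "\<lambda>w. case f (OutOf w) of Into v \<Rightarrow> v | OutLeg j \<Rightarrow> V"
    have g: "?g w = v" if "side_inputs m n V f v = {OutOf w}" for v w
    proof -
      have "f (OutOf w) = Into v" using that by (auto simp: side_inputs_def inputs_def)
      then show ?thesis by simp
    qed
    have lt: "w < V" if "side_inputs m n V f v = {OutOf w}" for v w
    proof -
      have "OutOf w \<in> inputs n V f v" using that by (auto simp: side_inputs_def)
      then show ?thesis by (simp add: inputs_def)
    qed
    show "bij_betw ?g (contractible m n V f) ?T"
    proof (rule bij_betw_imageI)
      show "inj_on ?g (contractible m n V f)"
      proof (rule inj_onI)
        fix w w' assume "w \<in> contractible m n V f" "w' \<in> contractible m n V f" and eq: "?g w = ?g w'"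
        then obtain v v' where "side_inputs m n V f v = {OutOf w}" "side_inputs m n V f v' = {OutOf w'}"
          by (auto simp: contractible_def)
        then show "w = w'" using g[of v w] g[of v' w'] eq by simp
      qed
      show "?g ` contractible m n V f = ?T"
      proof (intro set_eqI iffI)
        fix v assume "v \<in> ?g ` contractible m n V f"
        then show "v \<in> ?T" using g by (fastforce simp: contractible_def)
      next
        fix v assume v: "v \<in> ?T"
        then obtain w where "side_inputs m n V f v = {OutOf w}" by blast
        then show "v \<in> ?g ` contractible m n V f"
          using v g[of v w] lt[of v w] by (intro image_eqI[of _ _ w]) (auto simp: contractible_def)
      qed
    qed
  qed
  ultimately show ?thesis by (simp add: card_Un_disjoint)
qed

text \<open>
  If the side input of each spine vertex is a single input leg, no path enters the spine from
  outside, so that all vertices lie on the spine, with two inputs each.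
\<close>

lemma binary_if_finished:
  assumes "unfinished m n V f = {}" "v < V"
  shows "card (inputs n V f v) = 2"
proof -
  have leaf: "\<exists>i. side_inputs m n V f u = {InLeg i}" if "OutOf u \<in> spine m n V f" for u
    using assms(1) that by (auto simp: unfinished_def spine_def)
  have v: "OutOf v \<in> spine m n V f"
  proof (rule ccontr)
    assume "\<not> ?thesis"
    then obtain u w where "OutOf u \<in> spine m n V f" "OutOf w \<in> inputs n V f u - spine m n V f"
      using spine_entry[OF f assms(2)] by metis
    then show False using leaf[of u] by (auto simp: side_inputs_def)
  qed
  obtain i where i: "side_inputs m n V f v = {InLeg i}" using leaf[OF v] by blast
  obtain s where s: "inputs n V f v \<inter> spine m n V f = {s}" using spine_input[OF f v] .
  have "inputs n V f v = {s, InLeg i}" "s \<noteq> InLeg i"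
    using i s by (auto simp: side_inputs_def)
  then show ?thesis by simp
qed

end

context
  fixes m n V f v A
  assumes f: "is_parent m n V f" and A: "(v, A) \<in> splittings n V f"
begin

lemma merge_last_split: "merge_last V (split_at V f v A) = f"
proof
  fix s
  have "f s \<noteq> Into V" "f (OutOf V) = OutLeg 0"
    using f by (cases "s \<in> sources n V"; auto simp: is_parent_def)+
  then show "merge_last V (split_at V f v A) s = f s"
    using splitting_facts[OF f A] by (auto simp: merge_last_def split_at_def)
qed

context
  assumes side: "A \<inter> spine m n V f = {}"
begin

lemma side_inputs_split:
  "u < V \<Longrightarrow> side_inputs m n (Suc V) (split_at V f v A) u =
     (if u = v then insert (OutOf V) (side_inputs m n V f v - A) else side_inputs m n V f u)"
  using inputs_split_same[OF f A] inputs_split_other[OF f A, of u] spine_split[OF f A] side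
  by (auto simp: side_inputs_def spine_def)

lemma side_splitting_subset: "A \<subseteq> side_inputs m n V f v"
  using A side by (auto simp: side_inputs_def splittings_def)

lemma unfinished_split: "unfinished m n (Suc V) (split_at V f v A) = unfinished m n V f"
proof -
  have new: "OutOf V \<notin> spine m n (Suc V) (split_at V f v A)"
    using spine_split[OF f A] side by (simp add: spine_def)
  have v1: "insert (OutOf V) (side_inputs m n V f v - A) \<noteq> {InLeg i}" for i by auto
  have v2: "side_inputs m n V f v \<noteq> {s}" for s
    using card_mono[OF finite_side_inputs side_splitting_subset] A by (auto simp: splittings_def)
  show ?thesis
    using new v1 v2 spine_split[OF f A] side
    by (auto simp: unfinished_def side_inputs_split less_Suc_eq split: if_splits)
qed

text \<open>
  A side splitting preserves the contractible vertices. The new vertex joins them exactly if all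
  side inputs have been detached from a spine vertex.
\<close>

lemma contractible_split:
  "contractible m n (Suc V) (split_at V f v A) =
     (if (v, A) \<in> full_splittings m n V f then {V} else {}) \<union> contractible m n V f"
proof -
  let ?f' = "split_at V f v A"
  have new: "OutOf V \<notin> spine m n (Suc V) ?f'"
    using spine_split[OF f A] side by (simp add: spine_def)
  have P: "spine m n (Suc V) ?f' = spine m n V f" using spine_split[OF f A] side by simp
  have v2: "side_inputs m n V f v \<noteq> {s}" for s
    using card_mono[OF finite_side_inputs side_splitting_subset] A by (auto simp: splittings_def)
  have V1: "OutOf V \<notin> side_inputs m n V f u" for u
    by (auto simp: side_inputs_def inputs_def)
  have vV: "v < V" using splitting_facts[OF f A] by simp
  have "w \<in> contractible m n (Suc V) ?f' \<longleftrightarrow>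
      (w = V \<and> (v, A) \<in> full_splittings m n V f) \<or> w \<in> contractible m n V f" for w
  proof
    assume "w \<in> contractible m n (Suc V) ?f'"
    then obtain u where w: "w < Suc V" and u: "u < Suc V" "OutOf u \<in> spine m n V f"
        "side_inputs m n (Suc V) ?f' u = {OutOf w}"
      unfolding contractible_def P by blast
    have uV: "u < V" using u by (simp add: spine_def)
    show "(w = V \<and> (v, A) \<in> full_splittings m n V f) \<or> w \<in> contractible m n V f"
    proof (cases "u = v")
      case True
      then have "insert (OutOf V) (side_inputs m n V f v - A) = {OutOf w}"
        using trans[OF side_inputs_split[OF uV, symmetric] u(3)] by (simp only: if_True refl)
      then have "OutOf V \<in> {OutOf w}" "side_inputs m n V f v - A \<subseteq> {OutOf w}" by blast+
      then have "w = V" "side_inputs m n V f v - A = {}" using V1[of v] by (simp, blast)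
      then show ?thesis using side_splitting_subset A u(2) True by (auto simp: full_splittings_def)
    next
      case False
      then have eq: "side_inputs m n V f u = {OutOf w}" using u(3) side_inputs_split[OF uV] by simp
      then have "OutOf w \<in> side_inputs m n V f u" by simp
      then have "w < V" by (simp add: side_inputs_def inputs_def)
      then show ?thesis using uV u(2) eq unfolding contractible_def by blast
    qed
  next
    assume "(w = V \<and> (v, A) \<in> full_splittings m n V f) \<or> w \<in> contractible m n V f"
    then show "w \<in> contractible m n (Suc V) ?f'"
    proof
      assume *: "w = V \<and> (v, A) \<in> full_splittings m n V f"
      then have "side_inputs m n (Suc V) ?f' v = {OutOf w}" "OutOf v \<in> spine m n V f"
        using side_inputs_split[OF vV] by (auto simp: full_splittings_def)
      moreover have "w < Suc V" "v < Suc V" using * vV by simp_all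
      ultimately show ?thesis unfolding contractible_def P by blast
    next
      assume "w \<in> contractible m n V f"
      then obtain u where u: "w < V" "u < V" "OutOf u \<in> spine m n V f" "side_inputs m n V f u = {OutOf w}"
        unfolding contractible_def by blast
      then have "u \<noteq> v" using v2 by auto
      then have "side_inputs m n (Suc V) ?f' u = {OutOf w}" using side_inputs_split[OF u(2)] u by simp
      moreover have "w < Suc V" "u < Suc V" using u by simp_all
      ultimately show ?thesis using u(3) unfolding contractible_def P by blast
    qed
  qed
  then show ?thesis by auto
qed

end
end

lemma merge_last_contractible:
  assumes g: "is_parent m n (Suc V) g" and V: "V \<in> contractible m n (Suc V) g"
  defines "c \<equiv> merge_last V g"
  obtains v A where "is_parent m n V c" "(v, A) \<in> full_splittings m n V c" "split_at V c v A = g"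
    "spine m n (Suc V) g = spine m n V c"
proof -
  obtain v where v: "v < Suc V" "OutOf v \<in> spine m n (Suc V) g" "side_inputs m n (Suc V) g v = {OutOf V}"
    using V by (auto simp: contractible_def)
  have VP: "OutOf V \<notin> spine m n (Suc V) g" and gV: "g (OutOf V) = Into v"
    using v(3) by (auto simp: side_inputs_def inputs_def)
  then have vV: "v < V" using v by (cases "v = V") auto
  define A where "A = inputs n (Suc V) g V"
  have A: "A \<subseteq> sources n V" "OutOf V \<notin> A" "2 \<le> card A"
    using gV vV g by (auto simp: A_def inputs_def sources_Suc is_parent_def)
  have inA: "s \<in> A \<longleftrightarrow> g s = Into V" for s
    using g unfolding A_def inputs_def is_parent_def by (cases "s \<in> sources n (Suc V)") auto
  have cv: "inputs n V c v = (inputs n (Suc V) g v - {OutOf V}) \<union> A"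
    using A gV vV by (auto simp: c_def merge_last_def inputs_def inA sources_Suc)
  have cu: "inputs n V c u = inputs n (Suc V) g u" if "u < V" "u \<noteq> v" for u
    using that gV by (auto simp: c_def merge_last_def inputs_def sources_Suc)
  have gvP: "inputs n (Suc V) g v - {OutOf V} \<subseteq> spine m n (Suc V) g"
    using v(3) by (auto simp: side_inputs_def)
  have c: "is_parent m n V c" unfolding is_parent_def
  proof (intro conjI ballI allI impI)
    fix s assume "s \<in> sources n V"
    then have "g s \<in> OutLeg ` {..<m} \<union> Into ` {..<Suc V}" "s \<noteq> OutOf V"
      using g by (auto simp: is_parent_def sources_Suc)
    then show "c s \<in> OutLeg ` {..<m} \<union> Into ` {..<V}"
      using gV vV by (auto simp: c_def merge_last_def less_Suc_eq)
  next
    fix s assume "s \<notin> sources n V"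
    then show "c s = OutLeg 0"
      using g by (cases "s = OutOf V") (auto simp: c_def merge_last_def is_parent_def sources_Suc)
  next
    fix j assume "j < m"
    then obtain s where s: "s \<in> sources n (Suc V)" "g s = OutLeg j"
      and un: "\<And>s'. s' \<in> sources n (Suc V) \<Longrightarrow> g s' = OutLeg j \<Longrightarrow> s' = s"
      using is_parent_OutLegE[OF g] by blast
    have "s \<in> sources n V \<and> c s = OutLeg j"
      using s gV by (auto simp: c_def merge_last_def sources_Suc)
    moreover have "s' = s" if "s' \<in> sources n V \<and> c s' = OutLeg j" for s'
      by (rule un) (use that gV in \<open>auto simp: c_def merge_last_def sources_Suc split: if_splits\<close>)
    ultimately show "\<exists>!s. s \<in> sources n V \<and> c s = OutLeg j" by blast
  next
    fix u assume u: "u < V"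
    show "2 \<le> card (inputs n V c u)"
    proof (cases "u = v")
      case True
      have "card A \<le> card (inputs n V c v)" by (rule card_mono[OF finite_inputs]) (simp add: cv)
      then show ?thesis using A True by simp
    next
      case False
      then show ?thesis using cu[OF u] u g by (simp add: is_parent_def)
    qed
  qed
  obtain s where s: "inputs n (Suc V) g v \<inter> spine m n (Suc V) g = {s}"
    using spine_input[OF g v(2)] .
  have sv: "s \<in> inputs n (Suc V) g v" "s \<noteq> OutOf V" using s VP by auto
  have "s \<notin> A" using sv(1) vV by (auto simp: inA inputs_def)
  then have spl: "(v, A) \<in> splittings n V c"
    using vV A sv by (auto simp: splittings_def cv)
  have eq: "split_at V c v A = g"
  proof
    fix t show "split_at V c v A t = g t"
      using gV A by (auto simp: split_at_def c_def merge_last_def inA)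
  qed
  have side: "A \<inter> spine m n V c = {}"
    using spine_split[OF c spl] VP unfolding eq by (auto split: if_splits)
  then have P: "spine m n (Suc V) g = spine m n V c"
    using spine_split[OF c spl] unfolding eq by simp
  have "side_inputs m n V c v = A"
    using gvP side unfolding side_inputs_def cv P by blast
  then have "(v, A) \<in> full_splittings m n V c"
    using spl v(2) unfolding P by (simp add: full_splittings_def)
  then show thesis using that c eq P by blast
qed

section \<open>Contractions under relabellings\<close>

lemma side_inputs_relabel:
  assumes \<sigma>: "\<sigma> permutes {..<V}"
  shows "side_inputs m n V (relabel \<sigma> f) (\<sigma> v) = map_source \<sigma> ` side_inputs m n V f v"
  unfolding side_inputs_def inputs_relabel[OF \<sigma>] spine_relabel[OF \<sigma>]
  by (rule image_set_diff[OF bij_is_inj[OF bij_map_source[OF \<sigma>]], symmetric])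

lemma spine_relabel_iff:
  assumes \<sigma>: "\<sigma> permutes {..<V}"
  shows "OutOf (\<sigma> v) \<in> spine m n V (relabel \<sigma> f) \<longleftrightarrow> OutOf v \<in> spine m n V f"
  using inj_image_mem_iff[OF bij_is_inj[OF bij_map_source[OF \<sigma>]], of "OutOf v" "spine m n V f"]
  by (simp add: spine_relabel[OF \<sigma>])

lemma map_source_image_eq_singleton:
  assumes \<sigma>: "\<sigma> permutes {..<V}"
  shows "map_source \<sigma> ` S = {map_source \<sigma> s} \<longleftrightarrow> S = {s}"
  using inj_image_eq_iff[OF bij_is_inj[OF bij_map_source[OF \<sigma>]], of S "{s}"] by simp

lemma contractible_relabel:
  assumes \<sigma>: "\<sigma> permutes {..<V}"
  shows "contractible m n V (relabel \<sigma> f) = \<sigma> ` contractible m n V f"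
proof -
  have iff: "\<sigma> w \<in> contractible m n V (relabel \<sigma> f) \<longleftrightarrow> w \<in> contractible m n V f" for w
  proof -
    have "(\<exists>v<V. OutOf v \<in> spine m n V (relabel \<sigma> f) \<and> side_inputs m n V (relabel \<sigma> f) v = {OutOf (\<sigma> w)})
        \<longleftrightarrow> (\<exists>v<V. OutOf (\<sigma> v) \<in> spine m n V (relabel \<sigma> f) \<and>
              side_inputs m n V (relabel \<sigma> f) (\<sigma> v) = {OutOf (\<sigma> w)})"
      using permutes_in_image[OF \<sigma>] by (metis lessThan_iff permutes_inverses(1)[OF \<sigma>])
    also have "\<dots> \<longleftrightarrow> (\<exists>v<V. OutOf v \<in> spine m n V f \<and> side_inputs m n V f v = {OutOf w})"
      using map_source_image_eq_singleton[OF \<sigma>, of _ "OutOf w"]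
      by (simp add: spine_relabel_iff[OF \<sigma>] side_inputs_relabel[OF \<sigma>])
    finally show ?thesis using permutes_in_image[OF \<sigma>, of w] by (simp add: contractible_def)
  qed
  show ?thesis
  proof (intro set_eqI iffI)
    fix x assume "x \<in> contractible m n V (relabel \<sigma> f)"
    then show "x \<in> \<sigma> ` contractible m n V f"
      using iff[of "inv \<sigma> x"] permutes_inverses(1)[OF \<sigma>, of x] by (metis imageI)
  qed (auto simp: iff)
qed

lemma card_unfinished_relabel:
  assumes \<sigma>: "\<sigma> permutes {..<V}"
  shows "card (unfinished m n V (relabel \<sigma> f)) = card (unfinished m n V f)"
proof -
  have iff: "\<sigma> v \<in> unfinished m n V (relabel \<sigma> f) \<longleftrightarrow> v \<in> unfinished m n V f" for v
    using permutes_in_image[OF \<sigma>, of v] map_source_image_eq_singleton[OF \<sigma>, of _ "InLeg _"]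
    by (simp add: unfinished_def spine_relabel_iff[OF \<sigma>] side_inputs_relabel[OF \<sigma>])
  have "unfinished m n V (relabel \<sigma> f) = \<sigma> ` unfinished m n V f"
  proof (intro set_eqI iffI)
    fix x assume "x \<in> unfinished m n V (relabel \<sigma> f)"
    then show "x \<in> \<sigma> ` unfinished m n V f"
      using iff[of "inv \<sigma> x"] permutes_inverses(1)[OF \<sigma>, of x] by (metis imageI)
  qed (auto simp: iff)
  then show ?thesis using card_image[of \<sigma> "unfinished m n V f"] permutes_inj[OF \<sigma>]
    by (simp add: inj_on_subset[OF _ subset_UNIV])
qed

lemma merge_last_relabel:
  assumes \<kappa>: "\<kappa> permutes {..<V}"
  shows "merge_last V (relabel \<kappa> g) = relabel \<kappa> (merge_last V g)"
proof (rule relabel_eqI[OF \<kappa>])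
  fix s
  have V: "\<kappa> V = V" using \<kappa> by (simp add: permutes_not_in)
  have 1: "map_source \<kappa> s = OutOf V \<longleftrightarrow> s = OutOf V"
    using permutes_inj[OF \<kappa>] V by (cases s) (auto dest: injD[where y=V])
  have 2: "map_target \<kappa> t = Into V \<longleftrightarrow> t = Into V" for t
    using permutes_inj[OF \<kappa>] V by (cases t) (auto dest: injD[where y=V])
  show "merge_last V (relabel \<kappa> g) (map_source \<kappa> s) = map_target \<kappa> (merge_last V g s)"
    using relabel_apply[OF \<kappa>, of g "OutOf V"] V
    by (simp add: merge_last_def 1 2 relabel_apply[OF \<kappa>])
qed

lemma contract_relabel:
  assumes \<sigma>: "\<sigma> permutes {..<Suc V}" and w: "w < Suc V"
  obtains \<kappa> where "\<kappa> permutes {..<V}" "contract V (relabel \<sigma> g) (\<sigma> w) = relabel \<kappa> (contract V g w)"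
    "(fsign \<kappa> :: 'k::field) = fsign (transpose (\<sigma> w) V) * fsign \<sigma> * fsign (transpose w V)"
proof -
  define \<kappa> where "\<kappa> = transpose (\<sigma> w) V \<circ> (\<sigma> \<circ> transpose w V)"
  have sw: "\<sigma> w < Suc V" using permutes_in_image[OF \<sigma>, of w] w by simp
  have t1: "transpose w V permutes {..<Suc V}" and t2: "transpose (\<sigma> w) V permutes {..<Suc V}"
    using w sw by (auto intro!: permutes_swap_id)
  note st = permutes_compose[OF t1 \<sigma>]
  have \<kappa>S: "\<kappa> permutes {..<Suc V}" unfolding \<kappa>_def by (rule permutes_compose[OF st t2])
  have "\<kappa> V = V" by (simp add: \<kappa>_def)
  then have \<kappa>: "\<kappa> permutes {..<V}"
    by (intro permutes_superset[OF \<kappa>S]) (auto simp: less_Suc_eq)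
  have "relabel (transpose (\<sigma> w) V) (relabel \<sigma> g) = relabel \<kappa> (relabel (transpose w V) g)"
    unfolding relabel_relabel[OF t2 \<sigma>] relabel_relabel[OF \<kappa>S t1]
    by (simp add: \<kappa>_def comp_assoc)
  then have "contract V (relabel \<sigma> g) (\<sigma> w) = relabel \<kappa> (contract V g w)"
    by (simp add: contract_def merge_last_relabel[OF \<kappa>])
  moreover have "(fsign \<kappa> :: 'k) = fsign (transpose (\<sigma> w) V) * fsign \<sigma> * fsign (transpose w V)"
    unfolding \<kappa>_def by (simp only: fsign_compose[OF t2 st] fsign_compose[OF \<sigma> t1] mult.assoc)
  ultimately show thesis using that \<kappa> by blast
qed

text \<open>
  Each contraction is undone by a full splitting, up to a renumbering, and does not touch the spine.
\<close>

lemma contract_facts: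
  assumes g: "is_parent m n (Suc V) g" and w: "w \<in> contractible m n (Suc V) g"
  defines "c \<equiv> contract V g w"
  obtains v A where "is_parent m n V c" "(v, A) \<in> full_splittings m n V c"
    "split_at V c v A = relabel (transpose w V) g"
    "card (spine m n V c) = card (spine m n (Suc V) g)"
proof -
  let ?\<tau> = "transpose w V"
  have wV: "w < Suc V" using w by (simp add: contractible_def)
  then have \<tau>: "?\<tau> permutes {..<Suc V}" by (auto intro!: permutes_swap_id)
  have g': "is_parent m n (Suc V) (relabel ?\<tau> g)" by (rule is_parent_relabel[OF \<tau> g])
  have "V \<in> contractible m n (Suc V) (relabel ?\<tau> g)"
    unfolding contractible_relabel[OF \<tau>] using w by (intro image_eqI[of _ _ w]) auto
  then obtain v A where "is_parent m n V c" "(v, A) \<in> full_splittings m n V c"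
      "split_at V c v A = relabel (transpose w V) g" "spine m n (Suc V) (relabel ?\<tau> g) = spine m n V c"
    unfolding c_def contract_def by (rule merge_last_contractible[OF g'])
  then show thesis using that card_spine_relabel[OF \<tau>, of m n g] by simp
qed

lemma contract_sum_relabel:
  assumes g: "is_parent m n (Suc V) g" and \<sigma>: "\<sigma> permutes {..<Suc V}"
  shows "cong_mod (C m n) (contract_sum m n V (relabel \<sigma> g) :: dgraph \<Rightarrow>\<^sub>0 'k::field)
    (fscale (fsign \<sigma>) (contract_sum m n V g))"
proof -
  have "contract_sum m n V (relabel \<sigma> g) = (\<Sum>w\<in>contractible m n (Suc V) g.
      fscale (fsign (transpose (\<sigma> w) V)) (pgen n V (contract V (relabel \<sigma> g) (\<sigma> w))) :: dgraph \<Rightarrow>\<^sub>0 'k)"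
    unfolding contract_sum_def contractible_relabel[OF \<sigma>]
    by (subst sum.reindex) (auto intro: inj_on_subset[OF permutes_inj[OF \<sigma>]])
  also have "cong_mod (C m n) \<dots> (fscale (fsign \<sigma>) (contract_sum m n V g))"
    unfolding contract_sum_def fvs.scale_sum_right
  proof (rule cong_mod_sum[OF subspace_coinv_rels])
    fix w assume w: "w \<in> contractible m n (Suc V) g"
    then have "w < Suc V" by (simp add: contractible_def)
    then obtain \<kappa> where \<kappa>: "\<kappa> permutes {..<V}"
        "contract V (relabel \<sigma> g) (\<sigma> w) = relabel \<kappa> (contract V g w)"
        "(fsign \<kappa> :: 'k) = fsign (transpose (\<sigma> w) V) * fsign \<sigma> * fsign (transpose w V)"
      by (rule contract_relabel[OF \<sigma>])
    have c: "is_parent m n V (contract V g w)" using contract_facts[OF g w] by metis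
    have "cong_mod (C m n) (pgen n V (relabel \<kappa> (contract V g w)))
        (fscale (fsign \<kappa>) (pgen n V (contract V g w)) :: dgraph \<Rightarrow>\<^sub>0 'k)"
      by (rule cong_relabel[OF c \<kappa>(1)])
    from cong_mod_scale[OF subspace_coinv_rels this, of "fsign (transpose (\<sigma> w) V)"]
    show "cong_mod (C m n)
        (fscale (fsign (transpose (\<sigma> w) V)) (pgen n V (contract V (relabel \<sigma> g) (\<sigma> w))))
        (fscale (fsign \<sigma>) (fscale (fsign (transpose w V)) (pgen n V (contract V g w))) :: dgraph \<Rightarrow>\<^sub>0 'k)"
      unfolding \<kappa>(2,3) by (simp add: mult.assoc)
  qed
  finally show ?thesis .
qed

section \<open>The contracting homotopy\<close>

text \<open>
  The contraction, divided by the number of unfinished vertices, which is the same for a graph and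
  for its side splittings and contractions.
\<close>

definition homotopy_graph :: "nat \<Rightarrow> nat \<Rightarrow> dgraph \<Rightarrow> (dgraph \<Rightarrow>\<^sub>0 'k::field)" where
  "homotopy_graph m n G = (case nverts G of 0 \<Rightarrow> 0 | Suc V \<Rightarrow>
     fscale ((-1) ^ Suc V / of_nat (card (unfinished m n (Suc V) (parent n G))))
       (contract_sum m n V (parent n G)))"

definition homotopy :: "nat \<Rightarrow> nat \<Rightarrow> (dgraph \<Rightarrow>\<^sub>0 'k::field) \<Rightarrow> (dgraph \<Rightarrow>\<^sub>0 'k)" where
  "homotopy m n = lin_ext (homotopy_graph m n)"

definition spine_filtration :: "nat \<Rightarrow> nat \<Rightarrow> int \<Rightarrow> nat \<Rightarrow> dgraph set" where
  "spine_filtration m n d p = {G \<in> W m n. int (nverts G) = d \<and>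
     p \<le> card (spine m n (nverts G) (parent n G))}"

text \<open>
  Working modulo this subspace means passing to the associated graded of the filtration.
\<close>

definition mod_spine :: "nat \<Rightarrow> nat \<Rightarrow> int \<Rightarrow> nat \<Rightarrow> (dgraph \<Rightarrow>\<^sub>0 'k::field) set" where
  "mod_spine m n d p = {x + y | x y. x \<in> C m n \<and> y \<in> graph_span (spine_filtration m n d p)}"

interpretation homotopy: Vector_Spaces.linear fscale fscale
    "homotopy m n :: (dgraph \<Rightarrow>\<^sub>0 'k::field) \<Rightarrow> (dgraph \<Rightarrow>\<^sub>0 'k)" for m n
  unfolding homotopy_def by (rule lin_ext.linear_axioms)

lemma subspace_mod_spine [simp]: "fvs.subspace (mod_spine m n d p)"
  unfolding mod_spine_def by (rule fvs.subspace_sums) (simp_all add: subspace_graph_span)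

lemma cong_mod_spine_trans [trans]:
  "cong_mod (mod_spine m n d p) x y \<Longrightarrow> cong_mod (mod_spine m n d p) y z \<Longrightarrow>
    cong_mod (mod_spine m n d p) x z"
  by (rule cong_mod_trans) simp

lemma eq_cong_mod_trans [trans]:
  "x = y \<Longrightarrow> cong_mod M y z \<Longrightarrow> cong_mod M x z"
  "cong_mod M x y \<Longrightarrow> y = z \<Longrightarrow> cong_mod M x z"
  by simp_all

lemma C_subset_mod_spine: "x \<in> C m n \<Longrightarrow> x \<in> mod_spine m n d p"
  using fvs.subspace_0[OF subspace_graph_span] unfolding mod_spine_def by force

lemma filtration_subset_mod_spine:
  "x \<in> graph_span (spine_filtration m n d p) \<Longrightarrow> x \<in> mod_spine m n d p"
  using fvs.subspace_0[OF subspace_coinv_rels] unfolding mod_spine_def by force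

lemma cong_C_mod_spine: "cong_mod (C m n) x y \<Longrightarrow> cong_mod (mod_spine m n d p) x y"
  by (simp add: cong_mod_def C_subset_mod_spine)

lemma homotopy_pgen:
  "is_parent m n (Suc V) f \<Longrightarrow> homotopy m n (pgen n (Suc V) f) =
    fscale ((-1) ^ Suc V / of_nat (card (unfinished m n (Suc V) f))) (contract_sum m n V f)"
  by (simp add: homotopy_def homotopy_graph_def del: power_Suc)

lemma homotopy_in_C:
  "(x :: dgraph \<Rightarrow>\<^sub>0 'k::field) \<in> C m n \<Longrightarrow> homotopy m n x \<in> C m n"
  unfolding homotopy_def
proof (erule lin_ext_coinv[OF subspace_coinv_rels])
  fix \<sigma> G H assume G: "G \<in> W m n" and H: "H \<in> W m n" and iso: "graph_iso \<sigma> G H"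
  have V: "nverts H = nverts G" and \<sigma>: "\<sigma> permutes {..<nverts G}"
    using iso by (auto simp: graph_iso_def)
  note p = graph_iso_parent[OF iso G H]
  show "cong_mod (C m n) (homotopy_graph m n H :: dgraph \<Rightarrow>\<^sub>0 'k)
      (fscale (fsign \<sigma>) (homotopy_graph m n G))"
  proof (cases "nverts G")
    case 0
    then show ?thesis using V by (simp add: homotopy_graph_def)
  next
    case (Suc V0)
    have \<sigma>': "\<sigma> permutes {..<Suc V0}" and f: "is_parent m n (Suc V0) (parent n G)"
      using \<sigma> W_encodes(2)[OF G] Suc by simp_all
    let ?a = "(-1) ^ Suc V0 / of_nat (card (unfinished m n (Suc V0) (parent n G))) :: 'k"
    have hG: "homotopy_graph m n G = fscale ?a (contract_sum m n V0 (parent n G))"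
      and hH: "homotopy_graph m n H = fscale ?a (contract_sum m n V0 (relabel \<sigma> (parent n G)))"
      using Suc V by (simp_all add: homotopy_graph_def p card_unfinished_relabel[OF \<sigma>'] del: power_Suc)
    show ?thesis
      unfolding hG hH fvs.scale_left_commute[of "fsign \<sigma>" ?a]
      by (rule cong_mod_scale[OF subspace_coinv_rels contract_sum_relabel[OF f \<sigma>']])
  qed
qed

lemma homotopy_filtration:
  assumes "x \<in> graph_span (spine_filtration m n d p)"
  shows "homotopy m n x \<in> graph_span (spine_filtration m n (d - 1) p)"
  unfolding homotopy_def
proof (rule lin_ext_in_subspace[OF subspace_graph_span assms])
  fix G assume G: "G \<in> spine_filtration m n d p"
  then have GW: "G \<in> W m n" by (simp add: spine_filtration_def)
  show "homotopy_graph m n G \<in> graph_span (spine_filtration m n (d - 1) p)"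
  proof (cases "nverts G")
    case 0
    then show ?thesis by (simp add: homotopy_graph_def fvs.subspace_0[OF subspace_graph_span])
  next
    case (Suc V)
    then have f: "is_parent m n (Suc V) (parent n G)" using W_encodes(2)[OF GW] by simp
    have "graph_of n V (contract V (parent n G) w) \<in> spine_filtration m n (d - 1) p"
      if w: "w \<in> contractible m n (Suc V) (parent n G)" for w
    proof -
      have "is_parent m n V (contract V (parent n G) w)"
        "card (spine m n V (contract V (parent n G) w)) = card (spine m n (Suc V) (parent n G))"
        using contract_facts[OF f w] by metis+
      then show ?thesis using G Suc by (auto simp: spine_filtration_def)
    qed
    then have "contract_sum m n V (parent n G) \<in> graph_span (spine_filtration m n (d - 1) p)"
      unfolding contract_sum_def
      by (intro fvs.subspace_sum[OF subspace_graph_span] fvs.subspace_scale[OF subspace_graph_span]) simp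
    then show ?thesis
      unfolding homotopy_graph_def Suc nat.case by (rule fvs.subspace_scale[OF subspace_graph_span])
  qed
qed

text \<open>Splittings away from the spine commute with a contraction.\<close>

text \<open>
  The side splitting that is undone by the contraction is left out. What was split at the spine
  vertex \<open>v\<close> is split at the new vertex \<open>V\<close> instead.
\<close>

lemma side_splittings_contract:
  assumes c: "is_parent m n V c" and full: "(v, A) \<in> full_splittings m n V c"
  defines "g \<equiv> split_at V c v A"
  shows "bij_betw (\<lambda>(u, B). (if u = v then V else u, B))
    (side_splittings m n V c - {(v, A)}) (side_splittings m n (Suc V) g)"
    and "(u, B) \<in> side_splittings m n V c - {(v, A)} \<Longrightarrow>
      contract (Suc V) (split_at (Suc V) g (if u = v then V else u) B) V = split_at V c u B"
proof -
  let ?P = "spine m n V c" and ?\<phi> = "\<lambda>(u, B). (if u = v then V else u, B)"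
  have A: "(v, A) \<in> splittings n V c" and vP: "OutOf v \<in> ?P" and Aeq: "A = side_inputs m n V c v"
    using full by (auto simp: full_splittings_def)
  have side: "A \<inter> ?P = {}" using Aeq by (auto simp: side_inputs_def)
  have P: "spine m n (Suc V) g = ?P" using spine_split[OF c A] side by (simp add: g_def)
  have vV: "v < V" using splitting_facts[OF c A] by simp
  note ins = inputs_split_new[OF c A, folded g_def] inputs_split_other[OF c A, folded g_def]
  have into: "?\<phi> (u, B) \<in> side_splittings m n (Suc V) g"
    if Q: "(u, B) \<in> side_splittings m n V c - {(v, A)}" for u B
  proof -
    have B: "(u, B) \<in> splittings n V c" "B \<inter> ?P = {}" "(u, B) \<noteq> (v, A)"
      using Q by (auto simp: side_splittings_def)
    show ?thesis
    proof (cases "u = v")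
      case True
      then have "B \<subseteq> A" using side_splitting_subset[OF c] B Aeq by simp
      then show ?thesis using B True by (auto simp: side_splittings_def splittings_def P ins)
    next
      case False
      then show ?thesis using B ins(2)[of u] by (auto simp: side_splittings_def splittings_def P)
    qed
  qed
  have onto: "\<exists>Q\<in>side_splittings m n V c - {(v, A)}. R = ?\<phi> Q"
    if R: "R \<in> side_splittings m n (Suc V) g" for R
  proof -
    have RP: "snd R \<inter> ?P = {}" using R by (auto simp: side_splittings_def P)
    have R2: "((v, A), R) \<in> splittings2 n V c"
      using R A by (auto simp: splittings2_def side_splittings_def g_def)
    from c R2 show ?thesis
    proof (cases rule: splittings2_cases)
      case (new_vertex v' A' B)
      then have "(v, B) \<in> side_splittings m n V c - {(v, A)}"
        using RP A by (auto simp: side_splittings_def splittings_def)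
      then show ?thesis using new_vertex by (intro bexI[of _ "(v, B)"]) auto
    next
      case (new_edge v' A' K)
      then have "K \<subseteq> ?P" using Aeq by (auto simp: side_inputs_def)
      then show ?thesis using new_edge RP by auto
    next
      case (disjoint v' A' u B)
      have "B \<noteq> {}" using disjoint(4) by (auto simp: splittings_def)
      have "u \<noteq> v"
      proof
        assume "u = v"
        then have "B \<subseteq> A" using side_splitting_subset[OF c disjoint(4)] RP disjoint(1) Aeq by simp
        then show False using disjoint \<open>B \<noteq> {}\<close> by auto
      qed
      then show ?thesis using disjoint RP
        by (intro bexI[of _ "(u, B)"]) (auto simp: side_splittings_def)
    qed
  qed
  show "bij_betw ?\<phi> (side_splittings m n V c - {(v, A)}) (side_splittings m n (Suc V) g)"
  proof (rule bij_betw_imageI)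
    show "inj_on ?\<phi> (side_splittings m n V c - {(v, A)})"
      by (auto simp: inj_on_def side_splittings_def splittings_def split: if_splits)
    show "?\<phi> ` (side_splittings m n V c - {(v, A)}) = side_splittings m n (Suc V) g"
      using into onto by fast
  qed
  show "contract (Suc V) (split_at (Suc V) g (if u = v then V else u) B) V = split_at V c u B"
    if Q: "(u, B) \<in> side_splittings m n V c - {(v, A)}"
  proof -
    let ?R = "((v, A), ?\<phi> (u, B))"
    have R: "?R \<in> splittings2 n V c"
      using into[OF Q] A by (auto simp: splittings2_def side_splittings_def g_def)
    have B: "(u, B) \<in> splittings n V c" using Q by (auto simp: side_splittings_def)
    have "fst (swap_splittings V ?R) = (u, B)"
      using splitting_facts[OF c B] by (auto simp: swap_splittings_def)
    then obtain Q' where Q': "swap_splittings V ?R = ((u, B), Q')"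
      by (cases "swap_splittings V ?R") simp
    then have Q'in: "Q' \<in> splittings n (Suc V) (split_at V c u B)"
      using swap_splittings(1)[OF c R] by (auto simp: splittings2_def)
    have "relabel (transpose V (Suc V)) (split_at (Suc V) g (if u = v then V else u) B) =
        split_at2 V c (swap_splittings V ?R)"
      unfolding swap_splittings(3)[OF c R] by (simp add: split_at2_def g_def)
    also have "\<dots> = split_at (Suc V) (split_at V c u B) (fst Q') (snd Q')"
      unfolding Q' by (simp add: split_at2_def case_prod_unfold)
    finally show ?thesis
      using merge_last_split[OF is_parent_split[OF c B], of "fst Q'" "snd Q'"] Q'in
      by (simp add: contract_def)
  qed
qed

lemma side_splittings_relabel:
  assumes \<sigma>: "\<sigma> permutes {..<V}"
  shows "bij_betw (\<lambda>(v, A). (\<sigma> v, map_source \<sigma> ` A))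
    (side_splittings m n V f) (side_splittings m n V (relabel \<sigma> f))"
proof (rule bij_betw_subset[OF splittings_relabel[OF \<sigma>, of n f]])
  let ?\<psi> = "\<lambda>(v, A). (\<sigma> v, map_source \<sigma> ` A)"
  have inj: "inj (map_source \<sigma>)" by (rule bij_is_inj[OF bij_map_source[OF \<sigma>]])
  have iff: "?\<psi> Q \<in> side_splittings m n V (relabel \<sigma> f) \<longleftrightarrow> Q \<in> side_splittings m n V f"
    if "Q \<in> splittings n V f" for Q
  proof -
    have "map_source \<sigma> ` A \<inter> map_source \<sigma> ` spine m n V f = {} \<longleftrightarrow> A \<inter> spine m n V f = {}" for A
      by (simp flip: image_Int[OF inj])
    moreover have "?\<psi> Q \<in> splittings n V (relabel \<sigma> f)"
      using bij_betw_apply[OF splittings_relabel[OF \<sigma>] that] .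
    ultimately show ?thesis using that
      by (auto simp: side_splittings_def spine_relabel[OF \<sigma>] case_prod_unfold)
  qed
  show "side_splittings m n V f \<subseteq> splittings n V f" by (auto simp: side_splittings_def)
  show "?\<psi> ` side_splittings m n V f = side_splittings m n V (relabel \<sigma> f)"
  proof (intro set_eqI iffI)
    fix R assume R: "R \<in> side_splittings m n V (relabel \<sigma> f)"
    then have "R \<in> splittings n V (relabel \<sigma> f)" by (auto simp: side_splittings_def)
    then obtain Q where "Q \<in> splittings n V f" "R = ?\<psi> Q"
      using bij_betw_imp_surj_on[OF splittings_relabel[OF \<sigma>, of n f]] by blast
    then show "R \<in> ?\<psi> ` side_splittings m n V f" using iff R by blast
  next
    fix R assume "R \<in> ?\<psi> ` side_splittings m n V f"
    then obtain Q where "Q \<in> side_splittings m n V f" "R = ?\<psi> Q" by blast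
    moreover then have "Q \<in> splittings n V f" by (auto simp: side_splittings_def)
    ultimately show "R \<in> side_splittings m n V (relabel \<sigma> f)" using iff by blast
  qed
qed

lemma contract_side_splittings:
  assumes f: "is_parent m n (Suc V) f" and w: "w \<in> contractible m n (Suc V) f"
    and full: "Q \<in> full_splittings m n V (contract V f w)"
    and eq: "split_at V (contract V f w) (fst Q) (snd Q) = relabel (transpose w V) f"
    and c: "is_parent m n V (contract V f w)"
  shows "cong_mod (C m n)
    (\<Sum>(u, B)\<in>side_splittings m n (Suc V) f.
       pgen n (Suc V) (contract (Suc V) (split_at (Suc V) f u B) w))
    (fscale (fsign (transpose w V)) (\<Sum>(u, B)\<in>side_splittings m n V (contract V f w) - {Q}.
       pgen n (Suc V) (split_at V (contract V f w) u B)) :: dgraph \<Rightarrow>\<^sub>0 'k::field)"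
proof -
  let ?\<tau> = "transpose w V" and ?c = "contract V f w" and ?v = "fst Q" and ?V = "Suc V"
  have wV: "w < ?V" using w by (simp add: contractible_def)
  then have \<tau>: "?\<tau> permutes {..<?V}" by (auto intro!: permutes_swap_id)
  have \<tau>': "?\<tau> permutes {..<Suc ?V}" by (rule permutes_subset[OF \<tau>]) auto
  have wV': "w \<noteq> ?V" "V \<noteq> ?V" using wV by auto
  let ?g = "relabel ?\<tau> f"
  have Q: "(fst Q, snd Q) \<in> full_splittings m n V ?c" using full by simp
  have fg: "f = relabel ?\<tau> ?g" by (simp add: relabel_relabel[OF \<tau> \<tau>])
  let ?\<phi> = "\<lambda>(u, B). (if u = ?v then V else u, B)" and ?\<psi> = "\<lambda>(u, B). (?\<tau> u, map_source ?\<tau> ` B)"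
  have b1: "bij_betw ?\<phi> (side_splittings m n V ?c - {Q}) (side_splittings m n ?V ?g)"
    using side_splittings_contract(1)[OF c Q] by (simp add: eq)
  have b2: "bij_betw ?\<psi> (side_splittings m n ?V ?g) (side_splittings m n ?V f)"
    using side_splittings_relabel[OF \<tau>, of m n ?g] by (simp flip: fg)
  let ?t = "\<lambda>(u, B). pgen n ?V (contract ?V (split_at ?V f u B) w) :: dgraph \<Rightarrow>\<^sub>0 'k"
  have reindex: "(\<Sum>R\<in>side_splittings m n ?V f. ?t R) =
      (\<Sum>R\<in>side_splittings m n V ?c - {Q}. ?t (?\<psi> (?\<phi> R)))"
    using sum.reindex_bij_betw[OF bij_betw_trans[OF b1 b2], of ?t] by (simp add: comp_def)
  have "cong_mod (C m n) (\<Sum>R\<in>side_splittings m n V ?c - {Q}. ?t (?\<psi> (?\<phi> R)))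
      (\<Sum>R\<in>side_splittings m n V ?c - {Q}. fscale (fsign ?\<tau>) (pgen n ?V (split_at V ?c (fst R) (snd R))))"
  proof (rule cong_mod_sum[OF subspace_coinv_rels])
    fix R assume R: "R \<in> side_splittings m n V ?c - {Q}"
    obtain u B where uB: "R = (u, B)" by (cases R)
    have B: "(u, B) \<in> splittings n V ?c" using R uB by (auto simp: side_splittings_def)
    let ?u = "if u = ?v then V else u"
    have val: "contract ?V (split_at ?V ?g ?u B) V = split_at V ?c u B"
      using side_splittings_contract(2)[OF c Q, of u B] R uB by (simp add: eq)
    have split: "split_at ?V f (?\<tau> ?u) (map_source ?\<tau> ` B) = relabel ?\<tau> (split_at ?V ?g ?u B)"
      using relabel_split[OF \<tau>, of ?g ?u B] by (simp flip: fg)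
    obtain \<kappa> where \<kappa>: "\<kappa> permutes {..<?V}"
      "contract ?V (relabel ?\<tau> (split_at ?V ?g ?u B)) (?\<tau> V) = relabel \<kappa> (contract ?V (split_at ?V ?g ?u B) V)"
      "(fsign \<kappa> :: 'k) = fsign (transpose (?\<tau> V) ?V) * fsign ?\<tau> * fsign (transpose V ?V)"
      by (rule contract_relabel[OF \<tau>', of V "split_at ?V ?g ?u B"]) auto
    have sg: "(fsign \<kappa> :: 'k) = fsign ?\<tau>" using wV' \<kappa>(3) by (simp add: sign_swap_id)
    have "?t (?\<psi> (?\<phi> R)) = pgen n ?V (relabel \<kappa> (split_at V ?c u B))"
      using \<kappa>(2) by (simp add: uB split val)
    also have "cong_mod (C m n) \<dots> (fscale (fsign \<kappa>) (pgen n ?V (split_at V ?c u B)))"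
      by (rule cong_relabel[OF is_parent_split[OF c B] \<kappa>(1)])
    finally show "cong_mod (C m n) (?t (?\<psi> (?\<phi> R)))
        (fscale (fsign ?\<tau>) (pgen n ?V (split_at V ?c (fst R) (snd R))))"
      by (simp add: sg uB)
  qed
  then show ?thesis
    unfolding fvs.scale_sum_right reindex[symmetric] by (simp only: case_prod_unfold)
qed

text \<open>
  Splittings that move a spine input enlarge the spine and vanish in the associated graded.
\<close>

lemma sum_splittings_mod_spine:
  assumes f: "is_parent m n V f"
    and F: "\<And>v A. (v, A) \<in> splittings n V f \<Longrightarrow> A \<inter> spine m n V f \<noteq> {} \<Longrightarrow> F (v, A) \<in> mod_spine m n d p"
  shows "cong_mod (mod_spine m n d p) (\<Sum>Q\<in>splittings n V f. F Q) (\<Sum>Q\<in>side_splittings m n V f. F Q)"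
proof -
  have "(\<Sum>Q\<in>splittings n V f. F Q) - (\<Sum>Q\<in>side_splittings m n V f. F Q) =
      (\<Sum>Q\<in>splittings n V f - side_splittings m n V f. F Q)"
    by (rule sum_diff[symmetric]) (auto simp: side_splittings_def)
  also have "\<dots> \<in> mod_spine m n d p"
    by (rule fvs.subspace_sum[OF subspace_mod_spine]) (use F in \<open>auto simp: side_splittings_def\<close>)
  finally show ?thesis by (simp add: cong_mod_def)
qed

text \<open>
  Contracting the new vertex gives back the graph. The old contractible vertices occur with the
  opposite sign, since they have to move past the new vertex.
\<close>

lemma contract_sum_split:
  assumes f: "is_parent m n V f" and Q: "(v, A) \<in> side_splittings m n V f"
  shows "(contract_sum m n V (split_at V f v A) :: dgraph \<Rightarrow>\<^sub>0 'k::field) =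
    (if (v, A) \<in> full_splittings m n V f then pgen n V f else 0) -
    (\<Sum>w\<in>contractible m n V f. pgen n V (contract V (split_at V f v A) w))"
proof -
  let ?f' = "split_at V f v A" and ?K = "contractible m n V f"
  have A: "(v, A) \<in> splittings n V f" and side: "A \<inter> spine m n V f = {}"
    using Q by (auto simp: side_splittings_def)
  let ?t = "\<lambda>w. fscale (fsign (transpose w V)) (pgen n V (contract V ?f' w)) :: dgraph \<Rightarrow>\<^sub>0 'k"
  have V: "V \<notin> ?K" by (simp add: contractible_def)
  have "?t V = pgen n V f"
    using merge_last_split[OF f A] by (simp add: contract_def flip: id_def)
  moreover have "(\<Sum>w\<in>?K. ?t w) = - (\<Sum>w\<in>?K. pgen n V (contract V ?f' w))"
    unfolding sum_negf[symmetric] by (rule sum.cong) (use V in \<open>auto simp: sign_swap_id\<close>)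
  ultimately show ?thesis
    using V unfolding contract_sum_def contractible_split[OF f A side] by simp
qed

text \<open>
  Splitting and then contracting an old vertex cancels against contracting and then splitting. What
  remains is the graph itself, once for each full splitting and once for each contractible vertex,
  and these are \<open>card (unfinished m n V f)\<close> many, the number divided out in the
  homotopy.
\<close>

lemma homotopy_identity:
  assumes f: "is_parent m n V f" and unf: "unfinished m n V f \<noteq> {}"
  defines "p \<equiv> card (spine m n V f)"
  shows "cong_mod (mod_spine m n (int V) (Suc p))
    (lie_inf_diff (homotopy m n (pgen n V f)) + homotopy m n (lie_inf_diff (pgen n V f)))
    (pgen n V f :: dgraph \<Rightarrow>\<^sub>0 'k::field_char_0)"
proof -
  obtain V0 where V: "V = Suc V0" using unf by (cases V) (auto simp: unfinished_def)
  let ?M = "mod_spine m n (int V) (Suc p) :: (dgraph \<Rightarrow>\<^sub>0 'k) set"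
  let ?K = "contractible m n V f" and ?\<beta> = "of_nat (card (unfinished m n V f)) :: 'k"
  let ?e = "\<lambda>w. fsign (transpose w V0) :: 'k" and ?c = "\<lambda>w. contract V0 f w"
  have f': "is_parent m n (Suc V0) f" using f V by simp
  have \<beta>: "?\<beta> \<noteq> 0" using unf by (simp add: card_eq_0_iff)
  have "\<forall>w\<in>?K. \<exists>Q. is_parent m n V0 (?c w) \<and> Q \<in> full_splittings m n V0 (?c w) \<and>
      split_at V0 (?c w) (fst Q) (snd Q) = relabel (transpose w V0) f \<and>
      card (spine m n V0 (?c w)) = p"
  proof
    fix w assume "w \<in> ?K"
    then have "w \<in> contractible m n (Suc V0) f" using V by simp
    from contract_facts[OF f' this] show "\<exists>Q. is_parent m n V0 (?c w) \<and> Q \<in> full_splittings m n V0 (?c w) \<and>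
      split_at V0 (?c w) (fst Q) (snd Q) = relabel (transpose w V0) f \<and>
      card (spine m n V0 (?c w)) = p" unfolding p_def V by (metis fst_conv snd_conv)
  qed
  then obtain Q where "\<forall>w\<in>?K. is_parent m n V0 (?c w) \<and> Q w \<in> full_splittings m n V0 (?c w) \<and>
      split_at V0 (?c w) (fst (Q w)) (snd (Q w)) = relabel (transpose w V0) f \<and>
      card (spine m n V0 (?c w)) = p"
    by (metis (no_types, lifting))
  then have c: "\<And>w. w \<in> ?K \<Longrightarrow> is_parent m n V0 (?c w)"
    and full: "\<And>w. w \<in> ?K \<Longrightarrow> Q w \<in> full_splittings m n V0 (?c w)"
    and eq: "\<And>w. w \<in> ?K \<Longrightarrow> split_at V0 (?c w) (fst (Q w)) (snd (Q w)) = relabel (transpose w V0) f"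
    and cp: "\<And>w. w \<in> ?K \<Longrightarrow> card (spine m n V0 (?c w)) = p"
    by auto
  let ?R = "\<lambda>w. (\<Sum>(u, B)\<in>side_splittings m n V0 (?c w) - {Q w}. pgen n V (split_at V0 (?c w) u B)) :: dgraph \<Rightarrow>\<^sub>0 'k"
  have split_c: "cong_mod ?M (split_sum n V0 (?c w)) (fscale (?e w) (pgen n V f) + ?R w)" if w: "w \<in> ?K" for w
  proof -
    let ?t = "\<lambda>(u, B). pgen n V (split_at V0 (?c w) u B) :: dgraph \<Rightarrow>\<^sub>0 'k"
    have wV: "w < Suc V0" using w V by (simp add: contractible_def)
    then have \<tau>: "transpose w V0 permutes {..<V}" unfolding V by (auto intro!: permutes_swap_id)
    have "split_sum n V0 (?c w) = (\<Sum>Q\<in>splittings n V0 (?c w). ?t Q)" by (simp add: split_sum_def V)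
    also have "cong_mod ?M \<dots> (\<Sum>Q\<in>side_splittings m n V0 (?c w). ?t Q)"
    proof (rule sum_splittings_mod_spine[OF c[OF w]])
      fix v A assume A: "(v, A) \<in> splittings n V0 (?c w)" "A \<inter> spine m n V0 (?c w) \<noteq> {}"
      have "graph_of n V (split_at V0 (?c w) v A) \<in> spine_filtration m n (int V) (Suc p)"
        using is_parent_split[OF c[OF w] A(1)] card_spine_split[OF c[OF w] A(1)] A(2) cp[OF w]
        by (auto simp: spine_filtration_def V)
      then show "?t (v, A) \<in> ?M" by (simp add: filtration_subset_mod_spine)
    qed
    also have "(\<Sum>Q\<in>side_splittings m n V0 (?c w). ?t Q) = ?t (Q w) + ?R w"
      using subsetD[OF full_side_splittings full[OF w]] by (intro sum.remove) simp_all
    also have "?t (Q w) = pgen n V (relabel (transpose w V0) f)"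
      using eq[OF w] by (simp add: case_prod_unfold)
    also have "cong_mod ?M (pgen n V (relabel (transpose w V0) f) + ?R w) (fscale (?e w) (pgen n V f) + ?R w)"
      by (intro cong_mod_add subspace_mod_spine cong_C_mod_spine cong_relabel f \<tau>
          cong_mod_refl[OF subspace_mod_spine])
    finally show ?thesis .
  qed
  have "lie_inf_diff (homotopy m n (pgen n V f)) = fscale ((-1) ^ V / ?\<beta>)
      (\<Sum>w\<in>?K. fscale (?e w) (lie_inf_diff (pgen n V0 (?c w))))"
    unfolding V
    by (simp add: homotopy_pgen[OF f'] contract_sum_def lie_inf_diff.scale lie_inf_diff.sum del: power_Suc)
  also have "cong_mod ?M \<dots> (fscale ((-1) ^ V / ?\<beta>)
      (\<Sum>w\<in>?K. fscale (?e w) (fscale ((-1) ^ V) (fscale (?e w) (pgen n V f) + ?R w))))"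
  proof (intro cong_mod_scale cong_mod_sum subspace_mod_spine)
    fix w assume w: "w \<in> ?K"
    have "cong_mod ?M (lie_inf_diff (pgen n V0 (?c w))) (fscale ((-1) ^ V) (split_sum n V0 (?c w)))"
      using diff_pgen_cong[OF c[OF w]] unfolding V by (intro cong_C_mod_spine) simp
    also have "cong_mod ?M \<dots> (fscale ((-1) ^ V) (fscale (?e w) (pgen n V f) + ?R w))"
      by (intro cong_mod_scale subspace_mod_spine split_c w)
    finally show "cong_mod ?M (lie_inf_diff (pgen n V0 (?c w)))
      (fscale ((-1) ^ V) (fscale (?e w) (pgen n V f) + ?R w))" .
  qed
  also have "\<dots> = fscale (1 / ?\<beta>) (\<Sum>w\<in>?K. pgen n V f + fscale (?e w) (?R w))"
    by (simp add: fvs.scale_sum_right fvs.scale_right_distrib mult.assoc mult.left_commute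
        flip: power_mult_distrib)
  finally have dh: "cong_mod ?M (lie_inf_diff (homotopy m n (pgen n V f)))
      (fscale (1 / ?\<beta>) (\<Sum>w\<in>?K. pgen n V f + fscale (?e w) (?R w)))" .

  let ?S = "side_splittings m n V f"
  let ?h = "\<lambda>(v, A). homotopy m n (pgen n (Suc V) (split_at V f v A)) :: dgraph \<Rightarrow>\<^sub>0 'k"
  have "cong_mod (C m n) (lie_inf_diff (pgen n V f)) (fscale ((-1) ^ Suc V) (split_sum n V f) :: dgraph \<Rightarrow>\<^sub>0 'k)"
    using diff_pgen_cong[OF f] by simp
  then have "cong_mod (C m n) (homotopy m n (lie_inf_diff (pgen n V f)))
      (homotopy m n (fscale ((-1) ^ Suc V) (split_sum n V f)) :: dgraph \<Rightarrow>\<^sub>0 'k)"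
    unfolding cong_mod_def homotopy.diff[symmetric] by (rule homotopy_in_C)
  then have "cong_mod ?M (homotopy m n (lie_inf_diff (pgen n V f)))
      (homotopy m n (fscale ((-1) ^ Suc V) (split_sum n V f)))"
    by (rule cong_C_mod_spine)
  also have "\<dots> = fscale ((-1) ^ Suc V) (\<Sum>Q\<in>splittings n V f. ?h Q)"
    unfolding split_sum_def homotopy.scale homotopy.sum by (simp add: case_prod_unfold)
  also have "cong_mod ?M \<dots> (fscale ((-1) ^ Suc V) (\<Sum>Q\<in>?S. ?h Q))"
  proof (intro cong_mod_scale subspace_mod_spine sum_splittings_mod_spine[OF f])
    fix v A assume A: "(v, A) \<in> splittings n V f" "A \<inter> spine m n V f \<noteq> {}"
    have "graph_of n (Suc V) (split_at V f v A) \<in> spine_filtration m n (int V + 1) (Suc p)"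
      using is_parent_split[OF f A(1)] card_spine_split[OF f A(1)] A(2)
      by (auto simp: spine_filtration_def p_def)
    then have "?h (v, A) \<in> graph_span (spine_filtration m n (int V + 1 - 1) (Suc p))"
      by (simp only: prod.case) (rule homotopy_filtration, simp)
    then show "?h (v, A) \<in> ?M" by (intro filtration_subset_mod_spine) simp
  qed
  also have "(\<Sum>Q\<in>?S. ?h Q) = (\<Sum>(v, A)\<in>?S. fscale ((-1) ^ Suc V / ?\<beta>) (contract_sum m n V (split_at V f v A)))"
  proof (rule sum.cong[OF refl], clarify)
    fix v A assume "(v, A) \<in> ?S"
    then have A: "(v, A) \<in> splittings n V f" "A \<inter> spine m n V f = {}" by (auto simp: side_splittings_def)
    show "homotopy m n (pgen n (Suc V) (split_at V f v A)) =
        fscale ((-1) ^ Suc V / ?\<beta>) (contract_sum m n V (split_at V f v A))"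
      using homotopy_pgen[OF is_parent_split[OF f A(1)]] by (simp add: unfinished_split[OF f A])
  qed
  also have "fscale ((-1) ^ Suc V) \<dots> = fscale (1 / ?\<beta>) (\<Sum>(v, A)\<in>?S. contract_sum m n V (split_at V f v A))"
    by (simp add: fvs.scale_sum_right case_prod_unfold flip: power_mult_distrib)
  also have "(\<Sum>(v, A)\<in>?S. contract_sum m n V (split_at V f v A)) =
      (\<Sum>Q\<in>?S. if Q \<in> full_splittings m n V f then pgen n V f else 0) -
      (\<Sum>(v, A)\<in>?S. \<Sum>w\<in>?K. pgen n V (contract V (split_at V f v A) w))"
    unfolding sum_subtractf[symmetric] by (rule sum.cong) (auto simp: contract_sum_split[OF f])
  also have "(\<Sum>Q\<in>?S. if Q \<in> full_splittings m n V f then pgen n V f else 0) =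
      (\<Sum>Q\<in>full_splittings m n V f. pgen n V f)"
    using full_side_splittings[of m n V f] by (subst sum.inter_restrict[symmetric]) (auto simp: Int_absorb1)
  also have "(\<Sum>(v, A)\<in>?S. \<Sum>w\<in>?K. pgen n V (contract V (split_at V f v A) w)) =
      (\<Sum>w\<in>?K. \<Sum>(v, A)\<in>?S. pgen n V (contract V (split_at V f v A) w))"
    unfolding case_prod_unfold by (rule sum.swap)
  also have "cong_mod ?M (fscale (1 / ?\<beta>) ((\<Sum>Q\<in>full_splittings m n V f. pgen n V f) -
        (\<Sum>w\<in>?K. \<Sum>(v, A)\<in>?S. pgen n V (contract V (split_at V f v A) w))))
      (fscale (1 / ?\<beta>) ((\<Sum>Q\<in>full_splittings m n V f. pgen n V f) - (\<Sum>w\<in>?K. fscale (?e w) (?R w))))"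
  proof (intro cong_mod_scale cong_mod_diff cong_mod_sum subspace_mod_spine cong_mod_refl[OF subspace_mod_spine] cong_C_mod_spine)
    fix w assume w: "w \<in> ?K"
    show "cong_mod (C m n) (\<Sum>(v, A)\<in>?S. pgen n V (contract V (split_at V f v A) w)) (fscale (?e w) (?R w))"
      using contract_side_splittings[OF f' _ full[OF w] eq[OF w] c[OF w]] w unfolding V by simp
  qed
  finally have hd: "cong_mod ?M (homotopy m n (lie_inf_diff (pgen n V f)))
    (fscale (1 / ?\<beta>) ((\<Sum>Q\<in>full_splittings m n V f. pgen n V f) - (\<Sum>w\<in>?K. fscale (?e w) (?R w))))" .
  have const: "(\<Sum>i\<in>I. x) = fscale (of_nat (card I)) x" for I :: "'i set" and x :: "dgraph \<Rightarrow>\<^sub>0 'k"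
    by (induction I rule: infinite_finite_induct) (simp_all add: fvs.scale_left_distrib)
  have "fscale (1 / ?\<beta>) (\<Sum>w\<in>?K. pgen n V f + fscale (?e w) (?R w)) +
      fscale (1 / ?\<beta>) ((\<Sum>Q\<in>full_splittings m n V f. pgen n V f) - (\<Sum>w\<in>?K. fscale (?e w) (?R w))) =
      fscale (1 / ?\<beta>) ((\<Sum>w\<in>?K. pgen n V f) + (\<Sum>Q\<in>full_splittings m n V f. pgen n V f))"
    by (simp add: fvs.scale_right_distrib[symmetric] sum.distrib)
  also have "\<dots> = fscale (1 / ?\<beta> * ?\<beta>) (pgen n V f)"
    unfolding const card_unfinished[OF f] by (simp add: fvs.scale_left_distrib[symmetric] add.commute)
  also have "\<dots> = pgen n V f" using \<beta> by simp
  finally show ?thesis using cong_mod_add[OF subspace_mod_spine dh hd] by simp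
qed

section \<open>Acyclicity below the top degree\<close>

text \<open>
  The two ways to count the edges: by their sources and by their targets.
\<close>

lemma sum_card_inputs:
  assumes f: "is_parent m n V f"
  shows "(\<Sum>v<V. card (inputs n V f v)) + m = n + V"
proof -
  let ?S = "sources n V"
  let ?O = "\<lambda>j. {s \<in> ?S. f s = OutLeg j}"
  have eq: "?S = (\<Union>v<V. inputs n V f v) \<union> (\<Union>j<m. ?O j)"
    using f by (auto simp: is_parent_def inputs_def)
  have "card (?O j) = 1" if j: "j < m" for j
  proof -
    obtain s where s: "s \<in> ?S" "f s = OutLeg j"
      and un: "\<And>s'. s' \<in> ?S \<Longrightarrow> f s' = OutLeg j \<Longrightarrow> s' = s"
      using is_parent_OutLegE[OF f j] by blast
    have "?O j = {s}" using s by (intro equalityI subsetI) (blast dest: un, simp)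
    then show ?thesis by simp
  qed
  then have "card (\<Union>j<m. ?O j) = m"
    by (subst card_UN_disjoint) (auto simp: finite_sources)
  moreover have "card (\<Union>v<V. inputs n V f v) = (\<Sum>v<V. card (inputs n V f v))"
    by (rule card_UN_disjoint) (auto simp: inputs_def)
  moreover have "card ?S = card (\<Union>v<V. inputs n V f v) + card (\<Union>j<m. ?O j)"
    by (subst eq, rule card_Un_disjoint) (auto simp: inputs_def)
  ultimately show ?thesis by (simp add: card_sources)
qed

lemma binary_iff_top_degree:
  assumes f: "is_parent m n V f"
  shows "(\<forall>v<V. card (inputs n V f v) = 2) \<longleftrightarrow> int V = int n - int m"
proof
  assume "\<forall>v<V. card (inputs n V f v) = 2"
  then have "(\<Sum>v<V. card (inputs n V f v)) = 2 * V" by simp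
  then show "int V = int n - int m" using sum_card_inputs[OF f] by linarith
next
  assume V: "int V = int n - int m"
  have ge: "2 \<le> card (inputs n V f v)" if "v < V" for v using f that by (simp add: is_parent_def)
  have "(\<Sum>v<V. card (inputs n V f v)) = (\<Sum>v<V. 2)"
    using sum_card_inputs[OF f] V by simp
  then have "(\<Sum>v<V. card (inputs n V f v) - 2) = 0"
    using ge by (subst sum_subtractf_nat) auto
  then show "\<forall>v<V. card (inputs n V f v) = 2"
    using ge by (auto simp: le_antisym)
qed

lemma homotopy_cong: "cong_mod (C m n) x y \<Longrightarrow> cong_mod (C m n) (homotopy m n x) (homotopy m n y)"
  using homotopy_in_C[of "x - y" m n] by (simp add: cong_mod_def homotopy.diff)

lemma mod_spine_mono:
  assumes "p \<le> q" shows "mod_spine m n d q \<subseteq> mod_spine m n d p"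
proof -
  have "spine_filtration m n d q \<subseteq> spine_filtration m n d p"
    using assms by (auto simp: spine_filtration_def)
  then show ?thesis using graph_span_mono unfolding mod_spine_def by blast
qed

lemma homotopy_identity_filtration:
  assumes d: "d \<noteq> int n - int m" and x: "x \<in> graph_span (spine_filtration m n d p)"
  shows "cong_mod (mod_spine m n d (Suc p))
    (lie_inf_diff (homotopy m n x) + homotopy m n (lie_inf_diff x)) (x :: dgraph \<Rightarrow>\<^sub>0 'k::field_char_0)"
  using x
proof (induction rule: graph_span_induct)
  case subspace
  let ?T = "\<lambda>x :: dgraph \<Rightarrow>\<^sub>0 'k. lie_inf_diff (homotopy m n x) + homotopy m n (lie_inf_diff x) - x"
  have T: "?T 0 = 0" "?T (x + y) = ?T x + ?T y" "?T (fscale c x) = fscale c (?T x)" for x y c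
    by (simp_all add: homotopy.zero lie_inf_diff.zero homotopy.add lie_inf_diff.add homotopy.scale
        lie_inf_diff.scale fvs.scale_right_distrib fvs.scale_right_diff_distrib)
  show ?case
    unfolding fvs.subspace_def cong_mod_def mem_Collect_eq T
    by (simp only: Ball_def mem_Collect_eq T)
       (blast intro: fvs.subspace_0[OF subspace_mod_spine] fvs.subspace_add[OF subspace_mod_spine]
          fvs.subspace_scale[OF subspace_mod_spine])
next
  case (base G)
  let ?f = "parent n G" and ?V = "nverts G"
  have G: "G \<in> W m n" "d = int ?V" "p \<le> card (spine m n ?V ?f)"
    using base by (auto simp: spine_filtration_def)
  note f = W_encodes(2)[OF G(1)]
  have "unfinished m n ?V ?f \<noteq> {}"
    using binary_if_finished[OF f] binary_iff_top_degree[OF f] d G(2) by blast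
  from homotopy_identity[OF f this]
  have id: "cong_mod (mod_spine m n d (Suc p))
      (lie_inf_diff (homotopy m n (pgen n ?V ?f)) + homotopy m n (lie_inf_diff (pgen n ?V ?f)))
      (pgen n ?V ?f :: dgraph \<Rightarrow>\<^sub>0 'k)"
    using mod_spine_mono[of "Suc p" "Suc (card (spine m n ?V ?f))" m n d] G(2,3)
    by (auto simp: cong_mod_def)
  have G': "cong_mod (C m n) (fgen G) (pgen n ?V ?f :: dgraph \<Rightarrow>\<^sub>0 'k)"
    by (rule cong_pgen_parent[OF G(1)])
  have "cong_mod (C m n) (lie_inf_diff (homotopy m n (fgen G)) + homotopy m n (lie_inf_diff (fgen G)))
      (lie_inf_diff (homotopy m n (pgen n ?V ?f)) + homotopy m n (lie_inf_diff (pgen n ?V ?f)) :: dgraph \<Rightarrow>\<^sub>0 'k)"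
    by (intro cong_mod_add subspace_coinv_rels diff_cong homotopy_cong G')
  note 1 = cong_C_mod_spine[OF this, of d "Suc p"]
  have 2: "cong_mod (mod_spine m n d (Suc p)) (pgen n ?V ?f) (fgen G :: dgraph \<Rightarrow>\<^sub>0 'k)"
    by (rule cong_C_mod_spine[OF cong_mod_sym[OF subspace_coinv_rels G']])
  show ?case by (rule cong_mod_spine_trans[OF cong_mod_spine_trans[OF 1 id] 2])
qed

abbreviation graphs_deg :: "nat \<Rightarrow> nat \<Rightarrow> int \<Rightarrow> dgraph set" where
  "graphs_deg m n d \<equiv> {G \<in> W m n. int (nverts G) = d}"

text \<open>
  The homotopy corrects a cocycle to one with a larger spine, and the size of the spine is bounded
  by the number of edges.
\<close>

lemma acyclic_below_top:
  assumes d: "d \<noteq> int n - int m"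
    and x: "x \<in> graph_span (graphs_deg m n d)" and cocycle: "lie_inf_diff x \<in> C m n"
  obtains y where "y \<in> graph_span (graphs_deg m n (d - 1))"
    "cong_mod (C m n) x (lie_inf_diff y :: dgraph \<Rightarrow>\<^sub>0 'k::field_char_0)"
proof -
  \<comment> \<open>induction on the gap \<open>k\<close> between \<open>p\<close> and the bound for the size of the spine\<close>
  have claim: "\<exists>y\<in>graph_span (graphs_deg m n (d - 1)). cong_mod (C m n) x (lie_inf_diff y)"
    if "n + nat d < p + k" "x \<in> graph_span (spine_filtration m n d p)" "lie_inf_diff x \<in> C m n"
    for k p and x :: "dgraph \<Rightarrow>\<^sub>0 'k"
    using that
  proof (induction k arbitrary: p x)
    case 0
    have "card (spine m n (nverts G) (parent n G)) \<le> n + nverts G" for G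
      using card_mono[OF finite_sources, of "spine m n (nverts G) (parent n G)" n "nverts G"]
      by (auto simp: card_sources spine_def)
    then have "G \<notin> spine_filtration m n d p" for G
      using 0(1) le_trans[of p "card (spine m n (nverts G) (parent n G))" "n + nverts G"]
      by (auto simp: spine_filtration_def)
    then have "spine_filtration m n d p = {}" by blast
    then have "x = 0" using 0(2) by (simp add: graph_span_def)
    then show ?case
      by (intro bexI[of _ 0]) (simp_all add: lie_inf_diff.zero fvs.subspace_0[OF subspace_graph_span])
  next
    case (Suc k)
    let ?h = "homotopy m n"
    have hx: "?h x \<in> graph_span (graphs_deg m n (d - 1))"
      using homotopy_filtration[OF Suc.prems(2)]
        graph_span_mono[of "spine_filtration m n (d - 1) p" "graphs_deg m n (d - 1)"]
      by (auto simp: spine_filtration_def)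
    have "lie_inf_diff (?h x) + ?h (lie_inf_diff x) - x \<in> mod_spine m n d (Suc p)"
      using homotopy_identity_filtration[OF d Suc.prems(2)] by (simp add: cong_mod_def)
    then obtain c e where ce: "lie_inf_diff (?h x) + ?h (lie_inf_diff x) - x = c + e"
      and c: "c \<in> C m n" and e: "e \<in> graph_span (spine_filtration m n d (Suc p))"
      unfolding mod_spine_def by blast
    have hd: "?h (lie_inf_diff x) \<in> C m n" by (rule homotopy_in_C[OF Suc.prems(3)])
    have e_eq: "e = lie_inf_diff (?h x) - x + (?h (lie_inf_diff x) - c)"
      using ce by (simp add: algebra_simps)
    have hdc: "?h (lie_inf_diff x) - c \<in> C m n"
      by (rule fvs.subspace_diff[OF subspace_coinv_rels hd c])
    have "?h x \<in> graph_span (W m n)" using hx graph_span_mono[of "graphs_deg m n (d - 1)" "W m n"] by auto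
    then have "lie_inf_diff e \<in> C m n"
      unfolding e_eq lie_inf_diff.add lie_inf_diff.diff
      by (intro fvs.subspace_add[OF subspace_coinv_rels] fvs.subspace_diff[OF subspace_coinv_rels]
          diff_diff Suc.prems(3) diff_in_C[OF hdc, unfolded lie_inf_diff.diff])
    then obtain y where y: "y \<in> graph_span (graphs_deg m n (d - 1))" "cong_mod (C m n) e (lie_inf_diff y)"
      using Suc.IH[OF _ e] Suc.prems(1) by auto
    have "cong_mod (C m n) x (lie_inf_diff (?h x - y))"
    proof -
      have "x - lie_inf_diff (?h x - y) = (?h (lie_inf_diff x) - c) - (e - lie_inf_diff y)"
        by (simp add: e_eq lie_inf_diff.diff)
      also have "\<dots> \<in> C m n"
        by (rule fvs.subspace_diff[OF subspace_coinv_rels hdc y(2)[unfolded cong_mod_def]])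
      finally show ?thesis by (simp add: cong_mod_def)
    qed
    moreover have "?h x - y \<in> graph_span (graphs_deg m n (d - 1))"
      by (rule fvs.subspace_diff[OF subspace_graph_span hx y(1)])
    ultimately show ?case by blast
  qed
  have "spine_filtration m n d 0 = graphs_deg m n d" by (auto simp: spine_filtration_def)
  then have "\<exists>y\<in>graph_span (graphs_deg m n (d - 1)). cong_mod (C m n) x (lie_inf_diff y)"
    using claim[of 0 "Suc (n + nat d)" x] x cocycle by simp
  then show thesis using that by blast
qed

section \<open>Operations on graphs that commute with the differential\<close>

lemma coinv_rels_subset: "coinv_rels S \<subseteq> graph_span S"
  unfolding coinv_rels_def
  by (rule fvs.span_minimal[OF _ subspace_graph_span])
     (auto intro!: fvs.subspace_diff fvs.subspace_scale subspace_graph_span)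

text \<open>
  Binary vertices cannot be split, hence a graph with additional binary vertices has the same
  splittings.
\<close>

lemma splittings_transfer:
  assumes \<nu>: "inj_on \<nu> {..<V}" "\<And>v. v < V \<Longrightarrow> \<nu> v < V'"
    and \<iota>: "inj_on \<iota> (\<Union>v<V. inputs n V f v)"
    and inputs: "\<And>v. v < V \<Longrightarrow> inputs n' V' f' (\<nu> v) = \<iota> ` inputs n V f v"
    and other: "\<And>u. u < V' \<Longrightarrow> u \<notin> \<nu> ` {..<V} \<Longrightarrow> card (inputs n' V' f' u) = 2"
  shows "bij_betw (\<lambda>(v, A). (\<nu> v, \<iota> ` A)) (splittings n V f) (splittings n' V' f')"
proof (rule bij_betw_imageI)
  let ?\<phi> = "\<lambda>(v, A). (\<nu> v, \<iota> ` A)"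
  let ?U = "\<Union>v<V. inputs n V f v"
  have sub: "A \<subseteq> ?U" "v < V" if "(v, A) \<in> splittings n V f" for v A
    using that by (auto simp: splittings_def)
  show "inj_on ?\<phi> (splittings n V f)"
  proof (rule inj_onI, clarify)
    fix v A u B
    assume vA: "(v, A) \<in> splittings n V f" and uB: "(u, B) \<in> splittings n V f"
      and eq: "\<nu> v = \<nu> u" "\<iota> ` A = \<iota> ` B"
    show "v = u \<and> A = B"
      using inj_onD[OF \<nu>(1) eq(1)] inj_on_image_eq_iff[OF \<iota> sub(1)[OF vA] sub(1)[OF uB]]
        sub(2)[OF vA] sub(2)[OF uB] eq(2) by simp
  qed
  have into: "(\<nu> v, \<iota> ` A) \<in> splittings n' V' f' \<longleftrightarrow> (v, A) \<in> splittings n V f"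
    if "v < V" "A \<subseteq> inputs n V f v" for v A
  proof -
    have iU: "inputs n V f v \<subseteq> ?U" using that by auto
    have "card (\<iota> ` A) = card A"
      by (rule card_image[OF inj_on_subset[OF \<iota>]]) (use that iU in auto)
    moreover have "\<iota> ` A = \<iota> ` inputs n V f v \<longleftrightarrow> A = inputs n V f v"
      by (rule inj_on_image_eq_iff[OF \<iota>]) (use that iU in auto)
    ultimately show ?thesis using that \<nu>(2) by (auto simp: splittings_def inputs)
  qed
  show "?\<phi> ` splittings n V f = splittings n' V' f'"
  proof (intro set_eqI iffI)
    fix R assume "R \<in> ?\<phi> ` splittings n V f"
    then obtain v A where "R = (\<nu> v, \<iota> ` A)" "(v, A) \<in> splittings n V f" by auto
    then show "R \<in> splittings n' V' f'" using into[of v A] by (auto simp: splittings_def)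
  next
    fix R assume R: "R \<in> splittings n' V' f'"
    obtain u B where uB: "R = (u, B)" by (cases R)
    have u: "u < V'" "B \<subseteq> inputs n' V' f' u" "2 \<le> card B" "B \<noteq> inputs n' V' f' u"
      using R uB by (auto simp: splittings_def)
    have "u \<in> \<nu> ` {..<V}"
    proof (rule ccontr)
      assume "u \<notin> \<nu> ` {..<V}"
      then have "card (inputs n' V' f' u) = 2" using other u by simp
      then show False using u card_subset_eq[OF finite_inputs u(2)] card_mono[OF finite_inputs u(2)] by simp
    qed
    then obtain v where v: "v < V" "u = \<nu> v" by auto
    then obtain A where A: "A \<subseteq> inputs n V f v" "B = \<iota> ` A"
      using u(2) inputs[OF v(1)] by (metis subset_imageE)
    then show "R \<in> ?\<phi> ` splittings n V f"
      using into[OF v(1) A(1)] R v uB by (intro image_eqI[of _ _ "(v, A)"]) auto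
  qed
qed

text \<open>
  A partial operation \<open>\<Phi>\<close> on parent functions, with domain \<open>D\<close>, which
  adds \<open>c\<close> vertices. Compatibility with renumberings lets it descend to coinvariants;
  it is extended by zero off its domain.
\<close>

locale graph_map =
  fixes m n m' n' c :: nat
    and D :: "nat \<Rightarrow> (nat source \<Rightarrow> nat target) \<Rightarrow> bool"
    and \<Phi> :: "nat \<Rightarrow> (nat source \<Rightarrow> nat target) \<Rightarrow> nat source \<Rightarrow> nat target"
  assumes parent_op: "is_parent m n V f \<Longrightarrow> D V f \<Longrightarrow> is_parent m' n' (V + c) (\<Phi> V f)"
    and D_relabel: "is_parent m n V f \<Longrightarrow> \<sigma> permutes {..<V} \<Longrightarrow> D V (relabel \<sigma> f) \<longleftrightarrow> D V f"
    and op_relabel: "is_parent m n V f \<Longrightarrow> D V f \<Longrightarrow> \<sigma> permutes {..<V} \<Longrightarrow>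
      \<exists>\<sigma>'. \<sigma>' permutes {..<V + c} \<and> sign \<sigma>' = sign \<sigma> \<and> \<Phi> V (relabel \<sigma> f) = relabel \<sigma>' (\<Phi> V f)"
begin

definition op_graph :: "dgraph \<Rightarrow> (dgraph \<Rightarrow>\<^sub>0 'k::field)" where
  "op_graph G = (if D (nverts G) (parent n G)
     then pgen n' (nverts G + c) (\<Phi> (nverts G) (parent n G)) else 0)"

definition op :: "(dgraph \<Rightarrow>\<^sub>0 'k::field) \<Rightarrow> (dgraph \<Rightarrow>\<^sub>0 'k)" where
  "op = lin_ext op_graph"

sublocale op: Vector_Spaces.linear fscale fscale "op :: (dgraph \<Rightarrow>\<^sub>0 'k::field) \<Rightarrow> (dgraph \<Rightarrow>\<^sub>0 'k)"
  unfolding op_def by (rule lin_ext.linear_axioms)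

lemma op_pgen:
  "is_parent m n V f \<Longrightarrow> op (pgen n V f) = (if D V f then pgen n' (V + c) (\<Phi> V f) else 0)"
  by (simp add: op_def op_graph_def)

lemma op_in_C:
  "(x :: dgraph \<Rightarrow>\<^sub>0 'k::field) \<in> C m n \<Longrightarrow> op x \<in> C m' n'"
  unfolding op_def
proof (erule lin_ext_coinv[OF subspace_coinv_rels])
  fix \<sigma> G H assume G: "G \<in> W m n" and H: "H \<in> W m n" and iso: "graph_iso \<sigma> G H"
  have V: "nverts H = nverts G" and \<sigma>: "\<sigma> permutes {..<nverts G}"
    using iso by (auto simp: graph_iso_def)
  note p = graph_iso_parent[OF iso G H] and f = W_encodes(2)[OF G]
  show "cong_mod (C m' n') (op_graph H :: dgraph \<Rightarrow>\<^sub>0 'k) (fscale (fsign \<sigma>) (op_graph G))"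
  proof (cases "D (nverts G) (parent n G)")
    case False
    then show ?thesis using D_relabel[OF f \<sigma>] V p by (simp add: op_graph_def)
  next
    case True
    obtain \<sigma>' where \<sigma>': "\<sigma>' permutes {..<nverts G + c}" "sign \<sigma>' = sign \<sigma>"
        "\<Phi> (nverts G) (relabel \<sigma> (parent n G)) = relabel \<sigma>' (\<Phi> (nverts G) (parent n G))"
      using op_relabel[OF f True \<sigma>] by blast
    show ?thesis
      using cong_relabel[OF parent_op[OF f True] \<sigma>'(1)] D_relabel[OF f \<sigma>] True V p \<sigma>'(2,3)
      by (simp add: op_graph_def)
  qed
qed

lemma op_cong: "cong_mod (C m n) x y \<Longrightarrow> cong_mod (C m' n') (op x) (op y)"
  using op_in_C[of "x - y"] by (simp add: cong_mod_def op.diff)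

lemma op_graphs_deg:
  assumes "x \<in> graph_span (graphs_deg m n d)"
  shows "op x \<in> graph_span (graphs_deg m' n' (d + int c))"
  unfolding op_def
proof (rule lin_ext_in_subspace[OF subspace_graph_span assms])
  fix G assume "G \<in> graphs_deg m n d"
  then have "is_parent m n (nverts G) (parent n G)" "int (nverts G) = d" using W_encodes(2) by auto
  then show "op_graph G \<in> graph_span (graphs_deg m' n' (d + int c))"
    using parent_op by (auto simp: op_graph_def fvs.subspace_0[OF subspace_graph_span])
qed

end

text \<open>
  An operation under which splittings correspond: the vertex \<open>v\<close> becomes \<open>\<nu>
  v\<close>, its inputs are renamed by \<open>\<iota>\<close>, and all other vertices of the result
  are binary. The permutation \<open>\<pi>\<close> accounts for the position of the new vertex.
  Instances are compositions with binary graphs and the joining of two legs.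
\<close>

locale graph_operation = graph_map +
  fixes \<nu> :: "nat \<Rightarrow> nat"
    and \<iota> :: "nat \<Rightarrow> (nat source \<Rightarrow> nat target) \<Rightarrow> nat source \<Rightarrow> nat source"
    and \<pi> :: "nat \<Rightarrow> nat \<Rightarrow> nat"
  assumes D_split: "is_parent m n V f \<Longrightarrow> (v, A) \<in> splittings n V f \<Longrightarrow>
      D (Suc V) (split_at V f v A) \<longleftrightarrow> D V f"
    and \<pi>: "\<pi> V permutes {..<Suc V + c}"
    and \<nu>: "inj \<nu>" "v < V \<Longrightarrow> \<nu> v < V + c"
    and \<iota>: "is_parent m n V f \<Longrightarrow> D V f \<Longrightarrow> inj_on (\<iota> V f) (\<Union>v<V. inputs n V f v)"
    and inputs_op: "is_parent m n V f \<Longrightarrow> D V f \<Longrightarrow> v < V \<Longrightarrow>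
      inputs n' (V + c) (\<Phi> V f) (\<nu> v) = \<iota> V f ` inputs n V f v"
    and other_op: "is_parent m n V f \<Longrightarrow> D V f \<Longrightarrow> u < V + c \<Longrightarrow> u \<notin> \<nu> ` {..<V} \<Longrightarrow>
      card (inputs n' (V + c) (\<Phi> V f) u) = 2"
    and op_split: "is_parent m n V f \<Longrightarrow> D V f \<Longrightarrow> (v, A) \<in> splittings n V f \<Longrightarrow>
      split_at (V + c) (\<Phi> V f) (\<nu> v) (\<iota> V f ` A) = relabel (\<pi> V) (\<Phi> (Suc V) (split_at V f v A))"
    and degree_op: "int n' - int m' = int n - int m + int c"
begin

lemma split_sum_op:
  assumes f: "is_parent m n V f" and D: "D V f"
  shows "cong_mod (C m' n') (split_sum n' (V + c) (\<Phi> V f) :: dgraph \<Rightarrow>\<^sub>0 'k::field)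
    (fscale (fsign (\<pi> V)) (op (split_sum n V f)))"
proof -
  let ?\<phi> = "\<lambda>(v, A). (\<nu> v, \<iota> V f ` A)"
  have bij: "bij_betw ?\<phi> (splittings n V f) (splittings n' (V + c) (\<Phi> V f))"
    by (rule splittings_transfer)
       (use \<nu> \<iota>[OF f D] inputs_op[OF f D] other_op[OF f D] in \<open>auto intro: inj_on_subset\<close>)
  have val: "pgen n' (Suc (V + c)) (split_at (V + c) (\<Phi> V f) (\<nu> v) (\<iota> V f ` A)) =
      (pgen n' (Suc V + c) (relabel (\<pi> V) (\<Phi> (Suc V) (split_at V f v A))) :: dgraph \<Rightarrow>\<^sub>0 'k)"
    if "(v, A) \<in> splittings n V f" for v A
    by (simp add: op_split[OF f D that])
  have "split_sum n' (V + c) (\<Phi> V f) =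
      (\<Sum>(v, A)\<in>splittings n V f. pgen n' (Suc V + c) (relabel (\<pi> V) (\<Phi> (Suc V) (split_at V f v A))) :: dgraph \<Rightarrow>\<^sub>0 'k)"
    unfolding split_sum_def
    by (subst sum.reindex_bij_betw[OF bij, symmetric], rule sum.cong[OF refl]) (auto simp: val)
  moreover have "cong_mod (C m' n')
      (\<Sum>(v, A)\<in>splittings n V f. pgen n' (Suc V + c) (relabel (\<pi> V) (\<Phi> (Suc V) (split_at V f v A))) :: dgraph \<Rightarrow>\<^sub>0 'k)
      (\<Sum>(v, A)\<in>splittings n V f. fscale (fsign (\<pi> V)) (op (pgen n (Suc V) (split_at V f v A))))"
  proof (rule cong_mod_sum[OF subspace_coinv_rels], clarify)
    fix v A assume A: "(v, A) \<in> splittings n V f"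
    note f' = is_parent_split[OF f A]
    have D': "D (Suc V) (split_at V f v A)" using D_split[OF f A] D by simp
    show "cong_mod (C m' n') (pgen n' (Suc V + c) (relabel (\<pi> V) (\<Phi> (Suc V) (split_at V f v A))) :: dgraph \<Rightarrow>\<^sub>0 'k)
        (fscale (fsign (\<pi> V)) (op (pgen n (Suc V) (split_at V f v A))))"
      unfolding op_pgen[OF f'] using cong_relabel[OF parent_op[OF f' D'] \<pi>] D' by simp
  qed
  moreover have "(\<Sum>(v, A)\<in>splittings n V f. fscale (fsign (\<pi> V)) (op (pgen n (Suc V) (split_at V f v A)))) =
      (fscale (fsign (\<pi> V)) (op (split_sum n V f)) :: dgraph \<Rightarrow>\<^sub>0 'k)"
    by (simp add: split_sum_def op.sum fvs.scale_sum_right case_prod_unfold)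
  ultimately show ?thesis by simp
qed

lemma op_split_sum_undefined:
  assumes f: "is_parent m n V f" and D: "\<not> D V f"
  shows "op (split_sum n V f) = 0"
proof -
  have "op (pgen n (Suc V) (split_at V f v A)) = 0" if "(v, A) \<in> splittings n V f" for v A
    using op_pgen[OF is_parent_split[OF f that]] D_split[OF f that] D by simp
  then show ?thesis by (auto simp: split_sum_def op.sum intro!: sum.neutral)
qed

lemma diff_op:
  assumes x: "x \<in> graph_span (graphs_deg m n (int V))"
  shows "cong_mod (C m' n') (lie_inf_diff (op x))
    (fscale ((-1) ^ c * fsign (\<pi> V)) (op (lie_inf_diff x)) :: dgraph \<Rightarrow>\<^sub>0 'k::field)"
  using x
proof (induction rule: graph_span_induct)
  case subspace
  let ?s = "(-1) ^ c * fsign (\<pi> V) :: 'k"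
  have "cong_mod (C m' n') (lie_inf_diff (op (fscale a x))) (fscale ?s (op (lie_inf_diff (fscale a x))))"
    if "cong_mod (C m' n') (lie_inf_diff (op x)) (fscale ?s (op (lie_inf_diff x)))" for a x
    unfolding op.scale lie_inf_diff.scale fvs.scale_left_commute[of ?s a]
    by (rule cong_mod_scale[OF subspace_coinv_rels that])
  then show ?case unfolding fvs.subspace_def
    by (auto simp: lie_inf_diff.zero lie_inf_diff.add op.zero op.add fvs.scale_right_distrib
        simp del: fvs.scale_scale intro: cong_mod_add[OF subspace_coinv_rels])
next
  case (base G)
  then have G: "G \<in> W m n" and V: "nverts G = V" by auto
  let ?f = "parent n G" and ?s = "(-1) ^ c * fsign (\<pi> V) :: 'k"
  have f: "is_parent m n V ?f" using W_encodes(2)[OF G] V by simp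
  have dG: "cong_mod (C m n) (lie_inf_diff (fgen G)) (fscale ((-1) ^ (V + 1)) (split_sum n V ?f) :: dgraph \<Rightarrow>\<^sub>0 'k)"
    using diff_graph_cong[OF W_encodes[OF G]] V by (simp add: diff_fgen)
  have opd: "cong_mod (C m' n') (op (lie_inf_diff (fgen G)))
      (fscale ((-1) ^ (V + 1)) (op (split_sum n V ?f)) :: dgraph \<Rightarrow>\<^sub>0 'k)"
    using op_cong[OF dG] by (simp only: op.scale)
  show ?case
  proof (cases "D V ?f")
    case False
    then have "op (fgen G) = (0 :: dgraph \<Rightarrow>\<^sub>0 'k)" by (simp add: op_def op_graph_def V)
    moreover have "cong_mod (C m' n') (op (lie_inf_diff (fgen G))) (0 :: dgraph \<Rightarrow>\<^sub>0 'k)"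
      using opd op_split_sum_undefined[OF f False, where 'a='k] by simp
    from cong_mod_scale[OF subspace_coinv_rels this, of ?s]
    have "cong_mod (C m' n') (fscale ?s (op (lie_inf_diff (fgen G)))) (0 :: dgraph \<Rightarrow>\<^sub>0 'k)" by simp
    ultimately show ?thesis by (simp add: lie_inf_diff.zero cong_mod_sym[OF subspace_coinv_rels])
  next
    case True
    have "op (fgen G) = (pgen n' (V + c) (\<Phi> V ?f) :: dgraph \<Rightarrow>\<^sub>0 'k)"
      using True by (simp add: op_def op_graph_def V)
    then have "cong_mod (C m' n') (lie_inf_diff (op (fgen G)))
        (fscale ((-1) ^ (V + c + 1)) (split_sum n' (V + c) (\<Phi> V ?f)) :: dgraph \<Rightarrow>\<^sub>0 'k)"
      using diff_pgen_cong[OF parent_op[OF f True]] by simp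
    also have "cong_mod (C m' n') \<dots> (fscale ((-1) ^ (V + c + 1)) (fscale (fsign (\<pi> V)) (op (split_sum n V ?f))))"
      by (intro cong_mod_scale subspace_coinv_rels split_sum_op f True)
    also have "\<dots> = fscale ?s (fscale ((-1) ^ (V + 1)) (op (split_sum n V ?f)))"
      by (simp add: power_add mult_ac)
    also have "cong_mod (C m' n') \<dots> (fscale ?s (op (lie_inf_diff (fgen G))))"
      by (rule cong_mod_scale[OF subspace_coinv_rels cong_mod_sym[OF subspace_coinv_rels opd]])
    finally show ?thesis .
  qed
qed

end

section \<open>Boundaries in the top degree\<close>

text \<open>The elements homologous to zero, in the top degree and modulo coinvariants.\<close>

definition top_boundaries :: "nat \<Rightarrow> nat \<Rightarrow> (dgraph \<Rightarrow>\<^sub>0 'k::field) set" where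
  "top_boundaries m n = {x. \<exists>z\<in>graph_span (graphs_deg m n (int n - int m - 1)).
     cong_mod (C m n) x (lie_inf_diff z)}"

lemma subspace_top_boundaries [simp]: "fvs.subspace (top_boundaries m n)"
  unfolding fvs.subspace_def
proof (intro conjI ballI allI)
  show "0 \<in> top_boundaries m n"
    unfolding top_boundaries_def
    by (auto intro!: bexI[of _ 0] simp: lie_inf_diff.zero fvs.subspace_0[OF subspace_graph_span])
  fix x y :: "dgraph \<Rightarrow>\<^sub>0 'a" assume "x \<in> top_boundaries m n" "y \<in> top_boundaries m n"
  then obtain z z' where "z \<in> graph_span (graphs_deg m n (int n - int m - 1))" "cong_mod (C m n) x (lie_inf_diff z)"
    "z' \<in> graph_span (graphs_deg m n (int n - int m - 1))" "cong_mod (C m n) y (lie_inf_diff z')"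
    by (auto simp: top_boundaries_def)
  then show "x + y \<in> top_boundaries m n"
    unfolding top_boundaries_def
    by (auto intro!: bexI[of _ "z + z'"] cong_mod_add fvs.subspace_add[OF subspace_graph_span]
        simp: lie_inf_diff.add)
next
  fix c and x :: "dgraph \<Rightarrow>\<^sub>0 'a" assume "x \<in> top_boundaries m n"
  then obtain z where "z \<in> graph_span (graphs_deg m n (int n - int m - 1))" "cong_mod (C m n) x (lie_inf_diff z)"
    by (auto simp: top_boundaries_def)
  then show "fscale c x \<in> top_boundaries m n"
    unfolding top_boundaries_def
    using fvs.subspace_scale[OF subspace_graph_span, of z _ c]
    by (auto intro!: bexI[of _ "fscale c z"] cong_mod_scale simp: lie_inf_diff.scale)
qed

lemma C_subset_top_boundaries: "C m n \<subseteq> top_boundaries m n"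
  unfolding top_boundaries_def
  by (auto intro!: bexI[of _ 0] simp: lie_inf_diff.zero cong_mod_def fvs.subspace_0[OF subspace_graph_span])

lemma top_boundaries_subset: "top_boundaries m n \<subseteq> graph_span (W m n)"
proof
  fix x :: "dgraph \<Rightarrow>\<^sub>0 'a" assume "x \<in> top_boundaries m n"
  then obtain z where z: "z \<in> graph_span (graphs_deg m n (int n - int m - 1))" "x - lie_inf_diff z \<in> C m n"
    by (auto simp: top_boundaries_def cong_mod_def)
  have "lie_inf_diff z \<in> graph_span (W m n)"
    using diff_graph_span[OF z(1)] graph_span_mono[of "graphs_deg m n (int n - int m - 1 + 1)" "W m n"] by auto
  moreover have "x - lie_inf_diff z \<in> graph_span (W m n)" using z(2) coinv_rels_subset by blast
  ultimately have "lie_inf_diff z + (x - lie_inf_diff z) \<in> graph_span (W m n)"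
    by (rule fvs.subspace_add[OF subspace_graph_span])
  then show "x \<in> graph_span (W m n)" by simp
qed

lemma top_boundaries_cong:
  assumes "cong_mod (C m n) x y" "y \<in> top_boundaries m n"
  shows "x \<in> top_boundaries m n"
proof -
  have "x - y \<in> top_boundaries m n" using assms(1) C_subset_top_boundaries by (auto simp: cong_mod_def)
  then have "(x - y) + y \<in> top_boundaries m n" by (rule fvs.subspace_add[OF subspace_top_boundaries]) fact
  then show ?thesis by simp
qed

text \<open>
  The codegree \<open>n - m - V\<close> does not change, so that boundaries in the top degree go to
  boundaries in the top degree.
\<close>

lemma (in graph_operation) op_top_boundaries:
  assumes "x \<in> top_boundaries m n"
  shows "op x \<in> (top_boundaries m' n' :: (dgraph \<Rightarrow>\<^sub>0 'k::field) set)"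
proof -
  let ?d = "int n - int m - 1"
  obtain z where z: "z \<in> graph_span (graphs_deg m n ?d)" "cong_mod (C m n) x (lie_inf_diff z)"
    using assms by (auto simp: top_boundaries_def)
  show ?thesis
  proof (cases "0 \<le> ?d")
    case True
    then have dV: "?d = int (nat ?d)" by simp
    let ?s = "(-1) ^ c * fsign (\<pi> (nat ?d)) :: 'k"
    have ss: "?s * ?s = 1" by (simp add: algebra_simps flip: power_mult_distrib)
    have "cong_mod (C m' n') (lie_inf_diff (op z)) (fscale ?s (op (lie_inf_diff z)))"
      by (rule diff_op) (use z(1) dV in simp)
    from cong_mod_scale[OF subspace_coinv_rels this, of ?s]
    have *: "cong_mod (C m' n') (fscale ?s (lie_inf_diff (op z))) (op (lie_inf_diff z))"
      unfolding fvs.scale_scale ss by simp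
    have "op z \<in> graph_span (graphs_deg m' n' (int n' - int m' - 1))"
    proof -
      have "int n' - int m' - 1 = ?d + int c" using degree_op by simp
      then show ?thesis using op_graphs_deg[OF z(1)] by (simp only:)
    qed
    then have "op (lie_inf_diff z) \<in> top_boundaries m' n'"
      unfolding top_boundaries_def
      by (auto intro!: bexI[of _ "fscale ?s (op z)"] fvs.subspace_scale[OF subspace_graph_span]
          cong_mod_sym[OF subspace_coinv_rels *] simp: lie_inf_diff.scale simp del: fvs.scale_scale)
    then show ?thesis using op_cong[OF z(2)] top_boundaries_cong by blast
  next
    case False
    then have e: "graphs_deg m n ?d = {}" by auto
    have "z = 0" using z(1) unfolding e by (simp add: graph_span_def)
    then have "x \<in> C m n" using z(2) by (simp add: lie_inf_diff.zero cong_mod_def)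
    then show ?thesis using op_in_C C_subset_top_boundaries by blast
  qed
qed

section \<open>Disjoint union and grafting\<close>

definition shift :: "nat \<Rightarrow> nat \<Rightarrow> nat source \<Rightarrow> nat source" where
  "shift a V s = (case s of InLeg i \<Rightarrow> InLeg (a + i) | OutOf v \<Rightarrow> OutOf (V + v))"

definition unshift :: "nat \<Rightarrow> nat \<Rightarrow> nat source \<Rightarrow> nat source" where
  "unshift a V s = (case s of InLeg i \<Rightarrow> InLeg (i - a) | OutOf v \<Rightarrow> OutOf (v - V))"

definition producer :: "nat \<Rightarrow> nat \<Rightarrow> (nat source \<Rightarrow> nat target) \<Rightarrow> nat \<Rightarrow> nat source" where
  "producer n V f j = (THE s. s \<in> sources n V \<and> f s = OutLeg j)"

text \<open>
  Disjoint union if \<open>b\<close>, and otherwise grafting of \<open>k\<close> on top of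
  \<open>g\<close>. Treating both at once, the only differences are that the input legs of
  \<open>g\<close> persist in the first case and are matched with the outputs of \<open>k\<close> in
  the second.
\<close>

definition compose_parents ::
    "bool \<Rightarrow> nat \<Rightarrow> nat \<Rightarrow> nat \<Rightarrow> nat \<Rightarrow> nat \<Rightarrow> (nat source \<Rightarrow> nat target) \<Rightarrow> (nat source \<Rightarrow> nat target)
      \<Rightarrow> nat source \<Rightarrow> nat target" where
  "compose_parents b m1 n1 n2 V V2 g k s =
     (if s \<in> sources (if b then n1 else 0) V then g s
      else if s \<in> shift (if b then n1 else 0) V ` sources n2 V2 then
        (case k (unshift (if b then n1 else 0) V s) of
           Into v \<Rightarrow> Into (V + v)
         | OutLeg j \<Rightarrow> if b then OutLeg (m1 + j) else g (InLeg j))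
      else OutLeg 0)"

text \<open>
  The source in the composite that plays the part of a source of the left factor: an input leg that
  has been grafted onto is replaced by the source of \<open>k\<close> which feeds it.
\<close>

definition embed ::
    "bool \<Rightarrow> nat \<Rightarrow> nat \<Rightarrow> nat \<Rightarrow> (nat source \<Rightarrow> nat target) \<Rightarrow> nat source \<Rightarrow> nat source" where
  "embed b n2 V V2 k s =
     (case s of InLeg i \<Rightarrow> if b then InLeg i else shift 0 V (producer n2 V2 k i) | OutOf v \<Rightarrow> OutOf v)"

lemma unshift_shift [simp]: "unshift a V (shift a V s) = s"
  by (cases s) (auto simp: shift_def unshift_def)

lemma inj_shift [simp]: "inj (shift a V)"
  by (rule inj_on_inverseI[of _ "unshift a V"]) simp

lemma shift_eq_iff [simp]: "shift a V s = shift a V t \<longleftrightarrow> s = t"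
  by (metis unshift_shift)

lemma shift_notin_sources [simp]: "shift a V s \<notin> sources a V"
  by (cases s) (auto simp: shift_def)

lemma sources_add: "sources (a + n) (V + V2) = sources a V \<union> shift a V ` sources n V2"
proof (intro set_eqI iffI)
  fix s assume s: "s \<in> sources (a + n) (V + V2)"
  show "s \<in> sources a V \<union> shift a V ` sources n V2"
  proof (cases s)
    case (InLeg i)
    then show ?thesis using s
      by (cases "i < a") (auto simp: shift_def intro!: image_eqI[of _ _ "InLeg (i - a)"])
  next
    case (OutOf v)
    then show ?thesis using s
      by (cases "v < V") (auto simp: shift_def intro!: image_eqI[of _ _ "OutOf (v - V)"])
  qed
next
  fix s assume "s \<in> sources a V \<union> shift a V ` sources n V2"
  then show "s \<in> sources (a + n) (V + V2)"
  proof
    assume "s \<in> shift a V ` sources n V2"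
    then obtain t where "s = shift a V t" "t \<in> sources n V2" by blast
    then show ?thesis by (cases t) (auto simp: shift_def)
  qed (cases s; auto)
qed

lemma producer:
  assumes "is_parent m n V f" "j < m"
  shows "producer n V f j \<in> sources n V" "f (producer n V f j) = OutLeg j"
  using theI'[of "\<lambda>s. s \<in> sources n V \<and> f s = OutLeg j"] assms
  unfolding producer_def is_parent_def by blast+

lemma producer_eqI:
  assumes "is_parent m n V f" "j < m" "s \<in> sources n V" "f s = OutLeg j"
  shows "producer n V f j = s"
  using is_parent_OutLegE[OF assms(1,2)] producer[OF assms(1,2)] assms(3,4) by metis

context
  fixes b :: bool and m1 n1 V g m2 n2 V2 k a M
  assumes g: "is_parent m1 n1 V g" and k: "is_parent m2 n2 V2 k" and match: "b \<or> n1 = m2"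
  defines "a \<equiv> if b then n1 else 0" and "M \<equiv> if b then m1 + m2 else m1"
begin

private abbreviation "F \<equiv> compose_parents b m1 n1 n2 V V2 g k"
private abbreviation "I \<equiv> embed b n2 V V2 k"
private abbreviation "T \<equiv> {t \<in> sources n2 V2. b \<or> (\<exists>u. k t = Into u)}"

lemma compose_left: "s \<in> sources a V \<Longrightarrow> F s = g s"
  by (simp add: compose_parents_def a_def)

lemma compose_right: "t \<in> sources n2 V2 \<Longrightarrow> F (shift a V t) =
    (case k t of Into v \<Rightarrow> Into (V + v) | OutLeg j \<Rightarrow> if b then OutLeg (m1 + j) else g (InLeg j))"
  by (auto simp: compose_parents_def a_def[symmetric])

lemma compose_outside: "s \<notin> sources (a + n2) (V + V2) \<Longrightarrow> F s = OutLeg 0"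
  by (auto simp: compose_parents_def a_def[symmetric] sources_add)

lemma embed:
  assumes "s \<in> sources n1 V"
  shows "I s \<in> sources (a + n2) (V + V2)" "F (I s) = g s"
proof -
  consider v where "s = OutOf v" "v < V" | i where "s = InLeg i" "i < n1" "b"
    | i where "s = InLeg i" "i < m2" "\<not> b"
    using assms match by (cases s) auto
  then have "I s \<in> sources (a + n2) (V + V2) \<and> F (I s) = g s"
  proof cases
    case 3
    then show ?thesis
      using producer[OF k 3(2)] compose_right[of "producer n2 V2 k i"] sources_add[of 0 n2 V V2]
      by (auto simp: embed_def a_def sources_add)
  qed (use compose_left in \<open>auto simp: embed_def a_def\<close>)
  then show "I s \<in> sources (a + n2) (V + V2)" "F (I s) = g s" by auto
qed

lemma embed_inj: "inj_on I (sources n1 V)"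
proof (rule inj_onI)
  fix s t assume s: "s \<in> sources n1 V" and t: "t \<in> sources n1 V" and eq: "I s = I t"
  have out: "OutOf v \<noteq> shift 0 V u" if "v < V" for v u
    using that by (cases u) (auto simp: shift_def)
  have prod: "i = j" if "\<not> b" "i < n1" "j < n1" "producer n2 V2 k i = producer n2 V2 k j" for i j
  proof -
    have m: "i < m2" "j < m2" using match that by simp_all
    have "(OutLeg i :: nat target) = OutLeg j"
      using producer(2)[OF k m(1)] producer(2)[OF k m(2)] unfolding that(4) by (rule trans[OF sym])
    then show ?thesis by simp
  qed
  show "s = t"
  proof (cases s)
    case (InLeg i)
    show ?thesis
    proof (cases t)
      case t: (InLeg j)
      show ?thesis
      proof (cases b)
        case True
        then show ?thesis using eq InLeg t by (simp add: embed_def)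
      next
        case False
        then have "producer n2 V2 k i = producer n2 V2 k j"
          using eq InLeg t by (simp add: embed_def)
        then show ?thesis using prod[of i j] False InLeg t s \<open>t \<in> sources n1 V\<close> by simp
      qed
    next
      case t: (OutOf v)
      have v: "v < V" using t \<open>t \<in> sources n1 V\<close> by simp
      show ?thesis using eq InLeg t out[OF v, of "producer n2 V2 k i"]
        by (cases b) (simp_all add: embed_def)
    qed
  next
    case (OutOf v)
    have v: "v < V" using OutOf s by simp
    show ?thesis
    proof (cases t)
      case t: (InLeg i)
      show ?thesis using eq OutOf t out[OF v, of "producer n2 V2 k i"]
        by (cases b) (simp_all add: embed_def)
    qed (use eq OutOf in \<open>simp add: embed_def\<close>)
  qed
qed

lemma compose_cases [consumes 1, case_names left right]:
  assumes "x \<in> sources (a + n2) (V + V2)"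
  obtains s where "s \<in> sources n1 V" "x = I s" | t where "t \<in> T" "x = shift a V t"
proof -
  from assms consider "x \<in> sources a V" | t where "t \<in> sources n2 V2" "x = shift a V t"
    by (auto simp: sources_add)
  then show thesis
  proof cases
    case 1
    then have "x \<in> sources n1 V" "x = I x"
      by (cases x; auto simp: a_def embed_def split: if_splits)+
    then show thesis by (rule that(1))
  next
    case 2
    show thesis
    proof (cases "t \<in> T")
      case False
      then obtain j where j: "\<not> b" "k t = OutLeg j" using 2 by (cases "k t") auto
      then have jm: "j < m2" using k 2(1) by (fastforce simp: is_parent_def)
      then have "producer n2 V2 k j = t" using producer_eqI[OF k _ 2(1)] j by simp
      then show thesis
        using that(1)[of "InLeg j"] j jm match 2 by (simp add: embed_def a_def)
    qed (use that(2) 2 in blast)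
  qed
qed

lemma compose_rest:
  assumes t: "t \<in> T"
  shows "F (shift a V t) = (case k t of Into v \<Rightarrow> Into (V + v) | OutLeg j \<Rightarrow> OutLeg (m1 + j))"
    and "shift a V t \<in> sources (a + n2) (V + V2)"
    and "shift a V t \<notin> I ` sources n1 V"
    and "k t = OutLeg j \<Longrightarrow> b"
proof -
  have ts: "t \<in> sources n2 V2" using t by simp
  show b: "k t = OutLeg j \<Longrightarrow> b" for j using t by auto
  show "F (shift a V t) = (case k t of Into v \<Rightarrow> Into (V + v) | OutLeg j \<Rightarrow> OutLeg (m1 + j))"
    using compose_right[OF ts] b by (cases "k t") auto
  show "shift a V t \<in> sources (a + n2) (V + V2)" using ts by (simp add: sources_add)
  show "shift a V t \<notin> I ` sources n1 V"
  proof
    assume "shift a V t \<in> I ` sources n1 V"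
    then obtain s where s: "s \<in> sources n1 V" "shift a V t = I s" by blast
    show False
    proof (cases s)
      case (OutOf v)
      then have "shift a V t \<in> sources a V" using s by (simp add: embed_def)
      then show False by simp
    next
      case (InLeg i)
      show False
      proof (cases b)
        case True
        then have "shift a V t \<in> sources a V" using s InLeg by (simp add: embed_def a_def)
        then show False by simp
      next
        case False
        then have "t = producer n2 V2 k i" using s InLeg by (simp add: embed_def a_def)
        then have "k t = OutLeg i" using producer(2)[OF k, of i] s InLeg match False by simp
        then show False using b False by simp
      qed
    qed
  qed
qed

lemma inputs_compose_left:
  assumes v: "v < V"
  shows "inputs (a + n2) (V + V2) F v = I ` inputs n1 V g v"
proof (intro set_eqI iffI)
  fix x assume x: "x \<in> inputs (a + n2) (V + V2) F v"
  then have "x \<in> sources (a + n2) (V + V2)" by (simp add: inputs_def)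
  then show "x \<in> I ` inputs n1 V g v"
  proof (cases rule: compose_cases)
    case (left s)
    then show ?thesis using x left(2) embed[of s] by (auto simp: inputs_def)
  next
    case (right t)
    then show ?thesis using x v compose_rest(1)[of t] by (auto simp: inputs_def split: target.splits)
  qed
qed (auto simp: inputs_def embed)

lemma inputs_compose_right: "inputs (a + n2) (V + V2) F (V + u) = shift a V ` inputs n2 V2 k u"
proof (intro set_eqI iffI)
  fix x assume x: "x \<in> inputs (a + n2) (V + V2) F (V + u)"
  then have "x \<in> sources (a + n2) (V + V2)" by (simp add: inputs_def)
  then show "x \<in> shift a V ` inputs n2 V2 k u"
  proof (cases rule: compose_cases)
    case (left s)
    then have "g s = Into (V + u)" using x embed[of s] by (simp add: inputs_def)
    then show ?thesis using g left(1) by (fastforce simp: is_parent_def)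
  next
    case (right t)
    then have "k t = Into u"
      using x compose_rest(1)[of t] by (auto simp: inputs_def split: target.splits)
    then show ?thesis using right by (auto simp: inputs_def)
  qed
next
  fix x assume "x \<in> shift a V ` inputs n2 V2 k u"
  then obtain t where "x = shift a V t" "t \<in> sources n2 V2" "k t = Into u" by (auto simp: inputs_def)
  then show "x \<in> inputs (a + n2) (V + V2) F (V + u)"
    using compose_right[of t] by (simp add: inputs_def sources_add)
qed

lemma is_parent_compose: "is_parent M (a + n2) (V + V2) F"
  unfolding is_parent_def
proof (intro conjI ballI allI impI)
  fix x assume "x \<in> sources (a + n2) (V + V2)"
  then show "F x \<in> OutLeg ` {..<M} \<union> Into ` {..<V + V2}"
  proof (cases rule: compose_cases)
    case (left s)
    have "g s \<in> OutLeg ` {..<m1} \<union> Into ` {..<V}" using g left by (simp add: is_parent_def)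
    then show ?thesis using left embed[of s] by (auto simp: M_def)
  next
    case (right t)
    have "k t \<in> OutLeg ` {..<m2} \<union> Into ` {..<V2}" using k right by (simp add: is_parent_def)
    then show ?thesis using right compose_rest(1,4)[of t] by (auto simp: M_def)
  qed
next
  fix x assume "x \<notin> sources (a + n2) (V + V2)"
  then show "F x = OutLeg 0" by (rule compose_outside)
next
  fix j assume j: "j < M"
  show "\<exists>!x. x \<in> sources (a + n2) (V + V2) \<and> F x = OutLeg j"
  proof (cases "j < m1")
    case True
    obtain s where s: "s \<in> sources n1 V" "g s = OutLeg j"
      and un: "\<And>s'. s' \<in> sources n1 V \<Longrightarrow> g s' = OutLeg j \<Longrightarrow> s' = s"
      using is_parent_OutLegE[OF g True] by blast
    show ?thesis
    proof (rule ex1I[of _ "I s"])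
      show "I s \<in> sources (a + n2) (V + V2) \<and> F (I s) = OutLeg j" using embed[OF s(1)] s by simp
      fix x assume x: "x \<in> sources (a + n2) (V + V2) \<and> F x = OutLeg j"
      then have "x \<in> sources (a + n2) (V + V2)" by simp
      then show "x = I s"
      proof (cases rule: compose_cases)
        case (left s')
        then have "g s' = OutLeg j" using x embed[of s'] by simp
        then show ?thesis using un left by blast
      next
        case (right t)
        then show ?thesis using x compose_rest(1)[of t] True by (auto split: target.splits)
      qed
    qed
  next
    case False
    then have b: b and j': "j - m1 < m2" using j by (auto simp: M_def split: if_splits)
    obtain t where t: "t \<in> sources n2 V2" "k t = OutLeg (j - m1)"
      and un: "\<And>s'. s' \<in> sources n2 V2 \<Longrightarrow> k s' = OutLeg (j - m1) \<Longrightarrow> s' = t"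
      using is_parent_OutLegE[OF k j'] by blast
    have tT: "t \<in> T" using t b by simp
    show ?thesis
    proof (rule ex1I[of _ "shift a V t"])
      show "shift a V t \<in> sources (a + n2) (V + V2) \<and> F (shift a V t) = OutLeg j"
        using compose_rest(1,2)[OF tT] t False by simp
      fix x assume x: "x \<in> sources (a + n2) (V + V2) \<and> F x = OutLeg j"
      then have "x \<in> sources (a + n2) (V + V2)" by simp
      then show "x = shift a V t"
      proof (cases rule: compose_cases)
        case (left s)
        then have "g s = OutLeg j" using x embed[of s] by simp
        then show ?thesis using g left(1) False by (fastforce simp: is_parent_def)
      next
        case (right t')
        then have "k t' = OutLeg (j - m1)"
          using x compose_rest(1)[of t'] by (auto split: target.splits)
        then show ?thesis using un[of t'] right by simp
      qed
    qed
  qed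
next
  fix u assume u: "u < V + V2"
  show "2 \<le> card (inputs (a + n2) (V + V2) F u)"
  proof (cases "u < V")
    case True
    have "inputs n1 V g u \<subseteq> sources n1 V" by (rule inputs_subset)
    then show ?thesis using g True card_image[OF inj_on_subset[OF embed_inj]]
      by (simp add: inputs_compose_left is_parent_def)
  next
    case False
    then obtain w where w: "u = V + w" "w < V2" using u by (metis add_diff_inverse_nat nat_add_left_cancel_less)
    then show ?thesis using k
      by (simp add: inputs_compose_right is_parent_def card_image inj_on_subset[OF inj_shift])
  qed
qed

end

lemma map_source_fixed:
  assumes "\<sigma> permutes {..<V}" "s \<notin> OutOf ` {..<V}"
  shows "map_source \<sigma> s = s"
  using assms(2) permutes_not_in[OF assms(1)] by (cases s) auto

lemma compose_relabel_left:
  assumes \<sigma>: "\<sigma> permutes {..<V}"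
  shows "compose_parents b m1 n1 n2 V V2 (relabel \<sigma> g) k = relabel \<sigma> (compose_parents b m1 n1 n2 V V2 g k)"
proof -
  let ?a = "if b then n1 else 0"
  have \<sigma>': "\<sigma> permutes {..<V + V2}" by (rule permutes_subset[OF \<sigma>]) auto
  show ?thesis
  proof (rule relabel_eqI[OF \<sigma>'])
    fix s
    let ?F = "compose_parents b m1 n1 n2 V V2"
    have big: "\<sigma> (V + v) = V + v" for v by (rule permutes_not_in[OF \<sigma>]) simp
    have shift: "map_source \<sigma> (shift a V t) = shift a V t" for a t
      using big by (cases t) (auto simp: shift_def)
    have leg: "relabel \<sigma> g (InLeg j) = map_target \<sigma> (g (InLeg j))" for j
      using relabel_apply[OF \<sigma>, of g "InLeg j"] by simp
    show "?F (relabel \<sigma> g) k (map_source \<sigma> s) = map_target \<sigma> (?F g k s)"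
    proof (cases "s \<in> sources ?a V")
      case True
      then show ?thesis
        by (simp add: compose_parents_def relabel_apply[OF \<sigma>] map_source_sources[OF \<sigma>])
    next
      case False
      then have fixed: "map_source \<sigma> s = s" by (intro map_source_fixed[OF \<sigma>]) auto
      show ?thesis
        using False by (auto simp: compose_parents_def fixed leg big shift split: target.splits)
    qed
  qed
qed

text \<open>
  The cyclic permutation that moves the vertex \<open>V\<close> past the \<open>c\<close> vertices
  following it. It brings the new vertex of a splitting of the left factor to the last position.
\<close>

definition to_end :: "nat \<Rightarrow> nat \<Rightarrow> nat \<Rightarrow> nat" where
  "to_end V c x = (if x = V then V + c else if V < x \<and> x \<le> V + c then x - 1 else x)"

lemma to_end_permutes: "to_end V c permutes {..<Suc V + c}"
proof (rule bij_imp_permutes)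
  have "inj_on (to_end V c) {..<Suc V + c}"
    by (auto simp: inj_on_def to_end_def split: if_splits)
  moreover have "to_end V c ` {..<Suc V + c} \<subseteq> {..<Suc V + c}"
    by (auto simp: to_end_def)
  ultimately show "bij_betw (to_end V c) {..<Suc V + c} {..<Suc V + c}"
    by (simp add: bij_betw_def endo_inj_surj)
qed (auto simp: to_end_def)

context
  fixes b :: bool and m1 n1 V g m2 n2 V2 k a M
  assumes g: "is_parent m1 n1 V g" and k: "is_parent m2 n2 V2 k" and match: "b \<or> n1 = m2"
  defines "a \<equiv> if b then n1 else 0" and "M \<equiv> if b then m1 + m2 else m1"
begin

private abbreviation "FF \<equiv> compose_parents b m1 n1 n2"

lemma compose_split_left:
  assumes A: "(v, A) \<in> splittings n1 V g"
  shows "split_at (V + V2) (FF V V2 g k) v (embed b n2 V V2 k ` A) =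
    relabel (to_end V V2) (FF (Suc V) V2 (split_at V g v A) k)"
proof (rule relabel_eqI[OF to_end_permutes])
  note fA = splitting_facts[OF g A] and g' = is_parent_split[OF g A]
  let ?\<pi> = "to_end V V2" and ?g' = "split_at V g v A"
  let ?I = "embed b n2 V V2 k" and ?I' = "embed b n2 (Suc V) V2 k"
  let ?N = "a + n2"
  have sub: "A \<subseteq> sources n1 V" using fA by simp
  have AN: "?I ` A \<subseteq> sources ?N (V + V2)"
    using embed(1)[OF g k match] sub unfolding a_def by blast
  have memI: "?I s \<in> ?I ` A \<longleftrightarrow> s \<in> A" if "s \<in> sources n1 V" for s
    by (rule inj_on_image_mem_iff[OF embed_inj[OF g k match] that sub])
  have end_not: "OutOf (V + V2) \<notin> ?I ` A"
    using subsetD[OF AN, of "OutOf (V + V2)"] by auto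
  have small: "map_target ?\<pi> (g s) = g s" for s
  proof (cases "g s")
    case (Into u)
    then have "u < V" using g by (cases "s \<in> sources n1 V") (auto simp: is_parent_def)
    then show ?thesis using Into by (simp add: to_end_def)
  qed simp
  fix x
  show "split_at (V + V2) (FF V V2 g k) v (?I ` A) (map_source ?\<pi> x) = map_target ?\<pi> (FF (Suc V) V2 ?g' k x)"
  proof (cases "x \<in> sources ?N (Suc V + V2)")
    case False
    then have "map_source ?\<pi> x \<notin> sources ?N (Suc V + V2)"
      by (simp only: map_source_sources[OF to_end_permutes] not_False_eq_True)
    then have y: "map_source ?\<pi> x \<notin> sources ?N (V + V2)" "map_source ?\<pi> x \<noteq> OutOf (V + V2)"
      by (auto simp: sources_Suc)
    have "FF V V2 g k (map_source ?\<pi> x) = OutLeg 0"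
      using compose_outside[OF g k match] y(1) unfolding a_def by blast
    moreover have "FF (Suc V) V2 ?g' k x = OutLeg 0"
      using compose_outside[OF g' k match] False unfolding a_def by blast
    ultimately show ?thesis using y AN by (auto simp: split_at_def)
  next
    case True
    show ?thesis
    proof (rule compose_cases[OF g' k match True[unfolded a_def]], goal_cases left right)
      case (left s)
      note F' = embed(2)[OF g' k match left(1)]
      show ?thesis
      proof (cases "s = OutOf V")
        case True
        then show ?thesis using F' left fA end_not
          by (simp add: embed_def split_at_def to_end_def)
      next
        case False
        then have s: "s \<in> sources n1 V" using left(1) by (auto simp: sources_Suc)
        have px: "map_source ?\<pi> (?I' s) = ?I s"
        proof (cases s)
          case (OutOf u)
          then show ?thesis using s by (simp add: embed_def to_end_def)
        next
          case (InLeg i)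
          show ?thesis
          proof (cases b)
            case False
            then have "producer n2 V2 k i \<in> sources n2 V2"
              using producer(1)[OF k] match s InLeg by simp
            then show ?thesis using False InLeg
              by (cases "producer n2 V2 k i") (auto simp: embed_def shift_def to_end_def)
          qed (use InLeg in \<open>simp add: embed_def\<close>)
        qed
        have "?I s \<noteq> OutOf (V + V2)" using embed(1)[OF g k match s] by auto
        then show ?thesis
          using F' left(2) px memI[OF s] embed(2)[OF g k match s] small[of s] False
          by (simp add: split_at_def to_end_def)
      qed
    next
      case (right t)
      have tT: "t \<in> {t \<in> sources n2 V2. b \<or> (\<exists>u. k t = Into u)}" by (rule right(1))
      note c' = compose_rest[OF g' k match tT] and c = compose_rest[OF g k match tT]
      have px: "map_source ?\<pi> (shift a (Suc V) t) = shift a V t"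
        using tT by (cases t) (auto simp: shift_def to_end_def)
      have "shift a V t \<notin> ?I ` A" using c(3) sub unfolding a_def by blast
      moreover have "shift a V t \<noteq> OutOf (V + V2)" using c(2) unfolding a_def by auto
      moreover have "u < V2" if "k t = Into u" for u
        using k tT that by (fastforce simp: is_parent_def)
      ultimately show ?thesis
        using right(2) c'(1) c(1) px unfolding a_def[symmetric]
        by (auto simp: split_at_def to_end_def split: target.splits)
    qed
  qed
qed

lemma compose_relabel_right:
  assumes \<sigma>: "\<sigma> permutes {..<V2}"
  obtains \<sigma>' where "\<sigma>' permutes {..<V + V2}" "sign \<sigma>' = sign \<sigma>"
    "FF V V2 g (relabel \<sigma> k) = relabel \<sigma>' (FF V V2 g k)"
proof -
  define \<sigma>' where "\<sigma>' = map_permutation {..<V2} ((+) V) \<sigma>"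
  have inj: "inj_on ((+) V) {..<V2}" by simp
  have "\<sigma>' permutes (+) V ` {..<V2}"
    unfolding \<sigma>'_def by (rule map_permutation_permutes) (use \<sigma> in auto)
  then have p: "\<sigma>' permutes {..<V + V2}" by (rule permutes_subset) auto
  have sg: "sign \<sigma>' = sign \<sigma>" unfolding \<sigma>'_def by (rule sign_map_permutation[OF inj \<sigma>]) simp
  have low: "\<sigma>' w = w" if "w < V" for w
    by (rule permutes_not_in[OF \<open>\<sigma>' permutes (+) V ` {..<V2}\<close>]) (use that in auto)
  have high: "\<sigma>' (V + w) = V + \<sigma> w" for w
  proof (cases "w < V2")
    case True
    then show ?thesis unfolding \<sigma>'_def by (simp add: map_permutation_apply[OF inj])
  next
    case False
    then have "\<sigma> w = w" "\<sigma>' (V + w) = V + w"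
      using permutes_not_in[OF \<sigma>] permutes_not_in[OF p] by auto
    then show ?thesis by simp
  qed
  have "FF V V2 g (relabel \<sigma> k) = relabel \<sigma>' (FF V V2 g k)"
  proof (rule relabel_eqI[OF p])
    fix x
    have gx: "map_target \<sigma>' (g s) = g s" for s
    proof (cases "g s")
      case (Into u)
      then have "u < V" using g by (cases "s \<in> sources n1 V") (auto simp: is_parent_def)
      then show ?thesis using Into low by simp
    qed simp
    have shift: "map_source \<sigma>' (shift a V t) = shift a V (map_source \<sigma> t)" for t
      by (cases t) (auto simp: shift_def high)
    show "FF V V2 g (relabel \<sigma> k) (map_source \<sigma>' x) = map_target \<sigma>' (FF V V2 g k x)"
    proof (cases "x \<in> sources (a + n2) (V + V2)")
      case False
      then have "map_source \<sigma>' x \<notin> sources (a + n2) (V + V2)" by (simp add: map_source_sources[OF p])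
      then show ?thesis
        using compose_outside[OF g is_parent_relabel[OF \<sigma> k] match] compose_outside[OF g k match] False
        unfolding a_def by simp
    next
      case True
      then consider "x \<in> sources a V" | t where "t \<in> sources n2 V2" "x = shift a V t"
        by (auto simp: sources_add)
      then show ?thesis
      proof cases
        case 1
        then have "map_source \<sigma>' x = x" using low by (cases x) auto
        then show ?thesis using 1 gx
          using compose_left[OF g is_parent_relabel[OF \<sigma> k] match] compose_left[OF g k match]
          unfolding a_def by simp
      next
        case 2
        have "map_source \<sigma> t \<in> sources n2 V2" using 2 by (simp add: map_source_sources[OF \<sigma>])
        from compose_right[OF g is_parent_relabel[OF \<sigma> k] match this] compose_right[OF g k match 2(1)]
        show ?thesis unfolding 2(2) shift unfolding a_def
          by (cases "k t") (auto simp: relabel_apply[OF \<sigma>] high gx)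
      qed
    qed
  qed
  then show thesis using that p sg by blast
qed

lemma compose_split_right:
  assumes A: "(v, A) \<in> splittings n2 V2 k"
  shows "split_at (V + V2) (FF V V2 g k) (V + v) (shift a V ` A) = FF V (Suc V2) g (split_at V2 k v A)"
proof
  note fA = splitting_facts[OF k A] and k' = is_parent_split[OF k A]
  fix x
  have memA: "shift a V t \<in> shift a V ` A \<longleftrightarrow> t \<in> A" for t by auto
  have AN: "shift a V ` A \<subseteq> sources (a + n2) (V + V2)" using fA by (auto simp: sources_add)
  have new: "OutOf (V + V2) = shift a V (OutOf V2)" by (simp add: shift_def)
  show "split_at (V + V2) (FF V V2 g k) (V + v) (shift a V ` A) x = FF V (Suc V2) g (split_at V2 k v A) x"
  proof (cases "x \<in> sources (a + n2) (V + Suc V2)")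
    case False
    then have y: "x \<notin> sources (a + n2) (V + V2)" "x \<noteq> OutOf (V + V2)"
      by (auto simp: sources_Suc)
    then show ?thesis
      using compose_outside[OF g k' match, of x] compose_outside[OF g k match, of x] False AN
      unfolding a_def[symmetric] by (auto simp: split_at_def)
  next
    case True
    then consider "x \<in> sources a V" | t where "t \<in> sources n2 (Suc V2)" "x = shift a V t"
      unfolding sources_add by blast
    then show ?thesis
    proof cases
      case 1
      then have "x \<notin> shift a V ` A" "x \<noteq> OutOf (V + V2)" by auto
      then show ?thesis
        using compose_left[OF g k' match, of x] compose_left[OF g k match, of x] 1
        unfolding a_def[symmetric] by (simp add: split_at_def)
    next
      case 2
      show ?thesis
      proof (cases "t = OutOf V2")
        case True
        then show ?thesis
          using compose_right[OF g k' match 2(1)] 2(2) fA(2) memA[of t] new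
          unfolding a_def[symmetric] by (simp add: split_at_def)
      next
        case False
        then have t: "t \<in> sources n2 V2" using 2 by (simp add: sources_Suc)
        have "x \<noteq> OutOf (V + V2)" unfolding new 2(2) using False by simp
        then show ?thesis
          using compose_right[OF g k' match 2(1)] compose_right[OF g k match t] 2(2) memA[of t] False
          unfolding a_def[symmetric] by (simp add: split_at_def)
      qed
    qed
  qed
qed

end

lemma graph_map_left:
  fixes m1 n1 :: nat
  assumes k: "is_parent m2 n2 V2 k" and match: "b \<or> n1 = m2"
  defines "a \<equiv> if b then n1 else 0" and "M \<equiv> if b then m1 + m2 else m1"
  shows "graph_map m1 n1 M (a + n2) V2 (\<lambda>_ _. True) (\<lambda>V g. compose_parents b m1 n1 n2 V V2 g k)"
proof (rule graph_map.intro)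
  fix V f assume f: "is_parent m1 n1 V f"
  let ?F = "\<lambda>V g. compose_parents b m1 n1 n2 V V2 g k" and ?I = "embed b n2 V V2 k"
  show "is_parent M (a + n2) (V + V2) (?F V f)"
    using is_parent_compose[OF f k match] by (simp add: a_def M_def)
  show "\<exists>\<sigma>'. \<sigma>' permutes {..<V + V2} \<and> sign \<sigma>' = sign \<sigma> \<and> ?F V (relabel \<sigma> f) = relabel \<sigma>' (?F V f)"
    if \<sigma>: "\<sigma> permutes {..<V}" for \<sigma>
    using compose_relabel_left[OF \<sigma>, of b m1 n1 n2 V2 f k] permutes_subset[OF \<sigma>, of "{..<V + V2}"]
    by (intro exI[of _ \<sigma>]) auto
qed simp

lemma graph_map_right:
  fixes m2 n2 :: nat
  assumes g: "is_parent m1 n1 V1 g" and match: "b \<or> n1 = m2"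
  defines "a \<equiv> if b then n1 else 0" and "M \<equiv> if b then m1 + m2 else m1"
  shows "graph_map m2 n2 M (a + n2) V1 (\<lambda>_ _. True) (\<lambda>V f. compose_parents b m1 n1 n2 V1 V g f)"
proof (rule graph_map.intro)
  fix V f assume f: "is_parent m2 n2 V f"
  let ?F = "\<lambda>V f. compose_parents b m1 n1 n2 V1 V g f"
  show "is_parent M (a + n2) (V + V1) (?F V f)"
    using is_parent_compose[OF g f match] by (simp add: a_def M_def add.commute)
  show "\<exists>\<sigma>'. \<sigma>' permutes {..<V + V1} \<and> sign \<sigma>' = sign \<sigma> \<and> ?F V (relabel \<sigma> f) = relabel \<sigma>' (?F V f)"
    if \<sigma>: "\<sigma> permutes {..<V}" for \<sigma>
    using compose_relabel_right[OF g f match \<sigma>] by (metis add.commute)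
qed simp

lemma graph_operation_left:
  fixes m1 n1 :: nat
  assumes k: "is_parent m2 n2 V2 k" and match: "b \<or> n1 = m2"
    and bin: "\<forall>u<V2. card (inputs n2 V2 k u) = 2"
  defines "a \<equiv> if b then n1 else 0" and "M \<equiv> if b then m1 + m2 else m1"
  shows "graph_operation m1 n1 M (a + n2) V2 (\<lambda>_ _. True)
    (\<lambda>V g. compose_parents b m1 n1 n2 V V2 g k) (\<lambda>v. v) (\<lambda>V g. embed b n2 V V2 k) (\<lambda>V. to_end V V2)"
proof -
  have map: "graph_map m1 n1 M (a + n2) V2 (\<lambda>_ _. True) (\<lambda>V g. compose_parents b m1 n1 n2 V V2 g k)"
    unfolding a_def M_def by (rule graph_map_left[OF k match])
  show ?thesis
  proof (rule graph_operation.intro[OF map graph_operation_axioms.intro])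
  fix V f assume f: "is_parent m1 n1 V f"
  let ?F = "\<lambda>V g. compose_parents b m1 n1 n2 V V2 g k" and ?I = "embed b n2 V V2 k"
  show "inj_on ?I (\<Union>v<V. inputs n1 V f v)"
    by (rule inj_on_subset[OF embed_inj[OF f k match]]) (auto simp: inputs_def)
  show "inputs (a + n2) (V + V2) (?F V f) v = ?I ` inputs n1 V f v" if "v < V" for v
    using inputs_compose_left[OF f k match that] by (simp add: a_def)
  show "card (inputs (a + n2) (V + V2) (?F V f) u) = 2" if u: "u < V + V2" "u \<notin> (\<lambda>v. v) ` {..<V}" for u
  proof -
    obtain w where w: "u = V + w" "w < V2" using u by (metis add_diff_inverse_nat image_eqI lessThan_iff nat_add_left_cancel_less)
    then show ?thesis
      using inputs_compose_right[OF f k match, of w] bin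
      by (simp add: a_def card_image inj_on_subset[OF inj_shift])
  qed
  show "split_at (V + V2) (?F V f) v (?I ` A) = relabel (to_end V V2) (?F (Suc V) (split_at V f v A))"
    if "(v, A) \<in> splittings n1 V f" for v A
    by (rule compose_split_left[OF f k match that])
next
  show "int (a + n2) - int M = int n1 - int m1 + int V2"
    using binary_iff_top_degree[OF k] bin match by (auto simp: a_def M_def)
  show "to_end V V2 permutes {..<Suc V + V2}" for V by (rule to_end_permutes)
qed simp_all
qed

lemma graph_operation_right:
  fixes m2 n2 :: nat
  assumes g: "is_parent m1 n1 V1 g" and match: "b \<or> n1 = m2"
    and bin: "\<forall>u<V1. card (inputs n1 V1 g u) = 2"
  defines "a \<equiv> if b then n1 else 0" and "M \<equiv> if b then m1 + m2 else m1"
  shows "graph_operation m2 n2 M (a + n2) V1 (\<lambda>_ _. True)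
    (\<lambda>V f. compose_parents b m1 n1 n2 V1 V g f) (\<lambda>v. V1 + v) (\<lambda>V f. shift a V1) (\<lambda>V. id)"
proof -
  have map: "graph_map m2 n2 M (a + n2) V1 (\<lambda>_ _. True) (\<lambda>V f. compose_parents b m1 n1 n2 V1 V g f)"
    unfolding a_def M_def by (rule graph_map_right[OF g match])
  show ?thesis
  proof (rule graph_operation.intro[OF map graph_operation_axioms.intro])
  fix V f assume f: "is_parent m2 n2 V f"
  let ?F = "\<lambda>V f. compose_parents b m1 n1 n2 V1 V g f"
  show "inj_on (shift a V1) (\<Union>v<V. inputs n2 V f v)"
    by (rule inj_on_subset[OF inj_shift]) simp
  show "inputs (a + n2) (V + V1) (?F V f) (V1 + v) = shift a V1 ` inputs n2 V f v" if "v < V" for v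
    using inputs_compose_right[OF g f match, of v] by (simp add: a_def add.commute[of V V1])
  show "card (inputs (a + n2) (V + V1) (?F V f) u) = 2" if u: "u < V + V1" "u \<notin> (\<lambda>v. V1 + v) ` {..<V}" for u
  proof -
    have uV: "u < V1"
    proof (rule ccontr)
      assume "\<not> u < V1"
      then have "u = V1 + (u - V1)" "u - V1 < V" using u by simp_all
      then show False using u(2) by blast
    qed
    have "card (embed b n2 V1 V f ` inputs n1 V1 g u) = card (inputs n1 V1 g u)"
      by (rule card_image[OF inj_on_subset[OF embed_inj[OF g f match] inputs_subset]])
    then show ?thesis
      using inputs_compose_left[OF g f match uV] bin uV by (simp add: a_def add.commute[of V V1])
  qed
  show "split_at (V + V1) (?F V f) (V1 + v) (shift a V1 ` A) = relabel id (?F (Suc V) (split_at V f v A))"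
    if "(v, A) \<in> splittings n2 V f" for v A
    using compose_split_right[OF g f match that] by (simp add: a_def add.commute[of V V1])
next
  show "int (a + n2) - int M = int n2 - int m2 + int V1"
    using binary_iff_top_degree[OF g] bin match by (auto simp: a_def M_def)
qed (simp_all add: permutes_id inj_def)
qed

section \<open>Compositions of graphs\<close>

lemma nverts_hcomp [simp]: "nverts (hcomp_graph m n G K) = nverts G + nverts K"
  by (simp add: hcomp_graph_def)

lemma nverts_vcomp [simp]: "nverts (vcomp_graph G K) = nverts G + nverts K"
  by (simp add: vcomp_graph_def)

lemma mset_sources_add:
  "mset_set (sources (a + n) (V + V2)) =
     mset_set (sources a V) + image_mset (shift a V) (mset_set (sources n V2))"
proof -
  have "mset_set (sources a V \<union> shift a V ` sources n V2) =
      mset_set (sources a V) + mset_set (shift a V ` sources n V2)"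
    by (rule mset_set_Union) auto
  then show ?thesis
    by (simp add: sources_add image_mset_mset_set inj_on_subset[OF inj_shift])
qed

lemma hcomp_encodes:
  assumes G: "G \<in> W m n" and K: "K \<in> W p q"
  shows "encodes (n + q) (hcomp_graph m n G K)
    (compose_parents True m n q (nverts G) (nverts K) (parent n G) (parent q K))"
proof -
  let ?F = "compose_parents True m n q (nverts G) (nverts K) (parent n G) (parent q K)"
  note eG = W_encodes(1)[OF G, unfolded encodes_def] and eK = W_encodes(1)[OF K, unfolded encodes_def]
  let ?h = "\<lambda>(s, t). (case s of InLeg i \<Rightarrow> InLeg (n + i) | OutOf v \<Rightarrow> OutOf (nverts G + v),
      case t of OutLeg j \<Rightarrow> OutLeg (m + j) | Into v \<Rightarrow> Into (nverts G + v))"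
  have right: "?h (t, parent q K t) = (shift n (nverts G) t, ?F (shift n (nverts G) t))"
    if t: "t \<in> sources q (nverts K)" for t
    using compose_right[OF W_encodes(2)[OF G] W_encodes(2)[OF K], where b=True, simplified, OF t]
    by (auto simp: shift_def split: source.splits target.splits)
  have "mset (edges (hcomp_graph m n G K)) =
      image_mset (\<lambda>s. (s, parent n G s)) (mset_set (sources n (nverts G))) +
      image_mset (\<lambda>t. (shift n (nverts G) t, ?F (shift n (nverts G) t))) (mset_set (sources q (nverts K)))"
    unfolding hcomp_graph_def dgraph.sel mset_append mset_map eG eK image_mset.compositionality
    by (intro arg_cong2[where f="(+)"] refl image_mset_cong) (use right in auto)
  also have "image_mset (\<lambda>s. (s, parent n G s)) (mset_set (sources n (nverts G))) =
      image_mset (\<lambda>s. (s, ?F s)) (mset_set (sources n (nverts G)))"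
    by (rule image_mset_cong) (simp add: compose_parents_def)
  finally show ?thesis
    by (simp add: encodes_def mset_sources_add image_mset.compositionality comp_def)
qed

lemma vcomp_encodes:
  assumes G: "G \<in> W l m" and K: "K \<in> W m n"
  shows "encodes n (vcomp_graph G K)
    (compose_parents False l m n (nverts G) (nverts K) (parent m G) (parent n K))"
proof -
  let ?F = "compose_parents False l m n (nverts G) (nverts K) (parent m G) (parent n K)"
  let ?h = "\<lambda>(s, t). (map_source (\<lambda>v. nverts G + v) s,
      case t of OutLeg j \<Rightarrow> the (map_of (edges G) (InLeg j)) | Into v \<Rightarrow> Into (nverts G + v))"
  note eG = W_encodes(1)[OF G, unfolded encodes_def] and eK = W_encodes(1)[OF K, unfolded encodes_def]
  note pK = W_encodes(2)[OF K]
  have h: "?h (t, parent n K t) = (shift 0 (nverts G) t, ?F (shift 0 (nverts G) t))"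
    if t: "t \<in> sources n (nverts K)" for t
  proof -
    have leg: "the (map_of (edges G) (InLeg j)) = parent m G (InLeg j)" if "parent n K t = OutLeg j" for j
    proof -
      have "j < m" using pK t that by (fastforce simp: is_parent_def)
      then show ?thesis by (simp add: parent_def)
    qed
    have "map_source (\<lambda>v. nverts G + v) t = shift 0 (nverts G) t"
      by (cases t) (auto simp: shift_def)
    then show ?thesis
      using compose_right[OF W_encodes(2)[OF G] pK, where b=False, simplified, OF t] leg
      by (auto split: target.splits)
  qed
  have S: "{s \<in> sources m (nverts G). \<exists>v. s = OutOf v} = sources 0 (nverts G)"
    by (auto simp: sources_def)
  have "mset (filter (\<lambda>(s, t). \<exists>v. s = OutOf v) (edges G)) =
      image_mset (\<lambda>s. (s, parent m G s)) (mset_set {s \<in> sources m (nverts G). \<exists>v. s = OutOf v})"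
    unfolding mset_filter eG by (simp add: filter_mset_image_mset comp_def filter_mset_mset_set)
  also have "\<dots> = image_mset (\<lambda>s. (s, ?F s)) (mset_set (sources 0 (nverts G)))"
    unfolding S by (rule image_mset_cong) (simp add: compose_parents_def)
  finally have 1: "mset (filter (\<lambda>(s, t). \<exists>v. s = OutOf v) (edges G)) =
      image_mset (\<lambda>s. (s, ?F s)) (mset_set (sources 0 (nverts G)))" .
  have 2: "mset (map ?h (edges K)) = image_mset (\<lambda>s. (s, ?F s))
      (image_mset (shift 0 (nverts G)) (mset_set (sources n (nverts K))))"
    unfolding mset_map eK image_mset.compositionality
    by (rule image_mset_cong) (use h in auto)
  show ?thesis
    using 1 2 mset_sources_add[of 0 n "nverts G" "nverts K"]
    by (simp add: encodes_def vcomp_graph_def add.commute)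
qed

section \<open>Ideals are made of coinvariants and boundaries\<close>

definition comp_graph :: "bool \<Rightarrow> nat \<Rightarrow> nat \<Rightarrow> dgraph \<Rightarrow> dgraph \<Rightarrow> dgraph" where
  "comp_graph b m n G K = (if b then hcomp_graph m n G K else vcomp_graph G K)"

definition comp_outs :: "bool \<Rightarrow> nat \<Rightarrow> nat \<Rightarrow> nat" where
  "comp_outs b m1 m2 = (if b then m1 + m2 else m1)"

definition comp_ins :: "bool \<Rightarrow> nat \<Rightarrow> nat \<Rightarrow> nat" where
  "comp_ins b n1 n2 = (if b then n1 else 0) + n2"

lemma nverts_comp_graph [simp]: "nverts (comp_graph b m n G K) = nverts G + nverts K"
  by (simp add: comp_graph_def)

lemma comp_encodes:
  assumes G: "G \<in> W m1 n1" and K: "K \<in> W m2 n2" and match: "b \<or> n1 = m2"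
  shows "encodes (comp_ins b n1 n2) (comp_graph b m1 n1 G K)
      (compose_parents b m1 n1 n2 (nverts G) (nverts K) (parent n1 G) (parent n2 K))"
    and "is_parent (comp_outs b m1 m2) (comp_ins b n1 n2) (nverts G + nverts K)
      (compose_parents b m1 n1 n2 (nverts G) (nverts K) (parent n1 G) (parent n2 K))"
  using hcomp_encodes[OF G K] vcomp_encodes[of G m1 n1 K n2] G K match
    is_parent_compose[OF W_encodes(2)[OF G] W_encodes(2)[OF K] match]
  by (cases b; simp add: comp_ins_def comp_outs_def comp_graph_def)+

lemma comp_in_W:
  assumes "G \<in> W m1 n1" "K \<in> W m2 n2" "b \<or> n1 = m2"
  shows "comp_graph b m1 n1 G K \<in> W (comp_outs b m1 m2) (comp_ins b n1 n2)"
  using encodes_in_W[OF comp_encodes(1)[OF assms]] comp_encodes(2)[OF assms] by simp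

lemma comp_pgen_cong:
  assumes "G \<in> W m1 n1" "K \<in> W m2 n2" "b \<or> n1 = m2"
  shows "cong_mod (C (comp_outs b m1 m2) (comp_ins b n1 n2)) (fgen (comp_graph b m1 n1 G K))
      (pgen (comp_ins b n1 n2) (nverts G + nverts K)
        (compose_parents b m1 n1 n2 (nverts G) (nverts K) (parent n1 G) (parent n2 K)))"
  using cong_pgen[OF comp_encodes(1)[OF assms]] comp_encodes(2)[OF assms] by simp

lemma parent_comp:
  assumes "G \<in> W m1 n1" "K \<in> W m2 n2" "b \<or> n1 = m2"
  shows "parent (comp_ins b n1 n2) (comp_graph b m1 n1 G K) =
    compose_parents b m1 n1 n2 (nverts G) (nverts K) (parent n1 G) (parent n2 K)"
  using parent_eq[OF comp_encodes(1)[OF assms]] comp_encodes(2)[OF assms] by simp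

abbreviation comp_left :: "bool \<Rightarrow> nat \<Rightarrow> nat \<Rightarrow> dgraph \<Rightarrow> (dgraph \<Rightarrow>\<^sub>0 'k::field) \<Rightarrow> (dgraph \<Rightarrow>\<^sub>0 'k)" where
  "comp_left b m n K \<equiv> lin_ext (\<lambda>G. fgen (comp_graph b m n G K))"

abbreviation comp_right :: "bool \<Rightarrow> nat \<Rightarrow> nat \<Rightarrow> dgraph \<Rightarrow> (dgraph \<Rightarrow>\<^sub>0 'k::field) \<Rightarrow> (dgraph \<Rightarrow>\<^sub>0 'k)" where
  "comp_right b m n G \<equiv> lin_ext (\<lambda>K. fgen (comp_graph b m n G K))"

lemma comp_left_in_C:
  assumes K: "K \<in> W m2 n2" and match: "b \<or> n1 = m2" and x: "x \<in> C m1 n1"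
  shows "comp_left b m1 n1 K x \<in> (C (comp_outs b m1 m2) (comp_ins b n1 n2) :: (dgraph \<Rightarrow>\<^sub>0 'k::field) set)"
proof -
  interpret graph_map m1 n1 "comp_outs b m1 m2" "comp_ins b n1 n2" "nverts K" "\<lambda>_ _. True"
      "\<lambda>V g. compose_parents b m1 n1 n2 V (nverts K) g (parent n2 K)"
    unfolding comp_outs_def comp_ins_def by (rule graph_map_left[OF W_encodes(2)[OF K] match])
  have "cong_mod (C (comp_outs b m1 m2) (comp_ins b n1 n2)) (comp_left b m1 n1 K x) (op x)"
    unfolding op_def
    by (rule lin_ext_cong_mod[OF subspace_coinv_rels subsetD[OF coinv_rels_subset x]])
       (simp add: op_graph_def comp_pgen_cong[OF _ K match])
  then show ?thesis by (rule cong_mod_in[OF subspace_coinv_rels]) (rule op_in_C[OF x])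
qed

lemma comp_right_in_C:
  assumes G: "G \<in> W m1 n1" and match: "b \<or> n1 = m2" and x: "x \<in> C m2 n2"
  shows "comp_right b m1 n1 G x \<in> (C (comp_outs b m1 m2) (comp_ins b n1 n2) :: (dgraph \<Rightarrow>\<^sub>0 'k::field) set)"
proof -
  interpret graph_map m2 n2 "comp_outs b m1 m2" "comp_ins b n1 n2" "nverts G" "\<lambda>_ _. True"
      "\<lambda>V f. compose_parents b m1 n1 n2 (nverts G) V (parent n1 G) f"
    unfolding comp_outs_def comp_ins_def by (rule graph_map_right[OF W_encodes(2)[OF G] match])
  have "cong_mod (C (comp_outs b m1 m2) (comp_ins b n1 n2)) (comp_right b m1 n1 G x) (op x)"
    unfolding op_def
    by (rule lin_ext_cong_mod[OF subspace_coinv_rels subsetD[OF coinv_rels_subset x]])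
       (simp add: op_graph_def comp_pgen_cong[OF G _ match] add.commute[of _ "nverts G"])
  then show ?thesis by (rule cong_mod_in[OF subspace_coinv_rels]) (rule op_in_C[OF x])
qed

lemma binary_parent:
  assumes "K \<in> wheeled_graphs lie_arities m n"
  shows "K \<in> W m n" "\<forall>u<nverts K. card (inputs n (nverts K) (parent n K) u) = 2"
  using assms by (auto simp: binary_in_W_iff)

lemma comp_left_boundaries:
  assumes K: "K \<in> wheeled_graphs lie_arities m2 n2" and match: "b \<or> n1 = m2"
  shows "x \<in> top_boundaries m1 n1 \<Longrightarrow> comp_left b m1 n1 K x \<in>
      (top_boundaries (comp_outs b m1 m2) (comp_ins b n1 n2) :: (dgraph \<Rightarrow>\<^sub>0 'k::field) set)"
    and "G \<in> W m1 n1 \<Longrightarrow> \<exists>s. cong_mod (C (comp_outs b m1 m2) (comp_ins b n1 n2))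
      (lie_inf_diff (fgen (comp_graph b m1 n1 G K)))
      (fscale s (comp_left b m1 n1 K (lie_inf_diff (fgen G))) :: dgraph \<Rightarrow>\<^sub>0 'k::field)"
proof -
  note KW = binary_parent[OF K]
  interpret graph_operation m1 n1 "comp_outs b m1 m2" "comp_ins b n1 n2" "nverts K" "\<lambda>_ _. True"
      "\<lambda>V g. compose_parents b m1 n1 n2 V (nverts K) g (parent n2 K)" "\<lambda>v. v"
      "\<lambda>V g. embed b n2 V (nverts K) (parent n2 K)" "\<lambda>V. to_end V (nverts K)"
    unfolding comp_outs_def comp_ins_def
    by (rule graph_operation_left[OF W_encodes(2)[OF KW(1)] match KW(2)])
  have op: "cong_mod (C (comp_outs b m1 m2) (comp_ins b n1 n2)) (comp_left b m1 n1 K x) (op x :: dgraph \<Rightarrow>\<^sub>0 'k)"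
    if "x \<in> graph_span (W m1 n1)" for x
    unfolding op_def
    by (rule lin_ext_cong_mod[OF subspace_coinv_rels that])
       (simp add: op_graph_def comp_pgen_cong[OF _ KW(1) match])
  show "comp_left b m1 n1 K x \<in> (top_boundaries (comp_outs b m1 m2) (comp_ins b n1 n2) :: (dgraph \<Rightarrow>\<^sub>0 'k) set)"
    if "x \<in> top_boundaries m1 n1"
    by (rule top_boundaries_cong[OF op op_top_boundaries[OF that]]) (use that top_boundaries_subset in blast)
  assume G: "G \<in> W m1 n1"
  have "cong_mod (C (comp_outs b m1 m2) (comp_ins b n1 n2))
      (lie_inf_diff (fgen (comp_graph b m1 n1 G K))) (lie_inf_diff (op (fgen G)) :: dgraph \<Rightarrow>\<^sub>0 'k)"
    using diff_cong[OF op[of "fgen G"]] G by simp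
  also have "cong_mod (C (comp_outs b m1 m2) (comp_ins b n1 n2)) (lie_inf_diff (op (fgen G)))
      (fscale ((-1) ^ nverts K * fsign (to_end (nverts G) (nverts K))) (op (lie_inf_diff (fgen G))) :: dgraph \<Rightarrow>\<^sub>0 'k)"
    by (rule diff_op) (simp add: G)
  also have "cong_mod (C (comp_outs b m1 m2) (comp_ins b n1 n2)) \<dots>
      (fscale ((-1) ^ nverts K * fsign (to_end (nverts G) (nverts K))) (comp_left b m1 n1 K (lie_inf_diff (fgen G))))"
  proof (rule cong_mod_scale[OF subspace_coinv_rels cong_mod_sym[OF subspace_coinv_rels op]])
    have "lie_inf_diff (fgen G) \<in> graph_span (graphs_deg m1 n1 (int (nverts G) + 1))"
      by (rule diff_graph_span) (simp add: G)
    then show "lie_inf_diff (fgen G) \<in> graph_span (W m1 n1)"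
      using graph_span_mono[of "graphs_deg m1 n1 (int (nverts G) + 1)" "W m1 n1"] by auto
  qed
  finally show "\<exists>s. cong_mod (C (comp_outs b m1 m2) (comp_ins b n1 n2))
      (lie_inf_diff (fgen (comp_graph b m1 n1 G K)))
      (fscale s (comp_left b m1 n1 K (lie_inf_diff (fgen G))) :: dgraph \<Rightarrow>\<^sub>0 'k)" by blast
qed

lemma comp_right_boundaries:
  assumes G: "G \<in> wheeled_graphs lie_arities m1 n1" and match: "b \<or> n1 = m2"
  shows "x \<in> top_boundaries m2 n2 \<Longrightarrow> comp_right b m1 n1 G x \<in>
      (top_boundaries (comp_outs b m1 m2) (comp_ins b n1 n2) :: (dgraph \<Rightarrow>\<^sub>0 'k::field) set)"
    and "K \<in> W m2 n2 \<Longrightarrow> \<exists>s. cong_mod (C (comp_outs b m1 m2) (comp_ins b n1 n2))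
      (lie_inf_diff (fgen (comp_graph b m1 n1 G K)))
      (fscale s (comp_right b m1 n1 G (lie_inf_diff (fgen K))) :: dgraph \<Rightarrow>\<^sub>0 'k::field)"
proof -
  note GW = binary_parent[OF G]
  interpret graph_operation m2 n2 "comp_outs b m1 m2" "comp_ins b n1 n2" "nverts G" "\<lambda>_ _. True"
      "\<lambda>V f. compose_parents b m1 n1 n2 (nverts G) V (parent n1 G) f" "\<lambda>v. nverts G + v"
      "\<lambda>V f. shift (if b then n1 else 0) (nverts G)" "\<lambda>V. id"
    unfolding comp_outs_def comp_ins_def
    by (rule graph_operation_right[OF W_encodes(2)[OF GW(1)] match GW(2)])
  have op: "cong_mod (C (comp_outs b m1 m2) (comp_ins b n1 n2)) (comp_right b m1 n1 G x) (op x :: dgraph \<Rightarrow>\<^sub>0 'k)"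
    if "x \<in> graph_span (W m2 n2)" for x
    unfolding op_def
    by (rule lin_ext_cong_mod[OF subspace_coinv_rels that])
       (simp add: op_graph_def comp_pgen_cong[OF GW(1) _ match] add.commute[of _ "nverts G"])
  show "comp_right b m1 n1 G x \<in> (top_boundaries (comp_outs b m1 m2) (comp_ins b n1 n2) :: (dgraph \<Rightarrow>\<^sub>0 'k) set)"
    if "x \<in> top_boundaries m2 n2"
    by (rule top_boundaries_cong[OF op op_top_boundaries[OF that]]) (use that top_boundaries_subset in blast)
  assume K: "K \<in> W m2 n2"
  have "cong_mod (C (comp_outs b m1 m2) (comp_ins b n1 n2))
      (lie_inf_diff (fgen (comp_graph b m1 n1 G K))) (lie_inf_diff (op (fgen K)) :: dgraph \<Rightarrow>\<^sub>0 'k)"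
    using diff_cong[OF op[of "fgen K"]] K by simp
  also have "cong_mod (C (comp_outs b m1 m2) (comp_ins b n1 n2)) (lie_inf_diff (op (fgen K)))
      (fscale ((-1) ^ nverts G * fsign id) (op (lie_inf_diff (fgen K))) :: dgraph \<Rightarrow>\<^sub>0 'k)"
    by (rule diff_op) (simp add: K)
  also have "cong_mod (C (comp_outs b m1 m2) (comp_ins b n1 n2)) \<dots>
      (fscale ((-1) ^ nverts G * fsign id) (comp_right b m1 n1 G (lie_inf_diff (fgen K))))"
  proof (rule cong_mod_scale[OF subspace_coinv_rels cong_mod_sym[OF subspace_coinv_rels op]])
    have "lie_inf_diff (fgen K) \<in> graph_span (graphs_deg m2 n2 (int (nverts K) + 1))"
      by (rule diff_graph_span) (simp add: K)
    then show "lie_inf_diff (fgen K) \<in> graph_span (W m2 n2)"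
      using graph_span_mono[of "graphs_deg m2 n2 (int (nverts K) + 1)" "W m2 n2"] by auto
  qed
  finally show "\<exists>s. cong_mod (C (comp_outs b m1 m2) (comp_ins b n1 n2))
      (lie_inf_diff (fgen (comp_graph b m1 n1 G K)))
      (fscale s (comp_right b m1 n1 G (lie_inf_diff (fgen K))) :: dgraph \<Rightarrow>\<^sub>0 'k)" by blast
qed

lemma bilin_ext_right: "bilin_ext f x y = lin_ext (\<lambda>h. lin_ext (\<lambda>g. fgen (f g h)) x) y"
  unfolding bilin_ext_def lin_ext_def fvs.scale_sum_right
  by (subst sum.swap) (simp add: mult.commute)

lemma bilin_ext_left: "bilin_ext f x y = lin_ext (\<lambda>g. lin_ext (\<lambda>h. fgen (f g h)) y) x"
  by (simp add: bilin_ext_def)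

lemma coinv_rels_mono: "S \<subseteq> T \<Longrightarrow> coinv_rels S \<subseteq> coinv_rels T"
  unfolding coinv_rels_def by (rule fvs.span_mono) blast

lemma wheeled_graphs_mono: "T \<subseteq> T' \<Longrightarrow> wheeled_graphs T m n \<subseteq> wheeled_graphs T' m n"
  by (auto simp: wheeled_graphs_def)

text \<open>A family of subspaces closed under the compositions contains the ideal that its members generate.\<close>

lemma prop_ideal_subset:
  fixes Q :: "nat \<Rightarrow> nat \<Rightarrow> (dgraph \<Rightarrow>\<^sub>0 'k::field) set"
  assumes Q: "\<And>m n. fvs.subspace (Q m n)" and CQ: "\<And>m n. C m n \<subseteq> Q m n"
    and T: "T \<subseteq> lie_inf_arities" and I: "\<And>m n. I m n \<subseteq> Q m n"
    and left: "\<And>b m1 n1 m2 n2 x K. b \<or> n1 = m2 \<Longrightarrow> x \<in> Q m1 n1 \<Longrightarrow> K \<in> wheeled_graphs T m2 n2 \<Longrightarrow>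
      comp_left b m1 n1 K x \<in> Q (comp_outs b m1 m2) (comp_ins b n1 n2)"
    and right: "\<And>b m1 n1 m2 n2 x G. b \<or> n1 = m2 \<Longrightarrow> x \<in> Q m2 n2 \<Longrightarrow> G \<in> wheeled_graphs T m1 n1 \<Longrightarrow>
      comp_right b m1 n1 G x \<in> Q (comp_outs b m1 m2) (comp_ins b n1 n2)"
  shows "prop_ideal T I m n x \<Longrightarrow> x \<in> Q m n"
proof (induction rule: prop_ideal.induct)
  case (generator x m n)
  then show ?case using I by blast
next
  case (coinvariance x m n)
  have "wheel_free_graphs T m n \<subseteq> W m n"
    using wheeled_graphs_mono[OF T] by (auto simp: wheel_free_graphs_def)
  then show ?case using coinvariance CQ coinv_rels_mono by blast
next
  case (add m n x y)
  then show ?case by (intro fvs.subspace_add[OF Q])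
next
  case (scale m n x c)
  then show ?case by (intro fvs.subspace_scale[OF Q])
next
  case (hcomp_left m n x y p q)
  show ?case unfolding bilin_ext_right
    by (rule lin_ext_in_subspace[OF Q hcomp_left(2)])
       (use left[of True n p x m] hcomp_left(3) in
         \<open>auto simp: comp_graph_def comp_outs_def comp_ins_def wheel_free_graphs_def\<close>)
next
  case (hcomp_right x m n p q y)
  show ?case unfolding bilin_ext_left
    by (rule lin_ext_in_subspace[OF Q hcomp_right(1)])
       (use right[of True n p y q] hcomp_right(3) in
         \<open>auto simp: comp_graph_def comp_outs_def comp_ins_def wheel_free_graphs_def\<close>)
next
  case (vcomp_left l m x y n)
  show ?case unfolding bilin_ext_right
    by (rule lin_ext_in_subspace[OF Q vcomp_left(2)])
       (use left[of False m m x l] vcomp_left(3) in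
         \<open>auto simp: comp_graph_def comp_outs_def comp_ins_def wheel_free_graphs_def\<close>)
next
  case (vcomp_right x l m n y)
  show ?case unfolding bilin_ext_left
    by (rule lin_ext_in_subspace[OF Q vcomp_right(1)])
       (use right[of False m m y n] vcomp_right(3) in
         \<open>auto simp: comp_graph_def comp_outs_def comp_ins_def wheel_free_graphs_def\<close>)
qed

lemma prop_ideal_empty: "prop_ideal lie_inf_arities (\<lambda>_ _. {}) m n x \<Longrightarrow> x \<in> C m n"
  by (rule prop_ideal_subset[where Q="\<lambda>m n. C m n"])
     (simp_all add: comp_left_in_C comp_right_in_C)

definition corolla3 :: dgraph where
  "corolla3 = DGraph 1 [(OutOf 0, OutLeg 0), (InLeg 0, Into 0), (InLeg 1, Into 0), (InLeg 2, Into 0)]"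

text \<open>
  Only the order of the edges differs, and this is immaterial in the coinvariants.
\<close>

lemma W_edge_order:
  assumes G: "G \<in> W m n" and H: "nverts H = nverts G" "mset (edges H) = mset (edges G)"
  shows "H \<in> W m n" "cong_mod (C m n) (fgen H) (fgen G)"
proof -
  have "encodes n H (parent n G)" using W_encodes(1)[OF G] H by (simp add: encodes_def)
  then show HW: "H \<in> W m n" using encodes_in_W[of n H] W_encodes(2)[OF G] H by simp
  have "graph_iso id G H"
    using H by (simp add: graph_iso_def permutes_id source.map_id0 target.map_id0 map_prod.id)
  from cong_iso[OF G HW this] show "cong_mod (C m n) (fgen H) (fgen G)" by simp
qed

lemma corolla3_in_W: "corolla3 \<in> W 1 3"
proof -
  let ?f = "\<lambda>s. if s \<in> {InLeg 0, InLeg 1, InLeg 2} then Into 0 else OutLeg 0 :: nat target"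
  have S: "sources 3 1 = {OutOf 0, InLeg 0, InLeg 1, InLeg 2}"
    by (auto simp: sources_def numeral_3_eq_3 less_Suc_eq)
  have "encodes 3 corolla3 ?f" by (simp add: encodes_def corolla3_def S[simplified])
  moreover have "is_parent 1 3 1 ?f"
  proof -
    have "inputs 3 1 ?f 0 = {InLeg 0, InLeg 1, InLeg 2}" unfolding inputs_def S by auto
    then have "card (inputs 3 1 ?f 0) = 3" by simp
    then show ?thesis unfolding is_parent_def S by (auto simp: less_Suc_eq)
  qed
  ultimately show ?thesis using encodes_in_W[of 3 corolla3 ?f 1] by (simp add: corolla3_def)
qed

text \<open>
  The three splittings of the ternary corolla, one for each pair of inputs, are the three trees of
  the Jacobi relation.
\<close>

lemma diff_corolla3:
  "cong_mod (C 1 3) (jacobi :: dgraph \<Rightarrow>\<^sub>0 'k::field) (lie_inf_diff (fgen corolla3))"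
proof -
  have In: "In_edges corolla3 0 = {1, 2, 3}"
  proof (intro set_eqI iffI)
    fix e assume e: "e \<in> In_edges corolla3 0"
    then have "e < 4" by (simp add: In_edges_def corolla3_def)
    then have "e = 0 \<or> e = 1 \<or> e = 2 \<or> e = 3" by linarith
    then show "e \<in> {1, 2, 3}"
      using e by (elim disjE) (simp_all add: In_edges_def corolla3_def)
  next
    fix e :: nat assume "e \<in> {1, 2, 3}"
    then have "e = 1 \<or> e = 2 \<or> e = 3" by simp
    then show "e \<in> In_edges corolla3 0"
      by (elim disjE) (simp_all add: In_edges_def corolla3_def)
  qed
  let ?Js = "{J. J \<subseteq> In_edges corolla3 0 \<and> 2 \<le> card J \<and> 1 \<le> card (In_edges corolla3 0 - J)}"
  have Js: "?Js = {{1, 2}, {2, 3}, {1, 3}}"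
  proof (intro set_eqI iffI)
    fix J assume "J \<in> ?Js"
    then have J: "J \<subseteq> {1, 2, 3}" "2 \<le> card J" "1 \<le> card ({1, 2, 3} - J)" by (simp_all only: In mem_Collect_eq)
    then have "{1, 2, 3} - J \<noteq> {}" by (metis card.empty not_one_le_zero)
    then obtain x where x: "x \<in> {1, 2, 3}" "x \<notin> J" by blast
    have "card ({1, 2, 3} - {x}) = 2" using x(1) by (simp add: card_Diff_singleton)
    then have "J = {1, 2, 3} - {x}"
      using J(1,2) x(2) by (intro card_seteq) auto
    moreover have "x = 1 \<or> x = 2 \<or> x = 3" using x(1) by simp
    ultimately show "J \<in> {{1, 2}, {2, 3}, {1, 3}}"
      by (elim disjE) (simp_all add: insert_Diff_if)
  next
    fix J :: "nat set" assume "J \<in> {{1, 2}, {2, 3}, {1, 3}}"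
    then have "J = {1, 2} \<or> J = {2, 3} \<or> J = {1, 3}" by simp
    then show "J \<in> ?Js" unfolding In
      by (elim disjE) (simp_all add: insert_Diff_if)
  qed
  have d: "lie_inf_diff (fgen corolla3) = fgen (split_vertex corolla3 0 {1, 2}) +
      fgen (split_vertex corolla3 0 {2, 3}) + (fgen (split_vertex corolla3 0 {1, 3}) :: dgraph \<Rightarrow>\<^sub>0 'k)"
  proof -
    have "lie_inf_diff (fgen corolla3) = (\<Sum>J\<in>?Js. fgen (split_vertex corolla3 0 J) :: dgraph \<Rightarrow>\<^sub>0 'k)"
      by (simp add: diff_fgen lie_inf_diff_graph_def) (simp add: corolla3_def)
    then show ?thesis unfolding Js by (simp add: doubleton_eq_iff add.assoc)
  qed
  have sp: "split_vertex corolla3 0 J \<in> W 1 3" if "J \<in> ?Js" for J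
    by (rule split_vertex_in_W[OF corolla3_in_W]) (use that in \<open>auto simp: corolla3_def\<close>)
  have c: "cong_mod (C 1 3) (fgen (bracket_tree a b c)) (fgen (split_vertex corolla3 0 J) :: dgraph \<Rightarrow>\<^sub>0 'k)"
    if "J \<in> ?Js" "mset (edges (bracket_tree a b c)) = mset (edges (split_vertex corolla3 0 J))" for a b c J
    by (rule W_edge_order(2)[OF sp[OF that(1)] _ that(2)]) (simp add: bracket_tree_def corolla3_def)
  show ?thesis unfolding jacobi_def d
    by (intro cong_mod_add subspace_coinv_rels c; (unfold Js)?)
       (simp_all add: bracket_tree_def split_vertex_def corolla3_def upt_rec numeral_eq_Suc)
qed

lemma jacobi_in_top_boundaries: "jacobi \<in> top_boundaries 1 3"
  unfolding top_boundaries_def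
  using diff_corolla3 corolla3_in_W
  by (intro CollectI bexI[of _ "fgen corolla3"]) (simp_all add: corolla3_def)

lemma prop_ideal_jacobi: "prop_ideal lie_arities jacobi_relations m n x \<Longrightarrow> x \<in> top_boundaries m n"
proof (rule prop_ideal_subset[where Q=top_boundaries and T=lie_arities and I=jacobi_relations])
  show "lie_arities \<subseteq> lie_inf_arities" by (auto simp: lie_arities_def lie_inf_arities_def)
  show "jacobi_relations m n \<subseteq> top_boundaries m n" for m n
    by (simp add: jacobi_relations_def jacobi_in_top_boundaries[simplified])
qed (simp_all add: C_subset_top_boundaries comp_left_boundaries(1) comp_right_boundaries(1))

section \<open>Closing a pair of legs\<close>

text \<open>
  Joining output leg \<open>m\<close> to input leg \<open>n\<close> is restricted to graphs in which
  both edges have a vertex at their other end. This excludes the circle that arises from an edge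
  between the two legs, and it holds for graphs obtained by breaking an edge between vertices.
\<close>

definition closable :: "nat \<Rightarrow> nat \<Rightarrow> nat \<Rightarrow> (nat source \<Rightarrow> nat target) \<Rightarrow> bool" where
  "closable m n V f \<longleftrightarrow> (\<exists>v. f (InLeg n) = Into v) \<and> (\<exists>u<V. f (OutOf u) = OutLeg m)"

definition close_parent :: "nat \<Rightarrow> nat \<Rightarrow> nat \<Rightarrow> (nat source \<Rightarrow> nat target) \<Rightarrow> nat source \<Rightarrow> nat target" where
  "close_parent m n V f s =
     (if s \<in> sources n V then if f s = OutLeg m then f (InLeg n) else f s else OutLeg 0)"

text \<open>
  The input leg \<open>n\<close> disappears, and its edge is continued by the one that ended at
  output leg \<open>m\<close>.
\<close>

definition close_source :: "nat \<Rightarrow> nat \<Rightarrow> nat \<Rightarrow> (nat source \<Rightarrow> nat target) \<Rightarrow> nat source \<Rightarrow> nat source" where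
  "close_source m n V f s = (if s = InLeg n then producer (Suc n) V f m else s)"

lemma sources_Suc_leg: "sources (Suc n) V = insert (InLeg n) (sources n V)"
  by (auto simp: sources_def lessThan_Suc)

context
  fixes m n V f u w
  assumes f: "is_parent (Suc m) (Suc n) V f" and u: "u < V" "f (OutOf u) = OutLeg m"
    and w: "f (InLeg n) = Into w"
begin

lemma producer_closable: "producer (Suc n) V f m = OutOf u"
  by (rule producer_eqI[OF f]) (use u in auto)

lemma close_unique: "s \<in> sources (Suc n) V \<Longrightarrow> f s = OutLeg m \<Longrightarrow> s = OutOf u"
  using producer_eqI[OF f, of m s] producer_closable by simp

lemma inputs_close:
  "inputs n V (close_parent m n V f) v = close_source m n V f ` inputs (Suc n) V f v"
proof (intro set_eqI iffI)
  fix s assume s: "s \<in> inputs n V (close_parent m n V f) v"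
  then have ss: "s \<in> sources n V" and sv: "close_parent m n V f s = Into v" by (auto simp: inputs_def)
  have "s \<noteq> InLeg n" using ss by auto
  show "s \<in> close_source m n V f ` inputs (Suc n) V f v"
  proof (cases "f s = OutLeg m")
    case True
    then have "s = OutOf u" using close_unique ss by (simp add: sources_Suc_leg)
    moreover have "InLeg n \<in> inputs (Suc n) V f v"
      using sv ss True by (simp add: close_parent_def inputs_def)
    ultimately show ?thesis
      by (intro image_eqI[of _ _ "InLeg n"]) (simp_all add: close_source_def producer_closable)
  next
    case False
    then have "s \<in> inputs (Suc n) V f v"
      using sv ss by (simp add: close_parent_def inputs_def sources_Suc_leg)
    then show ?thesis using \<open>s \<noteq> InLeg n\<close>
      by (intro image_eqI[of _ _ s]) (simp_all add: close_source_def)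
  qed
next
  fix s assume "s \<in> close_source m n V f ` inputs (Suc n) V f v"
  then obtain t where t: "t \<in> inputs (Suc n) V f v" "s = close_source m n V f t" by blast
  then show "s \<in> inputs n V (close_parent m n V f) v"
    using u by (cases "t = InLeg n")
      (auto simp: close_source_def producer_closable inputs_def close_parent_def sources_Suc_leg)
qed

lemma inj_close_source: "inj_on (close_source m n V f) {s \<in> sources (Suc n) V. \<exists>v. f s = Into v}"
  using u by (auto simp: inj_on_def close_source_def producer_closable)

lemma is_parent_close: "is_parent m n V (close_parent m n V f)"
  unfolding is_parent_def
proof (intro conjI ballI allI impI)
  fix s assume s: "s \<in> sources n V"
  then have "f s \<in> OutLeg ` {..<Suc m} \<union> Into ` {..<V}" "f (InLeg n) \<in> OutLeg ` {..<Suc m} \<union> Into ` {..<V}"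
    using f by (simp_all add: is_parent_def sources_Suc_leg)
  then show "close_parent m n V f s \<in> OutLeg ` {..<m} \<union> Into ` {..<V}"
    using s w by (auto simp: close_parent_def less_Suc_eq)
next
  fix j assume j: "j < m"
  then obtain s where s: "s \<in> sources (Suc n) V" "f s = OutLeg j"
    and un: "\<And>s'. s' \<in> sources (Suc n) V \<Longrightarrow> f s' = OutLeg j \<Longrightarrow> s' = s"
    using is_parent_OutLegE[OF f, of j] by (metis less_SucI)
  show "\<exists>!s. s \<in> sources n V \<and> close_parent m n V f s = OutLeg j"
  proof (rule ex1I[of _ s])
    show "s \<in> sources n V \<and> close_parent m n V f s = OutLeg j"
      using s w j by (auto simp: sources_Suc_leg close_parent_def)
    fix s' assume s': "s' \<in> sources n V \<and> close_parent m n V f s' = OutLeg j"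
    then have "f s' = OutLeg j" using w by (simp add: close_parent_def split: if_splits)
    then show "s' = s" using un s' by (simp add: sources_Suc_leg)
  qed
next
  fix v assume v: "v < V"
  have "card (close_source m n V f ` inputs (Suc n) V f v) = card (inputs (Suc n) V f v)"
    by (rule card_image[OF inj_on_subset[OF inj_close_source]]) (auto simp: inputs_def)
  then show "2 \<le> card (inputs n V (close_parent m n V f) v)"
    using f v by (simp add: inputs_close is_parent_def)
qed (simp add: close_parent_def)

lemma close_split:
  assumes A: "(v, A) \<in> splittings (Suc n) V f"
  shows "split_at V (close_parent m n V f) v (close_source m n V f ` A) =
    close_parent m n (Suc V) (split_at V f v A)"
proof
  fix s
  note fA = splitting_facts[OF f A]
  have uA: "OutOf u \<notin> A" using fA(4)[of "OutOf u"] u by auto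
  have mem: "s \<in> close_source m n V f ` A \<longleftrightarrow> (s \<in> A \<and> s \<noteq> InLeg n) \<or> (s = OutOf u \<and> InLeg n \<in> A)"
    by (auto simp: close_source_def producer_closable image_iff)
  show "split_at V (close_parent m n V f) v (close_source m n V f ` A) s =
      close_parent m n (Suc V) (split_at V f v A) s"
  proof (cases "s \<in> sources n V")
    case True
    then have sV: "s \<noteq> OutOf V" "s \<noteq> InLeg n" by auto
    show ?thesis
    proof (cases "s = OutOf u")
      case True
      then show ?thesis using u uA sV unfolding split_at_def mem
        by (auto simp: close_parent_def split_at_def)
    next
      case False
      then have "f s \<noteq> OutLeg m" using close_unique[of s] True by (auto simp: sources_Suc_leg)
      then show ?thesis using sV False True unfolding split_at_def mem
        by (auto simp: close_parent_def split_at_def sources_Suc)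
    qed
  next
    case False
    show ?thesis
    proof (cases "s = OutOf V")
      case True
      then show ?thesis using fA(2) u unfolding split_at_def mem
        by (auto simp: close_parent_def split_at_def)
    next
      case sV: False
      have "s \<notin> A \<or> s = InLeg n" using fA(3) False by (auto simp: sources_Suc_leg)
      then show ?thesis using sV False u unfolding split_at_def mem
        by (auto simp: close_parent_def split_at_def sources_Suc)
    qed
  qed
qed

end

lemma close_relabel:
  assumes \<sigma>: "\<sigma> permutes {..<V}"
  shows "close_parent m n V (relabel \<sigma> f) = relabel \<sigma> (close_parent m n V f)"
proof (rule relabel_eqI[OF \<sigma>])
  fix s
  have "map_target \<sigma> t = OutLeg m \<longleftrightarrow> t = OutLeg m" for t by (cases t) auto
  moreover have "relabel \<sigma> f (InLeg n) = map_target \<sigma> (f (InLeg n))"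
    using relabel_apply[OF \<sigma>, of f "InLeg n"] by simp
  ultimately show "close_parent m n V (relabel \<sigma> f) (map_source \<sigma> s) = map_target \<sigma> (close_parent m n V f s)"
    by (simp add: close_parent_def map_source_sources[OF \<sigma>] relabel_apply[OF \<sigma>])
qed

lemma closable_relabel:
  assumes \<sigma>: "\<sigma> permutes {..<V}"
  shows "closable m n V (relabel \<sigma> f) \<longleftrightarrow> closable m n V f"
proof -
  have leg: "relabel \<sigma> f (InLeg n) = map_target \<sigma> (f (InLeg n))"
    using relabel_apply[OF \<sigma>, of f "InLeg n"] by simp
  have "(\<exists>v. map_target \<sigma> t = Into v) \<longleftrightarrow> (\<exists>v. t = Into v)" for t by (cases t) auto
  moreover have "(\<exists>u<V. relabel \<sigma> f (OutOf u) = OutLeg m) \<longleftrightarrow> (\<exists>u<V. f (OutOf u) = OutLeg m)"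
  proof -
    have eq: "relabel \<sigma> f (OutOf (\<sigma> u)) = OutLeg m \<longleftrightarrow> f (OutOf u) = OutLeg m" for u
      using relabel_apply[OF \<sigma>, of f "OutOf u"] by (cases "f (OutOf u)") auto
    have "(\<exists>u<V. relabel \<sigma> f (OutOf u) = OutLeg m) \<longleftrightarrow> (\<exists>u<V. relabel \<sigma> f (OutOf (\<sigma> u)) = OutLeg m)"
    proof
      assume "\<exists>u<V. relabel \<sigma> f (OutOf u) = OutLeg m"
      then obtain u where "u < V" "relabel \<sigma> f (OutOf u) = OutLeg m" by blast
      then show "\<exists>u<V. relabel \<sigma> f (OutOf (\<sigma> u)) = OutLeg m"
        using permutes_in_image[OF permutes_inv[OF \<sigma>], of u]
        by (intro exI[of _ "inv \<sigma> u"]) (simp add: permutes_inverses[OF \<sigma>])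
    next
      assume "\<exists>u<V. relabel \<sigma> f (OutOf (\<sigma> u)) = OutLeg m"
      then show "\<exists>u<V. relabel \<sigma> f (OutOf u) = OutLeg m"
        using permutes_in_image[OF \<sigma>] by (metis lessThan_iff)
    qed
    then show ?thesis by (simp add: eq)
  qed
  ultimately show ?thesis by (simp add: closable_def leg)
qed

lemma closable_split:
  assumes A: "(v, A) \<in> splittings n' V f" and f: "is_parent m' n' V f" and n: "n < n'"
  shows "closable m n (Suc V) (split_at V f v A) \<longleftrightarrow> closable m n V f"
proof -
  note fA = splitting_facts[OF f A]
  have "split_at V f v A (OutOf u) = OutLeg m \<longleftrightarrow> u \<noteq> V \<and> f (OutOf u) = OutLeg m" for u
    using fA(2) fA(4)[of "OutOf u"] by (auto simp: split_at_def)
  then have "(\<exists>u<Suc V. split_at V f v A (OutOf u) = OutLeg m) \<longleftrightarrow> (\<exists>u<V. f (OutOf u) = OutLeg m)"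
    by (auto simp: less_Suc_eq)
  moreover have "(\<exists>w. split_at V f v A (InLeg n) = Into w) \<longleftrightarrow> (\<exists>w. f (InLeg n) = Into w)"
    using fA(4)[of "InLeg n"] by (auto simp: split_at_def)
  ultimately show ?thesis by (simp add: closable_def)
qed

text \<open>
  Joining two legs adds no vertex and needs no renumbering, and both conditions of closability
  persist when a vertex is split.
\<close>

lemma graph_operation_close:
  "graph_operation (Suc m) (Suc n) m n 0 (closable m n) (close_parent m n) (\<lambda>v. v)
     (close_source m n) (\<lambda>_. id)"
proof -
  have obt: thesis if "closable m n V f" "\<And>u w. u < V \<Longrightarrow> f (OutOf u) = OutLeg m \<Longrightarrow> f (InLeg n) = Into w \<Longrightarrow> thesis"
    for V f thesis using that by (auto simp: closable_def)
  have map: "graph_map (Suc m) (Suc n) m n 0 (closable m n) (close_parent m n)"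
  proof (rule graph_map.intro)
    fix V f assume f: "is_parent (Suc m) (Suc n) V f"
    show "closable m n V (relabel \<sigma> f) \<longleftrightarrow> closable m n V f" if "\<sigma> permutes {..<V}" for \<sigma>
      by (rule closable_relabel[OF that])
    assume D: "closable m n V f"
    show "is_parent m n (V + 0) (close_parent m n V f)"
      by (rule obt[OF D]) (simp add: is_parent_close[OF f])
    show "\<exists>\<sigma>'. \<sigma>' permutes {..<V + 0} \<and> sign \<sigma>' = sign \<sigma> \<and>
        close_parent m n V (relabel \<sigma> f) = relabel \<sigma>' (close_parent m n V f)"
      if "\<sigma> permutes {..<V}" for \<sigma>
      using that close_relabel[OF that] by auto
  qed
  show ?thesis
  proof (rule graph_operation.intro[OF map graph_operation_axioms.intro])
    fix V f assume f: "is_parent (Suc m) (Suc n) V f"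
    show "closable m n (Suc V) (split_at V f v A) \<longleftrightarrow> closable m n V f"
      if "(v, A) \<in> splittings (Suc n) V f" for v A
      by (rule closable_split[OF that f]) simp
    assume D: "closable m n V f"
    show "inj_on (close_source m n V f) (\<Union>v<V. inputs (Suc n) V f v)"
      by (rule obt[OF D], rule inj_on_subset[OF inj_close_source[OF f]]) (auto simp: inputs_def)
    show "inputs n (V + 0) (close_parent m n V f) v = close_source m n V f ` inputs (Suc n) V f v" for v
      by (rule obt[OF D]) (simp add: inputs_close[OF f])
    show "split_at (V + 0) (close_parent m n V f) v (close_source m n V f ` A) =
        relabel id (close_parent m n (Suc V) (split_at V f v A))"
      if "(v, A) \<in> splittings (Suc n) V f" for v A
      by (rule obt[OF D]) (simp add: close_split[OF f _ _ _ that])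
  qed (simp_all add: permutes_id)
qed

section \<open>Breaking edges\<close>

text \<open>
  The output of \<open>c\<close> now goes to a new output leg, and a new input leg takes its place.
\<close>

definition break_parent :: "nat \<Rightarrow> nat \<Rightarrow> nat source \<Rightarrow> (nat source \<Rightarrow> nat target) \<Rightarrow> nat source \<Rightarrow> nat target" where
  "break_parent m n c f = f(c := OutLeg m, InLeg n := f c)"

lemma nverts_break_edge [simp]: "nverts (break_edge m n e G) = nverts G"
  by (simp add: break_edge_def)

lemma encodes_break:
  assumes G: "encodes n G f" and e: "e < length (edges G)" and c: "fst (edges G ! e) = c"
  shows "encodes (Suc n) (break_edge m n e G) (break_parent m n c f)"
proof -
  let ?S = "sources n (nverts G)" and ?f' = "break_parent m n c f"
  have cS: "c \<in> ?S" using encodes_bij[OF G] e c by (auto simp: bij_betw_def)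
  have ee: "edges G ! e = (c, f c)" using encodes_edge[OF G e] c by simp
  have nS: "InLeg n \<notin> ?S" by simp
  have "mset (edges (break_edge m n e G)) =
      add_mset (InLeg n, f c) (add_mset (c, OutLeg m) (mset (edges G) - {#(c, f c)#}))"
    using e by (simp add: break_edge_def mset_update ee)
  also have "mset (edges G) - {#(c, f c)#} = image_mset (\<lambda>s. (s, f s)) (mset_set (?S - {c}))"
    using G cS unfolding encodes_def by (simp add: mset_set.remove)
  also have "\<dots> = image_mset (\<lambda>s. (s, ?f' s)) (mset_set (?S - {c}))"
    by (rule image_mset_cong) (use nS in \<open>auto simp: break_parent_def\<close>)
  also have "add_mset (InLeg n, f c) (add_mset (c, OutLeg m) \<dots>) =
      image_mset (\<lambda>s. (s, ?f' s)) (add_mset (InLeg n) (add_mset c (mset_set (?S - {c}))))"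
    using cS by (auto simp: break_parent_def)
  also have "add_mset (InLeg n) (add_mset c (mset_set (?S - {c}))) = mset_set (sources (Suc n) (nverts G))"
    using cS nS by (simp add: sources_Suc_leg flip: mset_set.remove)
  finally show ?thesis by (simp add: encodes_def)
qed

context
  fixes m n V f u v
  assumes f: "is_parent m n V f" and u: "u < V" "f (OutOf u) = Into v"
begin

private abbreviation "f'' \<equiv> break_parent m n (OutOf u) f"

lemma inputs_break:
  "inputs (Suc n) V f'' w = (\<lambda>s. if s = OutOf u then InLeg n else s) ` inputs n V f w"
proof -
  have "InLeg n \<notin> sources n V" by simp
  then show ?thesis
    using u by (auto simp: inputs_def break_parent_def sources_Suc_leg image_iff split: if_splits)
qed

lemma is_parent_break: "is_parent (Suc m) (Suc n) V f''"
  unfolding is_parent_def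
proof (intro conjI ballI allI impI)
  fix s assume "s \<in> sources (Suc n) V"
  then show "f'' s \<in> OutLeg ` {..<Suc m} \<union> Into ` {..<V}"
  proof -
    have ran: "f t \<in> OutLeg ` {..<m} \<union> Into ` {..<V}" if "t \<in> sources n V" for t
      using f that by (simp add: is_parent_def)
    then have mono: "f t \<in> OutLeg ` {..<Suc m} \<union> Into ` {..<V}" if "t \<in> sources n V" for t
      using that by fastforce
    have "OutOf u \<in> sources n V" using u by simp
    then show ?thesis
      using mono \<open>s \<in> sources (Suc n) V\<close> by (auto simp: break_parent_def sources_Suc_leg)
  qed
next
  fix s assume s: "s \<notin> sources (Suc n) V"
  then have "s \<noteq> InLeg n" "s \<noteq> OutOf u" "s \<notin> sources n V" using u by (auto simp: sources_Suc_leg)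
  then show "f'' s = OutLeg 0" using f by (simp add: break_parent_def is_parent_def)
next
  fix j assume j: "j < Suc m"
  show "\<exists>!s. s \<in> sources (Suc n) V \<and> f'' s = OutLeg j"
  proof (cases "j = m")
    case True
    have "f s \<noteq> OutLeg m" if "s \<in> sources n V" for s using f that by (auto simp: is_parent_def)
    then show ?thesis using True u
      by (intro ex1I[of _ "OutOf u"]) (auto simp: break_parent_def sources_Suc_leg split: if_splits)
  next
    case False
    then have "j < m" using j by simp
    then obtain s where s: "s \<in> sources n V" "f s = OutLeg j"
      and un: "\<And>s'. s' \<in> sources n V \<Longrightarrow> f s' = OutLeg j \<Longrightarrow> s' = s"
      using is_parent_OutLegE[OF f] by blast
    show ?thesis
    proof (rule ex1I[of _ s])
      show "s \<in> sources (Suc n) V \<and> f'' s = OutLeg j"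
        using s u by (auto simp: break_parent_def sources_Suc_leg)
      fix s' assume s': "s' \<in> sources (Suc n) V \<and> f'' s' = OutLeg j"
      then have "s' \<in> sources n V" "f s' = OutLeg j"
        using u False by (auto simp: break_parent_def sources_Suc_leg split: if_splits)
      then show "s' = s" by (rule un)
    qed
  qed
next
  fix w assume w: "w < V"
  have "card ((\<lambda>s. if s = OutOf u then InLeg n else s) ` inputs n V f w) = card (inputs n V f w)"
    by (rule card_image) (auto simp: inj_on_def inputs_def split: if_splits)
  then show "2 \<le> card (inputs (Suc n) V f'' w)"
    using f w by (simp add: inputs_break is_parent_def)
qed

lemma close_break: "closable m n V f''" "close_parent m n V f'' = f"
proof -
  show "closable m n V f''" using u by (auto simp: closable_def break_parent_def)
  show "close_parent m n V f'' = f"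
  proof
    fix s
    have "f s \<noteq> OutLeg m" if "s \<in> sources n V" using f that by (auto simp: is_parent_def)
    then show "close_parent m n V f'' s = f s"
      using u f by (auto simp: close_parent_def break_parent_def is_parent_def)
  qed
qed

lemma break_split:
  assumes A: "(w, A) \<in> splittings n V f"
  shows "break_parent m n (OutOf u) (split_at V f w A) =
    split_at V f'' w ((\<lambda>s. if s = OutOf u then InLeg n else s) ` A)"
proof
  fix s
  note fA = splitting_facts[OF f A]
  have nA: "InLeg n \<notin> A" using fA(3) by auto
  have mem: "s \<in> (\<lambda>s. if s = OutOf u then InLeg n else s) ` A \<longleftrightarrow>
      (s \<in> A \<and> s \<noteq> OutOf u) \<or> (s = InLeg n \<and> OutOf u \<in> A)"
    by (auto simp: image_iff)
  show "break_parent m n (OutOf u) (split_at V f w A) s =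
      split_at V f'' w ((\<lambda>s. if s = OutOf u then InLeg n else s) ` A) s"
    using nA u(1) unfolding break_parent_def split_at_def mem by auto
qed

end

section \<open>Ideals of the wheeled extensions\<close>

lemma lin_ext_cong_keys:
  "(\<And>g. g \<in> Poly_Mapping.keys x \<Longrightarrow> f g = f' g) \<Longrightarrow> lin_ext f x = lin_ext f' x"
  by (simp add: lin_ext_def)

lemma lin_ext_cong_mod_keys:
  assumes "fvs.subspace D" "\<And>g. g \<in> Poly_Mapping.keys x \<Longrightarrow> cong_mod D (f g) (f' g)"
  shows "cong_mod D (lin_ext f x) (lin_ext f' x)"
  unfolding lin_ext_def by (intro cong_mod_sum cong_mod_scale assms)

lemma lin_ext_lin_ext: "lin_ext F (lin_ext H z) = lin_ext (\<lambda>p. lin_ext F (H p)) z"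
  by (simp add: lin_ext_def[of H] lin_ext_def[of "\<lambda>p. lin_ext F (H p)"] lin_ext.sum lin_ext.scale)

lemma keys_lin_ext_fgen:
  "Poly_Mapping.keys (lin_ext (\<lambda>p. fgen (h p)) z :: 'b \<Rightarrow>\<^sub>0 'k::field) \<subseteq> h ` Poly_Mapping.keys z"
proof
  fix k assume k: "k \<in> Poly_Mapping.keys (lin_ext (\<lambda>p. fgen (h p)) z :: 'b \<Rightarrow>\<^sub>0 'k)"
  show "k \<in> h ` Poly_Mapping.keys z"
  proof (rule ccontr)
    assume no: "k \<notin> h ` Poly_Mapping.keys z"
    have "Poly_Mapping.lookup (lin_ext (\<lambda>p. fgen (h p)) z :: 'b \<Rightarrow>\<^sub>0 'k) k = 0"
      unfolding lin_ext_def lookup_sum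
      by (rule sum.neutral) (use no in \<open>auto simp: lookup_single when_def\<close>)
    then show False using k by (simp add: in_keys_iff)
  qed
qed

lemma break_edge_in_W:
  assumes G: "G \<in> W m n" and e: "e < length (edges G)" "edges G ! e = (OutOf u, Into v)"
  shows "break_edge m n e G \<in> W (Suc m) (Suc n)"
    and "parent (Suc n) (break_edge m n e G) = break_parent m n (OutOf u) (parent n G)"
    and "u < nverts G" "parent n G (OutOf u) = Into v"
proof -
  note eG = W_encodes[OF G]
  have "fst (edges G ! e) \<in> sources n (nverts G)" using encodes_bij[OF eG(1)] e(1) by (auto simp: bij_betw_def)
  then show u: "u < nverts G" using e(2) by simp
  show p: "parent n G (OutOf u) = Into v" using encodes_snd[OF eG(1) e(1)] e(2) by simp
  have enc: "encodes (Suc n) (break_edge m n e G) (break_parent m n (OutOf u) (parent n G))"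
    by (rule encodes_break[OF eG(1) e(1)]) (simp add: e(2))
  note par = is_parent_break[OF eG(2) u p]
  show "break_edge m n e G \<in> W (Suc m) (Suc n)" by (rule encodes_in_W[OF enc]) (simp add: par)
  show "parent (Suc n) (break_edge m n e G) = break_parent m n (OutOf u) (parent n G)"
    by (rule parent_eq[OF enc, of "Suc m"]) (simp add: par)
qed

text \<open>
  Broken edges are glued together again one by one, the last one first. Each gluing is an operation
  on the broken graphs alone and hence linear in them, although the relation involves several
  graphs.
\<close>

lemma wheeled_ideal_subset:
  fixes Q :: "nat \<Rightarrow> nat \<Rightarrow> (dgraph \<Rightarrow>\<^sub>0 'k::field) set"
  assumes Q: "\<And>m n. fvs.subspace (Q m n)" and CQ: "\<And>m n. C m n \<subseteq> Q m n"
    and T: "T \<subseteq> lie_inf_arities"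
    and I: "\<And>m n x. prop_ideal T I m n x \<Longrightarrow> x \<in> Q m n"
    and close: "\<And>m n x. x \<in> Q (Suc m) (Suc n) \<Longrightarrow>
      graph_map.op (Suc n) n 0 (closable m n) (close_parent m n) x \<in> Q m n"
  shows "wheeled_ideal T I m n \<subseteq> Q m n"
proof -
  \<comment> \<open>cyclicity of the edges is given up, since it is lost when the first edge has been broken\<close>
  have claim: "lin_ext (\<lambda>(G, es). fgen G) z \<in> Q m n"
    if "Poly_Mapping.keys z \<subseteq> {(G, es). G \<in> W m n \<and> length es = r \<and> distinct es \<and>
        (\<forall>e\<in>set es. e < length (edges G) \<and> (\<exists>u v. edges G ! e = (OutOf u, Into v)))}"
      and "lin_ext (\<lambda>(G, es). fgen (break_edges m n es G)) z \<in> Q (m + r) (n + r)"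
    for r m n and z :: "(dgraph \<times> nat list) \<Rightarrow>\<^sub>0 'k"
    using that
  proof (induction r arbitrary: m n z)
    case 0
    have "lin_ext (\<lambda>(G, es). fgen (break_edges m n es G)) z = (lin_ext (\<lambda>(G, es). fgen G) z :: dgraph \<Rightarrow>\<^sub>0 'k)"
      using 0(1) by (intro lin_ext_cong_keys) auto
    then show ?case using 0(2) by simp
  next
    case (Suc r)
    let ?B = "\<lambda>(G, es). break_edge m n (hd es) G"
    let ?h = "\<lambda>p. (?B p, tl (snd p))"
    define z' where "z' = (lin_ext (\<lambda>p. fgen (?h p)) z :: (dgraph \<times> nat list) \<Rightarrow>\<^sub>0 'k)"
    have key: "\<exists>G e es u v. p = (G, e # es) \<and> G \<in> W m n \<and> length es = r \<and> distinct es \<and> e \<notin> set es \<and>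
        e < length (edges G) \<and> edges G ! e = (OutOf u, Into v) \<and>
        (\<forall>e\<in>set es. e < length (edges G) \<and> (\<exists>u v. edges G ! e = (OutOf u, Into v)))"
      if "p \<in> Poly_Mapping.keys z" for p
    proof -
      obtain G es' where p: "p = (G, es')" by (cases p)
      have *: "G \<in> W m n" "length es' = Suc r" "distinct es'"
        "\<forall>e\<in>set es'. e < length (edges G) \<and> (\<exists>u v. edges G ! e = (OutOf u, Into v))"
        using Suc.prems(1) that p by auto
      obtain e es where "es' = e # es" using *(2) by (cases es') auto
      then show ?thesis using * p by auto
    qed
    have "Poly_Mapping.keys z' \<subseteq> {(G, es). G \<in> W (Suc m) (Suc n) \<and> length es = r \<and> distinct es \<and>
        (\<forall>e\<in>set es. e < length (edges G) \<and> (\<exists>u v. edges G ! e = (OutOf u, Into v)))}"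
    proof
      fix q assume "q \<in> Poly_Mapping.keys z'"
      then obtain p where p: "p \<in> Poly_Mapping.keys z" "q = ?h p"
        using keys_lin_ext_fgen[of ?h z] unfolding z'_def by blast
      obtain G e es u v where pe: "p = (G, e # es)" "G \<in> W m n" "length es = r" "distinct es" "e \<notin> set es"
          "e < length (edges G)" "edges G ! e = (OutOf u, Into v)"
          "\<forall>e\<in>set es. e < length (edges G) \<and> (\<exists>u v. edges G ! e = (OutOf u, Into v))"
        using key[OF p(1)] by blast
      have "e' < length (edges (break_edge m n e G)) \<and>
          (\<exists>u v. edges (break_edge m n e G) ! e' = (OutOf u, Into v))" if "e' \<in> set es" for e'
      proof -
        have "e' \<noteq> e" "e' < length (edges G)" using that pe by auto
        then show ?thesis using pe(8) that by (auto simp: break_edge_def nth_append)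
      qed
      then show "q \<in> {(G, es). G \<in> W (Suc m) (Suc n) \<and> length es = r \<and> distinct es \<and>
          (\<forall>e\<in>set es. e < length (edges G) \<and> (\<exists>u v. edges G ! e = (OutOf u, Into v)))}"
        using p(2) pe break_edge_in_W(1)[OF pe(2,6,7)] by simp
    qed
    moreover have "lin_ext (\<lambda>(G, es). fgen (break_edges (Suc m) (Suc n) es G)) z' \<in> Q (Suc m + r) (Suc n + r)"
    proof -
      have "lin_ext (\<lambda>(G, es). fgen (break_edges (Suc m) (Suc n) es G)) z' =
          (lin_ext (\<lambda>(G, es). fgen (break_edges m n es G)) z :: dgraph \<Rightarrow>\<^sub>0 'k)"
        unfolding z'_def lin_ext_lin_ext by (rule lin_ext_cong_keys) (use key in fastforce)
      then show ?thesis using Suc.prems(2) by simp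
    qed
    ultimately have "lin_ext (\<lambda>(G, es). fgen G) z' \<in> Q (Suc m) (Suc n)" by (rule Suc.IH)
    also have "lin_ext (\<lambda>(G, es). fgen G) z' = (lin_ext (\<lambda>p. fgen (?B p)) z :: dgraph \<Rightarrow>\<^sub>0 'k)"
      unfolding z'_def lin_ext_lin_ext by (rule lin_ext_cong_keys) simp
    finally have zB: "lin_ext (\<lambda>p. fgen (?B p)) z \<in> Q (Suc m) (Suc n)" .
    interpret cl: graph_operation "Suc m" "Suc n" m n 0 "closable m n" "close_parent m n" "\<lambda>v. v"
        "close_source m n" "\<lambda>_. id" by (rule graph_operation_close)
    have "cl.op (lin_ext (\<lambda>p. fgen (?B p)) z) \<in> Q m n" by (rule close[OF zB])
    moreover have "cl.op (lin_ext (\<lambda>p. fgen (?B p)) z) = lin_ext (\<lambda>p. cl.op_graph (?B p)) z"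
      unfolding cl.op_def lin_ext_lin_ext by simp
    moreover have "cong_mod (C m n) (lin_ext (\<lambda>(G, es). fgen G) z)
        (lin_ext (\<lambda>p. cl.op_graph (?B p)) z :: dgraph \<Rightarrow>\<^sub>0 'k)"
    proof (rule lin_ext_cong_mod_keys[OF subspace_coinv_rels])
      fix p assume "p \<in> Poly_Mapping.keys z"
      then obtain G e es u v where pe: "p = (G, e # es)" "G \<in> W m n"
          "e < length (edges G)" "edges G ! e = (OutOf u, Into v)"
        using key by blast
      note b = break_edge_in_W[OF pe(2,3,4)]
      note cb = close_break[OF W_encodes(2)[OF pe(2)] b(3,4)]
      show "cong_mod (C m n) ((\<lambda>(G, es). fgen G) p) (cl.op_graph (?B p) :: dgraph \<Rightarrow>\<^sub>0 'k)"
        using cong_pgen_parent[OF pe(2)] cb by (simp add: pe(1) cl.op_graph_def b(2))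
    qed
    then have "lin_ext (\<lambda>(G, es). fgen G) z - lin_ext (\<lambda>p. cl.op_graph (?B p)) z \<in> Q m n"
      using CQ unfolding cong_mod_def by blast
    ultimately show ?case
      using fvs.subspace_add[OF Q, of "lin_ext (\<lambda>(G, es). fgen G) z - lin_ext (\<lambda>p. cl.op_graph (?B p)) z" m n
          "lin_ext (\<lambda>p. cl.op_graph (?B p)) z"] by simp
  qed
  show ?thesis unfolding wheeled_ideal_def
  proof (rule fvs.span_minimal[OF _ Q], clarify)
    fix z :: "(dgraph \<times> nat list) \<Rightarrow>\<^sub>0 'k" and r
    assume keys: "Poly_Mapping.keys z \<subseteq> {(G, es). G \<in> wheeled_graphs T m n \<and> length es = r \<and>
          distinct es \<and> (\<forall>e\<in>set es. cyclic_edge G e)}"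
      and ideal: "prop_ideal T I (m + r) (n + r) (lin_ext (\<lambda>(G, es). fgen (break_edges m n es G)) z)"
    show "lin_ext (\<lambda>(G, es). fgen G) z \<in> Q m n"
    proof (rule claim[OF _ I[OF ideal]], rule subset_trans[OF keys], clarify)
      fix G es e assume "G \<in> wheeled_graphs T m n" "\<forall>e\<in>set es. cyclic_edge G e"
      then show "G \<in> W m n \<and> length es = length es \<and> distinct es \<and>
        (\<forall>e\<in>set es. e < length (edges G) \<and> (\<exists>u v. edges G ! e = (OutOf u, Into v)))" if "distinct es"
        using that wheeled_graphs_mono[OF T] by (auto simp: cyclic_edge_def)
    qed
  qed
qed

lemma wheeled_ideal_empty: "wheeled_ideal lie_inf_arities (\<lambda>_ _. {}) m n \<subseteq> C m n"
proof (rule wheeled_ideal_subset[where Q="\<lambda>m n. C m n"])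
  fix m n and x :: "dgraph \<Rightarrow>\<^sub>0 'a" assume x: "x \<in> C (Suc m) (Suc n)"
  interpret graph_operation "Suc m" "Suc n" m n 0 "closable m n" "close_parent m n" "\<lambda>v. v"
      "close_source m n" "\<lambda>_. id" by (rule graph_operation_close)
  show "op x \<in> C m n" by (rule op_in_C[OF x])
qed (simp_all add: prop_ideal_empty)

lemma wheeled_ideal_jacobi: "wheeled_ideal lie_arities jacobi_relations m n \<subseteq> top_boundaries m n"
proof (rule wheeled_ideal_subset[where Q=top_boundaries])
  fix m n and x :: "dgraph \<Rightarrow>\<^sub>0 'a" assume x: "x \<in> top_boundaries (Suc m) (Suc n)"
  interpret graph_operation "Suc m" "Suc n" m n 0 "closable m n" "close_parent m n" "\<lambda>v. v"
      "close_source m n" "\<lambda>_. id" by (rule graph_operation_close)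
  show "op x \<in> top_boundaries m n" by (rule op_top_boundaries[OF x])
next
  show "lie_arities \<subseteq> lie_inf_arities" by (auto simp: lie_arities_def lie_inf_arities_def)
qed (simp_all add: C_subset_top_boundaries prop_ideal_jacobi)

section \<open>Graphs without wheels\<close>

lemma is_parent_IntoD:
  assumes "is_parent m n V f" "f s = Into w"
  shows "s \<in> sources n V" "w < V"
proof -
  show s: "s \<in> sources n V" using assms by (auto simp: is_parent_def)
  then have "f s \<in> OutLeg ` {..<m} \<union> Into ` {..<V}" using assms(1) by (simp add: is_parent_def)
  then show "w < V" using assms(2) by auto
qed

text \<open>
  A height function that strictly decreases along edges, a convenient certificate that there is no
  wheel.
\<close>

definition ranked :: "nat \<Rightarrow> (nat source \<Rightarrow> nat target) \<Rightarrow> bool" where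
  "ranked V f \<longleftrightarrow> (\<exists>\<rho> :: nat \<Rightarrow> nat. \<forall>u<V. \<forall>v. f (OutOf u) = Into v \<longrightarrow> \<rho> v < \<rho> u)"

definition step_rel :: "nat \<Rightarrow> (nat source \<Rightarrow> nat target) \<Rightarrow> (nat \<times> nat) set" where
  "step_rel V f = {(u, v). u < V \<and> f (OutOf u) = Into v}"

lemma adjacency_encodes: "encodes n G f \<Longrightarrow> adjacency G = step_rel (nverts G) f"
  by (auto simp: adjacency_def step_rel_def encodes_set)

text \<open>
  The number of vertices strictly below serves as height.
\<close>

lemma acyclic_iff_ranked:
  assumes f: "is_parent m n V f"
  shows "acyclic (step_rel V f) \<longleftrightarrow> ranked V f"
proof
  assume ac: "acyclic (step_rel V f)"
  let ?R = "step_rel V f"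
  have R: "?R \<subseteq> {..<V} \<times> {..<V}"
    using is_parent_IntoD(2)[OF f] by (auto simp: step_rel_def)
  \<comment> \<open>strictly smaller after a step, as a vertex on no wheel does not lie below itself\<close>
  define \<rho> where "\<rho> u = card {v. (u, v) \<in> ?R\<^sup>+}" for u
  have "\<rho> v < \<rho> u" if uv: "(u, v) \<in> ?R" for u v
    unfolding \<rho>_def
  proof (rule psubset_card_mono)
    have "{x. (u, x) \<in> ?R\<^sup>+} \<subseteq> {..<V}" using trancl_subset_Sigma[OF R] by auto
    then show "finite {x. (u, x) \<in> ?R\<^sup>+}" by (rule finite_subset) simp
    have "(v, v) \<notin> ?R\<^sup>+" using ac by (simp add: acyclic_def)
    then show "{x. (v, x) \<in> ?R\<^sup>+} \<subset> {x. (u, x) \<in> ?R\<^sup>+}"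
      using uv by (auto intro: trancl_into_trancl2)
  qed
  then show "ranked V f" unfolding ranked_def step_rel_def by blast
next
  assume "ranked V f"
  then obtain \<rho> :: "nat \<Rightarrow> nat" where \<rho>: "\<And>u v. (u, v) \<in> step_rel V f \<Longrightarrow> \<rho> v < \<rho> u"
    unfolding ranked_def step_rel_def by blast
  have "\<rho> v < \<rho> u" if "(u, v) \<in> (step_rel V f)\<^sup>+" for u v
    using that by induction (auto dest: \<rho> intro: less_trans)
  then show "acyclic (step_rel V f)" unfolding acyclic_def by blast
qed

lemma wheel_free_iff_ranked:
  "G \<in> W m n \<Longrightarrow> wheel_free G \<longleftrightarrow> ranked (nverts G) (parent n G)"
  unfolding wheel_free_def
  using adjacency_encodes[OF W_encodes(1)] acyclic_iff_ranked[OF W_encodes(2)] by metis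

lemma ranked_relabel:
  assumes \<sigma>: "\<sigma> permutes {..<V}" and f: "ranked V f"
  shows "ranked V (relabel \<sigma> f)"
proof -
  obtain \<rho> :: "nat \<Rightarrow> nat" where \<rho>: "\<And>u v. u < V \<Longrightarrow> f (OutOf u) = Into v \<Longrightarrow> \<rho> v < \<rho> u"
    using f unfolding ranked_def by blast
  have "\<rho> (inv \<sigma> v) < \<rho> (inv \<sigma> u)" if u: "u < V" "relabel \<sigma> f (OutOf u) = Into v" for u v
  proof -
    have iu: "inv \<sigma> u < V" using permutes_in_image[OF permutes_inv[OF \<sigma>], of u] u by simp
    have "relabel \<sigma> f (OutOf u) = map_target \<sigma> (f (OutOf (inv \<sigma> u)))" by (simp add: relabel_def)
    then obtain w where "f (OutOf (inv \<sigma> u)) = Into w" "\<sigma> w = v" using u(2) by (cases "f (OutOf (inv \<sigma> u))") auto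
    then show ?thesis using \<rho>[OF iu] by (simp add: permutes_inverses[OF \<sigma>] flip: \<open>\<sigma> w = v\<close>)
  qed
  then show ?thesis unfolding ranked_def by (intro exI[of _ "\<lambda>v. \<rho> (inv \<sigma> v)"]) blast
qed

lemma ranked_relabel_iff:
  assumes \<sigma>: "\<sigma> permutes {..<V}"
  shows "ranked V (relabel \<sigma> f) \<longleftrightarrow> ranked V f"
proof
  assume "ranked V (relabel \<sigma> f)"
  then have "ranked V (relabel (inv \<sigma>) (relabel \<sigma> f))" by (rule ranked_relabel[OF permutes_inv[OF \<sigma>]])
  then show "ranked V f" by (simp add: relabel_relabel[OF permutes_inv[OF \<sigma>] \<sigma>] permutes_inv_o[OF \<sigma>])
qed (rule ranked_relabel[OF \<sigma>])

lemma ranked_split: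
  assumes f: "is_parent m n V f" and A: "(v, A) \<in> splittings n V f" and r: "ranked V f"
  shows "ranked (Suc V) (split_at V f v A)"
proof -
  obtain \<rho> :: "nat \<Rightarrow> nat" where \<rho>: "\<And>u v. u < V \<Longrightarrow> f (OutOf u) = Into v \<Longrightarrow> \<rho> v < \<rho> u"
    using r unfolding ranked_def by blast
  note fA = splitting_facts[OF f A]
  let ?\<rho>' = "\<lambda>u. if u = V then 2 * \<rho> v + 1 else 2 * \<rho> u"
  have "?\<rho>' w < ?\<rho>' u" if u: "u < Suc V" "split_at V f v A (OutOf u) = Into w" for u w
  proof (cases "u = V")
    case True
    then show ?thesis using u fA by (auto simp: split_at_def)
  next
    case False
    then have uV: "u < V" using u by simp
    show ?thesis
    proof (cases "OutOf u \<in> A")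
      case True
      then have "w = V" "\<rho> v < \<rho> u" using u fA(4) \<rho>[OF uV, of v] by (auto simp: split_at_def)
      then show ?thesis using False by simp
    next
      case nA: False
      then have fw: "f (OutOf u) = Into w" using u False by (simp add: split_at_def)
      then have "w < V" using is_parent_IntoD(2)[OF f] by blast
      then show ?thesis using \<rho>[OF uV fw] False by simp
    qed
  qed
  then show ?thesis unfolding ranked_def by (intro exI[of _ ?\<rho>']) blast
qed

lemma binary_graphs_iff: "G \<in> wheeled_graphs lie_arities m n \<longleftrightarrow> G \<in> W m n \<and> int (nverts G) = int n - int m"
  using binary_iff_top_degree[OF W_encodes(2)] by (auto simp: binary_in_W_iff)

lemma wheel_free_binary_iff:
  "G \<in> wheel_free_graphs lie_arities m n \<longleftrightarrow>
    G \<in> W m n \<and> int (nverts G) = int n - int m \<and> ranked (nverts G) (parent n G)"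
  using wheel_free_iff_ranked by (auto simp: wheel_free_graphs_def binary_graphs_iff)

text \<open>
  The projection that forgets the graphs outside the smaller set respects isomorphisms, and it fixes
  \<open>x\<close>.
\<close>

lemma coinv_rels_restrict:
  assumes closed: "\<And>\<sigma> G H. graph_iso \<sigma> G H \<Longrightarrow> G \<in> S \<Longrightarrow> H \<in> S \<Longrightarrow> (G \<in> S' \<longleftrightarrow> H \<in> S')"
    and x: "x \<in> coinv_rels S" "x \<in> graph_span S'"
  shows "x \<in> (coinv_rels S' :: (dgraph \<Rightarrow>\<^sub>0 'k::field) set)"
proof -
  let ?r = "\<lambda>G. if G \<in> S' then fgen G else 0 :: dgraph \<Rightarrow>\<^sub>0 'k"
  have "lin_ext ?r x \<in> coinv_rels S'"
  proof (rule lin_ext_coinv[OF subspace_coinv_rels x(1)])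
    fix \<sigma> G H assume GH: "G \<in> S" "H \<in> S" "graph_iso \<sigma> G H"
    show "cong_mod (coinv_rels S') (?r H) (fscale (fsign \<sigma>) (?r G))"
    proof (cases "G \<in> S'")
      case True
      then show ?thesis using cong_iso[of G S' H \<sigma>] GH closed[OF GH(3,1,2)] by simp
    qed (use closed[OF GH(3,1,2)] in simp)
  qed
  moreover have "lin_ext ?r x = lin_ext fgen x"
    by (rule lin_ext_cong[OF x(2)]) simp
  moreover have "lin_ext fgen x = x" unfolding lin_ext_def by (rule poly_mapping_eq_sum_fgen[symmetric])
  ultimately show ?thesis by simp
qed

lemma C_restrict_binary:
  assumes "x \<in> C m n" "x \<in> graph_span (wheeled_graphs lie_arities m n)"
  shows "x \<in> coinv_rels (wheeled_graphs lie_arities m n)"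
  by (rule coinv_rels_restrict[OF _ assms]) (auto simp: binary_graphs_iff graph_iso_def)

lemma C_restrict_wheel_free:
  assumes "x \<in> C m n" "x \<in> graph_span (wheel_free_graphs lie_arities m n)"
  shows "x \<in> coinv_rels (wheel_free_graphs lie_arities m n)"
proof (rule coinv_rels_restrict[OF _ assms])
  fix \<sigma> G H assume iso: "graph_iso \<sigma> G H" and G: "G \<in> W m n" and H: "H \<in> W m n"
  have "nverts H = nverts G" "\<sigma> permutes {..<nverts G}" using iso by (auto simp: graph_iso_def)
  then show "G \<in> wheel_free_graphs lie_arities m n \<longleftrightarrow> H \<in> wheel_free_graphs lie_arities m n"
    using G H graph_iso_parent[OF iso G H] ranked_relabel_iff
    by (simp add: wheel_free_binary_iff)
qed

text \<open>
  Sort the vertices by height.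
\<close>

lemma topological_numbering:
  assumes "ranked V f"
  obtains \<sigma> where "\<sigma> permutes {..<V}" "\<And>u v. u < V \<Longrightarrow> relabel \<sigma> f (OutOf u) = Into v \<Longrightarrow> v < V \<Longrightarrow> v < u"
proof -
  obtain \<rho> :: "nat \<Rightarrow> nat" where \<rho>: "\<And>u v. u < V \<Longrightarrow> f (OutOf u) = Into v \<Longrightarrow> \<rho> v < \<rho> u"
    using assms unfolding ranked_def by blast
  define L where "L = sort_key \<rho> [0..<V]"
  have L: "length L = V" "distinct L" "set L = {..<V}" "sorted (map \<rho> L)"
    by (auto simp: L_def)
  define \<tau> where "\<tau> x = (if x < V then L ! x else x)" for x
  have \<tau>: "\<tau> permutes {..<V}"
  proof (rule bij_imp_permutes)
    have "bij_betw ((!) L) {..<V} {..<V}"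
      by (rule bij_betw_nth[OF L(2)]) (simp_all only: L(1,3))
    moreover have "bij_betw \<tau> {..<V} {..<V} \<longleftrightarrow> bij_betw ((!) L) {..<V} {..<V}"
      by (rule bij_betw_cong) (simp add: \<tau>_def)
    ultimately show "bij_betw \<tau> {..<V} {..<V}" by simp
  qed (simp add: \<tau>_def)
  have \<sigma>: "inv \<tau> permutes {..<V}" by (rule permutes_inv[OF \<tau>])
  show thesis
  proof (rule that[OF \<sigma>])
    fix u v assume u: "u < V" and r: "relabel (inv \<tau>) f (OutOf u) = Into v" and v: "v < V"
    have "relabel (inv \<tau>) f (OutOf u) = map_target (inv \<tau>) (f (OutOf (\<tau> u)))"
      by (simp add: relabel_def permutes_inv_inv[OF \<tau>])
    then obtain w where w: "f (OutOf (\<tau> u)) = Into w" "inv \<tau> w = v"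
      using r by (cases "f (OutOf (\<tau> u))") auto
    have "w = \<tau> v" using w(2) permutes_inverses(1)[OF \<tau>, of w] by simp
    then have "\<rho> (L ! v) < \<rho> (L ! u)" using \<rho>[of "\<tau> u" w] w(1) u v permutes_in_image[OF \<tau>, of u] by (simp add: \<tau>_def)
    moreover have "\<rho> (L ! u) \<le> \<rho> (L ! v)" if "u \<le> v"
      using sorted_nth_mono[OF L(4) that] v L(1) u by simp
    ultimately show "v < u" by (meson not_le)
  qed
qed

section \<open>Cutting a graph along its edges\<close>

text \<open>
  Vertices \<open>0, \<dots>, V1 - 1\<close> receive the cut edges, enumerated by \<open>c\<close>, of the part with vertices
  \<open>V1, \<dots>, V1 + V2 - 1\<close>.
\<close>

context
  fixes m n V1 V2 k :: nat and f :: "nat source \<Rightarrow> nat target" and c :: "nat \<Rightarrow> nat source"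
  assumes f: "is_parent m n (V1 + V2) f"
    and low: "\<And>v u. v < V1 \<Longrightarrow> f (OutOf v) \<noteq> Into (V1 + u)"
    and c: "bij_betw c {..<k} {t \<in> sources n V2. \<forall>u. f (shift 0 V1 t) \<noteq> Into (V1 + u)}"
begin

private abbreviation "K \<equiv> {t \<in> sources n V2. \<forall>u. f (shift 0 V1 t) \<noteq> Into (V1 + u)}"
private abbreviation "d \<equiv> the_inv_into {..<k} c"

definition lower_part :: "nat source \<Rightarrow> nat target" where
  "lower_part s = (if s \<in> sources k V1 then case s of InLeg j \<Rightarrow> f (shift 0 V1 (c j)) | OutOf v \<Rightarrow> f (OutOf v)
     else OutLeg 0)"

definition upper_part :: "nat source \<Rightarrow> nat target" where
  "upper_part t = (if t \<in> sources n V2 then if t \<in> K then OutLeg (d t)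
     else (case f (shift 0 V1 t) of Into x \<Rightarrow> Into (x - V1) | OutLeg j \<Rightarrow> OutLeg 0) else OutLeg 0)"

lemma cut_inverse: "t \<in> K \<Longrightarrow> d t < k" "t \<in> K \<Longrightarrow> c (d t) = t" "j < k \<Longrightarrow> d (c j) = j" "j < k \<Longrightarrow> c j \<in> K"
proof -
  have inj: "inj_on c {..<k}" and im: "c ` {..<k} = K" using c by (auto simp: bij_betw_def)
  show "t \<in> K \<Longrightarrow> d t < k" using the_inv_into_into[OF inj, of t "{..<k}"] im by simp
  show "t \<in> K \<Longrightarrow> c (d t) = t" using f_the_inv_into_f[OF inj, of t] im by simp
  show "j < k \<Longrightarrow> d (c j) = j" using the_inv_into_f_f[OF inj] by simp
  show "j < k \<Longrightarrow> c j \<in> K" using im by blast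
qed

lemma upper_part_K: "t \<in> K \<Longrightarrow> upper_part t = OutLeg (d t)"
  by (simp add: upper_part_def)

lemma upper_part_Into:
  assumes "t \<in> sources n V2" "t \<notin> K"
  obtains u where "f (shift 0 V1 t) = Into (V1 + u)" "upper_part t = Into u"
  using assms that by (auto simp: upper_part_def)

lemma is_parent_upper: "is_parent k n V2 upper_part"
    and inputs_upper: "inputs n (V1 + V2) f (V1 + u) = shift 0 V1 ` inputs n V2 upper_part u"
proof -
  have shs: "shift 0 V1 t \<in> sources n (V1 + V2)" if "t \<in> sources n V2" for t
    using sources_add[of 0 n V1 V2] that by auto
  show inp: "inputs n (V1 + V2) f (V1 + u) = shift 0 V1 ` inputs n V2 upper_part u" for u
  proof (intro set_eqI iffI)
    fix s assume s: "s \<in> inputs n (V1 + V2) f (V1 + u)"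
    then have "s \<in> sources 0 V1 \<union> shift 0 V1 ` sources n V2"
      using sources_add[of 0 n V1 V2] by (simp add: inputs_def)
    moreover have "s \<notin> sources 0 V1" using s low by (cases s) (auto simp: inputs_def)
    ultimately obtain t where t: "t \<in> sources n V2" "s = shift 0 V1 t" by blast
    then have "t \<notin> K" using s by (auto simp: inputs_def)
    then obtain u' where "f (shift 0 V1 t) = Into (V1 + u')" "upper_part t = Into u'"
      using upper_part_Into[OF t(1)] by blast
    then show "s \<in> shift 0 V1 ` inputs n V2 upper_part u" using s t by (auto simp: inputs_def)
  next
    fix s assume "s \<in> shift 0 V1 ` inputs n V2 upper_part u"
    then obtain t where t: "s = shift 0 V1 t" "t \<in> sources n V2" "upper_part t = Into u"
      by (auto simp: inputs_def)
    then have "t \<notin> K" using upper_part_K[of t] by auto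
    then obtain u' where "f (shift 0 V1 t) = Into (V1 + u')" "upper_part t = Into u'"
      using upper_part_Into[OF t(2)] by blast
    then show "s \<in> inputs n (V1 + V2) f (V1 + u)" using t shs by (simp add: inputs_def)
  qed
  show "is_parent k n V2 upper_part"
    unfolding is_parent_def
  proof (intro conjI ballI allI impI)
    fix t assume t: "t \<in> sources n V2"
    show "upper_part t \<in> OutLeg ` {..<k} \<union> Into ` {..<V2}"
    proof (cases "t \<in> K")
      case True
      then show ?thesis using cut_inverse(1)[OF True] by (simp add: upper_part_def)
    next
      case False
      then obtain u where u: "f (shift 0 V1 t) = Into (V1 + u)" "upper_part t = Into u"
        using upper_part_Into[OF t] by blast
      have "f (shift 0 V1 t) \<in> OutLeg ` {..<m} \<union> Into ` {..<V1 + V2}"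
        using f shs[OF t] by (simp add: is_parent_def)
      then show ?thesis using u by auto
    qed
  next
    fix j assume j: "j < k"
    show "\<exists>!s. s \<in> sources n V2 \<and> upper_part s = OutLeg j"
    proof (rule ex1I[of _ "c j"])
      show "c j \<in> sources n V2 \<and> upper_part (c j) = OutLeg j"
        using cut_inverse(3,4)[OF j] upper_part_K[of "c j"] by simp
      fix t assume t: "t \<in> sources n V2 \<and> upper_part t = OutLeg j"
      have "t \<in> K" using upper_part_Into[of t] t by (metis target.distinct(1))
      then have "d t = j" using t upper_part_K[of t] by simp
      then show "t = c j" using cut_inverse(2)[OF \<open>t \<in> K\<close>] by simp
    qed
  next
    fix u assume u: "u < V2"
    have "card (shift 0 V1 ` inputs n V2 upper_part u) = card (inputs n V2 upper_part u)"
      by (rule card_image) (simp add: inj_on_subset[OF inj_shift])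
    moreover have "V1 + u < V1 + V2" using u by simp
    then have "2 \<le> card (inputs n (V1 + V2) f (V1 + u))" using f unfolding is_parent_def by blast
    ultimately show "2 \<le> card (inputs n V2 upper_part u)" by (simp add: inp)
  qed (simp add: upper_part_def)
qed

private abbreviation "\<phi> s \<equiv> (case s of InLeg j \<Rightarrow> shift 0 V1 (c j) | OutOf v \<Rightarrow> OutOf v)"

lemma lower_bij: "bij_betw \<phi> (sources k V1) {s \<in> sources n (V1 + V2). \<forall>u. f s \<noteq> Into (V1 + u)}"
proof (rule bij_betw_imageI)
  have out: "OutOf v \<noteq> shift 0 V1 t" if "v < V1" for v t
    using that by (cases t) (auto simp: shift_def)
  have cinj: "c i = c j \<Longrightarrow> i < k \<Longrightarrow> j < k \<Longrightarrow> i = j" for i j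
    by (rule inj_onD[OF bij_betw_imp_inj_on[OF c]]) auto
  show "inj_on \<phi> (sources k V1)"
  proof (rule inj_onI)
    fix s t assume *: "s \<in> sources k V1" "t \<in> sources k V1" "\<phi> s = \<phi> t"
    show "s = t"
    proof (cases s)
      case s: (InLeg i)
      show ?thesis
      proof (cases t)
        case (InLeg j)
        then show ?thesis using * s cinj[of i j] by simp
      next
        case (OutOf v)
        then show ?thesis using * s out[of v "c i"] by simp
      qed
    next
      case s: (OutOf v)
      show ?thesis
      proof (cases t)
        case (InLeg j)
        then show ?thesis using * s out[of v "c j"] by simp
      qed (use * s in simp)
    qed
  qed
  show "\<phi> ` sources k V1 = {s \<in> sources n (V1 + V2). \<forall>u. f s \<noteq> Into (V1 + u)}"
  proof (intro set_eqI iffI)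
    fix x assume "x \<in> \<phi> ` sources k V1"
    then obtain s where s: "s \<in> sources k V1" "x = \<phi> s" by blast
    show "x \<in> {s \<in> sources n (V1 + V2). \<forall>u. f s \<noteq> Into (V1 + u)}"
    proof (cases s)
      case (InLeg j)
      then show ?thesis using s cut_inverse(4)[of j] sources_add[of 0 n V1 V2] by auto
    next
      case (OutOf v)
      then show ?thesis using s low by simp
    qed
  next
    fix x assume x: "x \<in> {s \<in> sources n (V1 + V2). \<forall>u. f s \<noteq> Into (V1 + u)}"
    then consider "x \<in> sources 0 V1" | t where "t \<in> sources n V2" "x = shift 0 V1 t"
      using sources_add[of 0 n V1 V2] by auto
    then show "x \<in> \<phi> ` sources k V1"
    proof cases
      case 1
      then show ?thesis by (intro image_eqI[of _ _ x]) (cases x; simp)+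
    next
      case 2
      then have "t \<in> K" using x by simp
      then show ?thesis using cut_inverse(1,2)[of t] 2
        by (intro image_eqI[of _ _ "InLeg (d t)"]) simp_all
    qed
  qed
qed

lemma lower_part_eq: "s \<in> sources k V1 \<Longrightarrow> lower_part s = f (\<phi> s)"
  by (cases s) (auto simp: lower_part_def)

lemma inputs_lower: "v < V1 \<Longrightarrow> inputs n (V1 + V2) f v = \<phi> ` inputs k V1 lower_part v"
proof (intro set_eqI iffI)
  fix s assume v: "v < V1" and s: "s \<in> inputs n (V1 + V2) f v"
  then have "s \<in> {s \<in> sources n (V1 + V2). \<forall>u. f s \<noteq> Into (V1 + u)}" by (auto simp: inputs_def)
  then obtain t where "t \<in> sources k V1" "s = \<phi> t" using lower_bij unfolding bij_betw_def by blast
  then show "s \<in> \<phi> ` inputs k V1 lower_part v" using s lower_part_eq[of t] by (auto simp: inputs_def)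
next
  fix s assume "s \<in> \<phi> ` inputs k V1 lower_part v"
  then obtain t where t: "t \<in> sources k V1" "s = \<phi> t" "lower_part t = Into v" by (auto simp: inputs_def)
  have "\<phi> t \<in> {s \<in> sources n (V1 + V2). \<forall>u. f s \<noteq> Into (V1 + u)}"
    using bij_betw_apply[OF lower_bij t(1)] .
  then show "s \<in> inputs n (V1 + V2) f v" using t lower_part_eq[of t] by (simp add: inputs_def)
qed

lemma card_inputs_lower: "v < V1 \<Longrightarrow> card (inputs n (V1 + V2) f v) = card (inputs k V1 lower_part v)"
  by (simp add: inputs_lower card_image
      inj_on_subset[OF bij_betw_imp_inj_on[OF lower_bij] inputs_subset])

lemma is_parent_lower: "is_parent m k V1 lower_part"
  unfolding is_parent_def
proof (intro conjI ballI allI impI)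
  fix s assume s: "s \<in> sources k V1"
  have "\<phi> s \<in> {s \<in> sources n (V1 + V2). \<forall>u. f s \<noteq> Into (V1 + u)}"
    using bij_betw_apply[OF lower_bij s] .
  then have *: "f (\<phi> s) \<in> OutLeg ` {..<m} \<union> Into ` {..<V1 + V2}" "\<And>u. f (\<phi> s) \<noteq> Into (V1 + u)"
    using f by (simp_all add: is_parent_def)
  show "lower_part s \<in> OutLeg ` {..<m} \<union> Into ` {..<V1}"
  proof (cases "f (\<phi> s)")
    case (Into x)
    then have "x < V1" using *(2)[of "x - V1"] by (cases "x < V1") simp_all
    then show ?thesis using lower_part_eq[OF s] Into by simp
  qed (use * lower_part_eq[OF s] in auto)
next
  fix j assume j: "j < m"
  obtain s where s: "s \<in> sources n (V1 + V2)" "f s = OutLeg j"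
    and un: "\<And>s'. s' \<in> sources n (V1 + V2) \<Longrightarrow> f s' = OutLeg j \<Longrightarrow> s' = s"
    using is_parent_OutLegE[OF f j] by blast
  have "s \<in> {s \<in> sources n (V1 + V2). \<forall>u. f s \<noteq> Into (V1 + u)}" using s by simp
  then obtain t where t: "t \<in> sources k V1" "s = \<phi> t" using lower_bij unfolding bij_betw_def by blast
  show "\<exists>!s. s \<in> sources k V1 \<and> lower_part s = OutLeg j"
  proof (rule ex1I[of _ t])
    show "t \<in> sources k V1 \<and> lower_part t = OutLeg j" using t s lower_part_eq by simp
    fix t' assume t': "t' \<in> sources k V1 \<and> lower_part t' = OutLeg j"
    then have "\<phi> t' \<in> sources n (V1 + V2)" "f (\<phi> t') = OutLeg j"
      using bij_betw_apply[OF lower_bij, of t'] lower_part_eq by auto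
    then have "\<phi> t' = \<phi> t" using un t by simp
    then show "t' = t" using bij_betw_imp_inj_on[OF lower_bij] t t' by (meson inj_onD)
  qed
next
  fix v assume "v < V1"
  moreover then have "v < V1 + V2" by simp
  then have "2 \<le> card (inputs n (V1 + V2) f v)" using f unfolding is_parent_def by blast
  ultimately show "2 \<le> card (inputs k V1 lower_part v)" by (simp add: card_inputs_lower)
qed (simp add: lower_part_def)

lemma compose_cut: "compose_parents False m k n V1 V2 lower_part upper_part = f"
proof
  fix s
  note cp = is_parent_lower is_parent_upper
  consider "s \<in> sources 0 V1" | t where "t \<in> sources n V2" "s = shift 0 V1 t" | "s \<notin> sources n (V1 + V2)"
    using sources_add[of 0 n V1 V2] by auto
  then show "compose_parents False m k n V1 V2 lower_part upper_part s = f s"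
  proof cases
    case 1
    then have "s \<in> sources k V1" by (cases s) auto
    then show ?thesis using 1 compose_left[OF cp, of False s] lower_part_eq[of s] by (cases s) auto
  next
    case 2
    show ?thesis
    proof (cases "t \<in> K")
      case True
      then show ?thesis
        using 2 compose_right[OF cp, of False t] cut_inverse(1,2)[OF True] upper_part_K[OF True]
        by (simp add: lower_part_eq)
    next
      case False
      then obtain u where "f (shift 0 V1 t) = Into (V1 + u)" "upper_part t = Into u"
        using upper_part_Into[OF 2(1)] by blast
      then show ?thesis using 2 compose_right[OF cp, of False t] by simp
    qed
  next
    case 3
    then show ?thesis using compose_outside[OF cp, of False s] f by (simp add: is_parent_def)
  qed
qed

end

section \<open>Boundaries of graphs with one ternary vertex\<close>

definition topological :: "nat \<Rightarrow> (nat source \<Rightarrow> nat target) \<Rightarrow> bool" where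
  "topological V f \<longleftrightarrow> (\<forall>u<V. \<forall>v. f (OutOf u) = Into v \<longrightarrow> v < u)"

lemma topological_ranked: "topological V f \<Longrightarrow> ranked V f"
  unfolding topological_def ranked_def by (rule exI[of _ "\<lambda>x. x"])

text \<open>
  The vertices of the upper factor are placed above all those of the lower one.
\<close>

lemma ranked_compose:
  assumes g: "is_parent m1 n1 V g" and k: "is_parent m2 n2 V2 k" and match: "b \<or> n1 = m2"
    and rg: "ranked V g" and rk: "ranked V2 k"
  shows "ranked (V + V2) (compose_parents b m1 n1 n2 V V2 g k)"
proof -
  let ?F = "compose_parents b m1 n1 n2 V V2 g k"
  obtain \<rho> :: "nat \<Rightarrow> nat" where \<rho>: "\<And>u v. u < V \<Longrightarrow> g (OutOf u) = Into v \<Longrightarrow> \<rho> v < \<rho> u"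
    using rg unfolding ranked_def by blast
  obtain \<rho>' :: "nat \<Rightarrow> nat" where \<rho>': "\<And>u v. u < V2 \<Longrightarrow> k (OutOf u) = Into v \<Longrightarrow> \<rho>' v < \<rho>' u"
    using rk unfolding ranked_def by blast
  \<comment> \<open>a bound for the heights in the lower factor\<close>
  define N where "N = Suc (\<Sum>v<V. \<rho> v)"
  have N: "\<rho> v < N" if "v < V" for v
    using member_le_sum[of v "{..<V}" \<rho>] that by (simp add: N_def)
  let ?r = "\<lambda>v. if v < V then \<rho> v else N + \<rho>' (v - V)"
  have "?r w < ?r u" if u: "u < V + V2" and Fu: "?F (OutOf u) = Into w" for u w
  proof (cases "u < V")
    case True
    then have "?F (OutOf u) = g (OutOf u)" using compose_left[OF g k match, of "OutOf u"] by simp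
    then have "g (OutOf u) = Into w" using Fu by simp
    then show ?thesis using \<rho>[OF True] is_parent_IntoD(2)[OF g] True by auto
  next
    case False
    then obtain x where x: "u = V + x" "x < V2" using u by (metis add_diff_inverse_nat nat_add_left_cancel_less)
    have sh: "shift (if b then n1 else 0) V (OutOf x) = OutOf u" by (simp add: shift_def x)
    have "?F (OutOf u) = (case k (OutOf x) of Into v \<Rightarrow> Into (V + v)
        | OutLeg j \<Rightarrow> if b then OutLeg (m1 + j) else g (InLeg j))"
      using compose_right[OF g k match, of "OutOf x"] x(2) unfolding sh by simp
    then consider v where "k (OutOf x) = Into v" "w = V + v" | j where "g (InLeg j) = Into w"
      using Fu by (auto split: target.splits if_splits)
    then show ?thesis
    proof cases
      case 1
      then show ?thesis using \<rho>'[OF x(2)] x by simp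
    next
      case 2
      then have "w < V" by (rule is_parent_IntoD(2)[OF g])
      then show ?thesis using N[of w] False by simp
    qed
  qed
  then show ?thesis unfolding ranked_def by (intro exI[of _ ?r]) blast
qed

lemma comp_wheel_free:
  assumes G: "G \<in> wheel_free_graphs lie_arities m1 n1" and K: "K \<in> wheel_free_graphs lie_arities m2 n2"
    and match: "b \<or> n1 = m2"
  shows "comp_graph b m1 n1 G K \<in> wheel_free_graphs lie_arities (comp_outs b m1 m2) (comp_ins b n1 n2)"
proof -
  have G': "G \<in> W m1 n1" "ranked (nverts G) (parent n1 G)" "int (nverts G) = int n1 - int m1"
    and K': "K \<in> W m2 n2" "ranked (nverts K) (parent n2 K)" "int (nverts K) = int n2 - int m2"
    using G K by (simp_all add: wheel_free_binary_iff)
  show ?thesis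
    using comp_in_W[OF G'(1) K'(1) match] parent_comp[OF G'(1) K'(1) match]
      ranked_compose[OF W_encodes(2)[OF G'(1)] W_encodes(2)[OF K'(1)] match G'(2) K'(2)] G'(3) K'(3) match
    by (auto simp: wheel_free_binary_iff comp_outs_def comp_ins_def)
qed

lemma jacobi_wheel_free: "jacobi \<in> graph_span (wheel_free_graphs lie_arities 1 3)"
proof -
  have keys: "Poly_Mapping.keys (jacobi :: dgraph \<Rightarrow>\<^sub>0 'a) \<subseteq> {bracket_tree 0 1 2, bracket_tree 1 2 0, bracket_tree 2 0 1}"
  proof -
    have "(jacobi :: dgraph \<Rightarrow>\<^sub>0 'a) \<in> graph_span {bracket_tree 0 1 2, bracket_tree 1 2 0, bracket_tree 2 0 1}"
      unfolding jacobi_def by (intro fvs.subspace_add[OF subspace_graph_span]) simp_all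
    then show ?thesis by (simp add: graph_span_def)
  qed
  have "(jacobi :: dgraph \<Rightarrow>\<^sub>0 'a) \<in> graph_span (W 1 3)"
    using top_boundaries_subset jacobi_in_top_boundaries by blast
  then have W: "Poly_Mapping.keys (jacobi :: dgraph \<Rightarrow>\<^sub>0 'a) \<subseteq> W 1 3" by (simp add: graph_span_def)
  have "G \<in> wheel_free_graphs lie_arities 1 3" if G: "G \<in> Poly_Mapping.keys (jacobi :: dgraph \<Rightarrow>\<^sub>0 'a)" for G
  proof -
    obtain a b c where G': "G = bracket_tree a b c" using G keys by auto
    then have "adjacency G = {(1, 0)}" by (auto simp: adjacency_def bracket_tree_def)
    then have "wheel_free G"
      unfolding wheel_free_def by (simp add: acyclic_insert acyclic_def[of "{}"])
    moreover have "G \<in> W 1 3" using G W by blast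
    moreover have "int (nverts G) = int 3 - int 1" using G' by (simp add: bracket_tree_def)
    ultimately show ?thesis unfolding wheel_free_graphs_def using binary_graphs_iff by blast
  qed
  then show ?thesis by (auto simp: graph_span_def)
qed

lemma one_ternary_vertex:
  assumes f: "is_parent m n V f" and V: "int V = int n - int m - 1"
  obtains p where "p < V" "card (inputs n V f p) = 3" "\<And>u. u < V \<Longrightarrow> u \<noteq> p \<Longrightarrow> card (inputs n V f u) = 2"
proof -
  have ge: "2 \<le> card (inputs n V f v)" if "v < V" for v using f that by (simp add: is_parent_def)
  have "(\<Sum>v<V. card (inputs n V f v)) = 2 * V + 1" using sum_card_inputs[OF f] V by linarith
  then have "(\<Sum>v<V. card (inputs n V f v) - 2) = 1"
    using ge by (subst sum_subtractf_nat) auto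
  from iffD1[OF sum_eq_1_iff[OF finite_lessThan] this]
  obtain p where p: "p < V" "card (inputs n V f p) - 2 = 1"
      "\<And>u. u < V \<Longrightarrow> p \<noteq> u \<Longrightarrow> card (inputs n V f u) - 2 = 0"
    unfolding Bex_def Ball_def lessThan_iff by metis
  have "card (inputs n V f p) = 3" using p(2) by linarith
  moreover have "card (inputs n V f u) = 2" if "u < V" "u \<noteq> p" for u
    using p(3)[OF that(1) that(2)[symmetric]] ge[OF that(1)] by linarith
  ultimately show thesis using that[OF p(1)] by blast
qed

text \<open>
  The identity on \<open>q\<close> strands.
\<close>

definition unit_parent :: "nat \<Rightarrow> nat source \<Rightarrow> nat target" where
  "unit_parent q s = (case s of InLeg i \<Rightarrow> if i < q then OutLeg i else OutLeg 0 | OutOf v \<Rightarrow> OutLeg 0)"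

lemma is_parent_unit: "is_parent q q 0 (unit_parent q)"
  unfolding is_parent_def
proof (intro conjI allI ballI impI)
  fix j assume "j < q"
  then show "\<exists>!s. s \<in> sources q 0 \<and> unit_parent q s = OutLeg j"
    by (intro ex1I[of _ "InLeg j"]) (auto simp: unit_parent_def sources_def)
qed (auto simp: unit_parent_def sources_def split: source.splits)

lemma comp_left_cong:
  assumes "K \<in> W m2 n2" "b \<or> n1 = m2" "cong_mod (C m1 n1) x y"
  shows "cong_mod (C (comp_outs b m1 m2) (comp_ins b n1 n2)) (comp_left b m1 n1 K x) (comp_left b m1 n1 K y)"
  using comp_left_in_C[OF assms(1,2), of "x - y" m1] assms(3) by (simp add: cong_mod_def lin_ext.diff)

lemma comp_right_cong:
  assumes "G \<in> W m1 n1" "b \<or> n1 = m2" "cong_mod (C m2 n2) x y"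
  shows "cong_mod (C (comp_outs b m1 m2) (comp_ins b n1 n2)) (comp_right b m1 n1 G x) (comp_right b m1 n1 G y)"
  using comp_right_in_C[OF assms(1,2), of "x - y" n2] assms(3) by (simp add: cong_mod_def lin_ext.diff)

lemma corolla3_parent:
  "parent 3 corolla3 (OutOf 0) = OutLeg 0" "i < 3 \<Longrightarrow> parent 3 corolla3 (InLeg i) = Into 0"
  "nverts corolla3 = 1"
proof -
  show "parent 3 corolla3 (OutOf 0) = OutLeg 0" "nverts corolla3 = 1"
    by (simp_all add: parent_def corolla3_def)
  assume "i < 3"
  then have "i = 0 \<or> i = 1 \<or> i = 2" by linarith
  then show "parent 3 corolla3 (InLeg i) = Into 0"
    by (elim disjE) (simp_all add: parent_def corolla3_def)
qed

text \<open>
  The vertices before and after the ternary one form the two binary factors, since in a topological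
  numbering edges only lead to smaller numbers. At the level of the ternary vertex, the
  \<open>q\<close> edges that pass by are identities.
\<close>

lemma topological_factorization:
  assumes b: "is_parent m n V b" and top: "topological V b" and V: "int V = int n - int m - 1"
  obtains q k' G1 G2 where "k' = 1 + q" "G1 \<in> wheel_free_graphs lie_arities m k'"
    "G2 \<in> wheel_free_graphs lie_arities (3 + q) n"
    "parent n (vcomp_graph (vcomp_graph G1 (hcomp_graph 1 3 corolla3 (graph_of q 0 (unit_parent q)))) G2) = b"
    "nverts (vcomp_graph (vcomp_graph G1 (hcomp_graph 1 3 corolla3 (graph_of q 0 (unit_parent q)))) G2) = V"
proof -
  obtain p where p: "p < V" "card (inputs n V b p) = 3"
    and other: "\<And>u. u < V \<Longrightarrow> u \<noteq> p \<Longrightarrow> card (inputs n V b u) = 2"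
    using one_ternary_vertex[OF b V] by blast
  define V2 where "V2 = V - Suc p"
  have VV: "V = Suc p + V2" using p(1) by (simp add: V2_def)
  have topI: "v < u" if "b (OutOf u) = Into v" for u v
    using top that is_parent_IntoD(1)[OF b that] by (auto simp: topological_def)
  let ?K = "{t \<in> sources n V2. \<forall>u. b (shift 0 (Suc p) t) \<noteq> Into (Suc p + u)}"
  define P where "P = {t \<in> sources n V2. b (shift 0 (Suc p) t) = Into p}"
  have "inputs n V b p = shift 0 (Suc p) ` P"
  proof (intro set_eqI iffI)
    fix s assume s: "s \<in> inputs n V b p"
    then have "s \<in> sources 0 (Suc p) \<union> shift 0 (Suc p) ` sources n V2"
      using sources_add[of 0 n "Suc p" V2] by (simp add: inputs_def VV)
    moreover have "s \<notin> sources 0 (Suc p)" using s topI by (cases s) (auto simp: inputs_def dest!: topI)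
    ultimately show "s \<in> shift 0 (Suc p) ` P" using s by (auto simp: P_def inputs_def)
  next
    fix s assume "s \<in> shift 0 (Suc p) ` P"
    then show "s \<in> inputs n V b p"
      using sources_add[of 0 n "Suc p" V2] by (auto simp: P_def inputs_def VV)
  qed
  then have cP: "card P = 3" using p(2) by (simp add: card_image inj_on_subset[OF inj_shift])
  have PK: "P \<subseteq> ?K" by (auto simp: P_def)
  obtain ks1 where ks1: "set ks1 = P" "distinct ks1"
    using finite_distinct_list[of P] by (auto simp: P_def)
  obtain ks2 where ks2: "set ks2 = ?K - P" "distinct ks2"
    using finite_distinct_list[of "?K - P"] by auto
  define q where "q = length ks2"
  define ks where "ks = ks1 @ ks2"
  have l1: "length ks1 = 3" using distinct_card[OF ks1(2)] ks1(1) cP by simp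
  have ks: "distinct ks" "set ks = ?K" "length ks = 3 + q"
    using ks1 ks2 PK l1 by (auto simp: ks_def q_def)
  let ?k = "3 + q"
  let ?c = "\<lambda>j. ks ! j"
  have c: "bij_betw ?c {..<?k} ?K" by (rule bij_betw_nth[OF ks(1)]) (simp_all only: ks(2,3))
  have b': "is_parent m n (Suc p + V2) b" using b VV by simp
  have low: "b (OutOf v) \<noteq> Into (Suc p + u)" if "v < Suc p" for v u
    using topI[of v "Suc p + u"] that by auto
  \<comment> \<open>first cut above the ternary vertex; the edges of \<open>ks1\<close> enter it and become the input legs \<open>0, 1, 2\<close>\<close>
  define h where "h = lower_part (Suc p) ?k b ?c"
  define g2 where "g2 = upper_part n (Suc p) V2 ?k b ?c"
  have h: "is_parent m ?k (Suc p) h" unfolding h_def by (rule is_parent_lower[OF b' low c])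
  have g2: "is_parent ?k n V2 g2" unfolding g2_def by (rule is_parent_upper[OF b' low c])
  have bcut: "compose_parents False m ?k n (Suc p) V2 h g2 = b"
    unfolding h_def g2_def by (rule compose_cut[OF b' low c])
  have h_out: "h (OutOf v) = b (OutOf v)" if "v < Suc p" for v
    unfolding h_def using that by (simp add: lower_part_def[OF b' low c])
  have h_in: "h (InLeg j) = b (shift 0 (Suc p) (ks ! j))" if "j < ?k" for j
    unfolding h_def using that by (simp add: lower_part_def[OF b' low c])
  have h_p: "h (InLeg j) = Into p \<longleftrightarrow> j < 3" if j: "j < ?k" for j
  proof (cases "j < 3")
    case True
    then have "ks ! j \<in> P" using ks1(1) l1 nth_mem[of j ks1] by (simp add: ks_def nth_append)
    then show ?thesis using True h_in[OF j] by (simp add: P_def)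
  next
    case False
    then have "ks ! j \<in> ?K - P" using ks2(1) l1 j nth_mem[of "j - 3" ks2] by (simp add: ks_def nth_append q_def)
    then show ?thesis using False h_in[OF j] by (simp add: P_def)
  qed
  \<comment> \<open>then cut below it; leg \<open>0\<close> is its output and the others are the strands passing by\<close>
  define c' :: "nat \<Rightarrow> nat source" where "c' j = (if j = 0 then OutOf 0 else InLeg (j + 2))" for j
  let ?K' = "{t \<in> sources ?k 1. \<forall>u. h (shift 0 p t) \<noteq> Into (p + u)}"
  have h': "is_parent m ?k (p + 1) h" using h by simp
  have low': "h (OutOf v) \<noteq> Into (p + u)" if "v < p" for v u
    using h_out[of v] topI[of v "p + u"] that by auto
  have K': "?K' = insert (OutOf 0) (InLeg ` {3..<?k})"
  proof (intro set_eqI)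
    fix t
    show "t \<in> ?K' \<longleftrightarrow> t \<in> insert (OutOf 0) (InLeg ` {3..<?k})"
    proof (cases t)
      case (InLeg j)
      have sh: "shift 0 p t = InLeg j" by (simp add: InLeg shift_def)
      have "(\<forall>u. h (InLeg j) \<noteq> Into (p + u)) \<longleftrightarrow> h (InLeg j) \<noteq> Into p" if "j < ?k"
      proof
        assume *: "h (InLeg j) \<noteq> Into p"
        show "\<forall>u. h (InLeg j) \<noteq> Into (p + u)"
        proof (intro allI notI)
          fix u assume hu: "h (InLeg j) = Into (p + u)"
          then have "p + u < Suc p" using is_parent_IntoD(2)[OF h] by blast
          then show False using hu * by simp
        qed
      qed (metis add.right_neutral)
      then show ?thesis using h_p[of j] unfolding mem_Collect_eq sh by (auto simp: InLeg)
    next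
      case (OutOf v)
      have "h (OutOf p) \<noteq> Into (p + u)" for u
        using h_out[of p] topI[of p "p + u"] by auto
      then show ?thesis using OutOf by (auto simp: shift_def)
    qed
  qed
  have c'_bij: "bij_betw c' {..<1 + q} ?K'"
    unfolding K'
  proof (rule bij_betw_imageI)
    show "inj_on c' {..<1 + q}" by (auto simp: inj_on_def c'_def split: if_splits)
    show "c' ` {..<1 + q} = insert (OutOf 0) (InLeg ` {3..<?k})"
    proof (intro set_eqI iffI)
      fix x :: "nat source" assume "x \<in> insert (OutOf 0) (InLeg ` {3..<?k})"
      then consider "x = OutOf 0" | i where "x = InLeg i" "3 \<le> i" "i < ?k" by auto
      then show "x \<in> c' ` {..<1 + q}"
      proof cases
        case 1
        then show ?thesis by (intro image_eqI[of _ _ 0]) (auto simp: c'_def)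
      next
        case 2
        then show ?thesis by (intro image_eqI[of _ _ "i - 2"]) (auto simp: c'_def)
      qed
    qed (auto simp: c'_def)
  qed
  define g1 where "g1 = lower_part p (1 + q) h c'"
  define e where "e = upper_part ?k p 1 (1 + q) h c'"
  have g1: "is_parent m (1 + q) p g1" unfolding g1_def by (rule is_parent_lower[OF h' low' c'_bij])
  have e: "is_parent (1 + q) ?k 1 e" unfolding e_def by (rule is_parent_upper[OF h' low' c'_bij])
  have hcut: "compose_parents False m (1 + q) ?k p 1 g1 e = h"
    unfolding g1_def e_def by (rule compose_cut[OF h' low' c'_bij])
  have e_cut: "e (c' j) = OutLeg j" if "j < 1 + q" for j
  proof -
    have "c' j \<in> ?K'" using c'_bij that by (auto simp: bij_betw_def)
    then have "e (c' j) = OutLeg (the_inv_into {..<1 + q} c' (c' j))"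
      unfolding e_def
      using upper_part_K[OF h' low' c'_bij, of "c' j"] by blast
    then show ?thesis using the_inv_into_f_f[OF bij_betw_imp_inj_on[OF c'_bij], of j] that by simp
  qed
  let ?I = "graph_of q 0 (unit_parent q)"
  have I: "?I \<in> W q q" using is_parent_unit by simp
  have parI: "parent q ?I = unit_parent q" by (rule parent_graph_of[OF is_parent_unit])
  let ?E = "hcomp_graph 1 3 corolla3 ?I"
  have E: "?E \<in> W (1 + q) (3 + q)"
    using comp_in_W[OF corolla3_in_W I, of True] by (simp add: comp_graph_def comp_outs_def comp_ins_def)
  \<comment> \<open>the middle layer is the corolla next to \<open>q\<close> strands\<close>
  have "parent (3 + q) ?E = compose_parents True 1 3 q 1 0 (parent 3 corolla3) (unit_parent q)"
    using parent_comp[OF corolla3_in_W I, of True] parI corolla3_parent(3)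
    by (simp add: comp_graph_def comp_ins_def)
  also have "\<dots> = e"
  proof
    fix s
    note cp = W_encodes(2)[OF corolla3_in_W, unfolded corolla3_parent(3)] is_parent_unit[of q]
    consider "s = OutOf 0" | i where "s = InLeg i" "i < 3" | i where "s = InLeg (3 + i)" "i < q"
        | "s \<notin> sources (3 + q) 1"
    proof (cases s)
      case (InLeg i)
      then show ?thesis using that(2)[of i] that(3)[of "i - 3"] that(4) by (cases "i < 3"; cases "i < 3 + q") auto
    next
      case (OutOf v)
      then show ?thesis using that(1,4) by (cases "v = 0") auto
    qed
    then show "compose_parents True 1 3 q 1 0 (parent 3 corolla3) (unit_parent q) s = e s"
    proof cases
      case 1
      then show ?thesis using compose_left[OF cp, of True s] corolla3_parent(1) e_cut[of 0] by (simp add: c'_def)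
    next
      case 2
      have "h (InLeg i) = Into (p + 0)" using h_p[of i] 2(2) by simp
      then have "InLeg i \<in> sources ?k 1 \<and> InLeg i \<notin> ?K'" using 2 by (auto simp: shift_def)
      then obtain u where "h (shift 0 p (InLeg i)) = Into (p + u)" "e (InLeg i) = Into u"
        using upper_part_Into[OF h' low' c'_bij, of "InLeg i"] unfolding e_def by blast
      then have "e (InLeg i) = Into 0" using \<open>h (InLeg i) = Into (p + 0)\<close> by (simp add: shift_def)
      then show ?thesis using 2 compose_left[OF cp, of True s] corolla3_parent(2)[of i] by simp
    next
      case 3
      have "c' (1 + i) = InLeg (3 + i)" by (simp add: c'_def)
      then have "e (InLeg (3 + i)) = OutLeg (1 + i)" using e_cut[of "1 + i"] 3(2) by simp
      then show ?thesis
        using 3 compose_right[OF cp, of True "InLeg i"] by (simp add: shift_def unit_parent_def)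
    next
      case 4
      then show ?thesis using compose_outside[OF cp, of True s] e by (simp add: is_parent_def)
    qed
  qed
  finally have parE: "parent (3 + q) ?E = e" .
  let ?G1 = "graph_of (1 + q) p g1" and ?G2 = "graph_of n V2 g2"
  have G1: "?G1 \<in> W m (1 + q)" "parent (1 + q) ?G1 = g1" using g1 by simp_all
  have G2: "?G2 \<in> W ?k n" "parent n ?G2 = g2" using g2 by simp_all
  let ?H = "vcomp_graph ?G1 ?E"
  have nE: "nverts ?E = 1" by (simp add: corolla3_parent(3))
  have H1: "?H \<in> W m ?k"
    using comp_in_W[OF G1(1) E, of False] by (simp add: comp_graph_def comp_outs_def comp_ins_def)
  have "parent ?k ?H = compose_parents False m (1 + q) ?k (nverts ?G1) (nverts ?E)
      (parent (1 + q) ?G1) (parent ?k ?E)"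
    using parent_comp[OF G1(1) E, of False] by (simp add: comp_graph_def comp_ins_def)
  moreover have "nverts ?G1 = p" by simp
  ultimately have H2: "parent ?k ?H = h" by (simp only: nE G1(2) parE hcut)
  note H = H1 H2
  have nH: "nverts ?H = Suc p" using nE by simp
  have "parent n (vcomp_graph ?H ?G2) =
      compose_parents False m ?k n (nverts ?H) (nverts ?G2) (parent ?k ?H) (parent n ?G2)"
    using parent_comp[OF H(1) G2(1), of False] by (simp add: comp_graph_def comp_ins_def)
  moreover have "nverts ?G2 = V2" by simp
  ultimately have "parent n (vcomp_graph ?H ?G2) = b" by (simp only: nH H(2) G2(2) bcut)
  moreover have "nverts (vcomp_graph ?H ?G2) = V" using nH VV by simp
  moreover have "?G1 \<in> wheel_free_graphs lie_arities m (1 + q)"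
  proof -
    have "card (inputs (1 + q) p g1 v) = 2" if v: "v < p" for v
    proof -
      have "card (inputs (1 + q) p g1 v) = card (inputs ?k (p + 1) h v)"
        unfolding g1_def by (rule card_inputs_lower[OF h' low' c'_bij v, symmetric])
      also have "\<dots> = card (inputs n (Suc p + V2) b v)"
        unfolding h_def using card_inputs_lower[OF b' low c, of v] v by simp
      finally show ?thesis using other[of v] v VV by simp
    qed
    then have "int p = int (1 + q) - int m" using binary_iff_top_degree[OF g1] by blast
    moreover have "topological p g1" unfolding topological_def
    proof (intro allI impI)
      fix u v assume u: "u < p" "g1 (OutOf u) = Into v"
      then have "h (OutOf u) = Into v"
        using lower_part_def[OF h' low' c'_bij, of "OutOf u"] by (simp add: g1_def sources_def)
      then show "v < u" using h_out[of u] u(1) topI by simp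
    qed
    ultimately show ?thesis using G1 topological_ranked by (simp add: wheel_free_binary_iff)
  qed
  moreover have "?G2 \<in> wheel_free_graphs lie_arities (3 + q) n"
  proof -
    have "card (inputs n V2 g2 u) = 2" if u: "u < V2" for u
    proof -
      have "inputs n V b (Suc p + u) = shift 0 (Suc p) ` inputs n V2 g2 u"
        unfolding g2_def VV by (rule inputs_upper[OF b' low c])
      then have "card (inputs n V2 g2 u) = card (inputs n V b (Suc p + u))"
        by (simp add: card_image inj_on_subset[OF inj_shift])
      then show ?thesis using other[of "Suc p + u"] u VV by simp
    qed
    then have "int V2 = int n - int ?k" using binary_iff_top_degree[OF g2] by blast
    moreover have "topological V2 g2" unfolding topological_def
    proof (intro allI impI)
      fix u v assume u: "u < V2" "g2 (OutOf u) = Into v"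
      then have "OutOf u \<in> inputs n V2 g2 v" by (simp add: inputs_def)
      then have "shift 0 (Suc p) (OutOf u) \<in> inputs n (Suc p + V2) b (Suc p + v)"
        using inputs_upper[OF b' low c] unfolding g2_def by blast
      then show "v < u" using topI[of "Suc p + u" "Suc p + v"] by (simp add: inputs_def shift_def)
    qed
    ultimately show ?thesis using G2 topological_ranked by (simp add: wheel_free_binary_iff)
  qed
  ultimately show thesis using that[of "1 + q" q ?G1 ?G2] by simp
qed

text \<open>
  The differential of a composite of a graph with binary graphs is, up to sign, the composite of the
  differential. So the boundary of the factorized graph is the corresponding composite of the Jacobi
  relation.
\<close>

lemma ideal_of_topological:
  assumes b: "is_parent m n V b" and top: "topological V b" and V: "int V = int n - int m - 1"
  obtains y where "prop_ideal lie_arities jacobi_relations m n y"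
    "y \<in> graph_span (wheel_free_graphs lie_arities m n)"
    "cong_mod (C m n) (split_sum n V b) (y :: dgraph \<Rightarrow>\<^sub>0 'k::field)"
proof -
  obtain q k' G1 G2 where k': "k' = 1 + q" and G1: "G1 \<in> wheel_free_graphs lie_arities m k'"
    and G2: "G2 \<in> wheel_free_graphs lie_arities (3 + q) n"
    and par: "parent n (vcomp_graph (vcomp_graph G1 (hcomp_graph 1 3 corolla3 (graph_of q 0 (unit_parent q)))) G2) = b"
    and nv: "nverts (vcomp_graph (vcomp_graph G1 (hcomp_graph 1 3 corolla3 (graph_of q 0 (unit_parent q)))) G2) = V"
    by (rule topological_factorization[OF b top V])
  let ?I = "graph_of q 0 (unit_parent q)"
  let ?E = "comp_graph True 1 3 corolla3 ?I"
  let ?H = "comp_graph False m k' G1 ?E"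
  let ?B = "comp_graph False m (3 + q) ?H G2"
  let ?cj = "comp_left True 1 3 ?I :: (dgraph \<Rightarrow>\<^sub>0 'k) \<Rightarrow> _"
  let ?cg = "comp_right False m k' G1 :: (dgraph \<Rightarrow>\<^sub>0 'k) \<Rightarrow> _"
  let ?cl = "comp_left False m (3 + q) G2 :: (dgraph \<Rightarrow>\<^sub>0 'k) \<Rightarrow> _"
  have IW: "?I \<in> W q q" using is_parent_unit by simp
  have I: "?I \<in> wheel_free_graphs lie_arities q q"
    using IW by (simp add: wheel_free_binary_iff ranked_def)
  have L: "G \<in> wheeled_graphs lie_arities m n" if "G \<in> wheel_free_graphs lie_arities m n" for G m n
    using that by (simp add: wheel_free_graphs_def)
  note WI = binary_parent(1)[OF L]
  have E: "?E \<in> W (1 + q) (3 + q)"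
    using comp_in_W[OF corolla3_in_W IW, of True] by (simp add: comp_outs_def comp_ins_def)
  have H: "?H \<in> W m (3 + q)"
    using comp_in_W[OF WI[OF G1] E, of False] k' by (simp add: comp_outs_def comp_ins_def)
  have B: "?B \<in> W m n"
    using comp_in_W[OF H WI[OF G2], of False] by (simp add: comp_outs_def comp_ins_def)
  have outs: "comp_outs True 1 q = 1 + q" "comp_ins True 3 q = 3 + q"
      "comp_outs False m k' = m" "comp_ins False k' (3 + q) = 3 + q"
      "comp_outs False m (3 + q) = m" "comp_ins False (3 + q) n = n"
    by (simp_all add: comp_outs_def comp_ins_def)
  obtain s3 where s3: "cong_mod (C (1 + q) (3 + q)) (lie_inf_diff (fgen ?E))
      (fscale s3 (?cj (lie_inf_diff (fgen corolla3))))"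
    using comp_left_boundaries(2)[OF L[OF I], of True 3 corolla3 1, where 'k='k] corolla3_in_W
    unfolding outs by blast
  have "cong_mod (C (1 + q) (3 + q)) (?cj (lie_inf_diff (fgen corolla3))) (?cj jacobi)"
    using comp_left_cong[OF IW _ cong_mod_sym[OF subspace_coinv_rels diff_corolla3], of True, where 'a='k]
    unfolding outs by simp
  then have dE: "cong_mod (C (1 + q) (3 + q)) (lie_inf_diff (fgen ?E)) (fscale s3 (?cj jacobi))"
    by (intro cong_coinv_trans[OF s3] cong_mod_scale[OF subspace_coinv_rels])
  obtain s2 where s2: "cong_mod (C m (3 + q)) (lie_inf_diff (fgen ?H)) (fscale s2 (?cg (lie_inf_diff (fgen ?E))))"
    using comp_right_boundaries(2)[OF L[OF G1], of False "1 + q" ?E "3 + q", where 'k='k] k' E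
    unfolding outs comp_outs_def comp_ins_def by auto
  have "cong_mod (C m (3 + q)) (?cg (lie_inf_diff (fgen ?E))) (?cg (fscale s3 (?cj jacobi)))"
    using comp_right_cong[OF WI[OF G1] _ dE, of False] k' unfolding comp_outs_def comp_ins_def by simp
  then have dH: "cong_mod (C m (3 + q)) (lie_inf_diff (fgen ?H)) (fscale s2 (?cg (fscale s3 (?cj jacobi))))"
    by (intro cong_coinv_trans[OF s2] cong_mod_scale[OF subspace_coinv_rels])
  obtain s1 where s1: "cong_mod (C m n) (lie_inf_diff (fgen ?B)) (fscale s1 (?cl (lie_inf_diff (fgen ?H))))"
    using comp_left_boundaries(2)[OF L[OF G2], of False "3 + q" ?H m, where 'k='k] H
    unfolding outs by auto
  have "cong_mod (C m n) (?cl (lie_inf_diff (fgen ?H))) (?cl (fscale s2 (?cg (fscale s3 (?cj jacobi)))))"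
    using comp_left_cong[OF WI[OF G2] _ dH, of False] unfolding outs by simp
  then have "cong_mod (C m n) (lie_inf_diff (fgen ?B)) (fscale s1 (?cl (fscale s2 (?cg (fscale s3 (?cj jacobi))))))"
    by (intro cong_coinv_trans[OF s1] cong_mod_scale[OF subspace_coinv_rels])
  then have dB: "cong_mod (C m n) (lie_inf_diff (fgen ?B)) (fscale (s1 * s2 * s3) (?cl (?cg (?cj jacobi))))"
    by (simp add: lin_ext.scale mult.assoc)
  let ?x = "?cl (?cg (?cj jacobi))"
  have hI: "?cj x = hcomp 1 3 x (fgen ?I)" for x
    unfolding bilin_ext_right lin_ext_fgen by (simp add: comp_graph_def)
  have hg: "?cg x = vcomp (fgen G1) x" for x
    unfolding bilin_ext_left lin_ext_fgen by (simp add: comp_graph_def)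
  have hl: "?cl x = vcomp x (fgen G2)" for x
    unfolding bilin_ext_right lin_ext_fgen by (simp add: comp_graph_def)
  have "prop_ideal lie_arities jacobi_relations 1 3 (jacobi :: dgraph \<Rightarrow>\<^sub>0 'k)"
    by (rule prop_ideal.generator) (simp add: jacobi_relations_def)
  then have "prop_ideal lie_arities jacobi_relations (1 + q) (3 + q) (?cj jacobi)"
    unfolding hI by (rule prop_ideal.hcomp_left) (use I in simp)
  then have "prop_ideal lie_arities jacobi_relations m (3 + q) (?cg (?cj jacobi))"
    unfolding hg by (intro prop_ideal.vcomp_right[of _ _ _ "1 + q"]) (use G1 k' in simp)
  then have ideal: "prop_ideal lie_arities jacobi_relations m n ?x"
    unfolding hl by (rule prop_ideal.vcomp_left) (use G2 in simp)
  have "?cj jacobi \<in> graph_span (wheel_free_graphs lie_arities (1 + q) (3 + q))"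
    by (rule lin_ext_in_subspace[OF subspace_graph_span jacobi_wheel_free])
       (use comp_wheel_free[OF _ I, of _ 1 3 True] in \<open>simp add: comp_outs_def comp_ins_def\<close>)
  then have "?cg (?cj jacobi) \<in> graph_span (wheel_free_graphs lie_arities m (3 + q))"
    by (rule lin_ext_in_subspace[OF subspace_graph_span])
       (use comp_wheel_free[OF G1, of _ "1 + q" "3 + q" False] k' in \<open>simp add: comp_outs_def comp_ins_def\<close>)
  then have wf: "?x \<in> graph_span (wheel_free_graphs lie_arities m n)"
    by (rule lin_ext_in_subspace[OF subspace_graph_span])
       (use comp_wheel_free[OF _ G2, of _ m "3 + q" False] in \<open>simp add: comp_outs_def comp_ins_def\<close>)
  let ?c = "(-1) ^ (V + 1) :: 'k"
  have parB: "parent n ?B = b" "nverts ?B = V" using par nv by (simp_all only: comp_graph_def if_True if_False k')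
  have "cong_mod (C m n) (lie_inf_diff (fgen ?B)) (fscale ?c (split_sum n V b))"
    using diff_graph_cong[OF W_encodes[OF B], where 'a='k] parB unfolding diff_fgen by simp
  from cong_mod_scale[OF subspace_coinv_rels cong_mod_sym[OF subspace_coinv_rels this], of ?c]
  have "cong_mod (C m n) (split_sum n V b) (fscale ?c (lie_inf_diff (fgen ?B)))"
    by (simp flip: power_mult_distrib)
  also have "cong_mod (C m n) \<dots> (fscale ?c (fscale (s1 * s2 * s3) ?x))"
    by (rule cong_mod_scale[OF subspace_coinv_rels dB])
  finally show thesis
    by (rule that[rotated 2]) (intro prop_ideal.scale ideal fvs.subspace_scale[OF subspace_graph_span] wf)+
qed

lemma ideal_of_ranked:
  assumes f: "is_parent m n V f" and r: "ranked V f" and V: "int V = int n - int m - 1"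
  obtains y where "prop_ideal lie_arities jacobi_relations m n y"
    "y \<in> graph_span (wheel_free_graphs lie_arities m n)"
    "cong_mod (C m n) (split_sum n V f) (y :: dgraph \<Rightarrow>\<^sub>0 'k::field)"
proof -
  obtain \<sigma> where \<sigma>: "\<sigma> permutes {..<V}"
    and top: "\<And>u v. u < V \<Longrightarrow> relabel \<sigma> f (OutOf u) = Into v \<Longrightarrow> v < V \<Longrightarrow> v < u"
    using topological_numbering[OF r] by metis
  note b = is_parent_relabel[OF \<sigma> f]
  have "topological V (relabel \<sigma> f)"
    unfolding topological_def using top is_parent_IntoD(2)[OF b] by blast
  then obtain y :: "dgraph \<Rightarrow>\<^sub>0 'k" where y: "prop_ideal lie_arities jacobi_relations m n y"
      "y \<in> graph_span (wheel_free_graphs lie_arities m n)"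
      "cong_mod (C m n) (split_sum n V (relabel \<sigma> f)) y"
    using ideal_of_topological[OF b _ V] by blast
  have "cong_mod (C m n) (fscale (fsign \<sigma>) (split_sum n V f)) (split_sum n V (relabel \<sigma> f) :: dgraph \<Rightarrow>\<^sub>0 'k)"
    by (rule cong_mod_sym[OF subspace_coinv_rels split_sum_relabel[OF f \<sigma>]])
  from cong_mod_scale[OF subspace_coinv_rels cong_coinv_trans[OF this y(3)], of "fsign \<sigma>"]
  have "cong_mod (C m n) (split_sum n V f) (fscale (fsign \<sigma>) y)" by simp
  then show thesis
    by (rule that[rotated 2]) (intro prop_ideal.scale y fvs.subspace_scale[OF subspace_graph_span])+
qed

section \<open>Breaking all wheels\<close>

fun break_parents :: "nat \<Rightarrow> nat \<Rightarrow> nat list \<Rightarrow> (nat source \<Rightarrow> nat target) \<Rightarrow> nat source \<Rightarrow> nat target" where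
  "break_parents m n [] f = f"
| "break_parents m n (u # us) f = break_parents (Suc m) (Suc n) us (break_parent m n (OutOf u) f)"

lemma break_parents_Into:
  "break_parents m n us f (OutOf x) = Into v \<Longrightarrow> f (OutOf x) = Into v \<and> x \<notin> set us"
proof (induction us arbitrary: m n f)
  case (Cons u us)
  then have "break_parent m n (OutOf u) f (OutOf x) = Into v \<and> x \<notin> set us" by fastforce
  then show ?case by (auto simp: break_parent_def split: if_splits)
qed simp

lemma break_parents_step:
  assumes f: "is_parent m n V f" and d: "distinct (u # us)"
    and us: "\<forall>x\<in>set (u # us). x < V \<and> (\<exists>v. f (OutOf x) = Into v)"
  defines "f' \<equiv> break_parent m n (OutOf u) f" and "\<iota> \<equiv> \<lambda>s. if s = OutOf u then InLeg n else s"
  shows "is_parent (Suc m) (Suc n) V f'" "distinct us"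
      "\<forall>x\<in>set us. x < V \<and> (\<exists>v. f' (OutOf x) = Into v)"
    and "bij_betw (\<lambda>(w, A). (w, \<iota> ` A)) (splittings n V f) (splittings (Suc n) V f')"
    and "\<And>w A. (w, A) \<in> splittings n V f \<Longrightarrow>
      break_parent m n (OutOf u) (split_at V f w A) = split_at V f' w (\<iota> ` A)"
proof -
  obtain v where u: "u < V" "f (OutOf u) = Into v" using us by auto
  show "is_parent (Suc m) (Suc n) V f'" unfolding f'_def by (rule is_parent_break[OF f u])
  show "distinct us" using d by simp
  show "\<forall>x\<in>set us. x < V \<and> (\<exists>v. f' (OutOf x) = Into v)"
    using us d by (auto simp: f'_def break_parent_def)
  have "bij_betw (\<lambda>(w, A). ((\<lambda>v. v) w, \<iota> ` A)) (splittings n V f) (splittings (Suc n) V f')"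
  proof (rule splittings_transfer)
    show "inj_on \<iota> (\<Union>v<V. inputs n V f v)" by (auto simp: inj_on_def inputs_def \<iota>_def split: if_splits)
    show "inputs (Suc n) V f' w = \<iota> ` inputs n V f w" for w
      unfolding f'_def \<iota>_def by (rule inputs_break[OF f u])
  qed auto
  then show "bij_betw (\<lambda>(w, A). (w, \<iota> ` A)) (splittings n V f) (splittings (Suc n) V f')" by simp
  show "break_parent m n (OutOf u) (split_at V f w A) = split_at V f' w (\<iota> ` A)"
    if "(w, A) \<in> splittings n V f" for w A
    unfolding f'_def \<iota>_def by (rule break_split[OF f u that])
qed

text \<open>
  By induction on the broken edges; each of them only renames one source, so that the splittings
  before and after correspond.
\<close>

lemma break_parents_split:
  assumes "is_parent m n V f" "distinct us" "\<forall>u\<in>set us. u < V \<and> (\<exists>v. f (OutOf u) = Into v)"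
  shows "is_parent (m + length us) (n + length us) V (break_parents m n us f) \<and>
    (\<forall>w A. (w, A) \<in> splittings n V f \<longrightarrow> (\<exists>B. (w, B) \<in> splittings (n + length us) V (break_parents m n us f) \<and>
      break_parents m n us (split_at V f w A) = split_at V (break_parents m n us f) w B)) \<and>
    (\<Sum>(w, A)\<in>splittings n V f. pgen (n + length us) (Suc V) (break_parents m n us (split_at V f w A))) =
      (split_sum (n + length us) V (break_parents m n us f) :: dgraph \<Rightarrow>\<^sub>0 'k::field)"
  using assms
proof (induction us arbitrary: m n f)
  case Nil
  then show ?case by (auto simp: split_sum_def)
next
  case (Cons u us)
  let ?f = "break_parent m n (OutOf u) f" and ?\<iota> = "\<lambda>s. if s = OutOf u then InLeg n else s"
  note step = break_parents_step[OF Cons.prems]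
  note IH = Cons.IH[OF step(1-3)]
  let ?b = "break_parents (Suc m) (Suc n) us"
  have "\<exists>B. (w, B) \<in> splittings (Suc n + length us) V (?b ?f) \<and>
      ?b (break_parent m n (OutOf u) (split_at V f w A)) = split_at V (?b ?f) w B"
    if A: "(w, A) \<in> splittings n V f" for w A
  proof -
    have "(w, ?\<iota> ` A) \<in> splittings (Suc n) V ?f"
      using bij_betw_apply[OF step(4) A] by simp
    then show ?thesis using IH step(5)[OF A] by simp
  qed
  moreover have "(\<Sum>(w, A)\<in>splittings n V f. pgen (Suc n + length us) (Suc V)
        (?b (break_parent m n (OutOf u) (split_at V f w A)))) =
      (split_sum (Suc n + length us) V (?b ?f) :: dgraph \<Rightarrow>\<^sub>0 'k)"
  proof -
    let ?F = "\<lambda>(w, B). pgen (Suc n + length us) (Suc V) (?b (split_at V ?f w B)) :: dgraph \<Rightarrow>\<^sub>0 'k"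
    have "(\<Sum>(w, A)\<in>splittings n V f. pgen (Suc n + length us) (Suc V)
        (?b (break_parent m n (OutOf u) (split_at V f w A)))) =
        (\<Sum>p\<in>splittings n V f. ?F ((\<lambda>(w, A). (w, ?\<iota> ` A)) p))"
      by (rule sum.cong[OF refl]) (auto simp: step(5))
    also have "\<dots> = (\<Sum>p\<in>splittings (Suc n) V ?f. ?F p)"
      by (rule sum.reindex_bij_betw[OF step(4)])
    finally show ?thesis using IH by simp
  qed
  ultimately show ?case using IH by simp
qed

lemma break_edges_in_W:
  assumes "G \<in> W m n" "distinct us"
    "\<And>u. u \<in> set us \<Longrightarrow> k + u < length (edges G) \<and> (\<exists>v. edges G ! (k + u) = (OutOf u, Into v))"
  shows "break_edges m n (map ((+) k) us) G \<in> W (m + length us) (n + length us) \<and>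
    parent (n + length us) (break_edges m n (map ((+) k) us) G) = break_parents m n us (parent n G) \<and>
    nverts (break_edges m n (map ((+) k) us) G) = nverts G"
  using assms
proof (induction us arbitrary: m n G)
  case (Cons u us)
  obtain v where e: "k + u < length (edges G)" "edges G ! (k + u) = (OutOf u, Into v)"
    using Cons.prems(3)[of u] by auto
  note b = break_edge_in_W[OF Cons.prems(1) e]
  have "k + x < length (edges (break_edge m n (k + u) G)) \<and>
      (\<exists>v. edges (break_edge m n (k + u) G) ! (k + x) = (OutOf x, Into v))" if x: "x \<in> set us" for x
  proof -
    have "x \<noteq> u" using x Cons.prems(2) by auto
    then show ?thesis using Cons.prems(3)[of x] x by (auto simp: break_edge_def nth_append)
  qed
  from Cons.IH[OF b(1) _ this] Cons.prems(2) show ?case by (simp add: b(2))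
qed simp

text \<open>
  A step of the original graph remains a step or becomes two, through the new vertex.
\<close>

lemma step_rel_split:
  assumes f: "is_parent m n V f" and A: "(w, A) \<in> splittings n V f"
  shows "step_rel V f \<subseteq> (step_rel (Suc V) (split_at V f w A))\<^sup>+"
proof clarify
  fix x y assume xy: "(x, y) \<in> step_rel V f"
  let ?R = "step_rel (Suc V) (split_at V f w A)"
  note fA = splitting_facts[OF f A]
  have x: "x < V" "f (OutOf x) = Into y" using xy by (auto simp: step_rel_def)
  show "(x, y) \<in> ?R\<^sup>+"
  proof (cases "OutOf x \<in> A")
    case True
    then have "y = w" using fA(4) x by simp
    have "(x, V) \<in> ?R" using True x by (simp add: step_rel_def split_at_def)
    moreover have "(V, w) \<in> ?R" using fA(2) by (simp add: step_rel_def split_at_def)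
    ultimately show ?thesis using \<open>y = w\<close> by (metis trancl.simps)
  next
    case False
    then have "(x, y) \<in> ?R" using x by (simp add: step_rel_def split_at_def)
    then show ?thesis by blast
  qed
qed

lemma cyclic_edge_split:
  assumes f: "is_parent m n V f" and A: "(w, A) \<in> splittings n V f"
    and u: "u < V" "f (OutOf u) = Into v" "(v, u) \<in> (step_rel V f)\<^sup>*"
  shows "cyclic_edge (graph_of n (Suc V) (split_at V f w A)) (n + u)"
    and "\<exists>v'. edges (graph_of n (Suc V) (split_at V f w A)) ! (n + u) = (OutOf u, Into v')"
    and "n + u < length (edges (graph_of n (Suc V) (split_at V f w A)))"
proof -
  let ?g = "split_at V f w A" and ?R = "step_rel (Suc V) (split_at V f w A)"
  let ?G = "graph_of n (Suc V) ?g"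
  note fA = splitting_facts[OF f A]
  have ad: "adjacency ?G = ?R"
    using adjacency_encodes[OF encodes_graph_of, of n "Suc V" ?g] by (simp add: graph_of_def)
  have edge: "edges ?G ! (n + u) = (OutOf u, ?g (OutOf u))"
  proof -
    have "(map InLeg [0..<n] @ map OutOf [0..<Suc V]) ! (n + u) = OutOf u"
      using u(1) by (simp add: nth_append del: upt_Suc)
    then show ?thesis using u(1) by (simp add: graph_of_def del: upt_Suc map_append)
  qed
  show len: "n + u < length (edges ?G)" using u(1) by (simp add: graph_of_def)
  have "step_rel V f \<subseteq> ?R\<^sup>*" using step_rel_split[OF f A] by auto
  then have "(step_rel V f)\<^sup>* \<subseteq> (?R\<^sup>*)\<^sup>*" by (rule rtrancl_mono)
  then have vu: "(v, u) \<in> ?R\<^sup>*" using u(3) by auto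
  obtain v' where v': "?g (OutOf u) = Into v'" "(v', u) \<in> ?R\<^sup>*"
  proof (cases "OutOf u \<in> A")
    case True
    then have "v = w" using fA(4) u by simp
    moreover have "(V, w) \<in> ?R" using fA(2) by (simp add: step_rel_def split_at_def)
    ultimately have "(V, u) \<in> ?R\<^sup>*" using vu by (metis converse_rtrancl_into_rtrancl)
    then show thesis using that[of V] True by (simp add: split_at_def)
  next
    case False
    then show thesis using that[of v] vu u by (simp add: split_at_def)
  qed
  show "\<exists>v'. edges ?G ! (n + u) = (OutOf u, Into v')" using edge v'(1) by simp
  show "cyclic_edge ?G (n + u)" using edge v' len by (auto simp: cyclic_edge_def ad)
qed

text \<open>
  A wheel that survives would contain a cyclic edge that was not broken.
\<close>

lemma ranked_break_parents:
  assumes f: "is_parent (m + length us) (n + length us) V (break_parents m n us f)"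
    and us: "\<And>u v. u < V \<Longrightarrow> f (OutOf u) = Into v \<Longrightarrow> (v, u) \<in> (step_rel V f)\<^sup>* \<Longrightarrow> u \<in> set us"
  shows "ranked V (break_parents m n us f)"
proof -
  let ?R = "step_rel V (break_parents m n us f)"
  have sub: "?R \<subseteq> step_rel V f" using break_parents_Into by (fastforce simp: step_rel_def)
  have "(x, x) \<notin> ?R\<^sup>+" for x
  proof
    assume "(x, x) \<in> ?R\<^sup>+"
    then obtain y where y: "(x, y) \<in> ?R" "(y, x) \<in> ?R\<^sup>*" by (meson tranclD)
    have "(y, x) \<in> (step_rel V f)\<^sup>*" using y(2) rtrancl_mono[OF sub] by blast
    moreover have "x < V" "f (OutOf x) = Into y" "x \<notin> set us"
      using y(1) break_parents_Into[of m n us f x y] by (auto simp: step_rel_def)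
    ultimately show False using us by blast
  qed
  then show ?thesis using acyclic_iff_ranked[OF f] by (simp add: acyclic_def)
qed

lemma keys_sum_fgen: "finite I \<Longrightarrow> Poly_Mapping.keys (\<Sum>i\<in>I. fgen (h i) :: 'g \<Rightarrow>\<^sub>0 'k::field) \<subseteq> h ` I"
proof (induction I rule: finite_induct)
  case (insert i I)
  then show ?case using keys_add[of "fgen (h i) :: 'g \<Rightarrow>\<^sub>0 'k" "\<Sum>i\<in>I. fgen (h i)"] by (auto split: if_splits)
qed simp

text \<open>
  Splitting commutes with breaking. After all wheels have been broken, the splittings sum up to an
  element of the ideal of the free prop; the same enumeration of edges can be broken in all
  splittings, because the list of edges of the representatives keeps them at the same positions.
\<close>

lemma split_sum_in_wheeled_ideal:
  assumes f: "is_parent m n V f" and V: "int V = int n - int m - 1"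
  shows "(split_sum n V f :: dgraph \<Rightarrow>\<^sub>0 'k::field) \<in> wheeled_ideal lie_arities jacobi_relations m n"
proof -
  \<comment> \<open>the vertices whose outgoing edge lies on a wheel; that edge is at position \<open>n + u\<close>\<close>
  define us where "us = filter (\<lambda>u. \<exists>v. f (OutOf u) = Into v \<and> (v, u) \<in> (step_rel V f)\<^sup>*) [0..<V]"
  define r where "r = length us"
  define es where "es = map ((+) n) us"
  have us: "distinct us" "\<forall>u\<in>set us. u < V \<and> (\<exists>v. f (OutOf u) = Into v)"
    by (auto simp: us_def)
  let ?S = "splittings n V f" and ?b = "break_parents m n us f"
  let ?G = "\<lambda>(w, A). graph_of n (Suc V) (split_at V f w A)"
  let ?L = "wheel_free_graphs lie_arities (m + r) (n + r)"
  have bp: "is_parent (m + r) (n + r) V ?b"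
      "\<And>w A. (w, A) \<in> ?S \<Longrightarrow> \<exists>B. (w, B) \<in> splittings (n + r) V ?b \<and>
        break_parents m n us (split_at V f w A) = split_at V ?b w B"
      "(\<Sum>(w, A)\<in>?S. pgen (n + r) (Suc V) (break_parents m n us (split_at V f w A))) =
        (split_sum (n + r) V ?b :: dgraph \<Rightarrow>\<^sub>0 'k)"
    using break_parents_split[OF f us, where 'k='k] unfolding r_def by blast+
  have rb: "ranked V ?b"
    by (rule ranked_break_parents[OF bp(1)[unfolded r_def]]) (auto simp: us_def)
  have G: "?G p \<in> W m n" "parent n (?G p) = split_at V f (fst p) (snd p)" "nverts (?G p) = Suc V"
      "e \<in> set es \<Longrightarrow> cyclic_edge (?G p) e"
      "u \<in> set us \<Longrightarrow> n + u < length (edges (?G p)) \<and> (\<exists>v. edges (?G p) ! (n + u) = (OutOf u, Into v))"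
    if p: "p \<in> ?S" for p e u
  proof -
    obtain w A where pw: "p = (w, A)" by (cases p)
    have A: "(w, A) \<in> ?S" using p pw by simp
    note s = is_parent_split[OF f A]
    show "?G p \<in> W m n" "parent n (?G p) = split_at V f (fst p) (snd p)" "nverts (?G p) = Suc V"
      using s by (simp_all add: pw graph_of_def[of _ "Suc V", THEN arg_cong[where f=nverts]])
    have cyc: "\<exists>v. u < V \<and> f (OutOf u) = Into v \<and> (v, u) \<in> (step_rel V f)\<^sup>*" if "u \<in> set us" for u
      using that by (auto simp: us_def)
    show "cyclic_edge (?G p) e" if e: "e \<in> set es"
    proof -
      obtain u where "u \<in> set us" "e = n + u" using e by (auto simp: es_def)
      then show ?thesis using cyc[of u] cyclic_edge_split(1)[OF f A] pw by auto
    qed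
    show "n + u < length (edges (?G p)) \<and> (\<exists>v. edges (?G p) ! (n + u) = (OutOf u, Into v))" if "u \<in> set us"
      using cyc[OF that] cyclic_edge_split(2,3)[OF f A] pw by auto
  qed
  note broken = break_edges_in_W[OF G(1) us(1) G(5), folded es_def r_def]
  let ?X = "\<Sum>p\<in>?S. fgen (break_edges m n es (?G p)) :: dgraph \<Rightarrow>\<^sub>0 'k"
  have "cong_mod (C (m + r) (n + r)) ?X (\<Sum>(w, A)\<in>?S. pgen (n + r) (Suc V) (break_parents m n us (split_at V f w A)))"
  proof (rule cong_mod_sum[OF subspace_coinv_rels])
    fix p assume p: "p \<in> ?S"
    obtain w A where pw: "p = (w, A)" by (cases p)
    from cong_pgen_parent[OF conjunct1[OF broken[OF p p]]] broken[OF p p] G(2,3)[OF p]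
    show "cong_mod (C (m + r) (n + r)) (fgen (break_edges m n es (?G p)) :: dgraph \<Rightarrow>\<^sub>0 'k)
        (case p of (w, A) \<Rightarrow> pgen (n + r) (Suc V) (break_parents m n us (split_at V f w A)))"
      by (simp add: pw)
  qed
  then have XS: "cong_mod (C (m + r) (n + r)) ?X (split_sum (n + r) V ?b)"
    unfolding bp(3) .
  have V': "int V = int (n + r) - int (m + r) - 1" using V by simp
  obtain y :: "dgraph \<Rightarrow>\<^sub>0 'k" where y: "prop_ideal lie_arities jacobi_relations (m + r) (n + r) y"
      "y \<in> graph_span ?L" "cong_mod (C (m + r) (n + r)) (split_sum (n + r) V ?b) y"
    by (rule ideal_of_ranked[OF bp(1) rb V'])
  have "break_edges m n es (?G p) \<in> ?L" if p: "p \<in> ?S" for p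
  proof -
    obtain w A where pw: "p = (w, A)" by (cases p)
    obtain B where B: "(w, B) \<in> splittings (n + r) V ?b"
        "break_parents m n us (split_at V f w A) = split_at V ?b w B"
      using bp(2)[of w A] p pw by blast
    have "ranked (Suc V) (split_at V ?b w B)" by (rule ranked_split[OF bp(1) B(1) rb])
    then show ?thesis
      using broken[OF p p] G(2,3)[OF p] B(2) V by (simp add: wheel_free_binary_iff pw)
  qed
  then have XL: "?X \<in> graph_span ?L"
    by (intro fvs.subspace_sum[OF subspace_graph_span]) simp
  \<comment> \<open>the relations needed involve graphs without wheels only, and these belong to the ideal\<close>
  have "?X - y \<in> C (m + r) (n + r)"
    using cong_coinv_trans[OF XS y(3)] by (simp add: cong_mod_def)
  then have "?X - y \<in> coinv_rels ?L"
    by (rule C_restrict_wheel_free) (intro fvs.subspace_diff[OF subspace_graph_span] XL y)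
  from prop_ideal.add[OF prop_ideal.coinvariance[OF this] y(1)]
  have ideal: "prop_ideal lie_arities jacobi_relations (m + r) (n + r) ?X" by simp
  define z where "z = (\<Sum>p\<in>?S. fgen (?G p, es) :: (dgraph \<times> nat list) \<Rightarrow>\<^sub>0 'k)"
  have "Poly_Mapping.keys z \<subseteq> (\<lambda>p. (?G p, es)) ` ?S"
    unfolding z_def by (rule keys_sum_fgen) simp
  also have "\<dots> \<subseteq> {(G, es). G \<in> wheeled_graphs lie_arities m n \<and>
      length es = r \<and> distinct es \<and> (\<forall>e\<in>set es. cyclic_edge G e)}"
  proof (rule image_subsetI)
    fix p assume p: "p \<in> ?S"
    have "?G p \<in> wheeled_graphs lie_arities m n"
      using G(1,3)[OF p] V by (simp add: binary_graphs_iff)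
    moreover have "length es = r" "distinct es"
      using us(1) by (simp_all add: es_def r_def distinct_map inj_on_def)
    ultimately show "(?G p, es) \<in> {(G, es). G \<in> wheeled_graphs lie_arities m n \<and>
        length es = r \<and> distinct es \<and> (\<forall>e\<in>set es. cyclic_edge G e)}"
      using G(4)[OF p] by simp
  qed
  finally have keys: "Poly_Mapping.keys z \<subseteq> {(G, es). G \<in> wheeled_graphs lie_arities m n \<and>
      length es = r \<and> distinct es \<and> (\<forall>e\<in>set es. cyclic_edge G e)}" .
  have "lin_ext (\<lambda>(G, es). fgen (break_edges m n es G)) z = ?X"
    by (simp add: z_def lin_ext.sum)
  then have "prop_ideal lie_arities jacobi_relations (m + r) (n + r)
      (lin_ext (\<lambda>(G, es). fgen (break_edges m n es G)) z)" using ideal by simp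
  then have "lin_ext (\<lambda>(G, es). fgen G) z \<in> wheeled_ideal lie_arities jacobi_relations m n"
    unfolding wheeled_ideal_def using keys
    by (intro fvs.span_base CollectI exI[of _ z] exI[of _ r] conjI refl)
  moreover have "lin_ext (\<lambda>(G, es). fgen G) z = split_sum n V f"
    by (simp add: z_def lin_ext.sum split_sum_def case_prod_unfold)
  ultimately show ?thesis by simp
qed

section \<open>The projection onto the binary graphs\<close>

text \<open>
  Each vertex has at least two inputs.
\<close>

lemma nverts_le_top: "G \<in> W m n \<Longrightarrow> int (nverts G) \<le> int n - int m"
proof -
  assume "G \<in> W m n"
  note f = W_encodes(2)[OF this]
  have "(\<Sum>v<nverts G. 2) \<le> (\<Sum>v<nverts G. card (inputs n (nverts G) (parent n G) v))"
    by (rule sum_mono) (use f in \<open>simp add: is_parent_def\<close>)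
  then show ?thesis using sum_card_inputs[OF f] by simp
qed

lemma lie_projection_fgen:
  assumes "G \<in> W m n"
  shows "lie_projection (fgen G) = (if int (nverts G) = int n - int m then fgen G else 0)"
proof -
  have "(\<forall>v<nverts G. (card (Out_edges G v), card (In_edges G v)) \<in> lie_arities) \<longleftrightarrow>
      G \<in> wheeled_graphs lie_arities m n"
    using assms by (auto simp: wheeled_graphs_def)
  then show ?thesis using assms by (simp add: lie_projection_def binary_graphs_iff)
qed

lemma lie_projection_lin_ext: "lie_projection x = lin_ext (\<lambda>G. lie_projection (fgen G)) x"
  by (simp add: lie_projection_def)

lemma lin_ext_fgen_id: "lin_ext fgen x = x"
  unfolding lin_ext_def by (rule poly_mapping_eq_sum_fgen[symmetric])

lemma lin_ext_zero_on: "x \<in> graph_span S \<Longrightarrow> (\<And>G. G \<in> S \<Longrightarrow> f G = 0) \<Longrightarrow> lin_ext f x = 0"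
  by (subst lin_ext_cong[of x S f "\<lambda>_. 0"]) (simp_all add: lin_ext_def)

lemma lie_projection_deg:
  assumes "x \<in> graph_span (graphs_deg m n d)"
  shows "lie_projection x = (if d = int n - int m then x else 0)"
proof (cases "d = int n - int m")
  case True
  have "lie_projection x = lin_ext fgen x"
    unfolding lie_projection_lin_ext[of x]
    by (rule lin_ext_cong[OF assms]) (use True in \<open>auto simp: lie_projection_fgen\<close>)
  then show ?thesis using True by (simp add: lin_ext_fgen_id)
next
  case False
  then show ?thesis
    unfolding lie_projection_lin_ext[of x]
    by (subst lin_ext_zero_on[OF assms]) (auto simp: lie_projection_fgen)
qed

text \<open>
  The codegree is additive and nonnegative. Thus a composite is in the top degree iff both factors
  are.
\<close>

lemma lie_projection_comp:
  fixes x y :: "dgraph \<Rightarrow>\<^sub>0 'k::field"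
  assumes x: "x \<in> graph_span (W m1 n1)" and y: "y \<in> graph_span (W m2 n2)" and match: "b \<or> n1 = m2"
  shows "lie_projection (bilin_ext (comp_graph b m1 n1) x y) =
    bilin_ext (comp_graph b m1 n1) (lie_projection x) (lie_projection y)"
proof -
  let ?c = "comp_graph b m1 n1"
  let ?P = "\<lambda>G. lie_projection (fgen G) :: dgraph \<Rightarrow>\<^sub>0 'k"
  let ?top = "\<lambda>m n G. int (nverts G) = int n - int m"
  \<comment> \<open>in degrees: with the matching condition, the codegrees of the factors add up\<close>
  have PP: "?P (?c G K) = (if ?top m1 n1 G \<and> ?top m2 n2 K then fgen (?c G K) else 0)"
    if G: "G \<in> W m1 n1" and K: "K \<in> W m2 n2" for G K
  proof -
    have "nverts (?c G K) = nverts G + nverts K"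
      by (simp add: comp_graph_def hcomp_graph_def vcomp_graph_def)
    moreover have "int (comp_ins b n1 n2) - int (comp_outs b m1 m2) = (int n1 - int m1) + (int n2 - int m2)"
      using match by (auto simp: comp_ins_def comp_outs_def)
    ultimately have "?top (comp_outs b m1 m2) (comp_ins b n1 n2) (?c G K) \<longleftrightarrow> ?top m1 n1 G \<and> ?top m2 n2 K"
      using nverts_le_top[OF G] nverts_le_top[OF K] by auto
    then show ?thesis by (simp add: lie_projection_fgen[OF comp_in_W[OF G K match]])
  qed
  have "lie_projection (bilin_ext ?c x y) = lin_ext (\<lambda>G. lin_ext (\<lambda>K. ?P (?c G K)) y) x"
    unfolding bilin_ext_left lie_projection_lin_ext[of "lin_ext _ _"] lin_ext_lin_ext lin_ext_fgen ..
  also have "\<dots> = lin_ext (\<lambda>G. lin_ext (\<lambda>G'. lin_ext (\<lambda>K. lin_ext (\<lambda>K'. fgen (?c G' K')) (?P K)) y) (?P G)) x"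
  proof (rule lin_ext_cong[OF x])
    fix G assume G: "G \<in> W m1 n1"
    show "lin_ext (\<lambda>K. ?P (?c G K)) y =
        lin_ext (\<lambda>G'. lin_ext (\<lambda>K. lin_ext (\<lambda>K'. fgen (?c G' K')) (?P K)) y) (?P G)"
    proof (cases "?top m1 n1 G")
      case True
      have "lin_ext (\<lambda>K. ?P (?c G K)) y = lin_ext (\<lambda>K. lin_ext (\<lambda>K'. fgen (?c G K')) (?P K)) y"
      proof (rule lin_ext_cong[OF y])
        fix K assume K: "K \<in> W m2 n2"
        show "?P (?c G K) = lin_ext (\<lambda>K'. fgen (?c G K')) (?P K)"
          unfolding PP[OF G K] lie_projection_fgen[OF K] using True by (simp add: lin_ext.zero)
      qed
      then show ?thesis unfolding lie_projection_fgen[OF G] using True by simp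
    next
      case False
      have "lin_ext (\<lambda>K. ?P (?c G K)) y = 0"
        by (rule lin_ext_zero_on[OF y]) (simp add: PP[OF G] False)
      then show ?thesis unfolding lie_projection_fgen[OF G] using False by (simp add: lin_ext.zero)
    qed
  qed
  also have "\<dots> = bilin_ext ?c (lie_projection x) (lie_projection y)"
    unfolding bilin_ext_left lie_projection_lin_ext[of x] lie_projection_lin_ext[of y] lin_ext_lin_ext ..
  finally show ?thesis .
qed

lemma is_prop_map_lie_projection:
  "is_prop_map lie_inf_arities (lie_projection :: (dgraph \<Rightarrow>\<^sub>0 'k::field) \<Rightarrow> (dgraph \<Rightarrow>\<^sub>0 'k))"
proof -
  have h: "hcomp_graph m n = comp_graph True m n" and v: "vcomp_graph = comp_graph False m n" for m n
    by (intro ext; simp add: comp_graph_def)+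
  have "lie_projection (hcomp m n x y) = hcomp m n (lie_projection x) (lie_projection y)"
    if "x \<in> graph_span (W m n)" "y \<in> graph_span (W p q)" for m n p q and x y :: "dgraph \<Rightarrow>\<^sub>0 'k"
    unfolding h using that by (rule lie_projection_comp) simp
  moreover have "lie_projection (vcomp x y) = vcomp (lie_projection x) (lie_projection y)"
    if "x \<in> graph_span (W l m)" "y \<in> graph_span (W m n)" for l m n and x y :: "dgraph \<Rightarrow>\<^sub>0 'k"
    unfolding v[of l m] using that by (rule lie_projection_comp) simp
  moreover have "lie_projection (fgen G) = (fgen G :: dgraph \<Rightarrow>\<^sub>0 'k)" if "nverts G = 0" for G
    using that by (simp add: lie_projection_def)
  ultimately show ?thesis unfolding is_prop_map_def by blast
qed

section \<open>Bijections on cohomology\<close>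

text \<open>
  The usual criterion on representatives. Surjectivity is asked for on cocycles, without a boundary.
\<close>

lemma bij_betw_cohomology:
  fixes f :: "('g \<Rightarrow>\<^sub>0 'k::field) \<Rightarrow> ('h \<Rightarrow>\<^sub>0 'k)"
  assumes A: "is_cochain_complex A" and B: "is_cochain_complex B" and f: "is_cochain_map A B f"
    and inj: "\<And>x z. x \<in> cocycles A d \<Longrightarrow> z \<in> chains B (d - 1) \<Longrightarrow> f x - diff B z \<in> rels B \<Longrightarrow>
      \<exists>y\<in>chains A (d - 1). x - diff A y \<in> rels A"
    and surj: "\<And>y. y \<in> cocycles B d \<Longrightarrow> \<exists>x\<in>cocycles A d. f x = y"
  shows "bij_betw (\<lambda>X. cohomologous B d `` (f ` X)) (cohomology A d) (cohomology B d)"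
proof -
  have equiv: "equiv (cocycles D d) (cohomologous D d)"
    and diff_cocycle: "x \<in> cocycles D d \<Longrightarrow> y \<in> cocycles D d \<Longrightarrow> x - y \<in> cocycles D d"
    if D: "is_cochain_complex D" for D :: "('i \<Rightarrow>\<^sub>0 'k) presented_complex" and x y
  proof -
    interpret D: Vector_Spaces.linear fscale fscale "diff D" using D by (simp add: is_cochain_complex_def)
    have sub: "fvs.subspace (chains D e)" "fvs.subspace (rels D)" for e
      using D by (simp_all add: is_cochain_complex_def)
    show "x - y \<in> cocycles D d" if "x \<in> cocycles D d" "y \<in> cocycles D d"
      using that sub by (auto simp: cocycles_def D.diff intro: fvs.subspace_diff)
    show "equiv (cocycles D d) (cohomologous D d)"
    proof (rule equivI)
      show "cohomologous D d \<subseteq> cocycles D d \<times> cocycles D d" by (auto simp: cohomologous_def)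
      show "refl_on (cocycles D d) (cohomologous D d)"
        by (rule refl_onI)
           (auto simp: cohomologous_def D.zero fvs.subspace_0[OF sub(2)] intro!: bexI[OF _ fvs.subspace_0[OF sub(1)]])
      show "sym (cohomologous D d)"
      proof (rule symI)
        fix x y assume "(x, y) \<in> cohomologous D d"
        then obtain z where z: "x \<in> cocycles D d" "y \<in> cocycles D d" "z \<in> chains D (d - 1)"
            "x - y - diff D z \<in> rels D" by (auto simp: cohomologous_def)
        have eq: "y - x - diff D (- z) = - (x - y - diff D z)" by (simp add: D.neg)
        have "y - x - diff D (- z) \<in> rels D" unfolding eq by (rule fvs.subspace_neg[OF sub(2) z(4)])
        then show "(y, x) \<in> cohomologous D d"
          using z(1,2) fvs.subspace_neg[OF sub(1) z(3)] unfolding cohomologous_def by blast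
      qed
      show "trans (cohomologous D d)"
      proof (rule transI)
        fix x y w assume "(x, y) \<in> cohomologous D d" "(y, w) \<in> cohomologous D d"
        then obtain z z' where z: "x \<in> cocycles D d" "w \<in> cocycles D d" "z \<in> chains D (d - 1)"
            "x - y - diff D z \<in> rels D" "z' \<in> chains D (d - 1)" "y - w - diff D z' \<in> rels D"
          by (auto simp: cohomologous_def)
        have eq: "x - w - diff D (z + z') = (x - y - diff D z) + (y - w - diff D z')" by (simp add: D.add)
        have "x - w - diff D (z + z') \<in> rels D" unfolding eq by (rule fvs.subspace_add[OF sub(2) z(4,6)])
        then show "(x, w) \<in> cohomologous D d"
          using z(1,2) fvs.subspace_add[OF sub(1) z(3,5)] unfolding cohomologous_def by blast
      qed
    qed
  qed
  note eA = equiv[OF A] and eB = equiv[OF B]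
  interpret F: Vector_Spaces.linear fscale fscale f using f by (simp add: is_cochain_map_def)
  have subA: "fvs.subspace (chains A e)" "fvs.subspace (rels A)" for e
    using A by (simp_all add: is_cochain_complex_def)
  have subB: "fvs.subspace (chains B e)" "fvs.subspace (rels B)" for e
    using B by (simp_all add: is_cochain_complex_def)
  have fchain: "f x \<in> chains B e" and frel: "x \<in> rels A \<Longrightarrow> f x \<in> rels B"
      and fdiff: "f (diff A x) - diff B (f x) \<in> rels B" and dA: "diff A x \<in> chains A (e + 1)"
    if x: "x \<in> chains A e" for x e
  proof -
    show "f x \<in> chains B e" using f x unfolding is_cochain_map_def image_subset_iff by simp
    show "f (diff A x) - diff B (f x) \<in> rels B" using f x unfolding is_cochain_map_def by simp
    show "diff A x \<in> chains A (e + 1)" using A x unfolding is_cochain_complex_def image_subset_iff by simp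
    have "f ` (rels A \<inter> chains A e) \<subseteq> rels B" using f unfolding is_cochain_map_def by simp
    then show "f x \<in> rels B" if "x \<in> rels A" using x that by (simp add: image_subset_iff)
  qed
  have fcocycle: "f x \<in> cocycles B d" if "x \<in> cocycles A d" for x
  proof -
    have x: "x \<in> chains A d" "diff A x \<in> rels A" using that by (auto simp: cocycles_def)
    have "f (diff A x) - (f (diff A x) - diff B (f x)) \<in> rels B"
      by (rule fvs.subspace_diff[OF subB(2) frel[OF dA[OF x(1)] x(2)] fdiff[OF x(1)]])
    then show ?thesis using fchain[OF x(1)] by (simp add: cocycles_def)
  qed
  have fcoh: "(f x, f y) \<in> cohomologous B d" if xy: "(x, y) \<in> cohomologous A d" for x y
  proof -
    obtain z where z: "x \<in> cocycles A d" "y \<in> cocycles A d" "z \<in> chains A (d - 1)"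
        "x - y - diff A z \<in> rels A" using xy by (auto simp: cohomologous_def)
    have "x - y - diff A z \<in> chains A d"
      using z dA[OF z(3)] by (auto simp: cocycles_def intro!: fvs.subspace_diff[OF subA(1)])
    then have "f (x - y - diff A z) + (f (diff A z) - diff B (f z)) \<in> rels B"
      using z by (intro fvs.subspace_add[OF subB(2)] frel fdiff)
    then have "f x - f y - diff B (f z) \<in> rels B" by (simp add: F.diff)
    then show ?thesis using fcocycle z fchain[OF z(3)] by (auto simp: cohomologous_def)
  qed
  have coh_inj: "(x, y) \<in> cohomologous A d"
    if x: "x \<in> cocycles A d" and y: "y \<in> cocycles A d" and xy: "(f x, f y) \<in> cohomologous B d" for x y
  proof -
    obtain z where z: "z \<in> chains B (d - 1)" "f x - f y - diff B z \<in> rels B"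
      using xy by (auto simp: cohomologous_def)
    then have "f (x - y) - diff B z \<in> rels B" by (simp add: F.diff)
    then have "\<exists>w\<in>chains A (d - 1). x - y - diff A w \<in> rels A"
      by (rule inj[OF diff_cocycle[OF A x y] z(1)])
    then show ?thesis using x y by (simp add: cohomologous_def)
  qed
  have cls: "cohomologous B d `` (f ` (cohomologous A d `` {x})) = cohomologous B d `` {f x}"
    if x: "x \<in> cocycles A d" for x
  proof (intro set_eqI iffI)
    fix w assume "w \<in> cohomologous B d `` (f ` (cohomologous A d `` {x}))"
    then obtain y where y: "(x, y) \<in> cohomologous A d" "(f y, w) \<in> cohomologous B d" by blast
    have "trans (cohomologous B d)" using eB by (simp add: equiv_def)
    from transD[OF this fcoh[OF y(1)] y(2)] show "w \<in> cohomologous B d `` {f x}" by blast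
  next
    fix w assume w: "w \<in> cohomologous B d `` {f x}"
    have "(x, x) \<in> cohomologous A d" using eA x by (simp add: equiv_def refl_on_def)
    then show "w \<in> cohomologous B d `` (f ` (cohomologous A d `` {x}))" using w by blast
  qed
  show ?thesis
  proof (rule bij_betw_imageI)
    show "inj_on (\<lambda>X. cohomologous B d `` (f ` X)) (cohomology A d)"
    proof (rule inj_onI)
      fix X Y assume X: "X \<in> cohomology A d" and Y: "Y \<in> cohomology A d"
        and eq: "cohomologous B d `` (f ` X) = cohomologous B d `` (f ` Y)"
      obtain x where x: "x \<in> cocycles A d" "X = cohomologous A d `` {x}"
        using X unfolding cohomology_def by (rule quotientE)
      obtain y where y: "y \<in> cocycles A d" "Y = cohomologous A d `` {y}"
        using Y unfolding cohomology_def by (rule quotientE)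
      have "cohomologous B d `` {f x} = cohomologous B d `` {f y}"
        using eq cls[OF x(1)] cls[OF y(1)] x(2) y(2) by simp
      then have "(f x, f y) \<in> cohomologous B d"
        by (rule eq_equiv_class[OF _ eB fcocycle[OF y(1)]])
      then have "(x, y) \<in> cohomologous A d" by (rule coh_inj[OF x(1) y(1)])
      then show "X = Y" unfolding x(2) y(2) by (rule equiv_class_eq[OF eA])
    qed
    show "(\<lambda>X. cohomologous B d `` (f ` X)) ` cohomology A d = cohomology B d"
    proof (intro set_eqI iffI)
      fix Z assume "Z \<in> (\<lambda>X. cohomologous B d `` (f ` X)) ` cohomology A d"
      then obtain X where X: "X \<in> cohomology A d" "Z = cohomologous B d `` (f ` X)" by blast
      obtain x where x: "x \<in> cocycles A d" "X = cohomologous A d `` {x}"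
        using X(1) unfolding cohomology_def by (rule quotientE)
      then have "Z = cohomologous B d `` {f x}" using X(2) cls by simp
      then show "Z \<in> cohomology B d" unfolding cohomology_def using quotientI[OF fcocycle[OF x(1)]] by simp
    next
      fix Z assume Z: "Z \<in> cohomology B d"
      obtain y where y: "y \<in> cocycles B d" "Z = cohomologous B d `` {y}"
        using Z unfolding cohomology_def by (rule quotientE)
      obtain x where x: "x \<in> cocycles A d" "f x = y" using surj[OF y(1)] by blast
      then have "Z = cohomologous B d `` (f ` (cohomologous A d `` {x}))" using y(2) cls by simp
      then show "Z \<in> (\<lambda>X. cohomologous B d `` (f ` X)) ` cohomology A d"
        unfolding cohomology_def using quotientI[OF x(1)] by blast
    qed
  qed
qed

section \<open>The quasi-isomorphism\<close>

lemma Lie_inf_wheeled_sel: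
  "chains (Lie_inf_wheeled m n) d = graph_span (graphs_deg m n d)"
  "rels (Lie_inf_wheeled m n) = (C m n :: (dgraph \<Rightarrow>\<^sub>0 'k::field) set)"
  "diff (Lie_inf_wheeled m n) = lie_inf_diff"
proof -
  have "C m n \<union> wheeled_ideal lie_inf_arities (\<lambda>_ _. {}) m n = (C m n :: (dgraph \<Rightarrow>\<^sub>0 'k) set)"
    using wheeled_ideal_empty by blast
  then show "rels (Lie_inf_wheeled m n) = (C m n :: (dgraph \<Rightarrow>\<^sub>0 'k::field) set)"
    using fvs.span_eq_iff[of "C m n :: (dgraph \<Rightarrow>\<^sub>0 'k) set"]
    by (simp add: Lie_inf_wheeled_def wheeled_extension_def)
qed (simp_all add: Lie_inf_wheeled_def wheeled_extension_def)

abbreviation lie_rels :: "nat \<Rightarrow> nat \<Rightarrow> (dgraph \<Rightarrow>\<^sub>0 'k::field) set" where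
  "lie_rels m n \<equiv> fvs.span (coinv_rels (wheeled_graphs lie_arities m n) \<union>
     wheeled_ideal lie_arities jacobi_relations m n)"

lemma Lie_wheeled_sel:
  "chains (Lie_wheeled m n) d = graph_span {G \<in> wheeled_graphs lie_arities m n. int (nverts G) = d}"
  "rels (Lie_wheeled m n) = lie_rels m n"
  "diff (Lie_wheeled m n) = (\<lambda>_. 0)"
  by (simp_all add: Lie_wheeled_def wheeled_extension_def)

text \<open>
  The wheeled extension of the Lie operad is concentrated in the top degree.
\<close>

lemma lie_chains:
  "graph_span {G \<in> wheeled_graphs lie_arities m n. int (nverts G) = d} =
    (if d = int n - int m then graph_span (graphs_deg m n d) else {0})"
proof (cases "d = int n - int m")
  case True
  then have "{G \<in> wheeled_graphs lie_arities m n. int (nverts G) = d} = graphs_deg m n d"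
    by (auto simp: binary_graphs_iff)
  then show ?thesis using True by simp
next
  case False
  then have e: "{G \<in> wheeled_graphs lie_arities m n. int (nverts G) = d} = {}"
    by (auto simp: binary_graphs_iff)
  show ?thesis unfolding e using False by (auto simp: graph_span_def)
qed

lemma lie_rels_top_boundaries: "lie_rels m n \<subseteq> top_boundaries m n"
proof (rule fvs.span_minimal)
  have "wheeled_graphs lie_arities m n \<subseteq> W m n" by (auto simp: binary_graphs_iff)
  then show "coinv_rels (wheeled_graphs lie_arities m n) \<union> wheeled_ideal lie_arities jacobi_relations m n
      \<subseteq> top_boundaries m n"
    by (intro Un_least wheeled_ideal_jacobi subset_trans[OF coinv_rels_mono C_subset_top_boundaries])
qed simp

lemma lie_projection_coinv: "x \<in> C m n \<Longrightarrow> lie_projection x \<in> lie_rels m n"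
proof -
  assume x: "x \<in> C m n"
  have "lie_projection x \<in> coinv_rels (wheeled_graphs lie_arities m n)"
    unfolding lie_projection_lin_ext[of x]
  proof (rule lin_ext_coinv[OF subspace_coinv_rels x])
    fix \<sigma> G H assume GH: "G \<in> W m n" "H \<in> W m n" and iso: "graph_iso \<sigma> G H"
    have V: "nverts H = nverts G" using iso by (simp add: graph_iso_def)
    show "cong_mod (coinv_rels (wheeled_graphs lie_arities m n)) (lie_projection (fgen H))
        (fscale (fsign \<sigma>) (lie_projection (fgen G)))"
    proof (cases "int (nverts G) = int n - int m")
      case True
      then have "G \<in> wheeled_graphs lie_arities m n" "H \<in> wheeled_graphs lie_arities m n"
        using GH V by (simp_all add: binary_graphs_iff)
      from cong_iso[OF this iso] True V show ?thesis
        unfolding lie_projection_fgen[OF GH(1)] lie_projection_fgen[OF GH(2)] by simp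
    next
      case False
      then show ?thesis using V
        unfolding lie_projection_fgen[OF GH(1)] lie_projection_fgen[OF GH(2)]
        by (simp add: cong_mod_def fvs.subspace_0[OF subspace_coinv_rels])
    qed
  qed
  then show ?thesis by (intro fvs.span_base) blast
qed

text \<open>
  Only boundaries in the top degree survive the projection, and these are relations.
\<close>

lemma lie_projection_diff:
  assumes x: "x \<in> graph_span (graphs_deg m n d)"
  shows "lie_projection (lie_inf_diff x) \<in> (lie_rels m n :: (dgraph \<Rightarrow>\<^sub>0 'k::field) set)"
proof -
  have "lie_projection (lie_inf_diff (fgen G)) \<in> (lie_rels m n :: (dgraph \<Rightarrow>\<^sub>0 'k) set)"
    if G: "G \<in> W m n" "int (nverts G) = d" for G
  proof -
    let ?V = "nverts G" and ?f = "parent n G"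
    have dG: "(lie_inf_diff (fgen G) :: dgraph \<Rightarrow>\<^sub>0 'k) \<in> graph_span (graphs_deg m n (d + 1))"
      by (rule diff_graph_span) (simp add: G)
    show ?thesis
    proof (cases "d + 1 = int n - int m")
      case True
      \<comment> \<open>both the boundary and the sum over the splittings are binary, so that they are congruent by isomorphisms of binary graphs\<close>
      let ?s = "fscale ((-1) ^ (?V + 1)) (split_sum n ?V ?f) :: dgraph \<Rightarrow>\<^sub>0 'k"
      note f = W_encodes(2)[OF G(1)]
      have L: "graphs_deg m n (d + 1) \<subseteq> wheeled_graphs lie_arities m n"
        using True by (auto simp: binary_graphs_iff)
      have "split_sum n ?V ?f \<in> wheeled_ideal lie_arities jacobi_relations m n"
        by (rule split_sum_in_wheeled_ideal[OF f]) (use G(2) True in simp)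
      then have s: "?s \<in> lie_rels m n" by (intro fvs.span_scale fvs.span_base) blast
      have "?s \<in> graph_span (wheeled_graphs lie_arities m n)"
        unfolding split_sum_def
        by (intro fvs.subspace_scale[OF subspace_graph_span] fvs.subspace_sum[OF subspace_graph_span])
           (use is_parent_split[OF f] G(2) True in \<open>auto simp: binary_graphs_iff graph_of_def[of _ "Suc ?V", THEN arg_cong[where f=nverts]]\<close>)
      moreover have "(lie_inf_diff (fgen G) :: dgraph \<Rightarrow>\<^sub>0 'k) \<in> graph_span (wheeled_graphs lie_arities m n)"
        by (rule subsetD[OF graph_span_mono[OF L] dG])
      moreover have "lie_inf_diff (fgen G) - ?s \<in> C m n"
        using diff_graph_cong[OF W_encodes[OF G(1)], where 'a='k] by (simp add: cong_mod_def diff_fgen)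
      ultimately have "lie_inf_diff (fgen G) - ?s \<in> coinv_rels (wheeled_graphs lie_arities m n)"
        by (intro C_restrict_binary fvs.subspace_diff[OF subspace_graph_span])
      then have "(lie_inf_diff (fgen G) - ?s) + ?s \<in> lie_rels m n"
        by (intro fvs.span_add[OF fvs.span_base s]) blast
      then show ?thesis using lie_projection_deg[OF dG] True by simp
    next
      case False
      then show ?thesis using lie_projection_deg[OF dG] by (simp add: fvs.span_zero)
    qed
  qed
  then have "lin_ext (\<lambda>G. lie_projection (lie_inf_diff (fgen G))) x \<in> (lie_rels m n :: (dgraph \<Rightarrow>\<^sub>0 'k) set)"
    by (intro lin_ext_in_subspace[OF fvs.subspace_span x]) simp
  moreover have "lie_projection (lie_inf_diff x) = lin_ext (\<lambda>G. lie_projection (lie_inf_diff (fgen G))) x"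
  proof -
    have "lie_projection (lie_inf_diff x) =
        lin_ext (\<lambda>G. lie_projection (fgen G)) (lin_ext lie_inf_diff_graph x)"
      by (simp add: lie_inf_diff_def flip: lie_projection_lin_ext)
    also have "\<dots> = lin_ext (\<lambda>G. lin_ext (\<lambda>H. lie_projection (fgen H)) (lie_inf_diff_graph G)) x"
      by (rule lin_ext_lin_ext)
    finally show ?thesis by (simp add: diff_fgen flip: lie_projection_lin_ext)
  qed
  ultimately show ?thesis by simp
qed

lemma is_cochain_complex_Lie_inf:
  "is_cochain_complex (Lie_inf_wheeled m n :: (dgraph \<Rightarrow>\<^sub>0 'k::field_char_0) presented_complex)"
proof -
  have "lie_inf_diff (lie_inf_diff x) \<in> C m n" if "x \<in> graph_span (graphs_deg m n d)"
    for d and x :: "dgraph \<Rightarrow>\<^sub>0 'k"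
    using that graph_span_mono[of "graphs_deg m n d" "W m n"] by (intro diff_diff) auto
  then show ?thesis
    unfolding is_cochain_complex_def Lie_inf_wheeled_sel
    using lie_inf_diff.linear_axioms diff_graph_span diff_in_C
    by (auto simp: subspace_graph_span)
qed

lemma linear_zero: "Vector_Spaces.linear fscale fscale (\<lambda>_ :: 'g \<Rightarrow>\<^sub>0 'k::field. 0 :: 'h \<Rightarrow>\<^sub>0 'k)"
  by unfold_locales simp_all

lemma is_cochain_complex_Lie: "is_cochain_complex (Lie_wheeled m n)"
  unfolding is_cochain_complex_def Lie_wheeled_sel
  using linear_zero
  by (auto simp: subspace_graph_span fvs.span_zero fvs.subspace_0[OF subspace_graph_span])

lemma is_cochain_map_lie_projection: "is_cochain_map (Lie_inf_wheeled m n) (Lie_wheeled m n) lie_projection"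
  unfolding is_cochain_map_def Lie_inf_wheeled_sel Lie_wheeled_sel
proof (intro conjI allI ballI image_subsetI)
  show "Vector_Spaces.linear fscale fscale (lie_projection :: (dgraph \<Rightarrow>\<^sub>0 'a) \<Rightarrow> _)"
    unfolding lie_projection_def[abs_def] by (rule lin_ext.linear_axioms)
  fix d and x :: "dgraph \<Rightarrow>\<^sub>0 'a" assume x: "x \<in> graph_span (graphs_deg m n d)"
  show "lie_projection x \<in> graph_span {G \<in> wheeled_graphs lie_arities m n. int (nverts G) = d}"
    unfolding lie_projection_deg[OF x] lie_chains using x by (cases "d = int n - int m") simp_all
  show "lie_projection (lie_inf_diff x) - 0 \<in> lie_rels m n"
    using lie_projection_diff[OF x] by simp
qed (use lie_projection_coinv in blast)

theorem theorem4p1p1: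
  "is_prop_map lie_inf_arities
      (lie_projection :: (dgraph \<Rightarrow>\<^sub>0 'k::field_char_0) \<Rightarrow> (dgraph \<Rightarrow>\<^sub>0 'k)) \<and>
   (\<forall>m n. quasi_isomorphism (Lie_inf_wheeled m n) (Lie_wheeled m n)
      (lie_projection :: (dgraph \<Rightarrow>\<^sub>0 'k) \<Rightarrow> (dgraph \<Rightarrow>\<^sub>0 'k)))"
proof (intro conjI allI is_prop_map_lie_projection)
  fix m n
  let ?A = "Lie_inf_wheeled m n :: (dgraph \<Rightarrow>\<^sub>0 'k) presented_complex"
  let ?B = "Lie_wheeled m n :: (dgraph \<Rightarrow>\<^sub>0 'k) presented_complex"
  have "bij_betw (\<lambda>X. cohomologous ?B d `` (lie_projection ` X)) (cohomology ?A d) (cohomology ?B d)" for d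
  proof (rule bij_betw_cohomology[OF is_cochain_complex_Lie_inf is_cochain_complex_Lie
        is_cochain_map_lie_projection])
    fix x z :: "dgraph \<Rightarrow>\<^sub>0 'k"
    assume x: "x \<in> cocycles ?A d" and px: "lie_projection x - diff ?B z \<in> rels ?B"
    have xc: "x \<in> graph_span (graphs_deg m n d)" "lie_inf_diff x \<in> C m n"
      using x by (simp_all add: cocycles_def Lie_inf_wheeled_sel)
    show "\<exists>y\<in>chains ?A (d - 1). x - diff ?A y \<in> rels ?A"
    proof (cases "d = int n - int m")
      case True
      then have "x \<in> lie_rels m n" using px lie_projection_deg[OF xc(1)] by (simp add: Lie_wheeled_sel)
      then have "x \<in> top_boundaries m n" using lie_rels_top_boundaries by blast
      then show ?thesis
        using True by (simp add: top_boundaries_def cong_mod_def Lie_inf_wheeled_sel)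
    next
      case False
      from acyclic_below_top[OF this xc] show ?thesis
        unfolding Lie_inf_wheeled_sel cong_mod_def by blast
    qed
  next
    fix y assume "y \<in> cocycles ?B d"
    then have y: "y \<in> chains ?B d" by (simp add: cocycles_def)
    show "\<exists>x\<in>cocycles ?A d. lie_projection x = y"
    proof (cases "d = int n - int m")
      case True
      then have yA: "y \<in> graph_span (graphs_deg m n d)" using y by (simp add: Lie_wheeled_sel lie_chains)
      have none: "graphs_deg m n (d + 1) = {}" using nverts_le_top True by fastforce
      have "lie_inf_diff y = 0" using diff_graph_span[OF yA] unfolding none by (simp add: graph_span_def)
      then have "y \<in> cocycles ?A d"
        using yA by (simp add: cocycles_def Lie_inf_wheeled_sel fvs.subspace_0[OF subspace_coinv_rels])
      moreover have "lie_projection y = y" using lie_projection_deg[OF yA] True by simp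
      ultimately show ?thesis by blast
    next
      case False
      then have "y = 0" using y by (simp add: Lie_wheeled_sel lie_chains)
      moreover have "0 \<in> cocycles ?A d"
        by (simp add: cocycles_def Lie_inf_wheeled_sel lie_inf_diff.zero fvs.subspace_0[OF subspace_coinv_rels]
            fvs.subspace_0[OF subspace_graph_span])
      moreover have "lie_projection (0 :: dgraph \<Rightarrow>\<^sub>0 'k) = 0" by (simp add: lie_projection_def lin_ext.zero)
      ultimately show ?thesis by blast
    qed
  qed
  then show "quasi_isomorphism ?A ?B lie_projection"
    unfolding quasi_isomorphism_def
    using is_cochain_complex_Lie_inf is_cochain_complex_Lie is_cochain_map_lie_projection by blast
qed

end
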